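(* Let $d>2$ be an integer, $c_0\in(0,1]$ and $\varepsilon\in(0,1)$. There exist constants $\mathbf{c},\mathbf{C}>0$ depending only on $(d,c_0)$, and $\boldsymbol{\delta}\in(0,1)$ depending only on $(d,c_0,\varepsilon)$, such that the following holds. If $J$ is an admissible kernel with constant $c_0$ and $G\in\mathcal G$, and $J$ and $G$ obey Assumption 1, then for every $\beta\in[0,\beta(\boldsymbol{\delta})]$ and every $x\in\mathbb Z^d$, $$G_\beta(x)\le \delta_0(x)+\frac{\mathbf{C}}{\sigma_J^d}\left(\frac{\sigma_J}{\sigma_J\vee|x|}\right)^{d-2-\varepsilon}\exp\left(-\mathbf{c}\,\frac{|x|}{\xi(\beta)}\right).$$
   Context: Notation: $|x|_2$ is the Euclidean norm and $|x|=\max_i|x_i|$; $a\vee b=\max(a,b)$, $a\wedge b=\min(a,b)$; $\delta_0$ is the Kronecker delta at $0\in\mathbb Z^d$; $(f*g)(x)=\sum_{y\in\mathbb Z^d}f(y)g(x-y)$; $\|f\|_1=\sum_x f(x)$ and $\||x|_2^2\cdot f\|_1=\sum_x|x|_2^2f(x)$ for $f\ge0$. A function on $\mathbb Z^d$ is $\mathbb Z^d$-symmetric if it is invariant under permutations of coordinates and sign changes of coordinates. Admissible kernel with constant $c_0\in(0,1]$: a function $J:\mathbb Z^d\to[0,\infty)$ with $J_0=0$, $\sum_xJ_x=1$, $\mathbb Z^d$-symmetric, with finite range $R_J=\max\{|x|:J_x>0\}\in[1,\infty)$, and, with $\sigma_J^2=\sum_x|x|_2^2J_x$, satisfying $c_0R_J\le\sigma_J$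 and $J_x\le c_0^{-1}R_J^{-d}$ for all $x$. Class $\mathcal G$: families of functions $G_\beta:\mathbb Z^d\to[0,\infty]$ indexed by $\beta\in[0,\beta_c]$, for some $\beta_c\in[0,\infty]$, such that: (i) $G_0=\delta_0$; (ii) for every $x$, $\beta\mapsto G_\beta(x)$ is non-decreasing and differentiable on $[0,\beta_c)$; (iii) each $G_\beta$ is $\mathbb Z^d$-symmetric; (iv) for each $\beta\in[0,\beta_c)$, $G_\beta(x)$ decays exponentially in $x$; (v) if $\beta_c<\infty$, $\lim_{\beta\uparrow\beta_c}G_\beta(x)=G_{\beta_c}(x)$ for every $x$ (possibly infinite). Assumption 1 (on an admissible kernel $J$ and $G\in\mathcal G$): (i) for all $0\le\beta'\le\beta<\beta_c$, $G_\beta\le G_{\beta'}+(\beta-\beta')(G_{\beta'}*J*G_\beta)$ pointwise; (ii) for every $\beta<\beta_c$ there is $H_\beta:\mathbb Z^d\to[0,\infty)$ (which may depend on $J,G$) with $\partial_\beta G_\beta\ge G_\beta*(J-H_\beta)*G_\beta$ pointwise, where $H_0=0$, $H_\beta(x)=H_\beta(-x)$, $\beta\mapsto H_\beta(x)$ is continuous on $[0,\beta_c)$, and $H_\beta(x)$ decays exponentially in $x$ for each fixed $\beta$. Set $F_\beta=J*G_\beta$ and, for $\beta<\beta_c$, $\chi(\beta)=\|G_\beta\|_1=\|F_\beta\|_1$, $\xi(\beta)^2=\||x|_2^2\cdot F_\beta\|_1/\chi(\beta)$, $E(\beta)=\sup_{0\le t\le\beta}\left(\|H_t\|_1+\||x|_2^2\cdot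 H_t\|_1/\xi(t)^2\right)$. For $\delta>0$, $\beta(\delta)=\sup\{\beta\in[0,\beta_c):E(\beta)<\delta\}$. If $\beta(\boldsymbol\delta)=\beta_c$, then at $\beta=\beta_c$ one takes $\xi(\beta_c)=\lim_{\beta\uparrow\beta_c}\xi(\beta)\in(0,\infty]$, and the exponential factor is $1$ if $\xi(\beta_c)=\infty$. *)

theory Defs
  imports "HOL-Analysis.Analysis"
begin

text \<open>
  The lattice is the type \<open>int ^ 'n\<close>, with \<open>d = CARD('n)\<close>. The functions \<open>G\<^sub>\<beta>\<close>
  take values in \<open>ennreal\<close>; below criticality they are finite (they decay exponentially), and
  the quantities that involve subtraction, division or differentiation are formed from the
  real-valued version \<open>fin_part G\<close>, for which all sums are absolutely convergent.
\<close>

subsection \<open>Functions on the lattice\<close>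

definition real_vec :: "int ^ 'n \<Rightarrow> real ^ 'n" where
  "real_vec x = (\<chi> i. real_of_int (x $ i))"

definition l2 :: "int ^ 'n \<Rightarrow> real" where
  "l2 x = norm (real_vec x)"

definition linf :: "int ^ 'n \<Rightarrow> real" where
  "linf x = infnorm (real_vec x)"

definition conv :: "(int ^ 'n \<Rightarrow> 'a) \<Rightarrow> (int ^ 'n \<Rightarrow> 'a) \<Rightarrow> int ^ 'n \<Rightarrow> 'a::{semiring_0, t2_space}" where
  "conv f g x = (\<Sum>\<^sub>\<infinity>y. f y * g (x - y))"

text \<open>Only used for nonnegative functions, hence no absolute value.\<close>
definition norm1 :: "(int ^ 'n \<Rightarrow> real) \<Rightarrow> real" where
  "norm1 f = (\<Sum>\<^sub>\<infinity>x. f x)"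

definition moment2 :: "(int ^ 'n \<Rightarrow> real) \<Rightarrow> real" where
  "moment2 f = norm1 (\<lambda>x. (l2 x)\<^sup>2 * f x)"

definition Zd_symmetric :: "(int ^ 'n \<Rightarrow> 'b) \<Rightarrow> bool" where
  "Zd_symmetric f \<longleftrightarrow>
     (\<forall>p x. bij p \<longrightarrow> f (\<chi> i. x $ p i) = f x) \<and>
     (\<forall>s x. (\<forall>i. s i = 1 \<or> s i = -1) \<longrightarrow> f (\<chi> i. s i * x $ i) = f x)"

definition exp_decay :: "(int ^ 'n \<Rightarrow> ennreal) \<Rightarrow> bool" where
  "exp_decay f \<longleftrightarrow> (\<exists>K m. 0 < m \<and> (\<forall>x. f x \<le> ennreal (K * exp (- m * linf x))))"

subsection \<open>Admissible kernels\<close>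

definition krange :: "(int ^ 'n \<Rightarrow> real) \<Rightarrow> real" where
  "krange J = Max (linf ` {x. 0 < J x})"

definition sigma_of :: "(int ^ 'n \<Rightarrow> real) \<Rightarrow> real" where
  "sigma_of J = sqrt (moment2 J)"

definition admissible :: "real \<Rightarrow> (int ^ 'n \<Rightarrow> real) \<Rightarrow> bool" where
  "admissible c\<^sub>0 J \<longleftrightarrow>
     (\<forall>x. 0 \<le> J x) \<and> J 0 = 0 \<and> (\<Sum>\<^sub>\<infinity>x. J x) = 1 \<and> Zd_symmetric J \<and>
     finite {x. 0 < J x} \<and> 1 \<le> krange J \<and>
     c\<^sub>0 * krange J \<le> sigma_of J \<and>
     (\<forall>x. J x \<le> 1 / (c\<^sub>0 * krange J ^ CARD('n)))"

subsection \<open>The class of families of functions\<close>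

text \<open>The half-open interval from \<open>0\<close> to \<open>\<beta>\<^sub>c\<close>, which may be empty or unbounded.\<close>
definition subcrit :: "ennreal \<Rightarrow> real set" where
  "subcrit \<beta>\<^sub>c = {\<beta>. 0 \<le> \<beta> \<and> ennreal \<beta> < \<beta>\<^sub>c}"

definition fin_part :: "(real \<Rightarrow> int ^ 'n \<Rightarrow> ennreal) \<Rightarrow> real \<Rightarrow> int ^ 'n \<Rightarrow> real" where
  "fin_part G \<beta> x = enn2real (G \<beta> x)"

text \<open>
  The parameter is a real number, so for \<open>\<beta>\<^sub>c = \<infinity>\<close> it ranges over the nonnegative reals.
  Values of \<open>G\<close> outside the parameter range play no role; in particular derivatives and
  limits are taken within \<open>subcrit \<beta>\<^sub>c\<close>, which makes them one-sided at the end points.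
\<close>
definition class_G :: "ennreal \<Rightarrow> (real \<Rightarrow> int ^ 'n \<Rightarrow> ennreal) \<Rightarrow> bool" where
  "class_G \<beta>\<^sub>c G \<longleftrightarrow>
     (\<forall>x. G 0 x = of_bool (x = 0)) \<and>
     (\<forall>x. mono_on (subcrit \<beta>\<^sub>c) (\<lambda>\<beta>. G \<beta> x) \<and>
          (\<lambda>\<beta>. fin_part G \<beta> x) differentiable_on subcrit \<beta>\<^sub>c) \<and>
     (\<forall>\<beta>. 0 \<le> \<beta> \<and> ennreal \<beta> \<le> \<beta>\<^sub>c \<longrightarrow> Zd_symmetric (G \<beta>)) \<and>
     (\<forall>\<beta>\<in>subcrit \<beta>\<^sub>c. exp_decay (G \<beta>)) \<and>
     (\<beta>\<^sub>c < \<infinity> \<longrightarrow>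
        (\<forall>x. ((\<lambda>\<beta>. G \<beta> x) \<longlongrightarrow> G (enn2real \<beta>\<^sub>c) x) (at (enn2real \<beta>\<^sub>c) within subcrit \<beta>\<^sub>c)))"

text \<open>
  The function \<open>H\<close> is a parameter because \<open>err\<close> and \<open>beta_of\<close> below depend on it.
\<close>
definition assumption1 ::
  "(int ^ 'n \<Rightarrow> real) \<Rightarrow> ennreal \<Rightarrow> (real \<Rightarrow> int ^ 'n \<Rightarrow> ennreal) \<Rightarrow> (real \<Rightarrow> int ^ 'n \<Rightarrow> real) \<Rightarrow> bool" where
  "assumption1 J \<beta>\<^sub>c G H \<longleftrightarrow>
     (\<forall>\<beta>\<in>subcrit \<beta>\<^sub>c. \<forall>\<beta>'\<in>{0..\<beta>}. \<forall>x.
        G \<beta> x \<le> G \<beta>' x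
          + ennreal (\<beta> - \<beta>') * conv (conv (G \<beta>') (\<lambda>y. ennreal (J y))) (G \<beta>) x) \<and>
     (\<forall>\<beta>\<in>subcrit \<beta>\<^sub>c. \<forall>x.
        conv (conv (fin_part G \<beta>) (\<lambda>y. J y - H \<beta> y)) (fin_part G \<beta>) x
          \<le> vector_derivative (\<lambda>t. fin_part G t x) (at \<beta> within subcrit \<beta>\<^sub>c)) \<and>
     (\<forall>\<beta>\<in>subcrit \<beta>\<^sub>c. \<forall>x. 0 \<le> H \<beta> x) \<and>
     (0 < \<beta>\<^sub>c \<longrightarrow> (\<forall>x. H 0 x = 0)) \<and>
     (\<forall>\<beta>\<in>subcrit \<beta>\<^sub>c. \<forall>x. H \<beta> (- x) = H \<beta> x) \<and>
     (\<forall>x. continuous_on (subcrit \<beta>\<^sub>c) (\<lambda>\<beta>. H \<beta> x)) \<and>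
     (\<forall>\<beta>\<in>subcrit \<beta>\<^sub>c. exp_decay (\<lambda>x. ennreal (H \<beta> x)))"

subsection \<open>Correlation length and error\<close>

definition Ffun :: "(int ^ 'n \<Rightarrow> real) \<Rightarrow> (real \<Rightarrow> int ^ 'n \<Rightarrow> ennreal) \<Rightarrow> real \<Rightarrow> int ^ 'n \<Rightarrow> real" where
  "Ffun J G \<beta> = conv J (fin_part G \<beta>)"

definition chi :: "(real \<Rightarrow> int ^ 'n \<Rightarrow> ennreal) \<Rightarrow> real \<Rightarrow> real" where
  "chi G \<beta> = norm1 (fin_part G \<beta>)"

definition xi :: "(int ^ 'n \<Rightarrow> real) \<Rightarrow> (real \<Rightarrow> int ^ 'n \<Rightarrow> ennreal) \<Rightarrow> real \<Rightarrow> real" where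
  "xi J G \<beta> = sqrt (moment2 (Ffun J G \<beta>) / chi G \<beta>)"

text \<open>
  The correlation length on the closed parameter interval: at \<open>\<beta>\<^sub>c\<close> it is the limit from
  below, possibly infinite.
\<close>
definition xi_ext ::
  "(int ^ 'n \<Rightarrow> real) \<Rightarrow> ennreal \<Rightarrow> (real \<Rightarrow> int ^ 'n \<Rightarrow> ennreal) \<Rightarrow> real \<Rightarrow> ennreal" where
  "xi_ext J \<beta>\<^sub>c G \<beta> =
     (if \<beta> \<in> subcrit \<beta>\<^sub>c then ennreal (xi J G \<beta>)
      else Lim (at \<beta> within subcrit \<beta>\<^sub>c) (\<lambda>t. ennreal (xi J G t)))"

definition exp_factor :: "real \<Rightarrow> real \<Rightarrow> ennreal \<Rightarrow> real" where
  "exp_factor c r \<xi> = (if \<xi> = \<infinity> then 1 else exp (- c * (r / enn2real \<xi>)))"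

definition err ::
  "(int ^ 'n \<Rightarrow> real) \<Rightarrow> (real \<Rightarrow> int ^ 'n \<Rightarrow> ennreal) \<Rightarrow> (real \<Rightarrow> int ^ 'n \<Rightarrow> real) \<Rightarrow> real \<Rightarrow> ennreal" where
  "err J G H \<beta> = (SUP t\<in>{0..\<beta>}. ennreal (norm1 (H t) + moment2 (H t) / (xi J G t)\<^sup>2))"

text \<open>The supremum is taken in \<open>ennreal\<close>, so that of the empty set is \<open>0\<close>.\<close>
definition beta_of ::
  "(int ^ 'n \<Rightarrow> real) \<Rightarrow> ennreal \<Rightarrow> (real \<Rightarrow> int ^ 'n \<Rightarrow> ennreal) \<Rightarrow> (real \<Rightarrow> int ^ 'n \<Rightarrow> real) \<Rightarrow> real \<Rightarrow> ennreal" where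
  "beta_of J \<beta>\<^sub>c G H \<delta> = Sup (ennreal ` {\<beta> \<in> subcrit \<beta>\<^sub>c. err J G H \<beta> < ennreal \<delta>})"

end

theory Submission
  imports Defs
begin

text \<open>
  Write \<open>S t\<close> for the susceptibility and \<open>\<xi> t\<close> for the correlation length. While the error is below a
  small \<open>\<delta>\<close>, the two differential inequalities give \<open>S t / S s = (\<xi> t / \<xi> s)\<close> to the power
  \<open>2 + O(\<delta>)\<close> and \<open>(t - s) * S s \<le> 1 - S s / S t + O(\<delta>)\<close>. Hence, for \<open>s\<close> with \<open>\<xi> s = \<rho>\<close>, the inequality
  \<open>G t \<le> G s + (t - s) * (F s * G t)\<close> compares \<open>G t\<close> with the Green function of a slightly killed
  random walk whose step law \<open>F s / S s\<close> is isotropic, of variance \<open>\<rho>\<^sup>2\<close>, with exponential moments at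
  the scale \<open>\<rho>\<close>. The weight \<open>\<bar>x\<bar>\<close> to the power \<open>-(d - 2 - \<epsilon>)\<close> times \<open>exp (- c * \<bar>x\<bar> / \<xi> t)\<close> is strictly
  superharmonic for this walk: the error terms are beaten either by the gain of order \<open>\<epsilon> * \<rho>\<^sup>2 / \<bar>x\<bar>\<^sup>2\<close>
  or by the killing of order \<open>\<rho>\<^sup>2 / (\<xi> t)\<^sup>2\<close>. With \<open>\<rho>\<close> a small multiple of \<open>min \<bar>x\<bar> (\<xi> t)\<close>, the only
  contribution which the weight does not control is the mass of \<open>G t\<close> in the ball of radius \<open>\<rho>\<close>,
  and this is \<open>O(S s)\<close>. So the supremum of the ratio of \<open>G t\<close> to the weight contracts, except at
  distances of order \<open>\<sigma>\<close>, where the walk with step law \<open>J\<close> gives the bound directly.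
\<close>

subsection \<open>The radial weight\<close>

text \<open>Two inputs are bootstraps over scales. Exponential moments pass to a scale up to 32
  times larger with the same constant. The mass in a ball, divided by \<open>S s\<close>, has a
  finite supremum q with q \<le> const + q / 2, and here transience is used. That the final
  constants do not see \<epsilon> has a specific cause. The contraction rate of the supremum tends
  to 0 with \<epsilon>, but that rate acts only where nothing is added. A term not proportional to
  the supremum occurs solely in the step from parameter 0, on the support of \<open>J\<close>, and
  there the gain comes from the offset \<open>m\<close> inside the weight, a fixed multiple of
  \<open>\<sigma>\<^sup>2\<close>. So \<epsilon> governs the speed of contraction, never its fixed
  point.\<close>

lemma power_le_exp:
  fixes x a :: real
  assumes "0 \<le> x" "0 < a"
  shows "x ^ n \<le> fact n / a ^ n * exp (a * x)"
proof -
  have "(a * x) ^ n / fact n \<le> (\<Sum>k<Suc n. (a * x) ^ k / fact k)"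
    using assms by (intro member_le_sum) auto
  also have "\<dots> \<le> exp (a * x)"
  proof -
    have s: "(\<lambda>k. (a * x) ^ k / fact k) sums exp (a * x)"
      using exp_converges[of "a * x"] by (simp add: field_simps)
    show ?thesis
      using sum_le_suminf[OF sums_summable[OF s], of "{..<Suc n}"] assms sums_unique[OF s] by simp
  qed
  finally have "a ^ n * x ^ n \<le> fact n * exp (a * x)"
    by (simp add: field_simps power_mult_distrib)
  then show ?thesis using assms by (simp add: field_simps)
qed

text \<open>With t = |x|^2 + m, b = \<xi>^2 and \<gamma> = c / \<xi> this is a smooth version of the
  weight: m removes the singularity at the origin and b flattens the exponential below the scale
  \<xi>, so that its logarithmic derivative in t never exceeds c / (2 \<xi>^2) in size.\<close>

definition fw :: "real \<Rightarrow> real \<Rightarrow> real \<Rightarrow> real \<Rightarrow> real" where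
  "fw \<alpha> \<gamma> b t = t powr (- \<alpha>) * exp (- \<gamma> * sqrt (t + b))"

text \<open>\<open>lu\<close> is minus the logarithmic derivative of \<open>fw\<close>, and each of
  \<open>lu1\<close>, \<open>lu2\<close>, \<open>lu3\<close> is minus the derivative of its
  predecessor, which makes all four nonnegative. The exponent 1 is written out so that the same
  differentiation rule fits it.\<close>

definition lu :: "real \<Rightarrow> real \<Rightarrow> real \<Rightarrow> real \<Rightarrow> real" where
  "lu \<alpha> \<gamma> b t = \<alpha> / t + \<gamma> / 2 / sqrt (t + b) ^ 1"
definition lu1 :: "real \<Rightarrow> real \<Rightarrow> real \<Rightarrow> real \<Rightarrow> real" where
  "lu1 \<alpha> \<gamma> b t = \<alpha> / t\<^sup>2 + \<gamma> / 4 / sqrt (t + b) ^ 3"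
definition lu2 :: "real \<Rightarrow> real \<Rightarrow> real \<Rightarrow> real \<Rightarrow> real" where
  "lu2 \<alpha> \<gamma> b t = 2 * \<alpha> / t ^ 3 + 3 * \<gamma> / 8 / sqrt (t + b) ^ 5"
definition lu3 :: "real \<Rightarrow> real \<Rightarrow> real \<Rightarrow> real \<Rightarrow> real" where
  "lu3 \<alpha> \<gamma> b t = 6 * \<alpha> / t ^ 4 + 15 * \<gamma> / 16 / sqrt (t + b) ^ 7"

lemma fw_pos: "0 < t \<Longrightarrow> 0 < fw \<alpha> \<gamma> b t"
  by (simp add: fw_def)

lemma fw_antimono:
  assumes "0 < s" "s \<le> t" "0 \<le> \<alpha>" "0 \<le> \<gamma>"
  shows "fw \<alpha> \<gamma> b t \<le> fw \<alpha> \<gamma> b s"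
  unfolding fw_def using assms
  by (intro mult_mono) (auto intro!: powr_mono2' mult_left_mono)

lemma DERIV_fw:
  assumes "0 < t" "0 \<le> b"
  shows "(fw \<alpha> \<gamma> b has_real_derivative - lu \<alpha> \<gamma> b t * fw \<alpha> \<gamma> b t) (at t)"
proof -
  have "t powr (- \<alpha> - 1) = t powr (- \<alpha>) / t"
    using assms by (simp add: powr_diff)
  then show ?thesis
    unfolding fw_def lu_def using assms
    by (auto intro!: derivative_eq_intros simp: field_simps)
qed

section \<open>Logarithmic derivatives of the weight and its Taylor expansion\<close>

lemma DERIV_inverse_power:
  assumes "0 < (t::real)"
  shows "((\<lambda>t. K / t ^ n) has_real_derivative - (real n * K / t ^ (n + 1))) (at t)"
proof (cases n)
  case (Suc k)
  have "((\<lambda>t. K / t ^ n) has_real_derivative (0 * t ^ n - real n * t ^ (n - Suc 0) * K) / (t ^ n)\<^sup>2) (at t)"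
    using assms DERIV_quotient[OF DERIV_const[of K] DERIV_pow[of n t UNIV]]
    by (simp add: power2_eq_square)
  moreover have "(0 * t ^ n - real n * t ^ (n - Suc 0) * K) / (t ^ n)\<^sup>2 = - (real n * K / t ^ (n + 1))"
    using assms Suc by (simp add: field_simps power2_eq_square)
  ultimately show ?thesis by simp
qed auto

lemma DERIV_inverse_sqrt_power:
  assumes "0 < t" "0 \<le> b"
  shows "((\<lambda>t. K / sqrt (t + b) ^ n) has_real_derivative - (real n * K / 2 / sqrt (t + b) ^ (n + 2))) (at t)"
proof -
  define r where "r = sqrt (t + b)"
  have r: "r > 0" using assms by (simp add: r_def)
  have 1: "((\<lambda>t. sqrt (t + b)) has_real_derivative inverse r / 2) (at t)"
    using assms by (auto intro!: derivative_eq_intros simp: r_def)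
  note 2 = DERIV_inverse_power[OF r, of K n]
  have "((\<lambda>t. K / sqrt (t + b) ^ n) has_real_derivative - (real n * K / r ^ (n + 1)) * (inverse r / 2)) (at t)"
    using DERIV_chain2[OF 2[unfolded r_def] 1] by (simp add: r_def)
  moreover have "- (real n * K / r ^ (n + 1)) * (inverse r / 2) = - (real n * K / 2 / r ^ (n + 2))"
    using r by (simp add: field_simps)
  ultimately show ?thesis by (simp add: r_def)
qed

lemma DERIV_lu:
  assumes "0 < t" "0 \<le> b"
  shows "(lu \<alpha> \<gamma> b has_real_derivative - lu1 \<alpha> \<gamma> b t) (at t)"
  using DERIV_add[OF DERIV_inverse_power[OF assms(1), of \<alpha> 1] DERIV_inverse_sqrt_power[OF assms, of "\<gamma> / 2" 1]]
  unfolding lu_def lu1_def by (simp add: eval_nat_numeral)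

lemma DERIV_lu1:
  assumes "0 < t" "0 \<le> b"
  shows "(lu1 \<alpha> \<gamma> b has_real_derivative - lu2 \<alpha> \<gamma> b t) (at t)"
  using DERIV_add[OF DERIV_inverse_power[OF assms(1), of \<alpha> 2] DERIV_inverse_sqrt_power[OF assms, of "\<gamma> / 4" 3]]
  unfolding lu1_def lu2_def by simp

lemma DERIV_lu2:
  assumes "0 < t" "0 \<le> b"
  shows "(lu2 \<alpha> \<gamma> b has_real_derivative - lu3 \<alpha> \<gamma> b t) (at t)"
  using DERIV_add[OF DERIV_inverse_power[OF assms(1), of "2 * \<alpha>" 3] DERIV_inverse_sqrt_power[OF assms, of "3 * \<gamma> / 8" 5]]
  unfolding lu2_def lu3_def by simp

lemma lu_nonneg:
  assumes "0 < t" "0 \<le> b" "0 \<le> \<alpha>" "0 \<le> \<gamma>"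
  shows "0 \<le> lu \<alpha> \<gamma> b t" "0 \<le> lu1 \<alpha> \<gamma> b t" "0 \<le> lu2 \<alpha> \<gamma> b t" "0 \<le> lu3 \<alpha> \<gamma> b t"
  using assms by (auto simp: lu_def lu1_def lu2_def lu3_def)

text \<open>Each further derivative gains a factor 1 / (t + b) \<le> 1 / t. Through
  \<open>lu_bounds\<close> all derivatives of the logarithm are thereby controlled by
  \<open>lu\<close> itself and powers of 1 / t.\<close>

lemma inverse_sqrt_power_bound:
  fixes t b k l :: real
  assumes "0 < t" "0 \<le> b" "0 \<le> k" "k \<le> l"
  shows "k / sqrt (t + b) ^ (2 * n + 1) \<le> l / sqrt (t + b) ^ 1 / t ^ n"
proof -
  have "sqrt (t + b) ^ (2 * n + 1) = (t + b) ^ n * sqrt (t + b)"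
    using assms by (simp add: power_mult)
  then have "k / sqrt (t + b) ^ (2 * n + 1) \<le> l / (t ^ n * sqrt (t + b))"
    using assms by (auto intro!: frac_le mult_right_mono power_mono)
  then show ?thesis by (simp add: field_simps)
qed

lemma lu_bounds:
  assumes "0 < t" "0 \<le> b" "0 \<le> \<alpha>" "0 \<le> \<gamma>"
  shows "lu1 \<alpha> \<gamma> b t \<le> lu \<alpha> \<gamma> b t / t"
    "lu2 \<alpha> \<gamma> b t \<le> 2 * lu \<alpha> \<gamma> b t / t\<^sup>2"
    "lu3 \<alpha> \<gamma> b t \<le> 6 * lu \<alpha> \<gamma> b t / t ^ 3"
proof -
  have "\<gamma> / 4 / sqrt (t + b) ^ 3 \<le> \<gamma> / 2 / sqrt (t + b) ^ 1 / t ^ 1"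
    using inverse_sqrt_power_bound[of t b "\<gamma> / 4" "\<gamma> / 2" 1] assms by simp
  then show "lu1 \<alpha> \<gamma> b t \<le> lu \<alpha> \<gamma> b t / t"
    by (simp add: lu_def lu1_def add_divide_distrib power2_eq_square) 
  have "3 * \<gamma> / 8 / sqrt (t + b) ^ 5 \<le> \<gamma> / sqrt (t + b) ^ 1 / t ^ 2"
    using inverse_sqrt_power_bound[of t b "3 * \<gamma> / 8" "\<gamma>" 2] assms by simp
  then show "lu2 \<alpha> \<gamma> b t \<le> 2 * lu \<alpha> \<gamma> b t / t\<^sup>2"
    by (simp add: lu_def lu2_def add_divide_distrib distrib_left eval_nat_numeral) 
  have "15 * \<gamma> / 16 / sqrt (t + b) ^ 7 \<le> 3 * \<gamma> / sqrt (t + b) ^ 1 / t ^ 3"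
    using inverse_sqrt_power_bound[of t b "15 * \<gamma> / 16" "3 * \<gamma>" 3] assms by simp
  then show "lu3 \<alpha> \<gamma> b t \<le> 6 * lu \<alpha> \<gamma> b t / t ^ 3"
    by (simp add: lu_def lu3_def add_divide_distrib distrib_left eval_nat_numeral) 
qed

text \<open>Taylor polynomial of degree 3 in q of the quotient fw (t + q) / fw t, with the
  derivatives expressed through those of the logarithm.\<close>

definition taylor3 :: "real \<Rightarrow> real \<Rightarrow> real \<Rightarrow> real \<Rightarrow> real \<Rightarrow> real" where
  "taylor3 \<alpha> \<gamma> b t q = 1 - lu \<alpha> \<gamma> b t * q + ((lu \<alpha> \<gamma> b t)\<^sup>2 + lu1 \<alpha> \<gamma> b t) * q\<^sup>2 / 2
     - (lu \<alpha> \<gamma> b t ^ 3 + 3 * lu \<alpha> \<gamma> b t * lu1 \<alpha> \<gamma> b t + lu2 \<alpha> \<gamma> b t) * q ^ 3 / 6"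

text \<open>The fourth derivative is fw times u^4 + 6 u^2 u1 + 3 u1^2 + 4 u u2 + u3, which
  \<open>lu_bounds\<close> turns into at most 6 (u + 1/s)^4; division by 4! leaves the 1/4. Of the
  intermediate point only a lower bound is kept, since everything evaluated there decreases.\<close>

lemma fw_taylor:
  assumes t: "0 < t" "0 < t'" and p: "0 \<le> b" "0 \<le> \<alpha>" "0 \<le> \<gamma>"
  obtains s where "min t t' \<le> s"
    "fw \<alpha> \<gamma> b t' \<le> fw \<alpha> \<gamma> b t * taylor3 \<alpha> \<gamma> b t (t' - t)
        + fw \<alpha> \<gamma> b s * (lu \<alpha> \<gamma> b s + 1 / s) ^ 4 * (t' - t) ^ 4 / 4"
proof (cases "t' = t")
  case True
  have "fw \<alpha> \<gamma> b t' \<le> fw \<alpha> \<gamma> b t * taylor3 \<alpha> \<gamma> b t (t' - t)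
        + fw \<alpha> \<gamma> b t * (lu \<alpha> \<gamma> b t + 1 / t) ^ 4 * (t' - t) ^ 4 / 4"
    using True by (simp add: taylor3_def)
  with True that[of t] show ?thesis by simp
next
  case False
  define f where "f = fw \<alpha> \<gamma> b"
  define u where "u = lu \<alpha> \<gamma> b"
  define u1 where "u1 = lu1 \<alpha> \<gamma> b"
  define u2 where "u2 = lu2 \<alpha> \<gamma> b"
  define u3 where "u3 = lu3 \<alpha> \<gamma> b"
  note defs = f_def u_def u1_def u2_def u3_def
  define D where "D = (\<lambda>(m::nat) s. if m = 0 then f s else if m = 1 then - u s * f s
     else if m = 2 then (u s ^ 2 + u1 s) * f s
     else if m = 3 then - (u s ^ 3 + 3 * u s * u1 s + u2 s) * f s
     else (u s ^ 4 + 6 * u s ^ 2 * u1 s + 3 * u1 s ^ 2 + 4 * u s * u2 s + u3 s) * f s)"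
  have df: "(f has_real_derivative - u s * f s) (at s)"
    and du: "(u has_real_derivative - u1 s) (at s)"
    and du1: "(u1 has_real_derivative - u2 s) (at s)"
    and du2: "(u2 has_real_derivative - u3 s) (at s)" if "0 < s" for s
    unfolding defs by (rule DERIV_fw DERIV_lu DERIV_lu1 DERIV_lu2; use that p in simp)+
  have D01: "(f has_real_derivative D 1 s) (at s)" if "0 < s" for s
    using df[OF that] by (simp add: D_def)
  have D12: "((\<lambda>s. - u s * f s) has_real_derivative D 2 s) (at s)" if "0 < s" for s
    by (rule DERIV_cong[OF DERIV_mult[OF DERIV_minus[OF du[OF that]] df[OF that]]])
      (simp add: D_def algebra_simps power2_eq_square)
  have D23: "((\<lambda>s. (u s ^ 2 + u1 s) * f s) has_real_derivative D 3 s) (at s)" if "0 < s" for s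
    by (rule DERIV_cong[OF DERIV_mult[OF DERIV_add[OF DERIV_power[OF du[OF that], of 2] du1[OF that]] df[OF that]]])
      (simp add: D_def algebra_simps eval_nat_numeral)
  have D34: "((\<lambda>s. - (u s ^ 3 + 3 * u s * u1 s + u2 s) * f s) has_real_derivative D 4 s) (at s)" if "0 < s" for s
    by (rule DERIV_cong[OF DERIV_mult[OF DERIV_minus[OF DERIV_add[OF DERIV_add[OF DERIV_power[OF du[OF that], of 3]
          DERIV_mult[OF DERIV_cmult[OF du[OF that], of 3] du1[OF that]]] du2[OF that]]] df[OF that]]])
      (simp add: D_def algebra_simps eval_nat_numeral)
  have D_eqs: "D 0 = f" "D 1 = (\<lambda>s. - u s * f s)" "D 2 = (\<lambda>s. (u s ^ 2 + u1 s) * f s)"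
    "D 3 = (\<lambda>s. - (u s ^ 3 + 3 * u s * u1 s + u2 s) * f s)"
    by (simp_all add: D_def)
  have DD: "(D m has_real_derivative D (Suc m) s) (at s)" if "m < 4" "0 < s" for m s
  proof -
    have "m = 0 \<or> m = 1 \<or> m = 2 \<or> m = 3" using that(1) by linarith
    then consider "m = 0" | "m = 1" | "m = 2" | "m = 3" by blast
    then show ?thesis
      using D01[folded D_eqs(1), OF that(2)] D12[folded D_eqs(2), OF that(2)]
        D23[folded D_eqs(3), OF that(2)] D34[folded D_eqs(4), OF that(2)]
      by cases (simp_all add: numeral_eq_Suc)
  qed
  have "\<exists>s. (if t' < t then t' < s \<and> s < t else t < s \<and> s < t') \<and>
     f t' = (\<Sum>m<4. (D m t / fact m) * (t' - t) ^ m) + (D 4 s / fact 4) * (t' - t) ^ 4"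
    using t False by (intro Taylor[where a = "min t t'" and b = "max t t'"]) (auto simp: D_eqs(1) intro!: DD)
  then obtain s where s': "if t' < t then t' < s \<and> s < t else t < s \<and> s < t'"
    and e: "f t' = (\<Sum>m<4. (D m t / fact m) * (t' - t) ^ m) + (D 4 s / fact 4) * (t' - t) ^ 4"
    by blast
  have s: "min t t' \<le> s" using s' by (auto split: if_splits)
  have s0: "0 < s" using s t by linarith
  have sum: "(\<Sum>m<4. (D m t / fact m) * q ^ m) = f t * taylor3 \<alpha> \<gamma> b t q" for q
  proof -
    have "(\<Sum>m<4. (D m t / fact m) * q ^ m) = D 0 t + D 1 t * q + D 2 t * q\<^sup>2 / 2 + D 3 t * q ^ 3 / 6"
      by (simp add: eval_nat_numeral lessThan_Suc)
    then show ?thesis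
      unfolding D_eqs taylor3_def defs[symmetric] by (simp add: field_simps)
  qed
  have b: "0 \<le> u s" "0 \<le> u1 s" "0 \<le> u2 s" "u1 s \<le> u s * (1/s)" "u2 s \<le> 2 * u s * (1/s)\<^sup>2" "u3 s \<le> 6 * u s * (1/s)^3"
    using lu_bounds[OF s0 p] lu_nonneg[OF s0 p] by (auto simp: defs divide_inverse power_inverse)
  define w where "w = 1 / s"
  have w: "0 \<le> w" using s0 by (simp add: w_def)
  note b' = b[folded w_def]
  have "u s ^ 4 + 6 * u s ^ 2 * u1 s + 3 * u1 s ^ 2 + 4 * u s * u2 s + u3 s
     \<le> u s ^ 4 + 6 * u s ^ 2 * (u s * w) + 3 * (u s * w) ^ 2 + 4 * u s * (2 * u s * w\<^sup>2) + 6 * u s * w ^ 3"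
    using b' w by (intro add_mono mult_left_mono power_mono) auto
  also have "\<dots> \<le> 6 * (u s + w) ^ 4"
  proof -
    have "6 * (u s + w) ^ 4 - (u s ^ 4 + 6 * u s ^ 2 * (u s * w) + 3 * (u s * w) ^ 2 + 4 * u s * (2 * u s * w\<^sup>2) + 6 * u s * w ^ 3)
      = 5 * u s ^ 4 + 18 * (u s ^ 3 * w) + 25 * (u s ^ 2 * w ^ 2) + 18 * (u s * w ^ 3) + 6 * w ^ 4"
      by (simp add: algebra_simps eval_nat_numeral)
    also have "\<dots> \<ge> 0" using b' w by (intro add_nonneg_nonneg mult_nonneg_nonneg) auto
    finally show ?thesis by simp
  qed
  finally have D4: "D 4 s \<le> 6 * (u s + w) ^ 4 * f s"
    using fw_pos[OF s0, of \<alpha> \<gamma> b] by (simp add: D_def defs mult_right_mono)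
  have "D 4 s / fact 4 * (t' - t) ^ 4 \<le> 6 * (u s + w) ^ 4 * f s / fact 4 * (t' - t) ^ 4"
    using D4 by (intro mult_right_mono divide_right_mono) auto
  also have "\<dots> = f s * (u s + 1 / s) ^ 4 * (t' - t) ^ 4 / 4"
    by (simp add: w_def fact_numeral)
  finally show ?thesis
    using that[OF s] e sum by (simp add: defs)
qed


text \<open>Moving the radius by at most z moves sqrt (A^2 + b) by at most z and so costs exp
  (\<gamma> z). The loss in the power is left as a hypothesis because short and long steps bound it
  differently.\<close>

lemma fw_le_shift:
  assumes "0 < A" "0 < A'" "\<bar>A - A'\<bar> \<le> z" "0 \<le> b" "0 \<le> \<gamma>"
    and k: "(A'\<^sup>2) powr (- \<alpha>) \<le> k * (A\<^sup>2) powr (- \<alpha>)"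
  shows "fw \<alpha> \<gamma> b (A'\<^sup>2) \<le> k * exp (\<gamma> * z) * fw \<alpha> \<gamma> b (A\<^sup>2)"
proof -
  have z: "0 \<le> z" using assms(3) by linarith
  have "sqrt (A\<^sup>2 + b) \<le> sqrt (A'\<^sup>2 + b) + z"
  proof (rule real_le_lsqrt)
    have "A \<le> A' + z" using assms by linarith
    then have "A\<^sup>2 \<le> (A' + z)\<^sup>2" using assms by (intro power_mono) auto
    also have "\<dots> \<le> A'\<^sup>2 + 2 * (sqrt (A'\<^sup>2 + b) * z) + z\<^sup>2"
    proof -
      have "A' \<le> sqrt (A'\<^sup>2 + b)" using assms by (intro real_le_rsqrt) auto
      then have "A' * z \<le> sqrt (A'\<^sup>2 + b) * z" using z by (rule mult_right_mono)
      then show ?thesis by (simp add: power2_sum)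
    qed
    finally show "A\<^sup>2 + b \<le> (sqrt (A'\<^sup>2 + b) + z)\<^sup>2"
      using assms by (simp add: power2_sum)
  qed (use assms z in auto)
  then have "- \<gamma> * sqrt (A'\<^sup>2 + b) \<le> \<gamma> * z - \<gamma> * sqrt (A\<^sup>2 + b)"
    using mult_left_mono[of "sqrt (A\<^sup>2 + b)" "sqrt (A'\<^sup>2 + b) + z" \<gamma>] assms by (simp add: distrib_left)
  then have "exp (- \<gamma> * sqrt (A'\<^sup>2 + b)) \<le> exp (\<gamma> * z) * exp (- \<gamma> * sqrt (A\<^sup>2 + b))"
    by (simp flip: exp_add)
  then have "fw \<alpha> \<gamma> b (A'\<^sup>2) \<le> (k * (A\<^sup>2) powr (- \<alpha>)) * (exp (\<gamma> * z) * exp (- \<gamma> * sqrt (A\<^sup>2 + b)))"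
    unfolding fw_def using k by (intro mult_mono) (auto intro: order_trans[OF _ k])
  then show ?thesis by (simp add: fw_def mult_ac)
qed

text \<open>Lengths are in units of the step length. Short steps, z \<le> A/2, are expanded by
  Taylor. For long ones 1 \<le> 16 z^4 / A^4, so both the value and the subtracted polynomial count
  as errors carrying a power of z, which the exponential absorbs. The indicator removes radii below
  one step, where the power would be unbounded. The constant is chosen before \<alpha>, c and
  \<xi>.\<close>

lemma fw_step:
  fixes a :: real and D :: nat
  assumes a: "0 < a"
  obtains C where "0 < C" "\<And>\<alpha> c \<xi> A A' z. 0 \<le> \<alpha> \<Longrightarrow> \<alpha> \<le> real D \<Longrightarrow> 0 < c \<Longrightarrow> c \<le> 1 \<Longrightarrow> c \<le> a / 2 \<Longrightarrow>
     1 \<le> A \<Longrightarrow> 1 \<le> \<xi> \<Longrightarrow> 0 < A' \<Longrightarrow> \<bar>A - A'\<bar> \<le> z \<Longrightarrow>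
     of_bool (1 \<le> A') * fw \<alpha> (c / \<xi>) (\<xi>\<^sup>2) (A'\<^sup>2) \<le> fw \<alpha> (c / \<xi>) (\<xi>\<^sup>2) (A\<^sup>2) *
       (taylor3 \<alpha> (c / \<xi>) (\<xi>\<^sup>2) (A\<^sup>2) (A'\<^sup>2 - A\<^sup>2) + C * (1 / A ^ 4 + c / \<xi>\<^sup>2) * exp (a * z))"
proof -
  define K where "K = real D + 1"
  have K: "1 \<le> K" by (simp add: K_def)
  \<comment> \<open>z^n \<le> p n * exp (a z / 2): half of the exponential pays for powers of z, the
    other half for exp (\<gamma> z), because \<gamma> \<le> c \<le> a / 2.\<close>
  define p where "p = (\<lambda>n. fact n / (a / 2) ^ n)"
  have p: "z ^ n \<le> p n * exp (a / 2 * z)" "0 < p n" if "0 \<le> z" for z :: real and n :: nat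
    using power_le_exp[of z "a / 2" n] a that by (auto simp: p_def)
  have p0: "0 < p n" for n using a by (simp add: p_def)
  \<comment> \<open>\<open>C1\<close> serves short steps, \<open>C2\<close> long ones. In
    \<open>C1\<close> the factors 64 = 4^4 / 4 and 4^D come from an intermediate point that may be
    as small as A^2 / 4, and 320 exceeds 8 * (5/2)^4.\<close>
  define C1 where "C1 = 64 * 4 ^ D * (320 * K ^ 4) * p 4"
  define C2 where "C2 = 20 * K * (p 2 + p 4) + 500 * K ^ 3 * p 6 + 16 * 4 ^ D * p (2 * D + 4)"
  have C12: "0 < C1" "0 < C2" using p0 K unfolding C1_def C2_def by (auto intro!: add_pos_pos mult_pos_pos)
  show ?thesis
  proof (rule that[of "C1 + C2"])
    show "0 < C1 + C2" using C12 by simp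
    fix \<alpha> c \<xi> A A' z :: real
    assume as: "0 \<le> \<alpha>" "\<alpha> \<le> real D" "0 < c" "c \<le> 1" "c \<le> a / 2" "1 \<le> A" "1 \<le> \<xi>" "0 < A'" "\<bar>A - A'\<bar> \<le> z"
    define \<gamma> where "\<gamma> = c / \<xi>"
    define b where "b = \<xi>\<^sup>2"
    define q where "q = A'\<^sup>2 - A\<^sup>2"
    define f where "f = fw \<alpha> \<gamma> b"
    define u where "u = lu \<alpha> \<gamma> b"
    define X where "X = 1 / A ^ 4 + c / \<xi>\<^sup>2"
    have z: "0 \<le> z" using as by linarith
    have b: "0 < b" "0 \<le> b" "sqrt b = \<xi>" using as by (auto simp: b_def)
    have g: "0 < \<gamma>" "0 \<le> \<gamma>" "\<gamma> \<le> c" "\<gamma> \<le> a / 2"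
    proof -
      show "0 < \<gamma>" "0 \<le> \<gamma>" using as by (auto simp: \<gamma>_def)
      have "c / \<xi> \<le> c / 1" using as by (intro divide_left_mono) auto
      then show "\<gamma> \<le> c" by (simp add: \<gamma>_def)
      then show "\<gamma> \<le> a / 2" using as by linarith
    qed
    have A2: "0 < A\<^sup>2" "0 < A'\<^sup>2" using as by auto
    have fA: "0 < f (A\<^sup>2)" using fw_pos[OF A2(1)] by (simp add: f_def)
    have X: "0 < X" using as by (auto simp: X_def intro!: add_pos_pos)
    have eg: "exp (\<gamma> * z) \<le> exp (a / 2 * z)" using mult_right_mono[OF g(4) z] by simp
    have ee: "exp (a / 2 * z) * exp (a / 2 * z) = exp (a * z)" by (simp flip: exp_add)
    have absq: "\<bar>q\<bar> \<le> z * (2 * A + z)"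
    proof -
      have "\<bar>q\<bar> = \<bar>A - A'\<bar> * (A + A')"
        using as by (simp add: q_def power2_eq_square square_diff_square_factored abs_mult abs_minus_commute mult.commute)
      also have "\<dots> \<le> z * (2 * A + z)" using as z by (intro mult_mono) auto
      finally show ?thesis .
    qed
    \<comment> \<open>Dimensionless size of the increment; the Taylor terms and the remainder are
      bounded by powers of it.\<close>
    define y where "y = (u (A\<^sup>2) + 1 / A\<^sup>2) * \<bar>q\<bar>"
    have u0: "0 \<le> u (A\<^sup>2)" using lu_nonneg(1)[OF A2(1) b(2) as(1) g(2)] by (simp add: u_def)
    have y0: "0 \<le> y" using u0 by (simp add: y_def)
    show "of_bool (1 \<le> A') * fw \<alpha> (c / \<xi>) (\<xi>\<^sup>2) (A'\<^sup>2) \<le> fw \<alpha> (c / \<xi>) (\<xi>\<^sup>2) (A\<^sup>2) *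
       (taylor3 \<alpha> (c / \<xi>) (\<xi>\<^sup>2) (A\<^sup>2) (A'\<^sup>2 - A\<^sup>2) + (C1 + C2) * (1 / A ^ 4 + c / \<xi>\<^sup>2) * exp (a * z))"
      unfolding X_def[symmetric]
      unfolding \<gamma>_def[symmetric] b_def[symmetric] q_def[symmetric]
      unfolding f_def[symmetric]
    proof (cases "z \<le> A / 2")
      case True
      obtain s where s: "min (A\<^sup>2) (A'\<^sup>2) \<le> s"
        and T: "f (A'\<^sup>2) \<le> f (A\<^sup>2) * taylor3 \<alpha> \<gamma> b (A\<^sup>2) q + f s * (u s + 1 / s) ^ 4 * q ^ 4 / 4"
        using fw_taylor[OF A2 b(2) as(1) g(2)] unfolding f_def q_def u_def by blast
      have A': "A / 2 \<le> A'" using as True by linarith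
      have A'2: "A\<^sup>2 / 4 \<le> A'\<^sup>2" using power_mono[OF A', of 2] as by (simp add: power_divide)
      have s4: "A\<^sup>2 / 4 \<le> s" using s A'2 A2 by linarith
      have s0: "0 < s" using s4 A2 by linarith
      have fs: "f s \<le> 4 ^ D * exp (\<gamma> * z) * f (A\<^sup>2)"
      proof -
        have k: "(A'\<^sup>2) powr (- \<alpha>) \<le> 4 ^ D * (A\<^sup>2) powr (- \<alpha>)"
        proof -
          have "(A'\<^sup>2) powr (- \<alpha>) \<le> (A\<^sup>2 / 4) powr (- \<alpha>)"
            using A'2 A2 as by (intro powr_mono2') auto
          also have "\<dots> = 4 powr \<alpha> * (A\<^sup>2) powr (- \<alpha>)"
            using A2 by (simp add: powr_divide powr_minus_divide)
          also have "\<dots> \<le> 4 powr (real D) * (A\<^sup>2) powr (- \<alpha>)"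
            using as by (intro mult_right_mono powr_mono) auto
          finally show ?thesis by (simp add: powr_realpow)
        qed
        have 1: "f (A'\<^sup>2) \<le> 4 ^ D * exp (\<gamma> * z) * f (A\<^sup>2)"
          unfolding f_def using as by (intro fw_le_shift k b g) auto
        have 2: "1 * f (A\<^sup>2) \<le> 4 ^ D * exp (\<gamma> * z) * f (A\<^sup>2)"
          using fA g z by (intro mult_right_mono) (auto intro!: order_trans[OF _ mult_mono[of 1 "4 ^ D" 1 "exp (\<gamma> * z)"]])
        have "f s \<le> f (min (A\<^sup>2) (A'\<^sup>2))"
          unfolding f_def using s A2 as g by (intro fw_antimono) auto
        with 1 2 show ?thesis by (auto simp: min_def split: if_splits)
      qed
      have us: "u s + 1 / s \<le> 4 * (u (A\<^sup>2) + 1 / A\<^sup>2)"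
      proof -
        have i: "1 / s \<le> 4 / A\<^sup>2" using s4 A2 s0 by (simp add: field_simps)
        have "sqrt (A\<^sup>2 + b) / 2 = sqrt ((A\<^sup>2 + b) / 4)" by (simp add: real_sqrt_divide)
        also have "\<dots> \<le> sqrt (s + b)" using s4 b by simp
        finally have "\<gamma> / 2 / sqrt (s + b) \<le> \<gamma> / 2 / (sqrt (A\<^sup>2 + b) / 2)"
          using g b A2 by (intro divide_left_mono mult_pos_pos) (auto intro: add_pos_pos s0)
        moreover have "\<alpha> / s \<le> \<alpha> * (4 / A\<^sup>2)" using mult_left_mono[OF i as(1)] by simp
        moreover have "\<gamma> / 2 / (sqrt (A\<^sup>2 + b) / 2) \<le> 4 * (\<gamma> / 2 / sqrt (A\<^sup>2 + b))"
          using g b A2 by (simp add: divide_right_mono)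
        ultimately show ?thesis using i by (simp add: u_def lu_def)
      qed
      have us0: "0 \<le> u s + 1 / s"
        using lu_nonneg(1)[OF s0 b(2) as(1) g(2)] s0 by (simp add: u_def)
      have yb: "y \<le> 5 / 2 * z * (K / A + \<gamma> / 2)"
      proof -
        have "\<bar>q\<bar> \<le> 5 / 2 * z * A" 
          using absq mult_left_mono[of "2 * A + z" "5 / 2 * A" z] True z as by auto
        then have "y \<le> (u (A\<^sup>2) + 1 / A\<^sup>2) * (5 / 2 * z * A)"
          unfolding y_def using u0 by (intro mult_left_mono) auto
        also have "\<dots> = 5 / 2 * z * ((\<alpha> + 1) / A + \<gamma> / 2 * (A / sqrt (A\<^sup>2 + b)))"
          using as by (simp add: u_def lu_def field_simps power2_eq_square)
        also have "\<dots> \<le> 5 / 2 * z * (K / A + \<gamma> / 2 * 1)"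
        proof -
          have "A \<le> sqrt (A\<^sup>2 + b)" using b as by (intro real_le_rsqrt) auto
          moreover have "0 < sqrt (A\<^sup>2 + b)" using calculation as by linarith
          ultimately have "A / sqrt (A\<^sup>2 + b) \<le> 1" by (simp add: divide_le_eq_1)
          then show ?thesis
            using z as g by (intro mult_left_mono add_mono divide_right_mono) (auto simp: K_def)
        qed
        finally show ?thesis by simp
      qed
      \<comment> \<open>The power part of \<open>y\<close> gives the 1/A^4 in \<open>X\<close>; for
        the exponential part \<gamma>^4 \<le> \<gamma>^2 \<le> c / \<xi>^2.\<close>
      have y4: "y ^ 4 \<le> 320 * K ^ 4 * z ^ 4 * X"
      proof -
        have "y ^ 4 \<le> (5 / 2 * z * (K / A + \<gamma> / 2)) ^ 4"
          using yb y0 by (intro power_mono)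
        also have "\<dots> = (5 / 2) ^ 4 * z ^ 4 * (K / A + \<gamma> / 2) ^ 4" by (simp only: power_mult_distrib)
        also have "\<dots> \<le> (5 / 2) ^ 4 * z ^ 4 * (8 * (K ^ 4 * X))"
        proof (intro mult_left_mono)
          have "(x + w) ^ 4 \<le> 8 * (x ^ 4 + w ^ 4)" if "0 \<le> x" "0 \<le> w" for x w :: real
          proof -
            have "(x + w)\<^sup>2 \<le> 2 * (x\<^sup>2 + w\<^sup>2)" using sum_squares_ge_zero[of "x - w" 0] by (simp add: power2_eq_square algebra_simps)
            then have "((x + w)\<^sup>2)\<^sup>2 \<le> (2 * (x\<^sup>2 + w\<^sup>2))\<^sup>2" by (intro power_mono) auto
            also have "\<dots> \<le> 8 * (x ^ 4 + w ^ 4)"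
              using zero_le_power2[of "x\<^sup>2 - w\<^sup>2"] by (simp add: power2_eq_square algebra_simps power4_eq_xxxx)
            finally show ?thesis by simp
          qed
          then have "(K / A + \<gamma> / 2) ^ 4 \<le> 8 * ((K / A) ^ 4 + (\<gamma> / 2) ^ 4)"
            using K as g by simp
          also have "(K / A) ^ 4 + (\<gamma> / 2) ^ 4 \<le> K ^ 4 * (1 / A ^ 4) + K ^ 4 * (c / \<xi>\<^sup>2)"
          proof (intro add_mono)
            have "(\<gamma> / 2) ^ 4 \<le> 1 * (c / \<xi>\<^sup>2)"
            proof -
              have "(\<gamma> / 2) ^ 4 \<le> \<gamma> ^ 4" using g by (intro power_mono) auto
              also have "\<dots> \<le> \<gamma> ^ 2" using g as by (intro power_decreasing) auto
              also have "\<dots> = c\<^sup>2 / \<xi>\<^sup>2" by (simp add: \<gamma>_def power_divide)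
              also have "\<dots> \<le> c / \<xi>\<^sup>2" using as by (intro divide_right_mono) (auto simp: power2_eq_square mult_le_cancel_left1)
              finally show ?thesis by simp
            qed
            also have "\<dots> \<le> K ^ 4 * (c / \<xi>\<^sup>2)" using K as by (intro mult_right_mono) auto
            finally show "(\<gamma> / 2) ^ 4 \<le> K ^ 4 * (c / \<xi>\<^sup>2)" .
          qed (simp add: power_divide)
          finally show "(K / A + \<gamma> / 2) ^ 4 \<le> 8 * (K ^ 4 * X)" by (simp add: X_def distrib_left)
        qed (use z in auto)
        also have "\<dots> \<le> 320 * K ^ 4 * z ^ 4 * X" using z K X by (simp add: power_divide)
        finally show ?thesis .
      qed
      have "f s * (u s + 1 / s) ^ 4 * q ^ 4 / 4 \<le> (4 ^ D * exp (\<gamma> * z) * f (A\<^sup>2)) * (4 * (u (A\<^sup>2) + 1 / A\<^sup>2)) ^ 4 * q ^ 4 / 4"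
        (is "_ \<le> _ * (4 * ?w) ^ 4 * _ / _")
        using fs us us0 fA by (intro divide_right_mono mult_right_mono mult_mono power_mono) auto
      also have "\<dots> = f (A\<^sup>2) * (64 * 4 ^ D * exp (\<gamma> * z) * y ^ 4)"
        unfolding y_def by (simp only: power_mult_distrib) (simp add: power_even_abs)
      also have "\<dots> \<le> f (A\<^sup>2) * (64 * 4 ^ D * exp (a / 2 * z) * (320 * K ^ 4 * (p 4 * exp (a / 2 * z)) * X))"
      proof -
        have "y ^ 4 \<le> 320 * K ^ 4 * (p 4 * exp (a / 2 * z)) * X"
          using y4 p(1)[OF z, of 4] K X by (auto intro!: order_trans[OF y4] mult_right_mono mult_left_mono)
        then show ?thesis
          using eg fA K X z by (intro mult_left_mono mult_mono) auto
      qed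
      also have "\<dots> = f (A\<^sup>2) * (C1 * X * (exp (a / 2 * z) * exp (a / 2 * z)))" by (simp add: C1_def)
      also have "\<dots> \<le> f (A\<^sup>2) * ((C1 + C2) * X * exp (a * z))"
        unfolding ee using C12 fA X by (intro mult_left_mono mult_right_mono) auto
      finally have R: "f s * (u s + 1 / s) ^ 4 * q ^ 4 / 4 \<le> f (A\<^sup>2) * ((C1 + C2) * X * exp (a * z))" .
      have "of_bool (1 \<le> A') * f (A'\<^sup>2) \<le> f (A'\<^sup>2)" using fw_pos[OF A2(2), of \<alpha> \<gamma> b] by (auto simp: f_def)
      with T R show "of_bool (1 \<le> A') * f (A'\<^sup>2) \<le> f (A\<^sup>2) * (taylor3 \<alpha> \<gamma> b (A\<^sup>2) q + (C1 + C2) * X * exp (a * z))"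
        by (simp add: distrib_left)
    next
      case False
      \<comment> \<open>From here on a factor 1/A^4 may be inserted anywhere at the price of 16
        z^4.\<close>
      have Az: "A \<le> 2 * z" using False by simp
      have A4: "A\<^sup>2 \<le> 4 * z\<^sup>2" using power_mono[OF Az, of 2] as by (simp add: power_mult_distrib)
      have A4': "1 \<le> 16 * z ^ 4 * (1 / A ^ 4)" using power_mono[OF Az, of 4] as by (simp add: power_mult_distrib field_simps)
      have q5: "\<bar>q\<bar> \<le> 5 * z\<^sup>2"
        using absq mult_left_mono[of "2 * A + z" "5 * z" z] Az z by (auto simp: power2_eq_square)
      have uq: "u (A\<^sup>2) + 1 / A\<^sup>2 \<le> K * (1 / A\<^sup>2 + c / \<xi>\<^sup>2)"
      proof -
        have "\<xi> \<le> sqrt (A\<^sup>2 + b)" using as by (intro real_le_rsqrt) (auto simp: b_def)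
        then have "\<gamma> / 2 / sqrt (A\<^sup>2 + b) \<le> \<gamma> / 2 / \<xi>"
          using g as by (intro divide_left_mono mult_pos_pos; linarith)
        also have "\<dots> \<le> c / \<xi>\<^sup>2" using as by (auto simp: \<gamma>_def power2_eq_square intro!: divide_left_mono)
        also have "\<dots> \<le> K * (c / \<xi>\<^sup>2)" using mult_right_mono[OF K, of "c / \<xi>\<^sup>2"] as by simp
        finally have "\<gamma> / 2 / sqrt (A\<^sup>2 + b) \<le> K * (c / \<xi>\<^sup>2)" .
        moreover have "\<alpha> / A\<^sup>2 + 1 / A\<^sup>2 \<le> K * (1 / A\<^sup>2)"
          using as by (simp add: K_def divide_right_mono flip: add_divide_distrib)
        ultimately show ?thesis by (simp add: u_def lu_def distrib_left)
      qed
      have yb: "y \<le> 5 * z\<^sup>2 * (K * (1 / A\<^sup>2 + c / \<xi>\<^sup>2))"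
      proof -
        have "y \<le> (K * (1 / A\<^sup>2 + c / \<xi>\<^sup>2)) * (5 * z\<^sup>2)"
          unfolding y_def using uq q5 u0 K as by (intro mult_mono) auto
        then show ?thesis by (simp add: mult_ac)
      qed
      have y1: "y \<le> 20 * K * (z\<^sup>2 + z ^ 4) * X"
      proof -
        have "1 / A\<^sup>2 = A\<^sup>2 * (1 / A ^ 4)" using as by (simp add: field_simps eval_nat_numeral)
        also have "\<dots> \<le> 4 * z\<^sup>2 * (1 / A ^ 4)" using A4 as by (intro mult_right_mono) auto
        finally have h: "1 / A\<^sup>2 \<le> 4 * z\<^sup>2 * (1 / A ^ 4)" .
        have "1 / A\<^sup>2 + c / \<xi>\<^sup>2 \<le> 4 * z\<^sup>2 * X + 1 * X"
        proof -
          have "1 / A ^ 4 \<le> X" "c / \<xi>\<^sup>2 \<le> X" using as by (auto simp: X_def)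
          then show ?thesis using h mult_left_mono[of "1 / A ^ 4" X "4 * z\<^sup>2"] by simp
        qed
        then have "5 * z\<^sup>2 * (K * (1 / A\<^sup>2 + c / \<xi>\<^sup>2)) \<le> 5 * z\<^sup>2 * (K * (4 * z\<^sup>2 * X + 1 * X))"
          using K by (intro mult_left_mono) auto
        also have "\<dots> = (20 * K * z ^ 4 + 5 * K * z\<^sup>2) * X" by (simp add: algebra_simps eval_nat_numeral)
        also have "\<dots> \<le> 20 * K * (z\<^sup>2 + z ^ 4) * X"
          using X K by (intro mult_right_mono) (auto simp: distrib_left)
        finally show ?thesis using yb by linarith
      qed
      have y3: "y ^ 3 \<le> 500 * K ^ 3 * z ^ 6 * X"
      proof -
        define v where "v = 1 / A\<^sup>2"
        define w where "w = c / \<xi>\<^sup>2"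
        have v: "0 \<le> v" "v \<le> 1" "v\<^sup>2 = 1 / A ^ 4" using as by (auto simp: v_def power_one_over)
        have w: "0 \<le> w" "w \<le> 1"
        proof -
          have "c * 1 \<le> 1 * \<xi>\<^sup>2" using as by (intro mult_mono) auto
          then show "w \<le> 1" using as by (auto simp: w_def)
        qed (use as in \<open>auto simp: w_def\<close>)
        have "(v + w) ^ 3 \<le> 4 * (v ^ 3 + w ^ 3)"
        proof -
          have "4 * (v ^ 3 + w ^ 3) - (v + w) ^ 3 = 3 * (v + w) * (v - w)\<^sup>2"
            by (simp add: eval_nat_numeral algebra_simps)
          also have "\<dots> \<ge> 0" using v w by auto
          finally show ?thesis by simp
        qed
        also have "\<dots> \<le> 4 * (v ^ 2 + w ^ 1)"
          using v w by (intro mult_left_mono add_mono power_decreasing) auto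
        also have "\<dots> = 4 * X" using v by (simp add: X_def w_def)
        finally have vw: "(v + w) ^ 3 \<le> 4 * X" .
        have "y ^ 3 \<le> (5 * z\<^sup>2 * (K * (v + w))) ^ 3"
          using yb y0 by (intro power_mono) (auto simp: v_def w_def)
        also have "\<dots> = 125 * K ^ 3 * z ^ 6 * (v + w) ^ 3" by (simp add: power_mult_distrib flip: power_mult)
        also have "\<dots> \<le> 125 * K ^ 3 * z ^ 6 * (4 * X)" using vw K z by (intro mult_left_mono) auto
        finally show ?thesis by simp
      qed
      have T3: "- taylor3 \<alpha> \<gamma> b (A\<^sup>2) q \<le> y + y ^ 3"
      proof -
        define w where "w = 1 / A\<^sup>2"
        have w: "0 \<le> w" by (simp add: w_def)
        define U where "U = u (A\<^sup>2)"
        have U: "0 \<le> U" using u0 by (simp add: U_def)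
        define U1 where "U1 = lu1 \<alpha> \<gamma> b (A\<^sup>2)"
        define U2 where "U2 = lu2 \<alpha> \<gamma> b (A\<^sup>2)"
        have bd: "U1 \<le> U * w" "U2 \<le> 2 * U * w\<^sup>2" "0 \<le> U1" "0 \<le> U2"
          using lu_bounds[OF A2(1) b(2) as(1) g(2)] lu_nonneg[OF A2(1) b(2) as(1) g(2)]
          by (auto simp: U_def U1_def U2_def u_def w_def power_one_over)
        have y: "y = (U + w) * \<bar>q\<bar>" by (simp add: y_def U_def w_def)
        have 1: "U * q \<le> y" unfolding y
          by (rule order_trans[OF mult_left_mono[OF abs_ge_self U] mult_right_mono]) (use w in auto)
        have 2: "(U ^ 3 + 3 * U * U1 + U2) * q ^ 3 / 6 \<le> y ^ 3"
        proof -
          have "(U ^ 3 + 3 * U * U1 + U2) * q ^ 3 / 6 \<le> (U ^ 3 + 3 * U * U1 + U2) * \<bar>q\<bar> ^ 3 / 6"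
            using bd U abs_ge_self[of "q ^ 3"] by (intro divide_right_mono mult_left_mono) (auto simp: power_abs)
          also have "\<dots> \<le> (U ^ 3 + 3 * U * U1 + U2) * \<bar>q\<bar> ^ 3" using bd U by simp
          also have "\<dots> \<le> (U + w) ^ 3 * \<bar>q\<bar> ^ 3"
          proof (intro mult_right_mono)
            have "U ^ 3 + 3 * U * U1 + U2 \<le> U ^ 3 + 3 * U * (U * w) + 2 * U * w\<^sup>2"
              using bd U by (intro add_mono mult_left_mono) auto
            also have "\<dots> \<le> U ^ 3 + 3 * U * (U * w) + 2 * U * w\<^sup>2 + (U * w\<^sup>2 + w ^ 3)" using U w by simp
            also have "\<dots> = (U + w) ^ 3" by (simp add: algebra_simps eval_nat_numeral)
            finally show "U ^ 3 + 3 * U * U1 + U2 \<le> (U + w) ^ 3" .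
          qed auto
          finally show ?thesis by (simp add: y power_mult_distrib)
        qed
        have "0 \<le> (U\<^sup>2 + U1) * q\<^sup>2 / 2" using bd by simp
        then show ?thesis using 1 2 unfolding taylor3_def by (simp add: U_def U1_def U2_def u_def)
      qed
      \<comment> \<open>The cutoff gives A' \<ge> 1, so the power at A' is at most 1; the power at A
        is restored by (A^2)^\<alpha> \<le> (4 z^2)^D.\<close>
      have far: "of_bool (1 \<le> A') * f (A'\<^sup>2) \<le> f (A\<^sup>2) * (16 * 4 ^ D * z ^ (2 * D + 4) * X * exp (\<gamma> * z))"
      proof (cases "1 \<le> A'")
        case A': True
        have "(A'\<^sup>2) powr (- \<alpha>) \<le> 1" using A' as powr_mono2'[of "-\<alpha>" 1 "A'\<^sup>2"] by (simp add: one_le_power)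
        also have "1 = (A\<^sup>2) powr \<alpha> * (A\<^sup>2) powr (- \<alpha>)" using A2 by (simp flip: powr_add)
        also have "\<dots> \<le> (4 * z\<^sup>2) ^ D * (A\<^sup>2) powr (- \<alpha>)"
        proof (intro mult_right_mono)
          have "(A\<^sup>2) powr \<alpha> \<le> (A\<^sup>2) powr (real D)" using as by (intro powr_mono) (auto simp: one_le_power)
          also have "\<dots> = (A\<^sup>2) ^ D" using A2 by (simp add: powr_realpow)
          also have "\<dots> \<le> (4 * z\<^sup>2) ^ D" using A4 by (intro power_mono) auto
          finally show "(A\<^sup>2) powr \<alpha> \<le> (4 * z\<^sup>2) ^ D" .
        qed auto
        finally have "f (A'\<^sup>2) \<le> (4 * z\<^sup>2) ^ D * exp (\<gamma> * z) * f (A\<^sup>2)"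
          unfolding f_def using as by (intro fw_le_shift b g) auto
        also have "\<dots> * 1 \<le> (4 * z\<^sup>2) ^ D * exp (\<gamma> * z) * f (A\<^sup>2) * (16 * z ^ 4 * X)"
        proof (intro mult_left_mono)
          have "16 * z ^ 4 * (1 / A ^ 4) \<le> 16 * z ^ 4 * X" using as z by (intro mult_left_mono) (auto simp: X_def)
          then show "1 \<le> 16 * z ^ 4 * X" using A4' by linarith
        qed (use fA z in auto)
        finally show ?thesis using A' by (simp add: power_mult_distrib power_add mult_ac flip: power_mult)
      next
        case False
        then show ?thesis using fA z X by simp
      qed
      have pz: "z ^ n \<le> p n * exp (a / 2 * z)" for n using p(1)[OF z] .
      define E where "E = exp (a / 2 * z)"
      have E: "1 \<le> E" "E * E = exp (a * z)" "exp (\<gamma> * z) \<le> E" using a z ee eg by (auto simp: E_def)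
      have "y \<le> 20 * K * (p 2 + p 4) * X * (E * E)"
      proof -
        have "y \<le> 20 * K * (p 2 * E + p 4 * E) * X"
          using pz[folded E_def] K X by (intro order_trans[OF y1] mult_right_mono mult_left_mono add_mono) auto
        also have "\<dots> = 20 * K * (p 2 + p 4) * X * (E * 1)" by (simp add: algebra_simps)
        also have "\<dots> \<le> 20 * K * (p 2 + p 4) * X * (E * E)"
          using E K X p0[of 2] p0[of 4] by (intro mult_left_mono) auto
        finally show ?thesis .
      qed
      moreover have "y ^ 3 \<le> 500 * K ^ 3 * p 6 * X * (E * E)"
      proof -
        have "y ^ 3 \<le> 500 * K ^ 3 * (p 6 * E) * X"
          using pz[folded E_def] K X by (intro order_trans[OF y3] mult_right_mono mult_left_mono) auto
        also have "\<dots> = 500 * K ^ 3 * p 6 * X * (E * 1)" by (simp add: algebra_simps)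
        also have "\<dots> \<le> 500 * K ^ 3 * p 6 * X * (E * E)"
          using E K X p0[of 6] by (intro mult_left_mono) auto
        finally show ?thesis .
      qed
      moreover have "of_bool (1 \<le> A') * f (A'\<^sup>2) \<le> f (A\<^sup>2) * (16 * 4 ^ D * p (2 * D + 4) * X * (E * E))"
      proof -
        have "16 * 4 ^ D * z ^ (2 * D + 4) * X * exp (\<gamma> * z) \<le> 16 * 4 ^ D * (p (2 * D + 4) * E) * X * E"
          using pz[folded E_def] X E z less_imp_le[OF p0]  by (intro mult_mono) auto
        also have "\<dots> = 16 * 4 ^ D * p (2 * D + 4) * X * (E * E)" by (simp add: algebra_simps)
        finally show ?thesis using far fA by (meson mult_left_mono less_imp_le order_trans)
      qed
      moreover have "f (A\<^sup>2) * (- taylor3 \<alpha> \<gamma> b (A\<^sup>2) q) \<le> f (A\<^sup>2) * (y + y ^ 3)"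
        using T3 fA by (intro mult_left_mono) auto
      moreover have "f (A\<^sup>2) * (y + y ^ 3) \<le> f (A\<^sup>2) * (20 * K * (p 2 + p 4) * X * (E * E) + 500 * K ^ 3 * p 6 * X * (E * E))"
        using calculation(1,2) fA by (intro mult_left_mono add_mono) auto
      ultimately have "of_bool (1 \<le> A') * f (A'\<^sup>2) \<le> f (A\<^sup>2) * taylor3 \<alpha> \<gamma> b (A\<^sup>2) q + f (A\<^sup>2) * (C2 * X * (E * E))"
        by (simp add: C2_def algebra_simps)
      also have "\<dots> \<le> f (A\<^sup>2) * taylor3 \<alpha> \<gamma> b (A\<^sup>2) q + f (A\<^sup>2) * ((C1 + C2) * X * (E * E))"
        using C12 fA X E by (intro add_left_mono mult_left_mono mult_right_mono) auto
      finally show "of_bool (1 \<le> A') * f (A'\<^sup>2) \<le> f (A\<^sup>2) * (taylor3 \<alpha> \<gamma> b (A\<^sup>2) q + (C1 + C2) * X * exp (a * z))"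
        by (simp add: E distrib_left)
    qed
  qed
qed

subsection \<open>Exponentially summable functions on the lattice\<close>

lemma summable_on_abs_le:
  fixes f g :: "'a \<Rightarrow> real"
  assumes "g summable_on A" "\<And>x. x \<in> A \<Longrightarrow> \<bar>f x\<bar> \<le> g x"
  shows "f summable_on A"
  using Infinite_Sum.abs_summable_on_comparison_test'[OF assms(1), of f] assms(2)
  by (auto intro: abs_summable_summable)

lemma real_vec_simps [simp]:
  "real_vec (x + y) = real_vec x + real_vec y"
  "real_vec (x - y) = real_vec x - real_vec y"
  "real_vec (- x) = - real_vec x"
  "real_vec 0 = 0"
  by (simp_all add: real_vec_def vec_eq_iff)

lemma real_vec_nth [simp]: "real_vec x $ i = real_of_int (x $ i)"
  by (simp add: real_vec_def)

lemma real_vec_eq_0_iff [simp]: "real_vec x = 0 \<longleftrightarrow> x = 0"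
  by (simp add: vec_eq_iff)

lemma l2_nonneg [simp]: "0 \<le> l2 x" by (simp add: l2_def)
lemma l2_zero [simp]: "l2 0 = 0" by (simp add: l2_def)
lemma l2_minus [simp]: "l2 (- x) = l2 x" by (simp add: l2_def)
lemma l2_triangle: "l2 (x + y) \<le> l2 x + l2 y" by (simp add: l2_def norm_triangle_ineq)
lemma l2_power2: "(l2 x)\<^sup>2 = (\<Sum>i\<in>UNIV. (real_of_int (x $ i))\<^sup>2)"
  by (simp add: l2_def norm_vec_def L2_set_def sum_nonneg)

lemma component_le_l2: "\<bar>real_of_int (x $ i)\<bar> \<le> l2 x"
  using component_le_norm_cart[of "real_vec x" i] by (simp add: l2_def)

lemma component_le_linf: "\<bar>real_of_int (x $ i)\<bar> \<le> linf x"
  using component_le_infnorm_cart[of "real_vec x" i] by (simp add: linf_def)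

lemma linf_nonneg [simp]: "0 \<le> linf x" by (simp add: linf_def infnorm_pos_le)

lemma linf_le_l2: "linf x \<le> l2 x"
  by (simp add: linf_def l2_def infnorm_le_norm)

lemma l2_le_linf: "l2 (x :: int ^ 'n) \<le> sqrt (real CARD('n)) * linf x"
  using norm_le_infnorm[of "real_vec x"] by (simp add: linf_def l2_def)

lemma summable_int_power:
  fixes r :: real
  assumes "0 \<le> r" "r < 1"
  shows "(\<lambda>k::int. r ^ nat \<bar>k\<bar>) summable_on UNIV"
proof -
  have g: "(\<lambda>n. r ^ n) summable_on UNIV"
    using assms by (subst summable_on_UNIV_nonneg_real_iff) (auto intro: summable_geometric)
  have 1: "(\<lambda>k::int. r ^ nat \<bar>k\<bar>) summable_on {0..}"
    by (rule summable_on_reindex_bij_witness[where i = int and j = nat, THEN iffD2, OF _ _ _ _ _ g]) auto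
  have g': "(\<lambda>n. r ^ (n + 1)) summable_on UNIV"
    using summable_on_cmult_right[OF g, of r] by simp
  have 2: "(\<lambda>k::int. r ^ nat \<bar>k\<bar>) summable_on {..<0}"
    by (rule summable_on_reindex_bij_witness[where i = "\<lambda>n. - int n - 1" and j = "\<lambda>k. nat (- k - 1)", THEN iffD2, OF _ _ _ _ _ g'])
      (auto simp flip: power_Suc simp: Suc_nat_eq_nat_zadd1)
  have "UNIV = {0::int..} \<union> {..<0}" by auto
  then show ?thesis using summable_on_union[OF 1 2] by simp
qed

text \<open>The sup norm dominates the average of the |x_i|, so the summand is at most a product of
  one-dimensional geometric factors. Sums of products over boxes factorise and bound every finite
  partial sum.\<close>

lemma summable_exp_linf:
  fixes m :: real
  assumes "0 < m"
  shows "(\<lambda>x::int ^ 'n. exp (- m * linf x)) summable_on UNIV"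
proof -
  define r where "r = exp (- m / real CARD('n))"
  have r: "0 \<le> r" "r < 1" using assms by (auto simp: r_def)
  define g where "g = (\<lambda>k::int. r ^ nat \<bar>k\<bar>)"
  have g0: "0 \<le> g k" for k using r by (simp add: g_def)
  have gs: "g summable_on UNIV" unfolding g_def by (rule summable_int_power[OF r])
  have S: "sum g K \<le> infsum g UNIV" if "finite K" for K
    using that g0 by (intro finite_sum_le_infsum gs) auto
  have "(\<lambda>x::int ^ 'n. \<Prod>i\<in>UNIV. g (x $ i)) summable_on UNIV"
  proof (rule nonneg_bdd_above_summable_on)
    show "bdd_above (sum (\<lambda>x::int ^ 'n. \<Prod>i\<in>UNIV. g (x $ i)) ` {F. F \<subseteq> UNIV \<and> finite F})"
    proof (rule bdd_aboveI2)
      fix F :: "(int ^ 'n) set" assume "F \<in> {F. F \<subseteq> UNIV \<and> finite F}"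
      then have F: "finite F" by simp
      define K where "K = (\<Union>x\<in>F. \<Union>i\<in>UNIV. {x $ i})"
      have K: "finite K" using F by (auto simp: K_def)
      have "(\<Sum>x\<in>F. \<Prod>i\<in>UNIV. g (x $ i)) = (\<Sum>p\<in>(\<lambda>x i. x $ i) ` F. \<Prod>i\<in>UNIV. g (p i))"
        by (subst sum.reindex) (auto simp: inj_on_def vec_eq_iff fun_eq_iff)
      also have "\<dots> \<le> (\<Sum>p\<in>PiE (UNIV :: 'n set) (\<lambda>_. K). \<Prod>i\<in>UNIV. g (p i))"
        using K g0 by (intro sum_mono2 finite_PiE) (auto simp: K_def prod_nonneg)
      also have "\<dots> = (\<Prod>i\<in>(UNIV::'n set). \<Sum>k\<in>K. g k)"
        using K by (subst prod_sum_PiE) auto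
      also have "\<dots> \<le> (\<Prod>i\<in>(UNIV::'n set). infsum g UNIV)"
        using S[OF K] g0 by (intro prod_mono) (auto intro: sum_nonneg)
      finally show "(\<Sum>x\<in>F. \<Prod>i\<in>UNIV. g (x $ i)) \<le> (\<Prod>i\<in>(UNIV::'n set). infsum g UNIV)" .
    qed
  qed (auto intro: prod_nonneg g0)
  then show ?thesis
  proof (rule summable_on_abs_le)
    fix x :: "int ^ 'n"
    have "(\<Sum>i\<in>UNIV. m / real CARD('n) * \<bar>real_of_int (x $ i)\<bar>) \<le> (\<Sum>i\<in>(UNIV::'n set). m / real CARD('n) * linf x)"
      using assms component_le_linf by (intro sum_mono mult_left_mono) auto
    then have "(\<Sum>i\<in>UNIV. m / real CARD('n) * \<bar>real_of_int (x $ i)\<bar>) \<le> m * linf x" by simp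
    then have "exp (- m * linf x) \<le> exp (- (\<Sum>i\<in>UNIV. m / real CARD('n) * \<bar>real_of_int (x $ i)\<bar>))" by simp
    also have "\<dots> = (\<Prod>i\<in>UNIV. exp (- (m / real CARD('n) * \<bar>real_of_int (x $ i)\<bar>)))"
      by (simp add: exp_sum flip: sum_negf)
    also have "\<dots> = (\<Prod>i\<in>UNIV. g (x $ i))"
      by (intro prod.cong refl) (simp add: g_def r_def mult_ac flip: exp_of_nat_mult)
    finally show "\<bar>exp (- m * linf x)\<bar> \<le> (\<Prod>i\<in>UNIV. g (x $ i))" by simp
  qed
qed

text \<open>An exponentially weighted l1 space. As \<open>l2\<close> is subadditive it is closed
  under convolution, and membership makes the rearrangements below absolutely convergent.\<close>

definition esum :: "real \<Rightarrow> (int ^ 'n \<Rightarrow> real) \<Rightarrow> bool" where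
  "esum m f \<longleftrightarrow> (\<lambda>x. \<bar>f x\<bar> * exp (m * l2 x)) summable_on UNIV"

lemma esum_summable:
  assumes "esum m f" "\<And>x. \<bar>w x\<bar> \<le> C * exp (m * l2 x)"
  shows "(\<lambda>x. f x * w x) summable_on UNIV"
proof (rule summable_on_abs_le)
  show "(\<lambda>x. C * (\<bar>f x\<bar> * exp (m * l2 x))) summable_on UNIV"
    using assms(1) unfolding esum_def by (rule summable_on_cmult_right)
  show "\<bar>f x * w x\<bar> \<le> C * (\<bar>f x\<bar> * exp (m * l2 x))" for x
    using mult_left_mono[OF assms(2)[of x], of "\<bar>f x\<bar>"] by (simp add: abs_mult mult_ac)
qed

lemma esum_mono:
  assumes "esum m f" "m' \<le> m"
  shows "esum m' f"
  unfolding esum_def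
proof (rule summable_on_abs_le)
  show "(\<lambda>x. \<bar>f x\<bar> * exp (m * l2 x)) summable_on UNIV" using assms(1) by (simp add: esum_def)
  show "\<bar>\<bar>f x\<bar> * exp (m' * l2 x)\<bar> \<le> \<bar>f x\<bar> * exp (m * l2 x)" for x
    using assms(2) by (auto simp: abs_mult intro!: mult_left_mono mult_right_mono)
qed

lemma esum_le:
  assumes "esum m g" "\<And>x. \<bar>f x\<bar> \<le> K * \<bar>g x\<bar>"
  shows "esum m f"
  unfolding esum_def
proof (rule summable_on_abs_le)
  show "(\<lambda>x. K * (\<bar>g x\<bar> * exp (m * l2 x))) summable_on UNIV"
    using assms(1) unfolding esum_def by (rule summable_on_cmult_right)
  show "\<bar>\<bar>f x\<bar> * exp (m * l2 x)\<bar> \<le> K * (\<bar>g x\<bar> * exp (m * l2 x))" for x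
    using mult_right_mono[OF assms(2)[of x], of "exp (m * l2 x)"] by (simp add: abs_mult mult_ac)
qed

lemma esum_add:
  assumes "esum m f" "esum m g"
  shows "esum m (\<lambda>x. f x + g x)"
  unfolding esum_def
proof (rule summable_on_abs_le)
  show "(\<lambda>x. \<bar>f x\<bar> * exp (m * l2 x) + \<bar>g x\<bar> * exp (m * l2 x)) summable_on UNIV"
    using assms unfolding esum_def by (rule summable_on_add)
  show "\<bar>\<bar>f x + g x\<bar> * exp (m * l2 x)\<bar> \<le> \<bar>f x\<bar> * exp (m * l2 x) + \<bar>g x\<bar> * exp (m * l2 x)" for x
    by (simp add: abs_mult flip: distrib_right)
qed

lemma esum_finite_support:
  assumes "finite {x. f x \<noteq> 0}"
  shows "esum m f"
  unfolding esum_def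
  by (rule finite_nonzero_values_imp_summable_on) (use assms in \<open>auto elim: rev_finite_subset\<close>)

text \<open>Half of the decay pays for summability and the other half for the weight;
  \<open>l2\<close> exceeds \<open>linf\<close> by at most a factor sqrt d, whence
  \<open>m'\<close>.\<close>

lemma esum_exp_bound:
  fixes f :: "int ^ 'n \<Rightarrow> real"
  assumes "0 < m" "\<And>x. \<bar>f x\<bar> \<le> K * exp (- m * linf x)"
  shows "\<exists>m'>0. esum m' f"
proof (intro exI conjI)
  define m' where "m' = m / (2 * sqrt (real CARD('n)))"
  show "0 < m'" using assms by (simp add: m'_def)
  show "esum m' f"
    unfolding esum_def
  proof (rule summable_on_abs_le)
    show "(\<lambda>x. K * exp (- (m / 2) * linf x)) summable_on UNIV"
      using assms by (intro summable_on_cmult_right summable_exp_linf) auto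
    fix x :: "int ^ 'n"
    have "m' * l2 x \<le> m' * (sqrt (real CARD('n)) * linf x)"
      using \<open>0 < m'\<close> l2_le_linf[of x] by (intro mult_left_mono) auto
    also have "\<dots> = m / 2 * linf x" by (simp add: m'_def)
    finally have "\<bar>f x\<bar> * exp (m' * l2 x) \<le> (K * exp (- m * linf x)) * exp (m / 2 * linf x)"
      using assms(2)[of x] by (intro mult_mono) (auto intro: order_trans[OF abs_ge_zero])
    also have "\<dots> = K * exp (- (m / 2) * linf x)"
      by (simp add: mult.assoc flip: exp_add)
    finally show "\<bar>\<bar>f x\<bar> * exp (m' * l2 x)\<bar> \<le> K * exp (- (m / 2) * linf x)" by (simp add: abs_mult)
  qed
qed

section \<open>Convolution and weighted sums\<close>

lemma infsum_reflect:
  fixes f :: "int ^ 'n \<Rightarrow> real"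
  shows "(\<Sum>\<^sub>\<infinity>x. f (a - x)) = (\<Sum>\<^sub>\<infinity>x. f x)"
  by (rule infsum_reindex_bij_witness[where i = "\<lambda>x. a - x" and j = "\<lambda>x. a - x"]) auto

lemma infsum_neg:
  fixes f :: "int ^ 'n \<Rightarrow> real"
  shows "(\<Sum>\<^sub>\<infinity>x. f (- x)) = (\<Sum>\<^sub>\<infinity>x. f x)"
  using infsum_reflect[of f 0] by simp

lemma conv_commute: "conv f g x = conv g f (x :: int ^ 'n)" for f g :: "int ^ 'n \<Rightarrow> real"
  unfolding conv_def using infsum_reflect[of "\<lambda>y. f y * g (x - y)" x] by (simp add: mult.commute)

text \<open>Fubini for the substitution x = y + z. A weight of at most exponential growth splits as
  |w (y + z)| \<le> C exp (m |y|) exp (m |z|), which gives a summable majorant on the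
  product.\<close>

lemma conv_weight:
  fixes f g w :: "int ^ 'n \<Rightarrow> real"
  assumes f: "esum m f" and g: "esum m g" and m: "0 \<le> m" and w: "\<And>x. \<bar>w x\<bar> \<le> C * exp (m * l2 x)"
  shows "(\<lambda>x. conv f g x * w x) summable_on UNIV"
    and "(\<Sum>\<^sub>\<infinity>x. conv f g x * w x) = (\<Sum>\<^sub>\<infinity>y. f y * (\<Sum>\<^sub>\<infinity>z. g z * w (y + z)))"
    and "\<And>y. (\<lambda>z. g z * w (y + z)) summable_on UNIV"
    and "(\<lambda>y. f y * (\<Sum>\<^sub>\<infinity>z. g z * w (y + z))) summable_on UNIV"
proof -
  define E where "E = (\<lambda>x::int ^ 'n. exp (m * l2 x))"
  have wE: "\<bar>w (y + z)\<bar> \<le> C * (E y * E z)" for y z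
  proof -
    have C: "0 \<le> C" using w[of 0] by (simp add: order_trans[OF abs_ge_zero])
    have "m * l2 (y + z) \<le> m * l2 y + m * l2 z"
      using mult_left_mono[OF l2_triangle m, of y z] by (simp add: distrib_left)
    then have "exp (m * l2 (y + z)) \<le> E y * E z" by (simp add: E_def flip: exp_add)
    then show ?thesis using w[of "y + z"] C by (meson mult_left_mono order_trans)
  qed
  define P where "P = (\<lambda>(y, z). (\<bar>f y\<bar> * E y) * (\<bar>g z\<bar> * E z))"
  have P: "P summable_on UNIV \<times> UNIV"
  proof (rule summable_on_SigmaI)
    show "((\<lambda>z. P (y, z)) has_sum (\<bar>f y\<bar> * E y) * (\<Sum>\<^sub>\<infinity>z. \<bar>g z\<bar> * E z)) UNIV" for y
      using g unfolding P_def esum_def E_def by (auto intro!: has_sum_cmult_right)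
    show "(\<lambda>y. (\<bar>f y\<bar> * E y) * (\<Sum>\<^sub>\<infinity>z. \<bar>g z\<bar> * E z)) summable_on UNIV"
      using f unfolding esum_def E_def by (rule summable_on_cmult_left)
  qed (auto simp: P_def E_def)
  have H: "(\<lambda>(y, z). f y * g z * w (y + z)) summable_on UNIV \<times> UNIV"
  proof (rule summable_on_abs_le)
    show "(\<lambda>p. C * P p) summable_on UNIV \<times> UNIV" using P by (rule summable_on_cmult_right)
    show "\<bar>case p of (y, z) \<Rightarrow> f y * g z * w (y + z)\<bar> \<le> C * P p" for p
    proof (cases p)
      case (Pair y z)
      have "\<bar>f y\<bar> * \<bar>g z\<bar> * \<bar>w (y + z)\<bar> \<le> \<bar>f y\<bar> * \<bar>g z\<bar> * (C * (E y * E z))"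
        using wE by (intro mult_left_mono) auto
      then show ?thesis using Pair by (simp add: P_def abs_mult mult_ac)
    qed
  qed
  have H': "(\<lambda>(x, y). f y * g (x - y) * w x) summable_on UNIV \<times> UNIV"
    by (rule summable_on_reindex_bij_witness[where j = "\<lambda>(x, y). (y, x - y)" and i = "\<lambda>(y, z). (y + z, y)", THEN iffD2, OF _ _ _ _ _ H]) auto
  have inner: "(\<Sum>\<^sub>\<infinity>y. f y * g (x - y) * w x) = conv f g x * w x" for x
    by (simp add: infsum_cmult_left' conv_def)
  show "(\<lambda>x. conv f g x * w x) summable_on UNIV"
    using summable_on_Sigma_banach[OF H'] by (simp add: inner)
  have inner2: "(\<Sum>\<^sub>\<infinity>z. f y * g z * w (y + z)) = f y * (\<Sum>\<^sub>\<infinity>z. g z * w (y + z))" for y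
    by (simp add: mult.assoc infsum_cmult_right')
  show "(\<lambda>y. f y * (\<Sum>\<^sub>\<infinity>z. g z * w (y + z))) summable_on UNIV"
    using summable_on_Sigma_banach[OF H] by (simp add: inner2)
  have "(\<Sum>\<^sub>\<infinity>x. conv f g x * w x) = (\<Sum>\<^sub>\<infinity>(x, y)\<in>UNIV\<times>UNIV. f y * g (x - y) * w x)"
    using infsum_Sigma'_banach[OF H'] by (simp add: inner)
  also have "\<dots> = (\<Sum>\<^sub>\<infinity>(y, z)\<in>UNIV\<times>UNIV. f y * g z * w (y + z))"
    by (rule infsum_reindex_bij_witness[where j = "\<lambda>(x, y). (y, x - y)" and i = "\<lambda>(y, z). (y + z, y)"]) auto
  also have "\<dots> = (\<Sum>\<^sub>\<infinity>y. f y * (\<Sum>\<^sub>\<infinity>z. g z * w (y + z)))"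
    using infsum_Sigma'_banach[OF H] by (simp add: inner2)
  finally show "(\<Sum>\<^sub>\<infinity>x. conv f g x * w x) = (\<Sum>\<^sub>\<infinity>y. f y * (\<Sum>\<^sub>\<infinity>z. g z * w (y + z)))" .
  show "(\<lambda>z. g z * w (y + z)) summable_on UNIV" for y
  proof (rule esum_summable[OF g])
    show "\<bar>w (y + z)\<bar> \<le> C * E y * exp (m * l2 z)" for z using wE[of y z] by (simp add: E_def mult_ac)
  qed
qed

lemma esum_conv:
  fixes f g :: "int ^ 'n \<Rightarrow> real"
  assumes f: "esum m f" and g: "esum m g" and m: "0 \<le> m"
  shows "esum m (conv f g)"
proof -
  have f': "esum m (\<lambda>x. \<bar>f x\<bar>)" and g': "esum m (\<lambda>x. \<bar>g x\<bar>)"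
    using f g by (simp_all add: esum_def)
  have s: "(\<lambda>x. conv (\<lambda>x. \<bar>f x\<bar>) (\<lambda>x. \<bar>g x\<bar>) x * exp (m * l2 x)) summable_on UNIV"
    by (rule conv_weight(1)[OF f' g' m, of _ 1]) auto
  show ?thesis
    unfolding esum_def
  proof (rule summable_on_abs_le[OF s])
    fix x
    have 1: "(\<lambda>y. \<bar>f y\<bar> * \<bar>g (x - y)\<bar>) summable_on UNIV"
    proof (rule esum_summable[OF f'])
      have gb: "\<bar>g z\<bar> \<le> (\<Sum>\<^sub>\<infinity>x. \<bar>g x\<bar> * exp (m * l2 x))" for z
      proof -
        have "\<bar>g z\<bar> * 1 \<le> \<bar>g z\<bar> * exp (m * l2 z)" using m by (intro mult_left_mono) auto
        also have "\<dots> = sum (\<lambda>x. \<bar>g x\<bar> * exp (m * l2 x)) {z}" by simp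
        also have "\<dots> \<le> (\<Sum>\<^sub>\<infinity>x. \<bar>g x\<bar> * exp (m * l2 x))"
          using g by (intro finite_sum_le_infsum) (auto simp: esum_def)
        finally show ?thesis by simp
      qed
      show "\<bar>\<bar>g (x - y)\<bar>\<bar> \<le> (\<Sum>\<^sub>\<infinity>x. \<bar>g x\<bar> * exp (m * l2 x)) * exp (m * l2 y)" for y
        using mult_mono[OF gb[of "x - y"], of 1 "exp (m * l2 y)"] m 
        by (auto intro: order_trans[OF abs_ge_zero gb])
    qed
    have "\<bar>conv f g x\<bar> \<le> conv (\<lambda>x. \<bar>f x\<bar>) (\<lambda>x. \<bar>g x\<bar>) x"
      using norm_infsum_bound[of "\<lambda>y. f y * g (x - y)" UNIV] 1 by (simp add: conv_def abs_mult)
    then show "\<bar>\<bar>conv f g x\<bar> * exp (m * l2 x)\<bar> \<le> conv (\<lambda>x. \<bar>f x\<bar>) (\<lambda>x. \<bar>g x\<bar>) x * exp (m * l2 x)"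
      by (simp add: abs_mult)
  qed
qed

subsection \<open>Superharmonicity of the weight\<close>

text \<open>Drift of the weight to second order, in units of the step length; 2 t / d + k bounds
  half the second moment of the increment of |x|^2. The pure power contributes exactly - \<alpha> (m
  + (d - 2 - 2 \<alpha>) t / d) / (t + m)^2, negative as long as 2 \<alpha> < d - 2. Everything else
  is of order c / \<xi>^2 or 1 / (t + m)^2.\<close>

lemma superharmonic_main_term:
  fixes t m D d \<alpha> c \<xi> k e :: real
  assumes "0 \<le> t" "0 < m" "1 \<le> t + m" "0 \<le> \<alpha>" "\<alpha> \<le> D" "1 \<le> d" "0 < c" "c \<le> 1" "1 \<le> \<xi>" "0 \<le> k"
    and e: "e = d - 2 - 2 * \<alpha>"
  shows "((lu \<alpha> (c / \<xi>) (\<xi>\<^sup>2) (t + m))\<^sup>2 + lu1 \<alpha> (c / \<xi>) (\<xi>\<^sup>2) (t + m)) * (2 * t / d + k) - lu \<alpha> (c / \<xi>) (\<xi>\<^sup>2) (t + m)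
    \<le> - \<alpha> * (m + e / d * t) / (t + m)\<^sup>2 + (4 * D + 4 + k * (2 * D\<^sup>2 + D + 3)) * (c / \<xi>\<^sup>2 + 1 / (t + m)\<^sup>2)"
proof -
  define T where "T = t + m"
  define \<gamma> where "\<gamma> = c / \<xi>"
  define v where "v = \<gamma> / 2 / sqrt (T + \<xi>\<^sup>2)"
  define Y where "Y = c / \<xi>\<^sup>2"
  have T: "1 \<le> T" "t \<le> T" "0 < T" using assms by (auto simp: T_def)
  have g: "0 < \<gamma>" using assms by (simp add: \<gamma>_def)
  have Y: "0 < Y" using assms by (simp add: Y_def)
  have r: "\<xi> \<le> sqrt (T + \<xi>\<^sup>2)" "sqrt T \<le> sqrt (T + \<xi>\<^sup>2)" "0 < sqrt (T + \<xi>\<^sup>2)"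
    using T assms by (auto intro!: real_le_rsqrt add_pos_pos)
  have v0: "0 \<le> v" using g T by (simp add: v_def)
  have vY: "v \<le> Y"
  proof -
    have "v \<le> \<gamma> / 2 / \<xi>" unfolding v_def using g r assms by (intro divide_left_mono mult_pos_pos) auto
    also have "\<dots> \<le> Y" using assms by (auto simp: \<gamma>_def Y_def power2_eq_square intro!: divide_left_mono)
    finally show ?thesis .
  qed
  have TvY: "T * v\<^sup>2 \<le> Y"
  proof -
    have "T * v\<^sup>2 = (\<gamma> / 2)\<^sup>2 * (T / (T + \<xi>\<^sup>2))" using T by (simp add: v_def power_divide)
    also have "\<dots> \<le> (\<gamma> / 2)\<^sup>2 * 1" using T by (intro mult_left_mono) (auto simp: add_pos_nonneg)
    also have "\<dots> \<le> \<gamma>\<^sup>2" by (simp add: power_divide)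
    also have "\<dots> = c\<^sup>2 / \<xi>\<^sup>2" by (simp add: \<gamma>_def power_divide)
    also have "\<dots> \<le> Y" unfolding Y_def using assms by (intro divide_right_mono) (auto simp: power2_eq_square mult_le_cancel_left1)
    finally show ?thesis .
  qed
  have v2Y: "v\<^sup>2 \<le> Y" using mult_right_mono[OF T(1), of "v\<^sup>2"] TvY by simp
  define u where "u = lu \<alpha> \<gamma> (\<xi>\<^sup>2) T"
  define u1 where "u1 = lu1 \<alpha> \<gamma> (\<xi>\<^sup>2) T"
  have u: "u = \<alpha> / T + v" by (simp add: u_def lu_def v_def)
  have u1: "u1 \<le> \<alpha> / T\<^sup>2 + v / T"
  proof -
    have "\<gamma> / 4 / sqrt (T + \<xi>\<^sup>2) ^ 3 \<le> \<gamma> / 2 / sqrt (T + \<xi>\<^sup>2) ^ 1 / T ^ 1"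
      using inverse_sqrt_power_bound[of T "\<xi>\<^sup>2" "\<gamma> / 4" "\<gamma> / 2" 1] T g by simp
    then show ?thesis by (simp add: u1_def lu1_def v_def)
  qed
  have "(u\<^sup>2 + u1) * (2 * t / d) - u \<le> - \<alpha> * (m + e / d * t) / T\<^sup>2 + (4 * D + 4) * Y"
  proof -
    have "(u\<^sup>2 + u1) * (2 * t / d) - u \<le> (u\<^sup>2 + (\<alpha> / T\<^sup>2 + v / T)) * (2 * t / d) - u"
      using u1 assms by (intro diff_right_mono mult_right_mono) auto
    also have "\<dots> = ((\<alpha>\<^sup>2 + \<alpha>) * (2 * t / d) / T\<^sup>2 - \<alpha> / T) + ((2 * \<alpha> * v / T + v\<^sup>2 + v / T) * (2 * t / d) - v)"
      by (simp add: u power2_sum power_divide algebra_simps add_divide_distrib)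
    also have "(\<alpha>\<^sup>2 + \<alpha>) * (2 * t / d) / T\<^sup>2 - \<alpha> / T = - \<alpha> * (m + e / d * t) / T\<^sup>2"
    proof -
      have 1: "\<alpha> / T = \<alpha> * (t + m) / T\<^sup>2" using T by (simp add: T_def[symmetric] power2_eq_square)
      have 2: "(\<alpha>\<^sup>2 + \<alpha>) * (2 * t / d) = \<alpha> * (t - e / d * t)"
        using assms by (simp add: e field_simps power2_eq_square)
      have "\<alpha> * (t - e / d * t) - \<alpha> * (t + m) = - \<alpha> * (m + e / d * t)" by (simp add: algebra_simps)
      then show ?thesis unfolding 1 2 diff_divide_distrib[symmetric] by simp
    qed
    also have "(2 * \<alpha> * v / T + v\<^sup>2 + v / T) * (2 * t / d) - v \<le> (4 * D + 4) * Y"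
    proof -
      have "(2 * \<alpha> * v / T + v\<^sup>2 + v / T) * (2 * t / d) \<le> (2 * \<alpha> * v / T + v\<^sup>2 + v / T) * (2 * T)"
      proof (intro mult_left_mono)
        have "2 * t / d \<le> 2 * t / 1" using assms by (intro divide_left_mono) auto
        then show "2 * t / d \<le> 2 * T" using T by simp
      qed (use assms v0 T in auto)
      also have "\<dots> = 4 * (\<alpha> * v) + 2 * (T * v\<^sup>2) + 2 * v" using T by (simp add: field_simps)
      also have "\<dots> \<le> 4 * (D * Y) + 2 * Y + 2 * Y"
        using assms v0 vY TvY by (intro add_mono mult_left_mono mult_mono) auto
      finally show ?thesis using v0 by (simp add: algebra_simps)
    qed
    finally show ?thesis by simp
  qed
  moreover have "(u\<^sup>2 + u1) * k \<le> k * (2 * D\<^sup>2 + D + 3) * (Y + 1 / T\<^sup>2)"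
  proof -
    have "u\<^sup>2 + u1 \<le> (2 * \<alpha>\<^sup>2 + \<alpha>) / T\<^sup>2 + (2 * v\<^sup>2 + v)"
    proof -
      have "u\<^sup>2 \<le> 2 * (\<alpha> / T)\<^sup>2 + 2 * v\<^sup>2"
        unfolding u using zero_le_power2[of "\<alpha> / T - v"] unfolding power2_sum power2_diff by linarith
      moreover have "v / T \<le> v / 1" using T v0 by (intro divide_left_mono) auto
      ultimately show ?thesis using u1 by (simp add: power_divide add_divide_distrib)
    qed
    also have "\<dots> \<le> (2 * D\<^sup>2 + D) / T\<^sup>2 + (2 * Y + Y)"
      using assms v2Y vY by (intro add_mono divide_right_mono mult_left_mono power_mono) auto
    also have "\<dots> = (2 * D\<^sup>2 + D) * (1 / T\<^sup>2) + 3 * Y" by simp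
    also have "\<dots> \<le> (2 * D\<^sup>2 + D + 3) * (1 / T\<^sup>2) + (2 * D\<^sup>2 + D + 3) * Y"
    proof (rule add_mono)
      show "(2 * D\<^sup>2 + D) * (1 / T\<^sup>2) \<le> (2 * D\<^sup>2 + D + 3) * (1 / T\<^sup>2)" by (rule mult_right_mono) auto
      have "0 \<le> D" using assms by linarith
      then show "3 * Y \<le> (2 * D\<^sup>2 + D + 3) * Y" using Y by (intro mult_right_mono) auto
    qed
    also have "\<dots> = (2 * D\<^sup>2 + D + 3) * (Y + 1 / T\<^sup>2)" by (simp add: algebra_simps)
    finally have U: "u\<^sup>2 + u1 \<le> (2 * D\<^sup>2 + D + 3) * (Y + 1 / T\<^sup>2)" .
    show ?thesis using mult_left_mono[OF U, of k] assms by (simp add: mult_ac)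
  qed
  moreover have "(4 * D + 4) * Y \<le> (4 * D + 4) * (Y + 1 / T\<^sup>2)"
    using assms by (intro mult_left_mono) auto
  ultimately have "(u\<^sup>2 + u1) * (2 * t / d + k) - u
    \<le> - \<alpha> * (m + e / d * t) / T\<^sup>2 + (4 * D + 4 + k * (2 * D\<^sup>2 + D + 3)) * (Y + 1 / T\<^sup>2)"
    unfolding distrib_left[of "u\<^sup>2 + u1"] distrib_right[of "4 * D + 4"] by linarith
  then show ?thesis by (simp add: u_def u1_def T_def Y_def \<gamma>_def)
qed

text \<open>A symmetric step law with standard deviation \<open>\<rho>\<close>, covariance a
  multiple of the identity, and an exponential moment at its own scale. Estimates for it depend only
  on \<open>a\<close> and \<open>K\<close>.\<close>

definition kernel :: "real \<Rightarrow> real \<Rightarrow> real \<Rightarrow> (int ^ 'n \<Rightarrow> real) \<Rightarrow> bool" where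
  "kernel a K \<rho> P \<longleftrightarrow> 0 < a \<and> 0 < \<rho> \<and> (\<forall>z. 0 \<le> P z) \<and> (\<forall>z. P (- z) = P z) \<and> (\<Sum>\<^sub>\<infinity>z. P z) = 1 \<and>
     esum (a / \<rho>) P \<and> (\<Sum>\<^sub>\<infinity>z. P z * exp (a * (l2 z / \<rho>))) \<le> K \<and>
     (\<Sum>\<^sub>\<infinity>z. P z * (l2 z)\<^sup>2) = \<rho>\<^sup>2 \<and>
     (\<forall>x. (\<Sum>\<^sub>\<infinity>z. P z * (real_vec x \<bullet> real_vec z)\<^sup>2) = (l2 x)\<^sup>2 * \<rho>\<^sup>2 / real CARD('n))"

lemma infsum_symmetrize:
  fixes P h :: "int ^ 'n \<Rightarrow> real"
  assumes "\<And>z. P (- z) = P z" "(\<lambda>z. P z * h z) summable_on UNIV"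
  shows "(\<Sum>\<^sub>\<infinity>z. P z * h z) = (\<Sum>\<^sub>\<infinity>z. P z * ((h z + h (- z)) / 2))"
proof -
  have s: "(\<lambda>z. P z * h (- z)) summable_on UNIV"
    by (rule summable_on_reindex_bij_witness[where i = uminus and j = uminus, THEN iffD1, OF _ _ _ _ _ assms(2)])
      (auto simp: assms(1))
  have e: "(\<Sum>\<^sub>\<infinity>z. P z * h (- z)) = (\<Sum>\<^sub>\<infinity>z. P z * h z)"
    using infsum_neg[of "\<lambda>z. P z * h z"] assms(1) by simp
  have "(\<Sum>\<^sub>\<infinity>z. P z * ((h z + h (- z)) / 2)) = (\<Sum>\<^sub>\<infinity>z. 1 / 2 * (P z * h z + P z * h (- z)))"
    by (simp add: algebra_simps add_divide_distrib)
  also have "\<dots> = 1 / 2 * ((\<Sum>\<^sub>\<infinity>z. P z * h z) + (\<Sum>\<^sub>\<infinity>z. P z * h (- z)))"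
    by (subst infsum_cmult_right', subst infsum_add) (use assms s in auto)
  finally show ?thesis using e by simp
qed

text \<open>Scale covariance: it reduces an arbitrary step length to the unit step length of
  \<open>fw_step\<close>.\<close>

lemma fw_scale:
  assumes "0 < \<rho>" "0 < T" "0 < \<xi>"
  shows "fw \<alpha> (c / \<xi>) (\<xi>\<^sup>2) (\<rho>\<^sup>2 * T) = \<rho> powr (- 2 * \<alpha>) * fw \<alpha> (c / (\<xi> / \<rho>)) ((\<xi> / \<rho>)\<^sup>2) T"
proof -
  have "sqrt (\<rho>\<^sup>2 * T + \<xi>\<^sup>2) = sqrt (\<rho>\<^sup>2 * (T + (\<xi> / \<rho>)\<^sup>2))"
    using assms by (simp add: distrib_left power_divide)
  also have "\<dots> = \<rho> * sqrt (T + (\<xi> / \<rho>)\<^sup>2)" using assms by (simp add: real_sqrt_mult)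
  finally have 1: "c / \<xi> * sqrt (\<rho>\<^sup>2 * T + \<xi>\<^sup>2) = c / (\<xi> / \<rho>) * sqrt (T + (\<xi> / \<rho>)\<^sup>2)" by simp
  have "(\<rho>\<^sup>2 * T) powr (- \<alpha>) = \<rho> powr (- 2 * \<alpha>) * T powr (- \<alpha>)"
    using assms powr_powr[of \<rho> 2 "- \<alpha>"] by (simp add: powr_mult)
  with 1 show ?thesis by (simp add: fw_def)
qed

text \<open>Average the one-step bound over z and -z. In the increment |z|^2 - 2 x.z of the squared
  radius the odd powers of x.z cancel; the cubes average to g^3 + 3 g h^2 \<ge> 0 with a nonpositive
  coefficient and are dropped; isotropy evaluates the quadratic term. What remains is
  \<open>superharmonic_main_term\<close>.\<close>

lemma kernel_superharmonic:
  fixes a K :: real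
  assumes a: "0 < a" and K: "0 \<le> K"
  obtains C where "0 < C" "\<And>(P :: int ^ 'n \<Rightarrow> real) \<rho> m \<xi> c \<alpha> x.
    kernel a K \<rho> P \<Longrightarrow> 0 \<le> \<alpha> \<Longrightarrow> \<alpha> \<le> real CARD('n) \<Longrightarrow> 0 < c \<Longrightarrow> c \<le> 1 \<Longrightarrow> c \<le> a / 2 \<Longrightarrow>
    \<rho> \<le> \<xi> \<Longrightarrow> 0 < m \<Longrightarrow> \<rho>\<^sup>2 \<le> (l2 x)\<^sup>2 + m \<Longrightarrow>
    (\<lambda>z. P z * (of_bool (\<rho>\<^sup>2 \<le> (l2 (x - z))\<^sup>2 + m) * fw \<alpha> (c / \<xi>) (\<xi>\<^sup>2) ((l2 (x - z))\<^sup>2 + m))) summable_on UNIV \<and>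
    (\<Sum>\<^sub>\<infinity>z. P z * (of_bool (\<rho>\<^sup>2 \<le> (l2 (x - z))\<^sup>2 + m) * fw \<alpha> (c / \<xi>) (\<xi>\<^sup>2) ((l2 (x - z))\<^sup>2 + m)))
    \<le> fw \<alpha> (c / \<xi>) (\<xi>\<^sup>2) ((l2 x)\<^sup>2 + m) *
      (1 - \<alpha> * \<rho>\<^sup>2 * (m + (real CARD('n) - 2 - 2 * \<alpha>) / real CARD('n) * (l2 x)\<^sup>2) / ((l2 x)\<^sup>2 + m)\<^sup>2
       + C * (c * \<rho>\<^sup>2 / \<xi>\<^sup>2 + \<rho> ^ 4 / ((l2 x)\<^sup>2 + m)\<^sup>2))"
proof -
  define D where "D = CARD('n)"
  have D1: "1 \<le> real D" by (simp add: D_def Suc_leI)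
  obtain C where C: "0 < C" and step: "\<And>\<alpha> c \<xi> A A' z. 0 \<le> \<alpha> \<Longrightarrow> \<alpha> \<le> real D \<Longrightarrow> 0 < c \<Longrightarrow> c \<le> 1 \<Longrightarrow> c \<le> a / 2 \<Longrightarrow>
     1 \<le> A \<Longrightarrow> 1 \<le> \<xi> \<Longrightarrow> 0 < A' \<Longrightarrow> \<bar>A - A'\<bar> \<le> z \<Longrightarrow>
     of_bool (1 \<le> A') * fw \<alpha> (c / \<xi>) (\<xi>\<^sup>2) (A'\<^sup>2) \<le> fw \<alpha> (c / \<xi>) (\<xi>\<^sup>2) (A\<^sup>2) *
       (taylor3 \<alpha> (c / \<xi>) (\<xi>\<^sup>2) (A\<^sup>2) (A'\<^sup>2 - A\<^sup>2) + C * (1 / A ^ 4 + c / \<xi>\<^sup>2) * exp (a * z))"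
    by (rule fw_step[OF a, where D = D]) (rule that)
  \<comment> \<open>Half the fourth moment of the scaled step, which is at most 4! / a^4 times the
    exponential moment.\<close>
  define k where "k = 12 / a ^ 4 * K"
  have k: "0 \<le> k" using a K by (simp add: k_def)
  define C' where "C' = 4 * real D + 4 + k * (2 * (real D)\<^sup>2 + real D + 3) + C * K"
  show ?thesis
  proof (rule that[of C'])
    have "0 \<le> k * (2 * (real D)\<^sup>2 + real D + 3)" "0 \<le> C * K" using k C K by auto
    then show "0 < C'" using D1 by (simp add: C'_def)
    fix P :: "int ^ 'n \<Rightarrow> real" and \<rho> m \<xi> c \<alpha> :: real and x :: "int ^ 'n"
    assume ker: "kernel a K \<rho> P" and al: "0 \<le> \<alpha>" "\<alpha> \<le> real CARD('n)" and c: "0 < c" "c \<le> 1" "c \<le> a / 2"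
      and xi: "\<rho> \<le> \<xi>" and m: "0 < m" and xm: "\<rho>\<^sup>2 \<le> (l2 x)\<^sup>2 + m"
    have P: "\<And>z. 0 \<le> P z" "\<And>z. P (- z) = P z" "(\<Sum>\<^sub>\<infinity>z. P z) = 1" and rho: "0 < \<rho>"
      and es: "esum (a / \<rho>) P" and eK: "(\<Sum>\<^sub>\<infinity>z. P z * exp (a * (l2 z / \<rho>))) \<le> K"
      and v: "(\<Sum>\<^sub>\<infinity>z. P z * (l2 z)\<^sup>2) = \<rho>\<^sup>2"
      and iso: "(\<Sum>\<^sub>\<infinity>z. P z * (real_vec x \<bullet> real_vec z)\<^sup>2) = (l2 x)\<^sup>2 * \<rho>\<^sup>2 / real CARD('n)"
      using ker unfolding kernel_def by blast+
    define \<tau> where "\<tau> = (\<lambda>y::int ^ 'n. (l2 y)\<^sup>2 + m)"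
    define A where "A = (\<lambda>y. sqrt (\<tau> y) / \<rho>)"
    define \<xi>' where "\<xi>' = \<xi> / \<rho>"
    have \<tau>0: "0 < \<tau> y" for y using m by (simp add: \<tau>_def add_nonneg_pos)
    have A0: "0 < A y" for y using \<tau>0 rho by (simp add: A_def)
    have A2: "(A y)\<^sup>2 = \<tau> y / \<rho>\<^sup>2" for y using \<tau>0[of y] rho by (simp add: A_def power_divide)
    have \<tau>A: "\<tau> y = \<rho>\<^sup>2 * (A y)\<^sup>2" for y using A2 rho by simp
    have A1: "1 \<le> A y \<longleftrightarrow> \<rho>\<^sup>2 \<le> \<tau> y" for y
    proof -
      have "1 \<le> A y \<longleftrightarrow> \<rho> \<le> sqrt (\<tau> y)" using rho by (simp add: A_def)
      also have "\<dots> \<longleftrightarrow> sqrt (\<rho>\<^sup>2) \<le> sqrt (\<tau> y)" using rho by simp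
      also have "\<dots> \<longleftrightarrow> \<rho>\<^sup>2 \<le> \<tau> y" by (rule real_sqrt_le_iff)
      finally show ?thesis .
    qed
    have Ax: "1 \<le> A x" using xm A1[of x] by (simp add: \<tau>_def)
    have xi1: "1 \<le> \<xi>'" using xi rho by (simp add: \<xi>'_def)
    \<comment> \<open>sqrt (|y|^2 + m) is the Euclidean norm of the point (y, sqrt m), hence
      1-Lipschitz in y.\<close>
    have Adiff: "\<bar>A x - A (x - z)\<bar> \<le> l2 z / \<rho>" for z
    proof -
      have gen: "sqrt (\<tau> y) \<le> sqrt (\<tau> w) + l2 (y - w)" for y w
      proof (rule real_le_lsqrt)
        have "l2 y \<le> l2 w + l2 (y - w)" using l2_triangle[of w "y - w"] by simp
        then have "(l2 y)\<^sup>2 \<le> (l2 w + l2 (y - w))\<^sup>2" by (intro power_mono) auto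
        moreover have "l2 w * l2 (y - w) \<le> sqrt (\<tau> w) * l2 (y - w)"
          using m by (intro mult_right_mono real_le_rsqrt) (auto simp: \<tau>_def)
        ultimately show "\<tau> y \<le> (sqrt (\<tau> w) + l2 (y - w))\<^sup>2"
          using \<tau>0[of w] by (simp add: power2_sum \<tau>_def)
      next
        show "0 \<le> sqrt (\<tau> w) + l2 (y - w)" using \<tau>0[of w] by simp
      qed
      have "\<bar>sqrt (\<tau> x) - sqrt (\<tau> (x - z))\<bar> \<le> l2 z"
        using gen[of x "x - z"] gen[of "x - z" x] by (simp add: abs_le_iff)
      then have "\<bar>sqrt (\<tau> x) - sqrt (\<tau> (x - z))\<bar> / \<rho> \<le> l2 z / \<rho>" using rho by (intro divide_right_mono) auto
      moreover have "A x - A (x - z) = (sqrt (\<tau> x) - sqrt (\<tau> (x - z))) / \<rho>" by (simp add: A_def diff_divide_distrib)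
      ultimately show ?thesis using rho by simp
    qed
    define f where "f = fw \<alpha> (c / \<xi>') (\<xi>'\<^sup>2)"
    define s where "s = \<rho> powr (- 2 * \<alpha>)"
    have s0: "0 < s" using rho by (simp add: s_def)
    have fs: "fw \<alpha> (c / \<xi>) (\<xi>\<^sup>2) (\<tau> y) = s * f ((A y)\<^sup>2)" for y
      unfolding \<tau>A f_def s_def \<xi>'_def using rho A0[of y] xi by (intro fw_scale) auto
    define u where "u = lu \<alpha> (c / \<xi>') (\<xi>'\<^sup>2) ((A x)\<^sup>2)"
    define u1 where "u1 = lu1 \<alpha> (c / \<xi>') (\<xi>'\<^sup>2) ((A x)\<^sup>2)"
    define u2 where "u2 = lu2 \<alpha> (c / \<xi>') (\<xi>'\<^sup>2) ((A x)\<^sup>2)"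
    have u0: "0 \<le> u" "0 \<le> u1" "0 \<le> u2"
      using lu_nonneg[of "(A x)\<^sup>2" "\<xi>'\<^sup>2" \<alpha> "c / \<xi>'"] A0[of x] al c xi1 by (auto simp: u_def u1_def u2_def)
    define X where "X = 1 / A x ^ 4 + c / \<xi>'\<^sup>2"
    have X: "0 \<le> X" using A0[of x] c by (simp add: X_def)
    define E where "E = (\<lambda>z::int ^ 'n. exp (a * (l2 z / \<rho>)))"
    define q where "q = (\<lambda>z. (A (x - z))\<^sup>2 - (A x)\<^sup>2)"
    define T where "T = (\<lambda>z. taylor3 \<alpha> (c / \<xi>') (\<xi>'\<^sup>2) ((A x)\<^sup>2) (q z))"
    define L where "L = (\<lambda>z. of_bool (\<rho>\<^sup>2 \<le> \<tau> (x - z)) * fw \<alpha> (c / \<xi>) (\<xi>\<^sup>2) (\<tau> (x - z)))"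
    define fA where "fA = f ((A x)\<^sup>2)"
    have fA0: "0 < fA" using fw_pos[of "(A x)\<^sup>2"] A0[of x] by (simp add: fA_def f_def)
    have Lb: "L z \<le> s * (fA * (T z + C * X * E z))" for z
      using mult_left_mono[OF step[OF al[folded D_def] c Ax xi1 A0 Adiff[of z]], of s] s0
      by (simp add: L_def fs A1 T_def q_def X_def E_def fA_def f_def mult_ac)
    have L0: "0 \<le> L z" for z using fw_pos[OF \<tau>0] by (auto simp: L_def intro: less_imp_le)
    have qq: "q z = (l2 z)\<^sup>2 / \<rho>\<^sup>2 - 2 * (real_vec x \<bullet> real_vec z) / \<rho>\<^sup>2" for z
    proof -
      have "(l2 (x - z))\<^sup>2 = (l2 x)\<^sup>2 + (l2 z)\<^sup>2 - 2 * (real_vec x \<bullet> real_vec z)"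
        by (simp add: l2_def power2_norm_eq_inner inner_diff_left inner_diff_right inner_commute)
      then show ?thesis by (simp add: q_def A2 \<tau>_def add_divide_distrib diff_divide_distrib)
    qed
    have E1: "1 \<le> E z" for z using a rho by (simp add: E_def)
    have zE: "(l2 z / \<rho>) ^ n \<le> fact n / a ^ n * E z" for z n
      using power_le_exp[of "l2 z / \<rho>" a n] a rho by (simp add: E_def)
    have sE: "(\<lambda>z. P z * E z) summable_on UNIV"
      by (rule esum_summable[OF es, of _ 1]) (simp add: E_def)
    have sP: "(\<lambda>z. P z * h z) summable_on UNIV" if "\<And>z. \<bar>h z\<bar> \<le> B * E z" for h :: "int ^ 'n \<Rightarrow> real" and B
      by (rule esum_summable[OF es, of _ B]) (use that in \<open>simp add: E_def\<close>)
    have cs: "\<bar>real_vec x \<bullet> real_vec z\<bar> \<le> l2 x * l2 z" for z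
      unfolding l2_def by (rule Cauchy_Schwarz_ineq2)
    define T' where "T' = (\<lambda>z. 1 - u * ((l2 z)\<^sup>2 / \<rho>\<^sup>2) + (u\<^sup>2 + u1) / 2 * (((l2 z)\<^sup>2 / \<rho>\<^sup>2)\<^sup>2 + 4 * (real_vec x \<bullet> real_vec z)\<^sup>2 / \<rho> ^ 4))"
    have TT: "(T z + T (- z)) / 2 \<le> T' z" for z
    proof -
      define g where "g = (l2 z)\<^sup>2 / \<rho>\<^sup>2"
      define h where "h = 2 * (real_vec x \<bullet> real_vec z) / \<rho>\<^sup>2"
      have g0: "0 \<le> g" by (simp add: g_def)
      have h2: "h\<^sup>2 = 4 * (real_vec x \<bullet> real_vec z)\<^sup>2 / \<rho> ^ 4"
        by (simp add: h_def power_divide power_mult_distrib flip: power_mult)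
      define w where "w = u ^ 3 + 3 * u * u1 + u2"
      have "T z = 1 - u * (g - h) + (u\<^sup>2 + u1) * (g - h)\<^sup>2 / 2 - w * (g - h) ^ 3 / 6"
        by (simp add: T_def taylor3_def u_def u1_def u2_def qq g_def h_def w_def)
      moreover have "T (- z) = 1 - u * (g + h) + (u\<^sup>2 + u1) * (g + h)\<^sup>2 / 2 - w * (g + h) ^ 3 / 6"
        by (simp add: T_def taylor3_def u_def u1_def u2_def qq g_def h_def w_def)
      ultimately have "(T z + T (- z)) / 2 = 1 - u * g + (u\<^sup>2 + u1) / 2 * (g\<^sup>2 + h\<^sup>2) - w * (g ^ 3 + 3 * g * h\<^sup>2) / 6"
        by (simp add: field_simps eval_nat_numeral)
      moreover have "0 \<le> w * (g ^ 3 + 3 * g * h\<^sup>2) / 6" using u0 g0 by (simp add: w_def)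
      ultimately show ?thesis by (simp add: T'_def g_def h2)
    qed
    have z2E: "(l2 z)\<^sup>2 / \<rho>\<^sup>2 \<le> 2 / a\<^sup>2 * E z" for z using zE[of z 2] by (simp add: power_divide)
    have z4E: "((l2 z)\<^sup>2 / \<rho>\<^sup>2)\<^sup>2 \<le> 24 / a ^ 4 * E z" for z using zE[of z 4] by (simp add: power_divide fact_numeral flip: power_mult)
    have z6E: "((l2 z)\<^sup>2 / \<rho>\<^sup>2) ^ 3 \<le> 720 / a ^ 6 * E z" for z using zE[of z 6] by (simp add: power_divide fact_numeral flip: power_mult)
    have s1: "(\<lambda>z. P z * (l2 z)\<^sup>2) summable_on UNIV"
      using sP[of "\<lambda>z. (l2 z)\<^sup>2" "\<rho>\<^sup>2 * (2 / a\<^sup>2)"] z2E rho by (simp add: field_simps)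
    have s2: "(\<lambda>z. P z * ((l2 z)\<^sup>2 / \<rho>\<^sup>2)\<^sup>2) summable_on UNIV"
      using sP[of "\<lambda>z. ((l2 z)\<^sup>2 / \<rho>\<^sup>2)\<^sup>2" "24 / a ^ 4"] z4E by simp
    have s3: "(\<lambda>z. P z * (real_vec x \<bullet> real_vec z)\<^sup>2) summable_on UNIV"
    proof (rule sP[of _ "(l2 x)\<^sup>2 * (\<rho>\<^sup>2 * (2 / a\<^sup>2))"])
      fix z
      have "(real_vec x \<bullet> real_vec z)\<^sup>2 \<le> (l2 x * l2 z)\<^sup>2" using cs[of z] by (intro iffD1[OF abs_le_square_iff]) simp
      also have "\<dots> \<le> (l2 x)\<^sup>2 * (\<rho>\<^sup>2 * (2 / a\<^sup>2) * E z)"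
        unfolding power_mult_distrib using z2E[of z] rho by (intro mult_left_mono) (auto simp: field_simps)
      finally show "\<bar>(real_vec x \<bullet> real_vec z)\<^sup>2\<bar> \<le> (l2 x)\<^sup>2 * (\<rho>\<^sup>2 * (2 / a\<^sup>2)) * E z" by (simp add: mult_ac)
    qed
    have s4: "P summable_on UNIV" using sP[of "\<lambda>_. 1" 1] E1 by simp
    have sT': "(\<lambda>z. P z * T' z) summable_on UNIV" and ET': "(\<Sum>\<^sub>\<infinity>z. P z * T' z) \<le>
        1 - u + (u\<^sup>2 + u1) / 2 * (24 / a ^ 4 * K + 4 * (l2 x)\<^sup>2 / (real D * \<rho>\<^sup>2))"
    proof -
      have i4: "((\<lambda>z. P z) has_sum 1) UNIV" by (rule has_sum_infsum[OF s4, unfolded P(3)])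
      have i1: "((\<lambda>z. P z * (l2 z)\<^sup>2) has_sum \<rho>\<^sup>2) UNIV" by (rule has_sum_infsum[OF s1, unfolded v])
      have i3: "((\<lambda>z. P z * (real_vec x \<bullet> real_vec z)\<^sup>2) has_sum ((l2 x)\<^sup>2 * \<rho>\<^sup>2 / real D)) UNIV"
        unfolding D_def by (rule has_sum_infsum[OF s3, unfolded iso])
      define S where "S = (\<Sum>\<^sub>\<infinity>z. P z * ((l2 z)\<^sup>2 / \<rho>\<^sup>2)\<^sup>2)"
      have i2: "((\<lambda>z. P z * ((l2 z)\<^sup>2 / \<rho>\<^sup>2)\<^sup>2) has_sum S) UNIV" unfolding S_def by (rule has_sum_infsum[OF s2])
      have SK: "S \<le> 24 / a ^ 4 * K"
      proof -
        have "S \<le> (\<Sum>\<^sub>\<infinity>z. 24 / a ^ 4 * (P z * E z))"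
          unfolding S_def
        proof (rule infsum_mono[OF s2 summable_on_cmult_right[OF sE]])
          show "P z * ((l2 z)\<^sup>2 / \<rho>\<^sup>2)\<^sup>2 \<le> 24 / a ^ 4 * (P z * E z)" for z
            using mult_left_mono[OF z4E P(1), of z z] by (simp only: mult_ac)
        qed
        also have "\<dots> = 24 / a ^ 4 * (\<Sum>\<^sub>\<infinity>z. P z * E z)" by (rule infsum_cmult_right')
        also have "\<dots> \<le> 24 / a ^ 4 * K" using eK a by (intro mult_left_mono) (auto simp: E_def)
        finally show ?thesis .
      qed
      have "((\<lambda>z. P z + (- u / \<rho>\<^sup>2) * (P z * (l2 z)\<^sup>2) + ((u\<^sup>2 + u1) / 2) * (P z * ((l2 z)\<^sup>2 / \<rho>\<^sup>2)\<^sup>2) +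
          ((u\<^sup>2 + u1) / 2 * 4 / \<rho> ^ 4) * (P z * (real_vec x \<bullet> real_vec z)\<^sup>2)) has_sum
          1 + (- u / \<rho>\<^sup>2) * \<rho>\<^sup>2 + ((u\<^sup>2 + u1) / 2) * S + ((u\<^sup>2 + u1) / 2 * 4 / \<rho> ^ 4) * ((l2 x)\<^sup>2 * \<rho>\<^sup>2 / real D)) UNIV"
        by (intro has_sum_add has_sum_cmult_right i1 i2 i3 i4)
      also have "(\<lambda>z. P z + (- u / \<rho>\<^sup>2) * (P z * (l2 z)\<^sup>2) + ((u\<^sup>2 + u1) / 2) * (P z * ((l2 z)\<^sup>2 / \<rho>\<^sup>2)\<^sup>2) +
          ((u\<^sup>2 + u1) / 2 * 4 / \<rho> ^ 4) * (P z * (real_vec x \<bullet> real_vec z)\<^sup>2)) = (\<lambda>z. P z * T' z)"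
        by (simp add: T'_def fun_eq_iff algebra_simps add_divide_distrib)
      finally have h: "((\<lambda>z. P z * T' z) has_sum
          1 + (- u / \<rho>\<^sup>2) * \<rho>\<^sup>2 + ((u\<^sup>2 + u1) / 2) * S + ((u\<^sup>2 + u1) / 2 * 4 / \<rho> ^ 4) * ((l2 x)\<^sup>2 * \<rho>\<^sup>2 / real D)) UNIV" .
      then show "(\<lambda>z. P z * T' z) summable_on UNIV" by (rule has_sum_imp_summable)
      have "(\<Sum>\<^sub>\<infinity>z. P z * T' z) = 1 + (- u / \<rho>\<^sup>2) * \<rho>\<^sup>2 + ((u\<^sup>2 + u1) / 2) * S + ((u\<^sup>2 + u1) / 2 * 4 / \<rho> ^ 4) * ((l2 x)\<^sup>2 * \<rho>\<^sup>2 / real D)"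
        using h by (rule infsumI)
      also have "\<dots> = 1 - u + (u\<^sup>2 + u1) / 2 * (S + 4 * (l2 x)\<^sup>2 / (real D * \<rho>\<^sup>2))"
        using rho D1 by (simp add: field_simps eval_nat_numeral)
      also have "\<dots> \<le> 1 - u + (u\<^sup>2 + u1) / 2 * (24 / a ^ 4 * K + 4 * (l2 x)\<^sup>2 / (real D * \<rho>\<^sup>2))"
        using SK u0 by (intro add_left_mono mult_left_mono add_right_mono) auto
      finally show "(\<Sum>\<^sub>\<infinity>z. P z * T' z) \<le>
        1 - u + (u\<^sup>2 + u1) / 2 * (24 / a ^ 4 * K + 4 * (l2 x)\<^sup>2 / (real D * \<rho>\<^sup>2))" .
    qed
    have sL: "(\<lambda>z. P z * L z) summable_on UNIV"
    proof (rule sP[of _ "fw \<alpha> (c / \<xi>) (\<xi>\<^sup>2) m"])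
      fix z
      have "L z \<le> fw \<alpha> (c / \<xi>) (\<xi>\<^sup>2) (\<tau> (x - z))"
        using fw_pos[OF \<tau>0[of "x - z"]] by (auto simp: L_def intro: less_imp_le)
      also have "\<dots> \<le> fw \<alpha> (c / \<xi>) (\<xi>\<^sup>2) m"
        using m al c rho xi by (intro fw_antimono) (auto simp: \<tau>_def)
      also have "\<dots> * 1 \<le> fw \<alpha> (c / \<xi>) (\<xi>\<^sup>2) m * E z"
        using E1 m by (intro mult_left_mono) (auto intro: less_imp_le fw_pos)
      finally show "\<bar>L z\<bar> \<le> fw \<alpha> (c / \<xi>) (\<xi>\<^sup>2) m * E z" using L0 by simp
    qed
    have "(\<Sum>\<^sub>\<infinity>z. P z * L z) = (\<Sum>\<^sub>\<infinity>z. P z * ((L z + L (- z)) / 2))"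
      by (rule infsum_symmetrize[OF P(2) sL])
    also have "\<dots> \<le> (\<Sum>\<^sub>\<infinity>z. s * fA * (P z * T' z) + s * fA * C * X * (P z * E z))"
    proof (rule infsum_mono)
      show "(\<lambda>z. P z * ((L z + L (- z)) / 2)) summable_on UNIV"
      proof -
        have "(\<lambda>z. P z * L (- z)) summable_on UNIV"
          by (rule summable_on_reindex_bij_witness[where i = uminus and j = uminus, THEN iffD1, OF _ _ _ _ _ sL])
            (auto simp: P)
        from summable_on_cmult_right[OF summable_on_add[OF sL this], of "1/2"]
        show ?thesis by (simp add: algebra_simps add_divide_distrib)
      qed
      show "(\<lambda>z. s * fA * (P z * T' z) + s * fA * C * X * (P z * E z)) summable_on UNIV"
        by (intro summable_on_add summable_on_cmult_right sT' sE)
      fix z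
      have Em: "E (- z) = E z" by (simp add: E_def)
      have "(L z + L (- z)) / 2 \<le> s * (fA * ((T z + T (- z)) / 2 + C * X * E z))"
        using Lb[of z] Lb[of "- z"] unfolding Em by (simp add: field_simps)
      also have "\<dots> \<le> s * (fA * (T' z + C * X * E z))"
        using TT[of z] s0 fA0 by (intro mult_left_mono add_right_mono) auto
      finally have LL: "(L z + L (- z)) / 2 \<le> s * (fA * (T' z + C * X * E z))" .
      show "P z * ((L z + L (- z)) / 2) \<le> s * fA * (P z * T' z) + s * fA * C * X * (P z * E z)"
        using mult_left_mono[OF LL P(1)[of z]] by (simp add: algebra_simps)
    qed
    also have "\<dots> = s * fA * (\<Sum>\<^sub>\<infinity>z. P z * T' z) + s * fA * C * X * (\<Sum>\<^sub>\<infinity>z. P z * E z)"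
      by (subst infsum_add) (auto intro!: summable_on_cmult_right sT' sE simp: infsum_cmult_right')
    also have "\<dots> \<le> s * fA * (1 - u + (u\<^sup>2 + u1) / 2 * (24 / a ^ 4 * K + 4 * (l2 x)\<^sup>2 / (real D * \<rho>\<^sup>2))) + s * fA * C * X * K"
      using ET' eK s0 fA0 C X by (intro add_mono mult_left_mono) (auto simp: E_def)
    also have "\<dots> = s * fA * (1 + ((u\<^sup>2 + u1) * (2 * ((l2 x)\<^sup>2 / \<rho>\<^sup>2) / real D + k) - u) + C * K * X)"
      by (simp add: k_def algebra_simps add_divide_distrib)
    also have "\<dots> \<le> s * fA * (1 + (- \<alpha> * (m / \<rho>\<^sup>2 + (real D - 2 - 2 * \<alpha>) / real D * ((l2 x)\<^sup>2 / \<rho>\<^sup>2)) / ((A x)\<^sup>2)\<^sup>2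
         + (4 * real D + 4 + k * (2 * (real D)\<^sup>2 + real D + 3)) * (c / \<xi>'\<^sup>2 + 1 / ((A x)\<^sup>2)\<^sup>2)) + C * K * X)"
    proof -
      have e: "(l2 x)\<^sup>2 / \<rho>\<^sup>2 + m / \<rho>\<^sup>2 = (A x)\<^sup>2" by (simp add: A2 \<tau>_def add_divide_distrib)
      have "1 \<le> (A x)\<^sup>2" using Ax by (simp add: one_le_power)
      then have "(u\<^sup>2 + u1) * (2 * ((l2 x)\<^sup>2 / \<rho>\<^sup>2) / real D + k) - u \<le>
        - \<alpha> * (m / \<rho>\<^sup>2 + (real D - 2 - 2 * \<alpha>) / real D * ((l2 x)\<^sup>2 / \<rho>\<^sup>2)) / ((A x)\<^sup>2)\<^sup>2
         + (4 * real D + 4 + k * (2 * (real D)\<^sup>2 + real D + 3)) * (c / \<xi>'\<^sup>2 + 1 / ((A x)\<^sup>2)\<^sup>2)"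
        unfolding u_def u1_def e[symmetric]
        using m rho al D1 c xi1 k by (intro superharmonic_main_term) (auto simp: D_def)
      then show ?thesis using s0 fA0 by (intro mult_left_mono add_right_mono add_left_mono) auto
    qed
    also have "\<dots> = fw \<alpha> (c / \<xi>) (\<xi>\<^sup>2) (\<tau> x) * (1 - \<alpha> * \<rho>\<^sup>2 * (m + (real D - 2 - 2 * \<alpha>) / real D * (l2 x)\<^sup>2) / (\<tau> x)\<^sup>2
        + C' * (c * \<rho>\<^sup>2 / \<xi>\<^sup>2 + \<rho> ^ 4 / (\<tau> x)\<^sup>2))"
    proof -
      have 1: "X = c * \<rho>\<^sup>2 / \<xi>\<^sup>2 + \<rho> ^ 4 / (\<tau> x)\<^sup>2"
      proof -
        have "A x ^ 4 = ((A x)\<^sup>2)\<^sup>2" by simp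
        also have "\<dots> = (\<tau> x)\<^sup>2 / \<rho> ^ 4" by (simp only: A2 power_divide) (simp flip: power_mult)
        finally show ?thesis by (simp add: X_def \<xi>'_def power_divide)
      qed
      have 2: "c / \<xi>'\<^sup>2 + 1 / ((A x)\<^sup>2)\<^sup>2 = X" by (simp add: X_def flip: power_mult)
      have 3: "- \<alpha> * (m / \<rho>\<^sup>2 + (real D - 2 - 2 * \<alpha>) / real D * ((l2 x)\<^sup>2 / \<rho>\<^sup>2)) / ((A x)\<^sup>2)\<^sup>2
         = - (\<alpha> * \<rho>\<^sup>2 * (m + (real D - 2 - 2 * \<alpha>) / real D * (l2 x)\<^sup>2) / (\<tau> x)\<^sup>2)"
      proof -
        define W where "W = m + (real D - 2 - 2 * \<alpha>) / real D * (l2 x)\<^sup>2"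
        have w: "m / \<rho>\<^sup>2 + (real D - 2 - 2 * \<alpha>) / real D * ((l2 x)\<^sup>2 / \<rho>\<^sup>2) = W / \<rho>\<^sup>2"
          by (simp add: W_def add_divide_distrib)
        show ?thesis unfolding w A2 W_def[symmetric] using rho by (simp add: field_simps power2_eq_square)
      qed
      show ?thesis unfolding 2 3 fs fA_def unfolding 1 C'_def by (simp add: algebra_simps)
    qed
    finally have "(\<Sum>\<^sub>\<infinity>z. P z * L z) \<le> fw \<alpha> (c / \<xi>) (\<xi>\<^sup>2) (\<tau> x) * (1 - \<alpha> * \<rho>\<^sup>2 * (m + (real D - 2 - 2 * \<alpha>) / real D * (l2 x)\<^sup>2) / (\<tau> x)\<^sup>2
        + C' * (c * \<rho>\<^sup>2 / \<xi>\<^sup>2 + \<rho> ^ 4 / (\<tau> x)\<^sup>2))" .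
    with sL show "(\<lambda>z. P z * (of_bool (\<rho>\<^sup>2 \<le> (l2 (x - z))\<^sup>2 + m) * fw \<alpha> (c / \<xi>) (\<xi>\<^sup>2) ((l2 (x - z))\<^sup>2 + m))) summable_on UNIV \<and>
    (\<Sum>\<^sub>\<infinity>z. P z * (of_bool (\<rho>\<^sup>2 \<le> (l2 (x - z))\<^sup>2 + m) * fw \<alpha> (c / \<xi>) (\<xi>\<^sup>2) ((l2 (x - z))\<^sup>2 + m)))
    \<le> fw \<alpha> (c / \<xi>) (\<xi>\<^sup>2) ((l2 x)\<^sup>2 + m) *
      (1 - \<alpha> * \<rho>\<^sup>2 * (m + (real CARD('n) - 2 - 2 * \<alpha>) / real CARD('n) * (l2 x)\<^sup>2) / ((l2 x)\<^sup>2 + m)\<^sup>2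
       + C' * (c * \<rho>\<^sup>2 / \<xi>\<^sup>2 + \<rho> ^ 4 / ((l2 x)\<^sup>2 + m)\<^sup>2))"
      unfolding L_def \<tau>_def D_def by blast
  qed
qed

subsection \<open>Moments of convolutions and one-sided slopes\<close>

lemma power_le_exp_l2:
  assumes "0 < m"
  shows "(l2 x) ^ k \<le> fact k / m ^ k * exp (m * l2 x)"
  using power_le_exp[of "l2 x" m k] assms by simp

lemma esum_summable_power:
  assumes "esum m f" "0 < m"
  shows "(\<lambda>x. f x * (l2 x) ^ k) summable_on UNIV"
  by (rule esum_summable[OF assms(1), of _ "fact k / m ^ k"]) (use power_le_exp_l2[OF assms(2)] in simp)

lemma esum_imp_summable:
  assumes "esum m f" "0 < m"
  shows "f summable_on UNIV"
  using esum_summable_power[OF assms, of 0] by simp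

lemma infsum_odd:
  fixes f h :: "int ^ 'n \<Rightarrow> real"
  assumes "\<And>z. f (- z) = f z" "\<And>z. h (- z) = - h z"
  shows "(\<Sum>\<^sub>\<infinity>z. f z * h z) = 0"
proof -
  have "(\<Sum>\<^sub>\<infinity>z. f z * h z) = (\<Sum>\<^sub>\<infinity>z. f (- z) * h (- z))" using infsum_neg[of "\<lambda>z. f z * h z"] by simp
  also have "\<dots> = - (\<Sum>\<^sub>\<infinity>z. f z * h z)" by (simp add: assms infsum_uminus)
  finally show ?thesis by simp
qed

lemma infsum_conv:
  fixes f g :: "int ^ 'n \<Rightarrow> real"
  assumes "esum m f" "esum m g" "0 < m"
  shows "(\<Sum>\<^sub>\<infinity>x. conv f g x) = (\<Sum>\<^sub>\<infinity>x. f x) * (\<Sum>\<^sub>\<infinity>x. g x)"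
  using conv_weight(2)[OF assms(1,2), of "\<lambda>_. 1" 1] assms(3) by (simp add: infsum_cmult_left')

text \<open>Second moments add under convolution because the cross term is odd.\<close>
lemma infsum_conv_quadratic:
  fixes f g w :: "int ^ 'n \<Rightarrow> real"
  assumes f: "esum m f" and g: "esum m g" and m: "0 < m" and even: "\<And>z. g (- z) = g z"
    and w: "\<And>x. \<bar>w x\<bar> \<le> B * (l2 x)\<^sup>2"
    and q: "\<And>y z. w (y + z) = w y + w z + b y z" and odd: "\<And>y z. b y (- z) = - b y z"
  shows "(\<Sum>\<^sub>\<infinity>x. conv f g x * w x) = (\<Sum>\<^sub>\<infinity>x. f x * w x) * (\<Sum>\<^sub>\<infinity>x. g x) + (\<Sum>\<^sub>\<infinity>x. f x) * (\<Sum>\<^sub>\<infinity>x. g x * w x)"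
proof -
  have B: "\<bar>w x\<bar> \<le> \<bar>B\<bar> * (2 / m\<^sup>2) * exp (m * l2 x)" for x
  proof -
    have "\<bar>w x\<bar> \<le> \<bar>B\<bar> * (l2 x)\<^sup>2" using w[of x] mult_right_mono[OF abs_ge_self[of B] zero_le_power2[of "l2 x"]] by linarith
    also have "\<dots> \<le> \<bar>B\<bar> * (2 / m\<^sup>2 * exp (m * l2 x))"
      using power_le_exp_l2[OF m, of x 2] by (intro mult_left_mono) auto
    finally show ?thesis by (simp add: mult.assoc)
  qed
  note cw = conv_weight[OF f g less_imp_le[OF m] B]
  have gs: "g summable_on UNIV" "(\<lambda>z. g z * w z) summable_on UNIV" "f summable_on UNIV" "(\<lambda>z. f z * w z) summable_on UNIV"
    using esum_imp_summable[OF g m] esum_imp_summable[OF f m] esum_summable[OF g B] esum_summable[OF f B] by auto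
  have inner: "(\<Sum>\<^sub>\<infinity>z. g z * w (y + z)) = w y * (\<Sum>\<^sub>\<infinity>z. g z) + (\<Sum>\<^sub>\<infinity>z. g z * w z)" for y
  proof -
    have sb: "(\<lambda>z. g z * b y z) summable_on UNIV"
    proof -
      have "(\<lambda>z. g z * w (y + z) + (- w y) * g z + (- 1) * (g z * w z)) summable_on UNIV"
        by (intro summable_on_add summable_on_cmult_right gs cw(3))
      moreover have "g z * w (y + z) + (- w y) * g z + (- 1) * (g z * w z) = g z * b y z" for z
        by (simp add: q algebra_simps)
      ultimately show ?thesis by simp
    qed
    have "(\<Sum>\<^sub>\<infinity>z. g z * w (y + z)) = (\<Sum>\<^sub>\<infinity>z. w y * g z + g z * w z + g z * b y z)"
      unfolding q by (simp add: algebra_simps)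
    also have "\<dots> = w y * (\<Sum>\<^sub>\<infinity>z. g z) + (\<Sum>\<^sub>\<infinity>z. g z * w z) + (\<Sum>\<^sub>\<infinity>z. g z * b y z)"
      by (rule infsumI[OF has_sum_add[OF has_sum_add[OF has_sum_cmult_right[OF has_sum_infsum[OF gs(1)]]
            has_sum_infsum[OF gs(2)]] has_sum_infsum[OF sb]]])
    also have "(\<Sum>\<^sub>\<infinity>z. g z * b y z) = 0" using infsum_odd[of g "b y"] even odd by blast
    finally show ?thesis by simp
  qed
  have "(\<Sum>\<^sub>\<infinity>x. conv f g x * w x) = (\<Sum>\<^sub>\<infinity>y. (f y * w y) * (\<Sum>\<^sub>\<infinity>z. g z) + f y * (\<Sum>\<^sub>\<infinity>z. g z * w z))"
    by (subst cw(2)) (simp add: inner algebra_simps)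
  also have "\<dots> = (\<Sum>\<^sub>\<infinity>x. f x * w x) * (\<Sum>\<^sub>\<infinity>x. g x) + (\<Sum>\<^sub>\<infinity>x. f x) * (\<Sum>\<^sub>\<infinity>x. g x * w x)"
    by (subst infsum_add) (auto intro!: summable_on_cmult_left gs simp: infsum_cmult_left')
  finally show ?thesis .
qed

lemma infsum_conv_l2:
  fixes f g :: "int ^ 'n \<Rightarrow> real"
  assumes "esum m f" "esum m g" "0 < m" "\<And>z. g (- z) = g z"
  shows "(\<Sum>\<^sub>\<infinity>x. conv f g x * (l2 x)\<^sup>2) = (\<Sum>\<^sub>\<infinity>x. f x * (l2 x)\<^sup>2) * (\<Sum>\<^sub>\<infinity>x. g x) + (\<Sum>\<^sub>\<infinity>x. f x) * (\<Sum>\<^sub>\<infinity>x. g x * (l2 x)\<^sup>2)"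
  by (rule infsum_conv_quadratic[OF assms, where B = 1 and b = "\<lambda>y z. 2 * (real_vec y \<bullet> real_vec z)"])
    (auto simp: l2_def power2_norm_eq_inner inner_add_left inner_add_right inner_commute)

lemma inner_square_le: "(real_vec v \<bullet> real_vec z)\<^sup>2 \<le> (l2 v)\<^sup>2 * (l2 z)\<^sup>2"
  using Cauchy_Schwarz_ineq[of "real_vec v" "real_vec z"] by (simp add: l2_def power2_norm_eq_inner)

lemma infsum_conv_inner:
  fixes f g :: "int ^ 'n \<Rightarrow> real"
  assumes "esum m f" "esum m g" "0 < m" "\<And>z. g (- z) = g z"
  shows "(\<Sum>\<^sub>\<infinity>x. conv f g x * (real_vec v \<bullet> real_vec x)\<^sup>2) =
     (\<Sum>\<^sub>\<infinity>x. f x * (real_vec v \<bullet> real_vec x)\<^sup>2) * (\<Sum>\<^sub>\<infinity>x. g x) + (\<Sum>\<^sub>\<infinity>x. f x) * (\<Sum>\<^sub>\<infinity>x. g x * (real_vec v \<bullet> real_vec x)\<^sup>2)"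
  by (rule infsum_conv_quadratic[OF assms, where B = "(l2 v)\<^sup>2" and b = "\<lambda>y z. 2 * (real_vec v \<bullet> real_vec y) * (real_vec v \<bullet> real_vec z)"])
    (simp_all add: inner_square_le inner_add_right power2_sum)

lemma Zd_symmetric_minus: "Zd_symmetric f \<Longrightarrow> f (- x) = f x"
  unfolding Zd_symmetric_def
  by (drule conjunct2, drule spec[of _ "\<lambda>_. - 1"], drule spec[of _ x]) (simp add: vec_eq_iff uminus_vec_def)

text \<open>Flipping the sign of one coordinate kills the mixed second moments, and swapping two
  coordinates equates the diagonal ones.\<close>

lemma Zd_symmetric_isotropic:
  fixes f :: "int ^ 'n \<Rightarrow> real"
  assumes sym: "Zd_symmetric f" and f: "esum m f" "0 < m"
  shows "(\<Sum>\<^sub>\<infinity>z. f z * (real_vec v \<bullet> real_vec z)\<^sup>2) = (l2 v)\<^sup>2 * (\<Sum>\<^sub>\<infinity>z. f z * (l2 z)\<^sup>2) / real CARD('n)"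
proof -
  define M where "M = (\<lambda>i j. \<Sum>\<^sub>\<infinity>z. f z * (real_of_int (z $ i) * real_of_int (z $ j)))"
  have s: "(\<lambda>z. f z * (real_of_int (z $ i) * real_of_int (z $ j))) summable_on UNIV" for i j
  proof (rule esum_summable[OF f(1)])
    fix z :: "int ^ 'n"
    have "\<bar>real_of_int (z $ i) * real_of_int (z $ j)\<bar> \<le> l2 z * l2 z"
      unfolding abs_mult by (intro mult_mono component_le_l2) auto
    also have "\<dots> \<le> fact 2 / m ^ 2 * exp (m * l2 z)" using power_le_exp_l2[OF f(2), of z 2] by (simp add: power2_eq_square)
    finally show "\<bar>real_of_int (z $ i) * real_of_int (z $ j)\<bar> \<le> fact 2 / m ^ 2 * exp (m * l2 z)" .
  qed
  have off: "M i j = 0" if "i \<noteq> j" for i j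
  proof -
    define s where "s = (\<lambda>k. if k = i then - 1 else 1 :: int)"
    define T where "T = (\<lambda>z::int ^ 'n. \<chi> k. s k * z $ k)"
    have TT: "T (T z) = z" for z by (simp add: T_def s_def vec_eq_iff)
    have fT: "f (T z) = f z" for z using sym unfolding Zd_symmetric_def T_def by (auto simp: s_def)
    have "M i j = (\<Sum>\<^sub>\<infinity>z. f (T z) * (real_of_int (T z $ i) * real_of_int (T z $ j)))"
      unfolding M_def by (rule infsum_reindex_bij_witness[where i = T and j = T]) (auto simp: TT)
    also have "\<dots> = (\<Sum>\<^sub>\<infinity>z. - (f z * (real_of_int (z $ i) * real_of_int (z $ j))))"
      unfolding fT using that by (simp add: T_def s_def)
    also have "\<dots> = - M i j" by (simp add: M_def infsum_uminus)
    finally show ?thesis by simp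
  qed
  have diag: "M i i = M j j" for i j
  proof -
    define p where "p = Transposition.transpose i j"
    define T where "T = (\<lambda>z::int ^ 'n. \<chi> k. z $ p k)"
    have TT: "T (T z) = z" for z by (simp add: T_def p_def vec_eq_iff)
    have fT: "f (T z) = f z" for z using sym unfolding Zd_symmetric_def T_def by (auto simp: p_def)
    have "M i i = (\<Sum>\<^sub>\<infinity>z. f (T z) * (real_of_int (T z $ i) * real_of_int (T z $ i)))"
      unfolding M_def by (rule infsum_reindex_bij_witness[where i = T and j = T]) (auto simp: TT)
    also have "\<dots> = M j j" unfolding fT by (simp add: T_def p_def M_def)
    finally show ?thesis .
  qed
  have hs: "((\<lambda>z. f z * (real_of_int (z $ i) * real_of_int (z $ j))) has_sum M i j) UNIV" for i j
    unfolding M_def by (rule has_sum_infsum[OF s])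
  have hsum: "((\<lambda>z. \<Sum>i\<in>A. h i z) has_sum (\<Sum>i\<in>A. S i)) UNIV" if "\<And>i. (h i has_sum S i) UNIV" "finite A"
    for h :: "'n \<Rightarrow> int ^ 'n \<Rightarrow> real" and S and A :: "'n set"
    using that(2) by (induction A rule: finite_induct) (auto intro!: has_sum_add that(1))
  define k where "k = (SOME i::'n. True)"
  have "((\<lambda>z. \<Sum>i\<in>UNIV. \<Sum>j\<in>UNIV. (real_of_int (v $ i) * real_of_int (v $ j)) * (f z * (real_of_int (z $ i) * real_of_int (z $ j))))
      has_sum (\<Sum>i\<in>UNIV. \<Sum>j\<in>UNIV. (real_of_int (v $ i) * real_of_int (v $ j)) * M i j)) UNIV"
    by (intro hsum has_sum_cmult_right hs finite)
  also have "(\<lambda>z. \<Sum>i\<in>UNIV. \<Sum>j\<in>UNIV. (real_of_int (v $ i) * real_of_int (v $ j)) * (f z * (real_of_int (z $ i) * real_of_int (z $ j))))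
     = (\<lambda>z. f z * (real_vec v \<bullet> real_vec z)\<^sup>2)"
    by (simp add: fun_eq_iff inner_vec_def power2_eq_square sum_product sum_distrib_left mult_ac)
  also have "(\<Sum>i\<in>UNIV. \<Sum>j\<in>UNIV. (real_of_int (v $ i) * real_of_int (v $ j)) * M i j) = (\<Sum>i\<in>UNIV. (real_of_int (v $ i))\<^sup>2 * M k k)"
  proof (rule sum.cong[OF refl])
    fix i
    have "(\<Sum>j\<in>UNIV. (real_of_int (v $ i) * real_of_int (v $ j)) * M i j) = (\<Sum>j\<in>{i}. (real_of_int (v $ i) * real_of_int (v $ j)) * M i j)"
      by (rule sum.mono_neutral_right) (auto simp: off)
    then show "(\<Sum>j\<in>UNIV. (real_of_int (v $ i) * real_of_int (v $ j)) * M i j) = (real_of_int (v $ i))\<^sup>2 * M k k"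
      using diag[of i k] by (simp add: power2_eq_square)
  qed
  also have "\<dots> = (l2 v)\<^sup>2 * M k k" by (simp add: l2_power2 sum_distrib_right)
  finally have 1: "(\<Sum>\<^sub>\<infinity>z. f z * (real_vec v \<bullet> real_vec z)\<^sup>2) = (l2 v)\<^sup>2 * M k k" by (rule infsumI)
  have "((\<lambda>z. \<Sum>i\<in>UNIV. f z * (real_of_int (z $ i) * real_of_int (z $ i))) has_sum (\<Sum>i\<in>(UNIV::'n set). M i i)) UNIV"
    by (intro hsum hs finite)
  also have "(\<lambda>z. \<Sum>i\<in>UNIV. f z * (real_of_int (z $ i) * real_of_int (z $ i))) = (\<lambda>z. f z * (l2 z)\<^sup>2)"
    by (simp add: fun_eq_iff l2_power2 sum_distrib_left) (simp add: power2_eq_square)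
  also have "(\<Sum>i\<in>(UNIV::'n set). M i i) = (\<Sum>i\<in>(UNIV::'n set). M k k)" by (rule sum.cong[OF refl diag])
  finally have "(\<Sum>\<^sub>\<infinity>z. f z * (l2 z)\<^sup>2) = (\<Sum>i\<in>(UNIV::'n set). M k k)" by (rule infsumI)
  then have 2: "(\<Sum>\<^sub>\<infinity>z. f z * (l2 z)\<^sup>2) = real CARD('n) * M k k" by simp
  show ?thesis unfolding 1 2 by simp
qed

lemma conv_minus:
  fixes f g :: "int ^ 'n \<Rightarrow> real"
  assumes "\<And>z. f (- z) = f z" "\<And>z. g (- z) = g z"
  shows "conv f g (- x) = conv f g x"
proof -
  have "conv f g (- x) = (\<Sum>\<^sub>\<infinity>y. f (- y) * g (- x - (- y)))"
    unfolding conv_def using infsum_neg[of "\<lambda>y. f y * g (- x - y)"] by simp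
  also have "\<dots> = (\<Sum>\<^sub>\<infinity>y. f y * g (x - y))"
  proof (rule infsum_cong)
    fix y
    have "g (- x - (- y)) = g (- (x - y))" by (simp add: algebra_simps)
    then show "f (- y) * g (- x - (- y)) = f y * g (x - y)" by (simp only: assms)
  qed
  finally show ?thesis by (simp add: conv_def)
qed

text \<open>A lower bound for the lower right Dini derivative.\<close>
definition rslope_ge :: "(real \<Rightarrow> real) \<Rightarrow> real \<Rightarrow> real \<Rightarrow> bool" where
  "rslope_ge f t L \<longleftrightarrow> (\<forall>\<gamma>>0. \<forall>\<^sub>F r in at_right t. (r - t) * (L - \<gamma>) \<le> f r - f t)"

text \<open>For each \<gamma> > 0 consider the last point at which f is not below the line of slope
  -\<gamma> through (s, f s). It exists by continuity, and the slope bound carries any such point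
  before u further to the right, so it is u. Then \<gamma> tends to 0.\<close>

lemma rslope_ge_imp_mono:
  fixes f :: "real \<Rightarrow> real"
  assumes su: "s \<le> u" and c: "continuous_on {s..u} f" and sl: "\<And>t. s \<le> t \<Longrightarrow> t < u \<Longrightarrow> rslope_ge f t 0"
  shows "f s \<le> f u"
proof -
  have "f s - f u \<le> \<gamma> * (u - s)" if g: "0 < \<gamma>" for \<gamma>
  proof -
    define A where "A = {t \<in> {s..u}. f s - \<gamma> * (t - s) - f t \<le> 0}"
    have "continuous_on {s..u} (\<lambda>t. f s - \<gamma> * (t - s) - f t)" by (intro continuous_intros c)
    then have "closed A" unfolding A_def by (intro continuous_closed_preimage_constant continuous_on_closed_Collect_le) (auto intro!: continuous_intros c)
    moreover have "bounded A" by (rule bounded_subset[of "{s..u}"]) (auto simp: A_def)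
    ultimately have "compact A" by (simp add: compact_eq_bounded_closed)
    moreover have "s \<in> A" using su by (simp add: A_def)
    ultimately obtain t where t: "t \<in> A" "\<And>r. r \<in> A \<Longrightarrow> r \<le> t" using compact_attains_sup[of A] by blast
    have "t = u"
    proof (rule ccontr)
      assume "t \<noteq> u"
      then have tu: "t < u" "s \<le> t" using t(1) by (auto simp: A_def)
      have "\<forall>\<^sub>F r in at_right t. (r - t) * (0 - \<gamma>) \<le> f r - f t"
        using sl[OF tu(2,1)] g by (simp add: rslope_ge_def)
      moreover have "\<forall>\<^sub>F r in at_right t. r \<in> {t<..<u}" by (rule eventually_at_rightI[OF _ tu(1)]) auto
      ultimately have "\<forall>\<^sub>F r in at_right t. (r - t) * (0 - \<gamma>) \<le> f r - f t \<and> r \<in> {t<..<u}"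
        by (rule eventually_conj)
      then obtain r where r: "(r - t) * (0 - \<gamma>) \<le> f r - f t" "t < r" "r < u"
        using eventually_happens[of _ "at_right t"] by (auto simp: trivial_limit_at_right_real)
      have "f s - \<gamma> * (t - s) - f t \<le> 0" using t(1) by (simp add: A_def)
      then have "f s - \<gamma> * (r - s) - f r \<le> 0" using r(1) by (simp add: algebra_simps)
      then have "r \<in> A" using r tu by (simp add: A_def)
      then show False using t(2)[of r] r by simp
    qed
    then show ?thesis using t(1) by (simp add: A_def)
  qed
  note le = this
  show ?thesis
  proof (rule ccontr)
    assume "\<not> f s \<le> f u"
    then have p: "0 < f s - f u" by simp
    have "f s - f u \<le> (f s - f u) / (2 * (u - s + 1)) * (u - s)" using p su by (intro le) auto
    also have "\<dots> \<le> (f s - f u) / 2" using p su by (simp add: field_simps)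
    finally show False using p by simp
  qed
qed

lemma rslope_ge_add:
  assumes "rslope_ge f t L" "rslope_ge g t M"
  shows "rslope_ge (\<lambda>x. f x + g x) t (L + M)"
  unfolding rslope_ge_def
proof (intro allI impI)
  fix \<gamma> :: real assume "0 < \<gamma>"
  then have "\<forall>\<^sub>F r in at_right t. (r - t) * (L - \<gamma> / 2) \<le> f r - f t" "\<forall>\<^sub>F r in at_right t. (r - t) * (M - \<gamma> / 2) \<le> g r - g t"
    using assms unfolding rslope_ge_def by (auto dest: half_gt_zero)
  then show "\<forall>\<^sub>F r in at_right t. (r - t) * (L + M - \<gamma>) \<le> f r + g r - (f t + g t)"
  proof eventually_elim
    case (elim r)
    have "(r - t) * (L + M - \<gamma>) = (r - t) * (L - \<gamma> / 2) + (r - t) * (M - \<gamma> / 2)"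
      by (simp flip: distrib_left)
    then show ?case using elim by linarith
  qed
qed

lemma rslope_ge_linear: "rslope_ge (\<lambda>x. k * x) t k"
  unfolding rslope_ge_def
proof (intro allI impI)
  fix \<gamma> :: real assume "0 < \<gamma>"
  have "\<forall>\<^sub>F r in at_right t. t < r" by (rule eventually_at_right_less)
  then show "\<forall>\<^sub>F r in at_right t. (r - t) * (k - \<gamma>) \<le> k * r - k * t"
    by eventually_elim (use \<open>0 < \<gamma>\<close> in \<open>simp add: algebra_simps\<close>)
qed

text \<open>The linearisation error of \<Phi> is a small multiple of |f r - f t|. The Lipschitz
  hypothesis makes it a small multiple of r - t; a lower slope bound alone would not limit upward
  jumps of f.\<close>

lemma rslope_ge_chain:
  assumes d: "(\<Phi> has_real_derivative p) (at (f t))" and p: "0 \<le> p" and sl: "rslope_ge f t L"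
    and lip: "\<forall>\<^sub>F r in at_right t. \<bar>f r - f t\<bar> \<le> B * (r - t)"
  shows "rslope_ge (\<lambda>x. \<Phi> (f x)) t (p * L)"
  unfolding rslope_ge_def
proof (intro allI impI)
  fix \<gamma> :: real assume g: "0 < \<gamma>"
  define B' where "B' = \<bar>B\<bar> + 1"
  have B': "0 < B'" "B \<le> B'" by (auto simp: B'_def)
  define e where "e = \<gamma> / (2 * B')"
  have e: "0 < e" using g B' by (simp add: e_def)
  obtain \<eta> where eta: "0 < \<eta>" "\<And>y. \<bar>y - f t\<bar> < \<eta> \<Longrightarrow> \<bar>\<Phi> y - \<Phi> (f t) - p * (y - f t)\<bar> \<le> e * \<bar>y - f t\<bar>"
  proof -
    have "(\<Phi> has_derivative (\<lambda>h. p * h)) (at (f t))" using d by (simp add: has_field_derivative_def)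
    then obtain \<eta> where "0 < \<eta>" "\<forall>y. norm (y - f t) < \<eta> \<longrightarrow> norm (\<Phi> y - \<Phi> (f t) - p * (y - f t)) \<le> e * norm (y - f t)"
      unfolding has_derivative_at_alt using e by blast
    with that show ?thesis by auto
  qed
  have 1: "\<forall>\<^sub>F r in at_right t. (r - t) * (L - \<gamma> / (2 * (p + 1))) \<le> f r - f t"
    using sl g p by (simp add: rslope_ge_def)
  have 2: "\<forall>\<^sub>F r in at_right t. r \<in> {t<..<t + \<eta> / B'}"
    by (rule eventually_at_rightI[of t "t + \<eta> / B'"]) (use eta B' in auto)
  show "\<forall>\<^sub>F r in at_right t. (r - t) * (p * L - \<gamma>) \<le> \<Phi> (f r) - \<Phi> (f t)"
    using 1 2 lip
  proof eventually_elim
    case (elim r)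
    have r: "0 < r - t" "B' * (r - t) < \<eta>" using elim B' by (auto simp: field_simps)
    have fr: "\<bar>f r - f t\<bar> \<le> B' * (r - t)" using elim(3) mult_right_mono[OF B'(2), of "r - t"] r by linarith
    then have "\<bar>\<Phi> (f r) - \<Phi> (f t) - p * (f r - f t)\<bar> \<le> e * \<bar>f r - f t\<bar>" using eta(2) r by auto
    also have "\<dots> \<le> e * (B' * (r - t))" using fr e by (intro mult_left_mono) auto
    also have "\<dots> = \<gamma> / 2 * (r - t)" using B' by (simp add: e_def)
    finally have "p * (f r - f t) - \<gamma> / 2 * (r - t) \<le> \<Phi> (f r) - \<Phi> (f t)" by linarith
    moreover have "p * ((r - t) * (L - \<gamma> / (2 * (p + 1)))) \<le> p * (f r - f t)" using elim(1) p by (intro mult_left_mono)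
    moreover have "(r - t) * (p * L - \<gamma>) \<le> p * ((r - t) * (L - \<gamma> / (2 * (p + 1)))) - \<gamma> / 2 * (r - t)"
    proof -
      define X where "X = \<gamma> / (2 * (p + 1))"
      have "p * X \<le> \<gamma> / 2" using p g by (simp add: X_def field_simps)
      then have "(r - t) * (p * X) \<le> (r - t) * (\<gamma> / 2)" using r by (intro mult_left_mono) auto
      moreover have "p * ((r - t) * (L - X)) - \<gamma> / 2 * (r - t) - (r - t) * (p * L - \<gamma>)
          = (r - t) * (\<gamma> / 2) - (r - t) * (p * X)"
        by (simp add: field_simps)
      ultimately show ?thesis unfolding X_def by linarith
    qed
    ultimately show ?case by linarith
  qed
qed

subsection \<open>Susceptibility and correlation length\<close>

text \<open>What the argument needs to know about the two inequalities: \<open>S\<close> is the susceptibility, \<open>\<xi>\<close> the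
  correlation length, and \<open>\<nu>\<close> tends to \<open>0\<close> with the error threshold \<open>\<delta>\<close>.\<close>
locale scales =
  fixes c\<^sub>0 \<nu> \<sigma> :: real and J :: "int ^ 'n \<Rightarrow> real" and I :: "real set"
    and g :: "real \<Rightarrow> int ^ 'n \<Rightarrow> real" and S \<xi> :: "real \<Rightarrow> real"
  assumes c0: "0 < c\<^sub>0" "c\<^sub>0 \<le> 1" and nu: "0 < \<nu>" "\<nu> \<le> 1 / 10" and d3: "3 \<le> CARD('n)" and sigma: "0 < \<sigma>"
    and J_nonneg: "\<And>z. 0 \<le> J z" and J_0: "J 0 = 0" and J_sum: "(\<Sum>\<^sub>\<infinity>z. J z) = 1"
    and J_even: "\<And>z. J (- z) = J z" and J_fin: "finite {z. J z \<noteq> 0}"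
    and J_range: "\<And>z. J z \<noteq> 0 \<Longrightarrow> l2 z \<le> sqrt (real CARD('n)) / c\<^sub>0 * \<sigma>"
    and J_le: "\<And>z. J z \<le> sqrt (real CARD('n)) ^ CARD('n) / c\<^sub>0 / \<sigma> ^ CARD('n)"
    and J_var: "(\<Sum>\<^sub>\<infinity>z. J z * (l2 z)\<^sup>2) = \<sigma>\<^sup>2"
    and I_nonneg: "\<And>t. t \<in> I \<Longrightarrow> 0 \<le> t"
    and I_down: "\<And>s t. t \<in> I \<Longrightarrow> 0 \<le> s \<Longrightarrow> s \<le> t \<Longrightarrow> s \<in> I"
    and g_nonneg: "\<And>t x. t \<in> I \<Longrightarrow> 0 \<le> g t x" and g_0: "0 \<in> I \<Longrightarrow> g 0 x = of_bool (x = 0)"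
    and g_even: "\<And>t x. t \<in> I \<Longrightarrow> g t (- x) = g t x"
    and g_mono: "\<And>s t x. t \<in> I \<Longrightarrow> 0 \<le> s \<Longrightarrow> s \<le> t \<Longrightarrow> g s x \<le> g t x"
    and g_esum: "\<And>t. t \<in> I \<Longrightarrow> \<exists>m>0. esum m (g t)"
    and g_upper: "\<And>s t x. t \<in> I \<Longrightarrow> 0 \<le> s \<Longrightarrow> s \<le> t \<Longrightarrow>
        g t x \<le> g s x + (t - s) * conv (conv J (g s)) (g t) x"
    and chi: "\<And>t. t \<in> I \<Longrightarrow> S t = (\<Sum>\<^sub>\<infinity>x. g t x)"
    and F_var: "\<And>t. t \<in> I \<Longrightarrow> (\<Sum>\<^sub>\<infinity>x. conv J (g t) x * (l2 x)\<^sup>2) = S t * (\<xi> t)\<^sup>2"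
    and F_iso: "\<And>t v. t \<in> I \<Longrightarrow> (\<Sum>\<^sub>\<infinity>x. conv J (g t) x * (real_vec v \<bullet> real_vec x)\<^sup>2)
        = (l2 v)\<^sup>2 * (S t * (\<xi> t)\<^sup>2) / real CARD('n)"
    and xi_cont: "\<And>t. t \<in> I \<Longrightarrow> continuous_on {0..t} \<xi>"
    and xi_mono: "\<And>s t. t \<in> I \<Longrightarrow> 0 \<le> s \<Longrightarrow> s \<le> t \<Longrightarrow> \<xi> s \<le> \<xi> t"
    and xi_0: "0 \<in> I \<Longrightarrow> \<xi> 0 = \<sigma>"
    and kill: "\<And>s t. t \<in> I \<Longrightarrow> 0 \<le> s \<Longrightarrow> s \<le> t \<Longrightarrow> (t - s) * S s * (1 - \<nu>) \<le> 1 - S s / S t"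
    and growth_lower: "\<And>s t. t \<in> I \<Longrightarrow> 0 \<le> s \<Longrightarrow> s \<le> t \<Longrightarrow> (\<xi> t / \<xi> s) powr (2 - \<nu>) \<le> S t / S s"
    and growth_upper: "\<And>s t. t \<in> I \<Longrightarrow> 0 \<le> s \<Longrightarrow> s \<le> t \<Longrightarrow> S t / S s \<le> (\<xi> t / \<xi> s) powr (2 + \<nu>)"

lemma lipschitz_continuous_interval:
  fixes f :: "real \<Rightarrow> real"
  assumes "\<And>a b. s \<le> a \<Longrightarrow> a \<le> b \<Longrightarrow> b \<le> u \<Longrightarrow> \<bar>f b - f a\<bar> \<le> L * (b - a)" "0 \<le> L"
  shows "continuous_on {s..u} f"
proof (rule lipschitz_on_continuous_on)
  show "L-lipschitz_on {s..u} f"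
  proof (rule lipschitz_onI)
    fix x y assume xy: "x \<in> {s..u}" "y \<in> {s..u}"
    consider "x \<le> y" | "y \<le> x" by linarith
    then show "dist (f x) (f y) \<le> L * dist x y"
    proof cases
      case 1
      then show ?thesis using assms(1)[of x y] xy by (simp add: dist_real_def abs_minus_commute)
    next
      case 2
      then show ?thesis using assms(1)[of y x] xy by (simp add: dist_real_def)
    qed
  qed (rule assms(2))
qed

lemma one_le_l2: "(x :: int ^ 'n) \<noteq> 0 \<Longrightarrow> 1 \<le> l2 x"
proof -
  assume "x \<noteq> 0"
  then obtain i where "x $ i \<noteq> 0" by (auto simp: vec_eq_iff)
  then have "1 \<le> \<bar>x $ i\<bar>" by linarith
  then have "1 \<le> \<bar>real_of_int (x $ i)\<bar>" by linarith
  then show ?thesis using component_le_l2[of x i] by linarith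
qed

text \<open>Real-valued data on the parameters where the error is at most \<delta>.
  \<open>H_small\<close> is that error with \<xi>^2 expanded, using that second moments of symmetric
  functions add under convolution.\<close>

locale family =
  fixes J :: "int ^ 'n \<Rightarrow> real" and I :: "real set" and g H :: "real \<Rightarrow> int ^ 'n \<Rightarrow> real" and \<delta> :: real
  assumes delta: "0 < \<delta>" "\<delta> \<le> 1 / 10"
    and J_nonneg: "\<And>z. 0 \<le> J z" and J_0: "J 0 = 0" and J_sum: "(\<Sum>\<^sub>\<infinity>z. J z) = 1"
    and J_sym: "Zd_symmetric J" and J_fin: "finite {z. J z \<noteq> 0}"
    and I_nonneg: "\<And>t. t \<in> I \<Longrightarrow> 0 \<le> t"
    and I_down: "\<And>s t. t \<in> I \<Longrightarrow> 0 \<le> s \<Longrightarrow> s \<le> t \<Longrightarrow> s \<in> I"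
    and g_nonneg: "\<And>t x. t \<in> I \<Longrightarrow> 0 \<le> g t x" and g_0: "\<And>x. 0 \<in> I \<Longrightarrow> g 0 x = of_bool (x = 0)"
    and g_sym: "\<And>t. t \<in> I \<Longrightarrow> Zd_symmetric (g t)"
    and g_mono: "\<And>s t x. t \<in> I \<Longrightarrow> 0 \<le> s \<Longrightarrow> s \<le> t \<Longrightarrow> g s x \<le> g t x"
    and g_esum: "\<And>t. t \<in> I \<Longrightarrow> \<exists>m>0. esum m (g t)"
    and g_upper: "\<And>s t x. t \<in> I \<Longrightarrow> 0 \<le> s \<Longrightarrow> s \<le> t \<Longrightarrow>
        g t x \<le> g s x + (t - s) * conv (conv (g s) J) (g t) x"
    and g_lower: "\<And>t u x. u \<in> I \<Longrightarrow> 0 \<le> t \<Longrightarrow> t < u \<Longrightarrow>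
        rslope_ge (\<lambda>r. g r x) t (conv (conv (g t) (\<lambda>y. J y - H t y)) (g t) x)"
    and H_nonneg: "\<And>t x. t \<in> I \<Longrightarrow> 0 \<le> H t x" and H_even: "\<And>t x. t \<in> I \<Longrightarrow> H t (- x) = H t x"
    and H_esum: "\<And>t. t \<in> I \<Longrightarrow> \<exists>m>0. esum m (H t)"
    and H_small: "\<And>t. t \<in> I \<Longrightarrow> (\<Sum>\<^sub>\<infinity>x. H t x) + (\<Sum>\<^sub>\<infinity>x. H t x * (l2 x)\<^sup>2) /
        (((\<Sum>\<^sub>\<infinity>x. J x * (l2 x)\<^sup>2) * (\<Sum>\<^sub>\<infinity>x. g t x) + (\<Sum>\<^sub>\<infinity>x. g t x * (l2 x)\<^sup>2)) / (\<Sum>\<^sub>\<infinity>x. g t x)) \<le> \<delta>"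
begin

definition "var = (\<Sum>\<^sub>\<infinity>x. J x * (l2 x)\<^sup>2)"
definition "susc t = (\<Sum>\<^sub>\<infinity>x. g t x)"
definition "mom t = (\<Sum>\<^sub>\<infinity>x. g t x * (l2 x)\<^sup>2)"
text \<open>The second moment of J * g t, because \<open>J\<close> has total mass 1 and variance
  \<open>var\<close>.\<close>

definition "fmom t = var * susc t + mom t"

lemma J_esum: "esum m J" by (rule esum_finite_support[OF J_fin])

lemma J_even: "J (- z) = J z" by (rule Zd_symmetric_minus[OF J_sym])

lemma g_even: "t \<in> I \<Longrightarrow> g t (- x) = g t x" by (rule Zd_symmetric_minus[OF g_sym])

lemma g_esum2:
  assumes "t \<in> I" "0 \<le> s" "s \<le> t"
  obtains m where "0 < m" "esum m (g s)" "esum m (g t)"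
proof -
  obtain m where m: "0 < m" "esum m (g t)" using g_esum[OF assms(1)] by blast
  have s: "s \<in> I" using I_down assms by blast
  have "esum m (g s)"
    by (rule esum_le[OF m(2), of _ 1]) (use g_mono[OF assms] g_nonneg[OF s] g_nonneg[OF assms(1)] in simp)
  with m that show ?thesis by blast
qed

lemma g_summable: "t \<in> I \<Longrightarrow> g t summable_on UNIV" "t \<in> I \<Longrightarrow> (\<lambda>x. g t x * (l2 x)\<^sup>2) summable_on UNIV"
  using g_esum[of t] esum_imp_summable esum_summable_power by blast+

lemma susc_ge_1: assumes "t \<in> I" shows "1 \<le> susc t"
proof -
  have "0 \<in> I" using I_down[OF assms] I_nonneg[OF assms] by simp
  then have "1 \<le> g t 0" using g_mono[OF assms, of 0 0] I_nonneg[OF assms] g_0[of 0] by simp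
  also have "\<dots> = sum (g t) {0}" by simp
  also have "\<dots> \<le> susc t" unfolding susc_def
    by (rule finite_sum_le_infsum[OF g_summable(1)[OF assms]]) (auto intro: g_nonneg assms)
  finally show ?thesis .
qed

lemma J_summable: "J summable_on UNIV" "(\<lambda>x. J x * (l2 x)\<^sup>2) summable_on UNIV"
  using esum_imp_summable[OF J_esum[of 1]] esum_summable_power[OF J_esum[of 1]] by auto

lemma var_ge_1: "1 \<le> var"
proof -
  have "(\<Sum>\<^sub>\<infinity>x. J x) \<le> (\<Sum>\<^sub>\<infinity>x. J x * (l2 x)\<^sup>2)"
  proof (rule infsum_mono[OF J_summable])
    fix x show "J x \<le> J x * (l2 x)\<^sup>2"
    proof (cases "x = 0")
      case False
      then have "1 \<le> (l2 x)\<^sup>2" using one_le_l2[of x] by (simp add: one_le_power)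
      then show ?thesis using mult_left_mono[of 1 _ "J x"] J_nonneg[of x] by simp
    qed (simp add: J_0)
  qed
  then show ?thesis by (simp add: J_sum var_def)
qed

lemma mom_nonneg: "t \<in> I \<Longrightarrow> 0 \<le> mom t"
  unfolding mom_def by (auto intro!: infsum_nonneg mult_nonneg_nonneg g_nonneg)

lemma fmom_ge_1: assumes "t \<in> I" shows "1 \<le> fmom t"
  using mult_mono[OF var_ge_1 susc_ge_1[OF assms]] var_ge_1 mom_nonneg[OF assms] by (simp add: fmom_def)

lemma susc_mono: "t \<in> I \<Longrightarrow> 0 \<le> s \<Longrightarrow> s \<le> t \<Longrightarrow> susc s \<le> susc t"
  unfolding susc_def by (intro infsum_mono g_summable g_mono) (auto intro: I_down)

lemma mom_mono: "t \<in> I \<Longrightarrow> 0 \<le> s \<Longrightarrow> s \<le> t \<Longrightarrow> mom s \<le> mom t"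
  unfolding mom_def by (intro infsum_mono g_summable mult_right_mono g_mono) (auto intro: I_down)

lemma fmom_mono: "t \<in> I \<Longrightarrow> 0 \<le> s \<Longrightarrow> s \<le> t \<Longrightarrow> fmom s \<le> fmom t"
  unfolding fmom_def using susc_mono mom_mono var_ge_1 by (intro add_mono mult_left_mono) auto

section \<open>Rates of change of the mass and the second moment\<close>

lemma conv_sums:
  assumes t: "t \<in> I" "0 \<le> s" "s \<le> t" and K: "esum k K" "0 < k" and Ke: "\<And>z. K (- z) = K z"
  shows "conv (conv (g s) K) (g t) summable_on UNIV"
    "(\<lambda>x. conv (conv (g s) K) (g t) x * (l2 x)\<^sup>2) summable_on UNIV"
    "(\<Sum>\<^sub>\<infinity>x. conv (conv (g s) K) (g t) x) = susc s * (\<Sum>\<^sub>\<infinity>x. K x) * susc t"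
    "(\<Sum>\<^sub>\<infinity>x. conv (conv (g s) K) (g t) x * (l2 x)\<^sup>2) =
      (mom s * (\<Sum>\<^sub>\<infinity>x. K x) + susc s * (\<Sum>\<^sub>\<infinity>x. K x * (l2 x)\<^sup>2)) * susc t + susc s * (\<Sum>\<^sub>\<infinity>x. K x) * mom t"
proof -
  obtain m0 where m0: "0 < m0" "esum m0 (g s)" "esum m0 (g t)" using g_esum2[OF t] by blast
  define m where "m = min m0 k"
  have m: "0 < m" "esum m (g s)" "esum m (g t)" "esum m K"
    using m0 K by (auto simp: m_def intro: esum_mono)
  have c: "esum m (conv (g s) K)" using m by (intro esum_conv) auto
  have c2: "esum m (conv (conv (g s) K) (g t))" using m c by (intro esum_conv) auto
  show "conv (conv (g s) K) (g t) summable_on UNIV"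
    "(\<lambda>x. conv (conv (g s) K) (g t) x * (l2 x)\<^sup>2) summable_on UNIV"
    using esum_imp_summable[OF c2 m(1)] esum_summable_power[OF c2 m(1)] by auto
  show "(\<Sum>\<^sub>\<infinity>x. conv (conv (g s) K) (g t) x) = susc s * (\<Sum>\<^sub>\<infinity>x. K x) * susc t"
    unfolding infsum_conv[OF c m(3,1)] infsum_conv[OF m(2,4,1)] susc_def by simp
  show "(\<Sum>\<^sub>\<infinity>x. conv (conv (g s) K) (g t) x * (l2 x)\<^sup>2) =
      (mom s * (\<Sum>\<^sub>\<infinity>x. K x) + susc s * (\<Sum>\<^sub>\<infinity>x. K x * (l2 x)\<^sup>2)) * susc t + susc s * (\<Sum>\<^sub>\<infinity>x. K x) * mom t"
    unfolding infsum_conv_l2[OF c m(3,1) g_even[OF t(1)]] infsum_conv_l2[OF m(2,4,1) Ke] infsum_conv[OF m(2,4,1)]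
      susc_def mom_def by simp
qed

lemma susc_upper:
  assumes "t \<in> I" "0 \<le> s" "s \<le> t"
  shows "susc t \<le> susc s + (t - s) * (susc s * susc t)"
proof -
  note c = conv_sums[OF assms J_esum zero_less_one J_even]
  have s: "s \<in> I" using I_down assms by blast
  have "susc t \<le> (\<Sum>\<^sub>\<infinity>x. g s x + (t - s) * conv (conv (g s) J) (g t) x)"
    unfolding susc_def using assms s by (intro infsum_mono summable_on_add summable_on_cmult_right g_summable c g_upper)
  also have "\<dots> = susc s + (t - s) * (susc s * susc t)"
    by (subst infsum_add[OF g_summable(1)[OF s] summable_on_cmult_right[OF c(1)]])
      (simp add: infsum_cmult_right' c(3) J_sum susc_def)
  finally show ?thesis .
qed

lemma mom_upper:
  assumes "t \<in> I" "0 \<le> s" "s \<le> t"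
  shows "mom t \<le> mom s + (t - s) * ((mom s + susc s * var) * susc t + susc s * mom t)"
proof -
  note c = conv_sums[OF assms J_esum zero_less_one J_even]
  have s: "s \<in> I" using I_down assms by blast
  have "mom t \<le> (\<Sum>\<^sub>\<infinity>x. g s x * (l2 x)\<^sup>2 + (t - s) * (conv (conv (g s) J) (g t) x * (l2 x)\<^sup>2))"
    unfolding mom_def
  proof (intro infsum_mono summable_on_add summable_on_cmult_right g_summable c assms s)
    fix x show "g t x * (l2 x)\<^sup>2 \<le> g s x * (l2 x)\<^sup>2 + (t - s) * (conv (conv (g s) J) (g t) x * (l2 x)\<^sup>2)"
      using mult_right_mono[OF g_upper[OF assms, of x], of "(l2 x)\<^sup>2"] by (simp add: algebra_simps)
  qed
  also have "\<dots> = mom s + (t - s) * ((mom s + susc s * var) * susc t + susc s * mom t)"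
    by (subst infsum_add[OF g_summable(2)[OF s] summable_on_cmult_right[OF c(2)]])
      (simp add: infsum_cmult_right' c(4) J_sum var_def[symmetric] mom_def[symmetric])
  finally show ?thesis .
qed

text \<open>Adding \<open>var\<close> times the bound for the mass makes the bound for the second
  moment symmetric in s and t; on the diagonal it becomes the rate 2 * fmom * susc.\<close>

lemma fmom_upper:
  assumes "t \<in> I" "0 \<le> s" "s \<le> t"
  shows "fmom t \<le> fmom s + (t - s) * (fmom s * susc t + susc s * fmom t)"
proof -
  have "var * susc t \<le> var * (susc s + (t - s) * (susc s * susc t))"
    using susc_upper[OF assms] var_ge_1 by (intro mult_left_mono) auto
  then show ?thesis using mom_upper[OF assms] by (simp add: fmom_def algebra_simps)
qed

text \<open>Pointwise derivatives need not add up over infinitely many points, but lower bounds do: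
  a finite set carries the slope up to \<gamma>/2, and the increments at all other points are
  nonnegative because g is nondecreasing in the parameter.\<close>

lemma weighted_slope:
  assumes u: "u \<in> I" "0 \<le> t" "t < u" and w: "\<And>x. 0 \<le> w x"
    and gw: "\<And>r. r \<in> I \<Longrightarrow> (\<lambda>x. g r x * w x) summable_on UNIV"
    and D: "(\<lambda>x. conv (conv (g t) (\<lambda>y. J y - H t y)) (g t) x * w x) summable_on UNIV"
  shows "rslope_ge (\<lambda>r. \<Sum>\<^sub>\<infinity>x. g r x * w x) t (\<Sum>\<^sub>\<infinity>x. conv (conv (g t) (\<lambda>y. J y - H t y)) (g t) x * w x)"
  unfolding rslope_ge_def
proof (intro allI impI)
  fix \<gamma> :: real assume gam: "0 < \<gamma>"
  define D' where "D' = conv (conv (g t) (\<lambda>y. J y - H t y)) (g t)"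
  define S where "S = (\<Sum>\<^sub>\<infinity>x. D' x * w x)"
  have tI: "t \<in> I" using I_down u by auto
  obtain A where A: "finite A" "dist (\<Sum>x\<in>A. D' x * w x) S \<le> \<gamma> / 2"
    using infsum_finite_approximation[OF D, of "\<gamma> / 2"] gam unfolding S_def D'_def by auto
  define k where "k = \<gamma> / (2 * ((\<Sum>x\<in>A. w x) + 1))"
  have W: "0 \<le> (\<Sum>x\<in>A. w x)" by (simp add: sum_nonneg w)
  have k: "0 < k" "k * (\<Sum>x\<in>A. w x) \<le> \<gamma> / 2" using gam W by (auto simp: k_def field_simps)
  have "\<forall>\<^sub>F r in at_right t. \<forall>x\<in>A. (r - t) * (D' x - k) \<le> g r x - g t x"
    using A(1) g_lower[OF u] k(1) by (intro eventually_ball_finite) (auto simp: rslope_ge_def D'_def)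
  moreover have "\<forall>\<^sub>F r in at_right t. r \<in> {t<..<u}" by (rule eventually_at_rightI[OF _ u(3)]) auto
  ultimately show "\<forall>\<^sub>F r in at_right t. (r - t) * (S - \<gamma>) \<le> (\<Sum>\<^sub>\<infinity>x. g r x * w x) - (\<Sum>\<^sub>\<infinity>x. g t x * w x)"
  proof eventually_elim
    case (elim r)
    have rI: "r \<in> I" using I_down[OF u(1)] elim u by auto
    have df: "((\<lambda>x. g r x * w x - g t x * w x) has_sum ((\<Sum>\<^sub>\<infinity>x. g r x * w x) - (\<Sum>\<^sub>\<infinity>x. g t x * w x))) UNIV"
      using has_sum_add[OF has_sum_infsum[OF gw[OF rI]] has_sum_uminusI[OF has_sum_infsum[OF gw[OF tI]]]] by simp
    have "(r - t) * (S - \<gamma>) \<le> (r - t) * ((\<Sum>x\<in>A. D' x * w x) - k * (\<Sum>x\<in>A. w x))"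
    proof (rule mult_left_mono)
      have "S - (\<Sum>x\<in>A. D' x * w x) \<le> \<gamma> / 2" using A(2) unfolding dist_real_def by linarith
      then show "S - \<gamma> \<le> (\<Sum>x\<in>A. D' x * w x) - k * (\<Sum>x\<in>A. w x)" using k(2) by linarith
    qed (use elim in simp)
    also have "\<dots> = (\<Sum>x\<in>A. (r - t) * (D' x - k) * w x)"
      by (simp add: sum_distrib_left sum_subtractf sum.distrib algebra_simps)
    also have "\<dots> \<le> (\<Sum>x\<in>A. g r x * w x - g t x * w x)"
    proof (rule sum_mono)
      fix x assume "x \<in> A"
      then have "(r - t) * (D' x - k) * w x \<le> (g r x - g t x) * w x"
        using elim w by (intro mult_right_mono) auto
      then show "(r - t) * (D' x - k) * w x \<le> g r x * w x - g t x * w x" by (simp add: algebra_simps)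
    qed
    also have "\<dots> \<le> (\<Sum>\<^sub>\<infinity>x. g r x * w x - g t x * w x)"
    proof (rule finite_sum_le_infsum[OF has_sum_imp_summable[OF df] A(1)])
      show "0 \<le> g r x * w x - g t x * w x" for x
        using mult_right_mono[OF g_mono[OF rI u(2), of x] w[of x]] elim by simp
    qed auto
    also have "\<dots> = (\<Sum>\<^sub>\<infinity>x. g r x * w x) - (\<Sum>\<^sub>\<infinity>x. g t x * w x)" by (rule infsumI[OF df])
    finally show ?case .
  qed
qed

text \<open>Let h be the mass of \<open>H t\<close> and h2 its second moment. The mass grows at rate
  (1 - h) susc^2. For the second moment, \<open>H_small\<close> gives h2 * susc \<le> (\<delta> - h)
  * fmom, so the loss 2 h fmom susc + h2 susc^2 is at most (\<delta> + h) fmom susc \<le> 2 \<delta>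
  fmom susc.\<close>

lemma slopes:
  assumes u: "u \<in> I" "0 \<le> t" "t < u"
  shows "rslope_ge susc t (susc t * ((1 - \<delta>) * susc t))"
    and "rslope_ge fmom t (fmom t * ((2 - 2 * \<delta>) * susc t))"
proof -
  have tI: "t \<in> I" using I_down u by auto
  define K where "K = (\<lambda>y. J y - H t y)"
  obtain k where k: "0 < k" "esum k (H t)" using H_esum[OF tI] by blast
  have K: "esum k K"
    using esum_add[OF J_esum esum_le[OF k(2), of "\<lambda>y. - H t y" 1]] by (simp add: K_def)
  have Ke: "K (- z) = K z" for z by (simp add: K_def J_even H_even[OF tI])
  note c = conv_sums[OF tI u(2) order_refl K k(1) Ke]
  define h where "h = (\<Sum>\<^sub>\<infinity>x. H t x)"
  define h2 where "h2 = (\<Sum>\<^sub>\<infinity>x. H t x * (l2 x)\<^sup>2)"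
  have hs: "H t summable_on UNIV" "(\<lambda>x. H t x * (l2 x)\<^sup>2) summable_on UNIV"
    using esum_imp_summable[OF k(2,1)] esum_summable_power[OF k(2,1)] by auto
  have K0: "(\<Sum>\<^sub>\<infinity>x. K x) = 1 - h"
    using infsumI[OF has_sum_add[OF has_sum_infsum[OF J_summable(1)] has_sum_uminusI[OF has_sum_infsum[OF hs(1)]]]]
    by (simp add: K_def h_def J_sum)
  have K2: "(\<Sum>\<^sub>\<infinity>x. K x * (l2 x)\<^sup>2) = var - h2"
    using infsumI[OF has_sum_add[OF has_sum_infsum[OF J_summable(2)] has_sum_uminusI[OF has_sum_infsum[OF hs(2)]]]]
    by (simp add: K_def h2_def var_def left_diff_distrib)
  have h0: "0 \<le> h" "0 \<le> h2" unfolding h_def h2_def by (auto intro!: infsum_nonneg H_nonneg tI mult_nonneg_nonneg)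
  have c1: "1 \<le> susc t" and f1: "1 \<le> fmom t" using susc_ge_1 fmom_ge_1 tI by auto
  have hd: "h + h2 / (fmom t / susc t) \<le> \<delta>"
    using H_small[OF tI] by (simp add: h_def h2_def fmom_def var_def susc_def mom_def)
  have hd1: "h \<le> \<delta>"
  proof -
    have "0 \<le> h2 / (fmom t / susc t)" using h0 c1 f1 by (intro divide_nonneg_nonneg) auto
    then show ?thesis using hd by linarith
  qed
  have hd2: "h2 * susc t \<le> (\<delta> - h) * fmom t"
  proof -
    have "h2 * susc t / fmom t \<le> \<delta> - h" using hd by simp
    then show ?thesis using f1 by (simp add: divide_le_eq)
  qed
  have sl1: "rslope_ge susc t (susc t * (1 - h) * susc t)"
    using weighted_slope[OF u, of "\<lambda>_. 1"] g_summable(1) c(1,3) unfolding K_def[symmetric] K0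
    by (simp add: susc_def[abs_def])
  have mono: "rslope_ge f t L'" if "rslope_ge f t L" "L' \<le> L" for f L L'
    unfolding rslope_ge_def
  proof (intro allI impI)
    fix \<gamma> :: real assume "0 < \<gamma>"
    then have "\<forall>\<^sub>F r in at_right t. (r - t) * (L - \<gamma>) \<le> f r - f t" using that(1) by (simp add: rslope_ge_def)
    moreover have "\<forall>\<^sub>F r in at_right t. t < r" by (rule eventually_at_right_less)
    ultimately show "\<forall>\<^sub>F r in at_right t. (r - t) * (L' - \<gamma>) \<le> f r - f t"
    proof eventually_elim
      case (elim r)
      have "(r - t) * (L' - \<gamma>) \<le> (r - t) * (L - \<gamma>)" using elim that(2) by (intro mult_left_mono) auto
      then show ?case using elim by linarith
    qed
  qed
  show "rslope_ge susc t (susc t * ((1 - \<delta>) * susc t))"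
  proof (rule mono[OF sl1])
    have "susc t * (1 - \<delta>) * susc t \<le> susc t * (1 - h) * susc t"
      using hd1 c1 by (intro mult_right_mono mult_left_mono) auto
    then show "susc t * ((1 - \<delta>) * susc t) \<le> susc t * (1 - h) * susc t" by (simp add: mult.assoc)
  qed
  have fm: "fmom r = (\<Sum>\<^sub>\<infinity>x. g r x * (var + (l2 x)\<^sup>2))" if "r \<in> I" for r
    using infsumI[OF has_sum_add[OF has_sum_cmult_right[OF has_sum_infsum[OF g_summable(1)[OF that]], of var] has_sum_infsum[OF g_summable(2)[OF that]]]]
    by (simp add: fmom_def susc_def mom_def algebra_simps)
  define D where "D = conv (conv (g t) K) (g t)"
  have Dh: "((\<lambda>x. D x * (var + (l2 x)\<^sup>2)) has_sum var * (susc t * (1 - h) * susc t) +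
      ((mom t * (1 - h) + susc t * (var - h2)) * susc t + susc t * (1 - h) * mom t)) UNIV"
    using has_sum_add[OF has_sum_cmult_right[OF has_sum_infsum[OF c(1)], of var] has_sum_infsum[OF c(2)]]
    unfolding c(3,4) K0 K2 D_def by (simp add: algebra_simps)
  have "rslope_ge (\<lambda>r. \<Sum>\<^sub>\<infinity>x. g r x * (var + (l2 x)\<^sup>2)) t (\<Sum>\<^sub>\<infinity>x. D x * (var + (l2 x)\<^sup>2))"
    unfolding D_def K_def
  proof (rule weighted_slope[OF u])
    show "0 \<le> var + (l2 x)\<^sup>2" for x using var_ge_1 by simp
    show "(\<lambda>x. g r x * (var + (l2 x)\<^sup>2)) summable_on UNIV" if "r \<in> I" for r
      using summable_on_add[OF summable_on_cmult_right[OF g_summable(1)[OF that], of var] g_summable(2)[OF that]] by (simp add: algebra_simps)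
    show "(\<lambda>x. conv (conv (g t) (\<lambda>y. J y - H t y)) (g t) x * (var + (l2 x)\<^sup>2)) summable_on UNIV"
      using has_sum_imp_summable[OF Dh] by (simp add: D_def K_def)
  qed
  then have sl2: "rslope_ge fmom t (\<Sum>\<^sub>\<infinity>x. D x * (var + (l2 x)\<^sup>2))"
    unfolding rslope_ge_def
  proof (intro allI impI)
    fix \<gamma> :: real
    assume *: "\<forall>\<gamma>>0. \<forall>\<^sub>F r in at_right t. (r - t) * ((\<Sum>\<^sub>\<infinity>x. D x * (var + (l2 x)\<^sup>2)) - \<gamma>)
       \<le> (\<Sum>\<^sub>\<infinity>x. g r x * (var + (l2 x)\<^sup>2)) - (\<Sum>\<^sub>\<infinity>x. g t x * (var + (l2 x)\<^sup>2))" and "0 < \<gamma>"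
    moreover have "\<forall>\<^sub>F r in at_right t. r \<in> {t<..<u}" by (rule eventually_at_rightI[OF _ u(3)]) auto
    ultimately have "\<forall>\<^sub>F r in at_right t. (r - t) * ((\<Sum>\<^sub>\<infinity>x. D x * (var + (l2 x)\<^sup>2)) - \<gamma>)
       \<le> (\<Sum>\<^sub>\<infinity>x. g r x * (var + (l2 x)\<^sup>2)) - (\<Sum>\<^sub>\<infinity>x. g t x * (var + (l2 x)\<^sup>2)) \<and> r \<in> {t<..<u}"
      by (intro eventually_conj) auto
    then show "\<forall>\<^sub>F r in at_right t. (r - t) * ((\<Sum>\<^sub>\<infinity>x. D x * (var + (l2 x)\<^sup>2)) - \<gamma>) \<le> fmom r - fmom t"
    proof eventually_elim
      case (elim r)
      then have "r \<in> I" using I_down[OF u(1)] u by auto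
      with elim show ?case by (simp add: fm tI)
    qed
  qed
  show "rslope_ge fmom t (fmom t * ((2 - 2 * \<delta>) * susc t))"
  proof (rule mono[OF sl2])
    have "(\<Sum>\<^sub>\<infinity>x. D x * (var + (l2 x)\<^sup>2)) = 2 * fmom t * susc t * (1 - h) + var * (susc t)\<^sup>2 * h - susc t * (h2 * susc t)"
      unfolding infsumI[OF Dh] fmom_def by (simp add: algebra_simps power2_eq_square)
    moreover have "susc t * (h2 * susc t) \<le> susc t * ((\<delta> - h) * fmom t)"
      using hd2 c1 by (intro mult_left_mono) auto
    moreover have "0 \<le> var * (susc t)\<^sup>2 * h" using h0 var_ge_1 by simp
    moreover have "2 * fmom t * susc t * (1 - h) + 0 - susc t * ((\<delta> - h) * fmom t) - fmom t * ((2 - 2 * \<delta>) * susc t)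
       = (\<delta> - h) * (fmom t * susc t)" by (simp add: algebra_simps)
    moreover have "0 \<le> (\<delta> - h) * (fmom t * susc t)" using hd1 c1 f1 by (intro mult_nonneg_nonneg) auto
    ultimately show "fmom t * ((2 - 2 * \<delta>) * susc t) \<le> (\<Sum>\<^sub>\<infinity>x. D x * (var + (l2 x)\<^sup>2))" by linarith
  qed
qed

lemma susc_lipschitz:
  assumes "u \<in> I" "0 \<le> s" "s \<le> a" "a \<le> b" "b \<le> u"
  shows "\<bar>susc b - susc a\<bar> \<le> (susc u * susc u) * (b - a)"
proof -
  have I: "a \<in> I" "b \<in> I" using I_down[OF assms(1)] assms by auto
  have "susc a * susc b \<le> susc u * susc u"
    using assms I susc_ge_1 by (intro mult_mono susc_mono) (auto intro: order_trans[OF zero_le_one])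
  then have "(b - a) * (susc a * susc b) \<le> (b - a) * (susc u * susc u)" using assms by (intro mult_left_mono) auto
  then show ?thesis using susc_upper[OF I(2), of a] susc_mono[OF I(2), of a] assms by (simp add: mult.commute)
qed

lemma fmom_lipschitz:
  assumes "u \<in> I" "0 \<le> s" "s \<le> a" "a \<le> b" "b \<le> u"
  shows "\<bar>fmom b - fmom a\<bar> \<le> (2 * (fmom u * susc u)) * (b - a)"
proof -
  have I: "a \<in> I" "b \<in> I" using I_down[OF assms(1)] assms by auto
  have "fmom a * susc b + susc a * fmom b \<le> fmom u * susc u + susc u * fmom u"
    using assms I susc_ge_1 fmom_ge_1 by (intro add_mono mult_mono susc_mono fmom_mono) (auto intro: order_trans[OF zero_le_one])
  then have "(b - a) * (fmom a * susc b + susc a * fmom b) \<le> (b - a) * (2 * (fmom u * susc u))"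
    using assms by (intro mult_left_mono) (auto simp: mult.commute)
  then show ?thesis using fmom_upper[OF I(2), of a] fmom_mono[OF I(2), of a] assms by (simp add: mult.commute)
qed

lemma continuous:
  assumes "u \<in> I" "0 \<le> s"
  shows "continuous_on {s..u} susc" "continuous_on {s..u} fmom"
  using lipschitz_continuous_interval[of s u susc, OF susc_lipschitz[OF assms]]
    lipschitz_continuous_interval[of s u fmom, OF fmom_lipschitz[OF assms]]
    susc_ge_1[OF assms(1)] fmom_ge_1[OF assms(1)] by auto

text \<open>The difference bounds contain values at both parameters; Lipschitz continuity replaces
  those at r by those at t, at a cost quadratic in r - t.\<close>

lemma upper_slopes:
  assumes u: "u \<in> I" "0 \<le> t" "t < u"
  shows "rslope_ge (\<lambda>r. - susc r) t (- (susc t * susc t))"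
    and "rslope_ge (\<lambda>r. - fmom r) t (- (fmom t * (2 * susc t)))"
proof -
  have tI: "t \<in> I" using I_down u by auto
  have c1: "1 \<le> susc t" "1 \<le> fmom t" using susc_ge_1 fmom_ge_1 tI by auto
  define B where "B = susc t * (susc u * susc u)"
  define B2 where "B2 = fmom t * (susc u * susc u) + susc t * (2 * (fmom u * susc u))"
  have B: "0 \<le> B" "0 \<le> B2" using c1 susc_ge_1[OF u(1)] fmom_ge_1[OF u(1)] by (auto simp: B_def B2_def)
  have ev: "\<forall>\<^sub>F r in at_right t. r \<in> {t<..<u} \<and> r \<in> {t<..<t + \<gamma> / (C + 1)}" if "0 < \<gamma>" "0 \<le> C" for \<gamma> C
    by (intro eventually_conj eventually_at_rightI[OF _ u(3)] eventually_at_rightI[of t "t + \<gamma> / (C + 1)"]) (use that in auto)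
  have main: "(r - t) * (- L - \<gamma>) \<le> - X" if r: "t < r" "r < t + \<gamma> / (C + 1)" and C: "0 \<le> C"
    and X: "X \<le> (r - t) * (L + C * (r - t))" for r \<gamma> L C X
  proof -
    have "C * (r - t) \<le> (C + 1) * (r - t)" using r by (intro mult_right_mono) auto
    also have "\<dots> \<le> \<gamma>" using r C by (simp add: field_simps)
    finally have "(r - t) * (L + C * (r - t)) \<le> (r - t) * (L + \<gamma>)" using r by (intro mult_left_mono) auto
    moreover have "(r - t) * (- L - \<gamma>) = - ((r - t) * (L + \<gamma>))" by (simp add: algebra_simps)
    ultimately show ?thesis using X by linarith
  qed
  show "rslope_ge (\<lambda>r. - susc r) t (- (susc t * susc t))"
    unfolding rslope_ge_def
  proof (intro allI impI)
    fix \<gamma> :: real assume g: "0 < \<gamma>"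
    show "\<forall>\<^sub>F r in at_right t. (r - t) * (- (susc t * susc t) - \<gamma>) \<le> - susc r - - susc t"
      using ev[OF g B(1)]
    proof eventually_elim
      case (elim r)
      have rI: "r \<in> I" using I_down[OF u(1)] elim u by auto
      have 1: "susc r - susc t \<le> (r - t) * (susc t * susc r)" using susc_upper[OF rI u(2)] elim by auto
      have "susc r - susc t \<le> susc u * susc u * (r - t)" using susc_lipschitz[OF u(1,2), of t r] elim by auto
      then have "susc t * susc r \<le> susc t * (susc t + susc u * susc u * (r - t))" using c1 by (intro mult_left_mono) auto
      also have "\<dots> = susc t * susc t + B * (r - t)" by (simp add: B_def algebra_simps)
      finally have "(r - t) * (susc t * susc r) \<le> (r - t) * (susc t * susc t + B * (r - t))" using elim by (intro mult_left_mono) auto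
      with 1 have X: "susc r - susc t \<le> (r - t) * (susc t * susc t + B * (r - t))" by (rule order_trans)
      have "(r - t) * (- (susc t * susc t) - \<gamma>) \<le> - (susc r - susc t)"
        by (rule main[OF _ _ B(1) X]) (use elim in auto)
      then show ?case by simp
    qed
  qed
  show "rslope_ge (\<lambda>r. - fmom r) t (- (fmom t * (2 * susc t)))"
    unfolding rslope_ge_def
  proof (intro allI impI)
    fix \<gamma> :: real assume g: "0 < \<gamma>"
    show "\<forall>\<^sub>F r in at_right t. (r - t) * (- (fmom t * (2 * susc t)) - \<gamma>) \<le> - fmom r - - fmom t"
      using ev[OF g B(2)]
    proof eventually_elim
      case (elim r)
      have rI: "r \<in> I" using I_down[OF u(1)] elim u by auto
      have 1: "fmom r - fmom t \<le> (r - t) * (fmom t * susc r + susc t * fmom r)" using fmom_upper[OF rI u(2)] elim by auto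
      have "susc r \<le> susc t + susc u * susc u * (r - t)" "fmom r \<le> fmom t + 2 * (fmom u * susc u) * (r - t)"
        using susc_lipschitz[OF u(1,2), of t r] fmom_lipschitz[OF u(1,2), of t r] elim by auto
      then have "fmom t * susc r + susc t * fmom r \<le> fmom t * (susc t + susc u * susc u * (r - t)) + susc t * (fmom t + 2 * (fmom u * susc u) * (r - t))"
        using c1 by (intro add_mono mult_left_mono) auto
      also have "\<dots> = fmom t * (2 * susc t) + B2 * (r - t)" by (simp add: B2_def algebra_simps)
      finally have "(r - t) * (fmom t * susc r + susc t * fmom r) \<le> (r - t) * (fmom t * (2 * susc t) + B2 * (r - t))"
        using elim by (intro mult_left_mono) auto
      with 1 have X: "fmom r - fmom t \<le> (r - t) * (fmom t * (2 * susc t) + B2 * (r - t))" by (rule order_trans)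
      have "(r - t) * (- (fmom t * (2 * susc t)) - \<gamma>) \<le> - (fmom r - fmom t)"
        by (rule main[OF _ _ B(2) X]) (use elim in auto)
      then show ?case by simp
    qed
  qed
qed

text \<open>For logarithms all rates become multiples of \<open>susc\<close>, and for - 1 / susc a
  constant, so that suitable pairs cancel.\<close>

lemma ln_slopes:
  assumes u: "u \<in> I" "0 \<le> t" "t < u"
  shows "rslope_ge (\<lambda>r. ln (susc r)) t ((1 - \<delta>) * susc t)" "rslope_ge (\<lambda>r. - ln (susc r)) t (- susc t)"
    "rslope_ge (\<lambda>r. ln (fmom r)) t ((2 - 2 * \<delta>) * susc t)" "rslope_ge (\<lambda>r. - ln (fmom r)) t (- (2 * susc t))"
    "rslope_ge (\<lambda>r. - 1 / susc r) t (1 - \<delta>)"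
proof -
  have tI: "t \<in> I" using I_down u by auto
  have c1: "1 \<le> susc t" "1 \<le> fmom t" using susc_ge_1 fmom_ge_1 tI by auto
  have ev: "\<forall>\<^sub>F r in at_right t. r \<in> {t<..<u}" by (rule eventually_at_rightI[OF _ u(3)]) auto
  have l1: "\<forall>\<^sub>F r in at_right t. \<bar>susc r - susc t\<bar> \<le> (susc u * susc u) * (r - t)"
    using ev by eventually_elim (use susc_lipschitz[OF u(1,2)] in auto)
  have l2: "\<forall>\<^sub>F r in at_right t. \<bar>fmom r - fmom t\<bar> \<le> (2 * (fmom u * susc u)) * (r - t)"
    using ev by eventually_elim (use fmom_lipschitz[OF u(1,2)] in auto)
  have l1': "\<forall>\<^sub>F r in at_right t. \<bar>- susc r - - susc t\<bar> \<le> (susc u * susc u) * (r - t)"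
    using l1 by eventually_elim (simp add: abs_minus_commute)
  have l2': "\<forall>\<^sub>F r in at_right t. \<bar>- fmom r - - fmom t\<bar> \<le> (2 * (fmom u * susc u)) * (r - t)"
    using l2 by eventually_elim (simp add: abs_minus_commute)
  have d1: "(ln has_real_derivative 1 / y) (at y)" if "1 \<le> y" for y :: real
    using that by (auto intro!: derivative_eq_intros)
  have d2: "((\<lambda>x. - ln (- x)) has_real_derivative 1 / y) (at (- y))" if "1 \<le> y" for y :: real
    using that by (auto intro!: derivative_eq_intros simp: divide_simps)
  have d3: "((\<lambda>x. - 1 / x) has_real_derivative 1 / (y * y)) (at y)" if "1 \<le> y" for y :: real
    using that by (auto intro!: derivative_eq_intros simp: field_simps)
  show "rslope_ge (\<lambda>r. ln (susc r)) t ((1 - \<delta>) * susc t)"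
    using rslope_ge_chain[OF d1[OF c1(1)] _ slopes(1)[OF u] l1] c1 by simp
  show "rslope_ge (\<lambda>r. ln (fmom r)) t ((2 - 2 * \<delta>) * susc t)"
    using rslope_ge_chain[OF d1[OF c1(2)] _ slopes(2)[OF u] l2] c1 by simp
  show "rslope_ge (\<lambda>r. - ln (susc r)) t (- susc t)"
    using rslope_ge_chain[OF d2[OF c1(1)] _ upper_slopes(1)[OF u] l1'] c1 by simp
  show "rslope_ge (\<lambda>r. - ln (fmom r)) t (- (2 * susc t))"
    using rslope_ge_chain[OF d2[OF c1(2)] _ upper_slopes(2)[OF u] l2'] c1 by simp
  show "rslope_ge (\<lambda>r. - 1 / susc r) t (1 - \<delta>)"
    using rslope_ge_chain[OF d3[OF c1(1)] _ slopes(1)[OF u] l1] c1 by simp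
qed

lemma rslope_ge_cmult:
  assumes "rslope_ge f t L" "0 < k"
  shows "rslope_ge (\<lambda>r. k * f r) t (k * L)"
  unfolding rslope_ge_def
proof (intro allI impI)
  fix \<gamma> :: real assume "0 < \<gamma>"
  then have "\<forall>\<^sub>F r in at_right t. (r - t) * (L - \<gamma> / k) \<le> f r - f t" using assms by (simp add: rslope_ge_def)
  then show "\<forall>\<^sub>F r in at_right t. (r - t) * (k * L - \<gamma>) \<le> k * f r - k * f t"
  proof eventually_elim
    case (elim r)
    have "k * ((r - t) * (L - \<gamma> / k)) \<le> k * (f r - f t)" using elim assms by (intro mult_left_mono) auto
    moreover have "k * ((r - t) * (L - \<gamma> / k)) = (r - t) * (k * L - \<gamma>)" using assms by (simp add: field_simps)
    moreover have "k * (f r - f t) = k * f r - k * f t" by (rule right_diff_distrib)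
    ultimately show ?case by linarith
  qed
qed

text \<open>Each claim is the monotonicity of a combination with nonnegative slope: ln fmom - (2 - 2
  \<delta>) ln susc, then 2 ln susc - (1 - \<delta>) ln fmom, then - 1 / susc - (1 - \<delta>)
  t.\<close>

lemma comparison:
  assumes "u \<in> I" "0 \<le> s" "s \<le> u"
  shows "(2 - 2 * \<delta>) * (ln (susc u) - ln (susc s)) \<le> ln (fmom u) - ln (fmom s)"
    and "(1 - \<delta>) * (ln (fmom u) - ln (fmom s)) \<le> 2 * (ln (susc u) - ln (susc s))"
    and "(1 - \<delta>) * (u - s) \<le> 1 / susc s - 1 / susc u"
proof -
  have I: "t \<in> I" if "s \<le> t" "t \<le> u" for t using I_down[OF assms(1)] assms that by auto
  have ne: "susc t \<noteq> 0" "fmom t \<noteq> 0" if "t \<in> {s..u}" for t using susc_ge_1[OF I] fmom_ge_1[OF I] that by fastforce+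
  note cont = continuous[OF assms(1,2)]
  have d: "0 < 2 - 2 * \<delta>" "0 < 1 - \<delta>" using delta by auto
  have "ln (fmom s) + (2 - 2 * \<delta>) * (- ln (susc s)) \<le> ln (fmom u) + (2 - 2 * \<delta>) * (- ln (susc u))"
  proof (rule rslope_ge_imp_mono[OF assms(3)])
    show "continuous_on {s..u} (\<lambda>t. ln (fmom t) + (2 - 2 * \<delta>) * (- ln (susc t)))"
      using ne by (intro continuous_intros cont) auto
    fix t assume t: "s \<le> t" "t < u"
    then have t0: "0 \<le> t" using assms by simp
    show "rslope_ge (\<lambda>t. ln (fmom t) + (2 - 2 * \<delta>) * (- ln (susc t))) t 0"
      using rslope_ge_add[OF ln_slopes(3)[OF assms(1) t0 t(2)] rslope_ge_cmult[OF ln_slopes(2)[OF assms(1) t0 t(2)] d(1)]] by simp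
  qed
  then show "(2 - 2 * \<delta>) * (ln (susc u) - ln (susc s)) \<le> ln (fmom u) - ln (fmom s)" by (simp add: algebra_simps)
  have "2 * ln (susc s) + (1 - \<delta>) * (- ln (fmom s)) \<le> 2 * ln (susc u) + (1 - \<delta>) * (- ln (fmom u))"
  proof (rule rslope_ge_imp_mono[OF assms(3)])
    show "continuous_on {s..u} (\<lambda>t. 2 * ln (susc t) + (1 - \<delta>) * (- ln (fmom t)))"
      using ne by (intro continuous_intros cont) auto
    fix t assume t: "s \<le> t" "t < u"
    then have t0: "0 \<le> t" using assms by simp
    show "rslope_ge (\<lambda>t. 2 * ln (susc t) + (1 - \<delta>) * (- ln (fmom t))) t 0"
      using rslope_ge_add[OF rslope_ge_cmult[OF ln_slopes(1)[OF assms(1) t0 t(2)], of 2] rslope_ge_cmult[OF ln_slopes(4)[OF assms(1) t0 t(2)] d(2)]] by simp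
  qed
  then show "(1 - \<delta>) * (ln (fmom u) - ln (fmom s)) \<le> 2 * (ln (susc u) - ln (susc s))" by (simp add: algebra_simps)
  have "- 1 / susc s + (- (1 - \<delta>)) * s \<le> - 1 / susc u + (- (1 - \<delta>)) * u"
  proof (rule rslope_ge_imp_mono[OF assms(3)])
    show "continuous_on {s..u} (\<lambda>t. - 1 / susc t + (- (1 - \<delta>)) * t)"
      using ne by (intro continuous_intros cont) auto
    fix t assume t: "s \<le> t" "t < u"
    then have t0: "0 \<le> t" using assms by simp
    show "rslope_ge (\<lambda>t. - 1 / susc t + (- (1 - \<delta>)) * t) t 0"
      using rslope_ge_add[OF ln_slopes(5)[OF assms(1) t0 t(2)] rslope_ge_linear[of "- (1 - \<delta>)" t]] by simp
  qed
  then show "(1 - \<delta>) * (u - s) \<le> 1 / susc s - 1 / susc u" by (simp add: algebra_simps)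
qed

text \<open>The correlation length: the standard deviation of the probability law (J * g t) / susc
  t.\<close>

definition "corr t = sqrt (fmom t / susc t)"

lemma corr_pos: "t \<in> I \<Longrightarrow> 0 < corr t"
  using susc_ge_1[of t] fmom_ge_1[of t] by (simp add: corr_def)

text \<open>With X and Y the increments of ln susc and ln fmom, the logarithm of the ratio of
  correlation lengths is (Y - X) / 2, and \<open>comparison\<close> confines Y - X between (1 - 2
  \<delta>) X and (1 + \<delta>) / (1 - \<delta>) X. The 8 is a convenient bound for the resulting
  error in the exponent when \<delta> \<le> 1/10.\<close>

lemma growth:
  assumes "u \<in> I" "0 \<le> s" "s \<le> u"
  shows "corr s \<le> corr u" "(corr u / corr s) powr (2 - 8 * \<delta>) \<le> susc u / susc s"
    "susc u / susc s \<le> (corr u / corr s) powr (2 + 8 * \<delta>)"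
proof -
  have sI: "s \<in> I" using I_down assms by auto
  define X where "X = ln (susc u) - ln (susc s)"
  define Y where "Y = ln (fmom u) - ln (fmom s)"
  have XY: "(2 - 2 * \<delta>) * X \<le> Y" "(1 - \<delta>) * Y \<le> 2 * X" using comparison(1,2)[OF assms] by (auto simp: X_def Y_def)
  have p: "1 \<le> susc u" "1 \<le> susc s" "1 \<le> fmom u" "1 \<le> fmom s" using susc_ge_1 fmom_ge_1 sI assms by auto
  have X0: "0 \<le> X" using susc_mono[OF assms] p by (simp add: X_def)
  have c: "0 < corr s" "0 < corr u" using corr_pos sI assms by auto
  have lnc: "ln (corr u / corr s) = (Y - X) / 2"
    using p c by (simp add: ln_div corr_def ln_sqrt X_def Y_def field_simps)
  have YX: "(1 - 2 * \<delta>) * X \<le> Y - X" using XY(1) by (simp add: algebra_simps)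
  have "0 \<le> (1 - 2 * \<delta>) * X" using X0 delta by simp
  then have "0 \<le> ln (corr u / corr s)" using YX lnc by simp
  then show "corr s \<le> corr u" using c by (simp add: ln_div)
  have eX: "susc u / susc s = exp X" using p by (simp add: X_def exp_diff)
  have pw: "(corr u / corr s) powr k = exp (k * ((Y - X) / 2))" for k
    using c lnc by (simp add: powr_def)
  have "(2 - 8 * \<delta>) * ((Y - X) / 2) \<le> X"
  proof -
    have "(1 - \<delta>) * (Y - X) \<le> (1 + \<delta>) * X" using XY(2) by (simp add: algebra_simps)
    then have "(1 - 4 * \<delta>) * ((1 - \<delta>) * (Y - X)) \<le> (1 - 4 * \<delta>) * ((1 + \<delta>) * X)" using delta by (intro mult_left_mono) auto
    also have "\<dots> \<le> (1 - \<delta>) * X"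
    proof -
      have "(1 - \<delta>) * X - (1 - 4 * \<delta>) * ((1 + \<delta>) * X) = (2 * \<delta> + 4 * \<delta> * \<delta>) * X" by (simp add: algebra_simps)
      also have "\<dots> \<ge> 0" using X0 delta by simp
      finally show ?thesis by simp
    qed
    finally have "(1 - \<delta>) * ((1 - 4 * \<delta>) * (Y - X)) \<le> (1 - \<delta>) * X" by (simp add: mult_ac)
    then have "(1 - 4 * \<delta>) * (Y - X) \<le> X" using delta by simp
    moreover have "(2 - 8 * \<delta>) * ((Y - X) / 2) = (1 - 4 * \<delta>) * (Y - X)" by (simp add: field_simps)
    ultimately show ?thesis by (simp only:)
  qed
  then show "(corr u / corr s) powr (2 - 8 * \<delta>) \<le> susc u / susc s" by (simp add: pw eX)
  have "X \<le> (2 + 8 * \<delta>) * ((Y - X) / 2)"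
  proof -
    have "0 \<le> (2 * \<delta> - 8 * \<delta> * \<delta>) * X"
    proof (intro mult_nonneg_nonneg X0)
      have "0 \<le> 2 * \<delta> * (1 - 4 * \<delta>)" using delta by simp
      then show "0 \<le> 2 * \<delta> - 8 * \<delta> * \<delta>" by (simp add: algebra_simps)
    qed
    then have "X \<le> (1 + 4 * \<delta>) * ((1 - 2 * \<delta>) * X)" by (simp add: algebra_simps)
    also have "\<dots> \<le> (1 + 4 * \<delta>) * (Y - X)" using YX delta by (intro mult_left_mono) auto
    also have "(1 + 4 * \<delta>) * (Y - X) = (2 + 8 * \<delta>) * ((Y - X) / 2)" by (simp add: field_simps)
    finally show ?thesis .
  qed
  then show "susc u / susc s \<le> (corr u / corr s) powr (2 + 8 * \<delta>)" by (simp add: pw eX)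
qed

text \<open>Here \<nu> = 8 \<delta> is fixed by the growth exponents; the killing bound is the
  estimate on 1 / susc multiplied by susc s.\<close>

lemma scalesI:
  assumes c0: "0 < c\<^sub>0" "c\<^sub>0 \<le> 1" and nu: "\<nu> = 8 * \<delta>" "\<nu> \<le> 1 / 10" and d3: "3 \<le> CARD('n)"
    and J_range: "\<And>z. J z \<noteq> 0 \<Longrightarrow> l2 z \<le> sqrt (real CARD('n)) / c\<^sub>0 * sqrt var"
    and J_le: "\<And>z. J z \<le> sqrt (real CARD('n)) ^ CARD('n) / c\<^sub>0 / sqrt var ^ CARD('n)"
  shows "scales c\<^sub>0 \<nu> (sqrt var) J I g susc corr"
proof
  show "0 < \<nu>" using nu delta by simp
  show "0 < sqrt var" using var_ge_1 by simp
  show "(\<Sum>\<^sub>\<infinity>z. J z * (l2 z)\<^sup>2) = (sqrt var)\<^sup>2" using var_ge_1 by (simp add: var_def)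
  fix s t :: real and x v :: "int ^ 'n"
  show "\<exists>m>0. esum m (g t)" if "t \<in> I" using g_esum[OF that] .
  show "g t x \<le> g s x + (t - s) * conv (conv J (g s)) (g t) x" if "t \<in> I" "0 \<le> s" "s \<le> t"
  proof -
    have "conv J (g s) = conv (g s) J" by (rule ext) (rule conv_commute)
    then show ?thesis using g_upper[OF that] by simp
  qed
  show "susc t = (\<Sum>\<^sub>\<infinity>x. g t x)" by (simp add: susc_def)
  have cc: "susc t * (corr t)\<^sup>2 = fmom t" if "t \<in> I"
    using susc_ge_1[OF that] fmom_ge_1[OF that] by (simp add: corr_def)
  obtain m where m: "t \<in> I \<Longrightarrow> 0 < m" "t \<in> I \<Longrightarrow> esum m (g t)" using g_esum[of t] by (cases "t \<in> I") auto
  show "(\<Sum>\<^sub>\<infinity>x. conv J (g t) x * (l2 x)\<^sup>2) = susc t * (corr t)\<^sup>2" if "t \<in> I"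
    using infsum_conv_l2[OF J_esum m(2,1)[OF that] g_even[OF that]]
    unfolding cc[OF that] unfolding fmom_def var_def susc_def mom_def J_sum by simp
  show "(\<Sum>\<^sub>\<infinity>x. conv J (g t) x * (real_vec v \<bullet> real_vec x)\<^sup>2) = (l2 v)\<^sup>2 * (susc t * (corr t)\<^sup>2) / real CARD('n)" if "t \<in> I"
    using infsum_conv_inner[OF J_esum m(2,1)[OF that] g_even[OF that], of v]
    unfolding Zd_symmetric_isotropic[OF J_sym J_esum zero_less_one] Zd_symmetric_isotropic[OF g_sym[OF that] m(2,1)[OF that]]
    unfolding cc[OF that] unfolding fmom_def var_def susc_def mom_def J_sum by (simp add: field_simps)
  show "continuous_on {0..t} corr" if "t \<in> I"
  proof -
    have "susc r \<noteq> 0" if "r \<in> {0..t}" for r using susc_ge_1[of r] I_down[OF \<open>t \<in> I\<close>] that by fastforce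
    then show ?thesis unfolding corr_def[abs_def] using continuous[OF that order_refl] by (intro continuous_intros) auto
  qed
  show "corr s \<le> corr t" if "t \<in> I" "0 \<le> s" "s \<le> t" using growth(1)[OF that] .
  show "corr 0 = sqrt var" if "0 \<in> I"
  proof -
    have "((\<lambda>x. g 0 x * w x) has_sum w 0) UNIV" for w :: "int ^ 'n \<Rightarrow> real"
      using has_sum_finite_neutralI[of "{0::int^'n}" UNIV "\<lambda>x. g 0 x * w x" "w 0"] g_0[OF that] by (simp add: has_sum_cong_neutral)
    from infsumI[OF this[of "\<lambda>_. 1"]] infsumI[OF this[of "\<lambda>x. (l2 x)\<^sup>2"]]
    show ?thesis by (simp add: corr_def fmom_def susc_def mom_def)
  qed
  show "(t - s) * susc s * (1 - \<nu>) \<le> 1 - susc s / susc t" if "t \<in> I" "0 \<le> s" "s \<le> t"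
  proof -
    have c: "1 \<le> susc s" "1 \<le> susc t" using susc_ge_1 I_down that by auto
    have "(1 - \<nu>) * (t - s) \<le> (1 - \<delta>) * (t - s)" using nu delta that by (intro mult_right_mono) auto
    also have "\<dots> \<le> 1 / susc s - 1 / susc t" by (rule comparison(3)[OF that])
    finally have "susc s * ((1 - \<nu>) * (t - s)) \<le> susc s * (1 / susc s - 1 / susc t)" using c by (intro mult_left_mono) auto
    also have "\<dots> = 1 - susc s / susc t" using c by (simp add: right_diff_distrib)
    finally show ?thesis by (simp add: mult_ac)
  qed
  show "(corr t / corr s) powr (2 - \<nu>) \<le> susc t / susc s" if "t \<in> I" "0 \<le> s" "s \<le> t" using growth(2)[OF that] nu by simp
  show "susc t / susc s \<le> (corr t / corr s) powr (2 + \<nu>)" if "t \<in> I" "0 \<le> s" "s \<le> t" using growth(3)[OF that] nu by simp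
qed (rule c0 nu d3 J_range J_le J_nonneg J_0 J_sum J_even J_fin g_nonneg I_nonneg I_down g_0 g_even g_mono; assumption)+

end

subsection \<open>Exponential moments at the scale of the correlation length\<close>

text \<open>Compare power series: for even n \<ge> 4, y^n \<le> (L y)^n / L^4. A moment at a rate L
  times larger thus controls the remainder of the second-order expansion.\<close>

lemma cosh_le_quadratic_quartic:
  fixes y L :: real
  assumes "1 \<le> L"
  shows "cosh y \<le> 1 + y\<^sup>2 / 2 + cosh (L * y) / L ^ 4"
proof -
  define u where "u = (\<lambda>x n. if even n then x ^ n / fact n else (0::real))"
  define e where "e = (\<lambda>n::nat. (if n = 0 then 1 else 0) + (if n = 2 then y\<^sup>2 / 2 else 0 :: real))"
  have s: "u x sums cosh x" for x using cosh_converges[of x] by (simp add: u_def scaleR_conv_of_real divide_inverse mult.commute if_distrib cong: if_cong)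
  have "e sums (1 + y\<^sup>2 / 2)"
    unfolding e_def by (intro sums_add sums_single[of 0 "\<lambda>_. 1"] sums_single[of 2 "\<lambda>_. y\<^sup>2 / 2"])
  then have r: "(\<lambda>n. e n + u (L * y) n / L ^ 4) sums (1 + y\<^sup>2 / 2 + cosh (L * y) / L ^ 4)"
    by (intro sums_add sums_divide s)
  have "u y n \<le> e n + u (L * y) n / L ^ 4" for n
  proof (cases "even n")
    case True
    then have yn: "0 \<le> y ^ n" by (simp add: zero_le_even_power)
    have "n = 0 \<or> n = 2 \<or> 4 \<le> n" using True by presburger
    then consider "n = 0" | "n = 2" | "4 \<le> n" by blast
    then show ?thesis
    proof cases
      case 3
      have "1 * (y ^ n / fact n) \<le> (L ^ n / L ^ 4) * (y ^ n / fact n)"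
        using yn assms 3 by (intro mult_right_mono) (auto simp: power_increasing)
      then show ?thesis using 3 True by (simp add: u_def e_def power_mult_distrib mult.commute)
    qed (use assms in \<open>auto simp: u_def e_def\<close>)
  qed (simp add: u_def e_def)
  then show ?thesis using sums_le[OF _ s r] by blast
qed

lemma cosh_le_quadratic:
  fixes y :: real
  assumes "\<bar>y\<bar> \<le> 1"
  shows "cosh y \<le> 1 + y\<^sup>2"
proof (cases "y = 0")
  case False
  define L where "L = 1 / \<bar>y\<bar>"
  have L: "1 \<le> L" "\<bar>y\<bar> = 1 / L" using assms False by (auto simp: L_def)
  have "cosh y = cosh \<bar>y\<bar>" by (auto simp: abs_if)
  also have "\<dots> \<le> 1 + \<bar>y\<bar>\<^sup>2 / 2 + cosh (L * \<bar>y\<bar>) / L ^ 4" by (rule cosh_le_quadratic_quartic[OF L(1)])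
  also have "L * \<bar>y\<bar> = 1" using False by (simp add: L_def)
  also have "cosh (1::real) / L ^ 4 \<le> 2 / L ^ 4"
  proof -
    have "exp (1::real) \<le> 3" by (rule exp_le)
    moreover have "exp (- 1 :: real) \<le> 1" by simp
    ultimately have "exp 1 + exp (- 1 :: real) \<le> 4" by linarith
    then have "cosh (1::real) \<le> 2" by (simp add: cosh_def)
    then show ?thesis using L by (intro divide_right_mono) auto
  qed
  also have "2 / L ^ 4 = 2 * y ^ 4" by (simp add: L_def power_one_over power_even_abs)
  finally have 1: "cosh y \<le> 1 + y\<^sup>2 / 2 + 2 * y ^ 4" by simp
  show ?thesis
  proof (cases "\<bar>y\<bar> \<le> 1 / 2")
    case True
    then have "y\<^sup>2 \<le> (1 / 2)\<^sup>2" by (metis abs_le_square_iff abs_of_pos half_gt_zero zero_less_one)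
    then have "y\<^sup>2 * y\<^sup>2 \<le> 1 / 4 * y\<^sup>2" by (intro mult_right_mono) (auto simp: power_divide)
    then show ?thesis using 1 by (simp add: power4_eq_xxxx power2_eq_square)
  next
    case F: False
    have sh: "cosh x \<le> 1 + x\<^sup>2" if "0 \<le> x" "x \<le> 1" for x :: real
    proof -
      have "exp x \<le> 1 + x + x\<^sup>2" using that by (rule exp_bound)
      moreover have "exp (- x) \<le> 1 - x + x\<^sup>2"
      proof -
        have "1 \<le> exp x * (1 - x + x\<^sup>2)"
        proof -
          have "1 + x + x\<^sup>2 / 2 \<le> exp x" using that by (intro exp_lower_Taylor_quadratic)
          then have "(1 + x + x\<^sup>2 / 2) * (1 - x + x\<^sup>2) \<le> exp x * (1 - x + x\<^sup>2)"
            using that by (intro mult_right_mono) (auto intro: add_nonneg_nonneg)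
          moreover have "(1 + x + x\<^sup>2 / 2) * (1 - x + x\<^sup>2) = 1 + x\<^sup>2 / 2 + x ^ 3 / 2 + x ^ 4 / 2"
            by (simp add: field_simps eval_nat_numeral)
          moreover have "0 \<le> x\<^sup>2 / 2 + x ^ 3 / 2 + x ^ 4 / 2" using that by simp
          ultimately show ?thesis by linarith
        qed
        then show ?thesis by (simp add: exp_minus field_simps)
      qed
      ultimately show ?thesis by (simp add: cosh_def)
    qed
    have "cosh y = cosh \<bar>y\<bar>" by (auto simp: abs_if)
    then show ?thesis using sh[of "\<bar>y\<bar>"] assms by simp
  qed
qed auto

text \<open>Let D be the supremum of U - \<Psi>, finite because U is bounded and \<Psi> nonnegative.
  Subtracting the two inequalities gives D \<le> \<theta> * max D 0, where \<theta> < 1 is the mass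
  of A, so D \<le> 0.\<close>

lemma comparison_principle:
  fixes A b U \<Psi> :: "int ^ 'n \<Rightarrow> real"
  assumes A: "\<And>z. 0 \<le> A z" "A summable_on UNIV" "(\<Sum>\<^sub>\<infinity>z. A z) < 1"
    and U: "\<And>x. 0 \<le> U x" "\<And>x. U x \<le> B" and P: "\<And>x. 0 \<le> \<Psi> x"
    and Us: "\<And>x. U x \<le> b x + (\<Sum>\<^sub>\<infinity>z. A z * U (x - z))"
    and Ps: "\<And>x. (\<lambda>z. A z * \<Psi> (x - z)) summable_on UNIV" "\<And>x. b x + (\<Sum>\<^sub>\<infinity>z. A z * \<Psi> (x - z)) \<le> \<Psi> x"
  shows "U x \<le> \<Psi> x"
proof -
  have bdd: "bdd_above (range (\<lambda>x. U x - \<Psi> x))"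
    by (rule bdd_aboveI2[of _ _ B]) (use U(2) P in \<open>smt (verit)\<close>)
  define D where "D = (SUP x. U x - \<Psi> x)"
  have D: "U x - \<Psi> x \<le> D" for x unfolding D_def by (rule cSUP_upper[OF _ bdd]) simp
  define D' where "D' = max D 0"
  have sU: "(\<lambda>z. A z * U (x - z)) summable_on UNIV" for x
    by (rule summable_on_abs_le[OF summable_on_cmult_right[OF A(2), of B]])
      (use A U in \<open>auto simp: abs_mult mult.commute[of B] intro!: mult_left_mono\<close>)
  define \<theta> where "\<theta> = (\<Sum>\<^sub>\<infinity>z. A z)"
  have th: "0 \<le> \<theta>" "\<theta> < 1" using A by (auto simp: \<theta>_def infsum_nonneg)
  have "U x - \<Psi> x \<le> D' * \<theta>" for x
  proof -
    have "(\<Sum>\<^sub>\<infinity>z. A z * U (x - z)) \<le> (\<Sum>\<^sub>\<infinity>z. A z * \<Psi> (x - z) + D' * A z)"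
    proof (rule infsum_mono[OF sU summable_on_add[OF Ps(1) summable_on_cmult_right[OF A(2)]]])
      fix z
      have "U (x - z) \<le> \<Psi> (x - z) + D'" using D[of "x - z"] by (auto simp: D'_def)
      then show "A z * U (x - z) \<le> A z * \<Psi> (x - z) + D' * A z"
        using mult_left_mono[OF _ A(1)[of z]] by (fastforce simp: distrib_left mult.commute)
    qed
    also have "\<dots> = (\<Sum>\<^sub>\<infinity>z. A z * \<Psi> (x - z)) + D' * \<theta>"
      by (subst infsum_add[OF Ps(1) summable_on_cmult_right[OF A(2)]]) (simp add: infsum_cmult_right' \<theta>_def)
    finally show ?thesis using Us[of x] Ps(2)[of x] by linarith
  qed
  then have "D \<le> D' * \<theta>" unfolding D_def by (intro cSUP_least) auto
  then have "D \<le> 0"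
  proof (rule contrapos_pp)
    assume "\<not> D \<le> 0"
    then have "D' = D" "0 < D" by (auto simp: D'_def)
    then show "\<not> D \<le> D' * \<theta>" using th mult_strict_left_mono[of \<theta> 1 D] by simp
  qed
  then show ?thesis using D[of x] by linarith
qed

context scales begin

abbreviation F where "F t \<equiv> conv J (g t)"

lemma J_esum: "esum m J" by (rule esum_finite_support[OF J_fin])

lemma F_fin: "F t x = (\<Sum>w | J w \<noteq> 0. J w * g t (x - w))"
proof -
  have "F t x = infsum (\<lambda>w. J w * g t (x - w)) {w. J w \<noteq> 0}"
    unfolding conv_def by (rule infsum_cong_neutral) auto
  then show ?thesis using J_fin by simp
qed

lemma F_nonneg: "t \<in> I \<Longrightarrow> 0 \<le> F t x"
  unfolding F_fin by (intro sum_nonneg mult_nonneg_nonneg J_nonneg g_nonneg)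

lemma F_even: "t \<in> I \<Longrightarrow> F t (- x) = F t x"
  by (rule conv_minus) (auto simp: J_even g_even)

lemma F_esum: assumes "esum m (g t)" "0 \<le> m" shows "esum m (F t)"
  by (rule esum_conv[OF J_esum assms])

lemma g_summable: "t \<in> I \<Longrightarrow> g t summable_on UNIV"
  using g_esum[of t] esum_imp_summable by blast

lemma F_has_sum: assumes "t \<in> I" shows "(F t has_sum S t) UNIV"
proof -
  obtain m where m: "0 < m" "esum m (g t)" using g_esum[OF assms] by blast
  have "(\<Sum>\<^sub>\<infinity>x. F t x) = S t"
    using infsum_conv[OF J_esum m(2,1)] by (simp add: J_sum chi[OF assms])
  moreover have "F t summable_on UNIV" using esum_imp_summable[OF F_esum[OF m(2)] m(1)] m by simp
  ultimately show ?thesis by (metis has_sum_infsum)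
qed

lemma zero_in_I: "t \<in> I \<Longrightarrow> 0 \<in> I" using I_down[of t 0] I_nonneg[of t] by simp

lemma g_le_S: assumes "t \<in> I" shows "g t x \<le> S t"
proof -
  have "g t x = sum (g t) {x}" by simp
  also have "\<dots> \<le> S t" unfolding chi[OF assms]
    by (rule finite_sum_le_infsum[OF g_summable[OF assms]]) (auto intro: g_nonneg assms)
  finally show ?thesis .
qed

lemma S_ge_1: assumes "t \<in> I" shows "1 \<le> S t"
  using g_le_S[OF assms, of 0] g_mono[OF assms, of 0 0] g_0[OF zero_in_I[OF assms]] I_nonneg[OF assms] by simp

lemma S_mono: "t \<in> I \<Longrightarrow> 0 \<le> s \<Longrightarrow> s \<le> t \<Longrightarrow> S s \<le> S t"
  unfolding chi chi[OF I_down] by (intro infsum_mono g_summable g_mono) (auto intro: I_down)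

lemma g_0_has_sum: "0 \<in> I \<Longrightarrow> ((\<lambda>x. g 0 x * w x) has_sum w 0) UNIV"
  using has_sum_finite_neutralI[of "{0}" UNIV "\<lambda>x. g 0 x * w x" "w 0"] g_0 by simp

lemma S_0: "0 \<in> I \<Longrightarrow> S 0 = 1"
  using infsumI[OF g_0_has_sum, of "\<lambda>_. 1"] chi[of 0] by simp

lemma F_0: assumes "0 \<in> I" shows "F 0 = J"
proof
  fix x
  have "F 0 x = conv (g 0) J x" by (rule conv_commute)
  also have "\<dots> = J x" unfolding conv_def using infsumI[OF g_0_has_sum[OF assms], of "\<lambda>y. J (x - y)"] by simp
  finally show "F 0 x = J x" .
qed

lemma xi_ge: assumes "t \<in> I" shows "\<sigma> \<le> \<xi> t"
  using xi_mono[OF assms order_refl I_nonneg[OF assms]] xi_0[OF zero_in_I[OF assms]] by simp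

lemma xi_pos: "t \<in> I \<Longrightarrow> 0 < \<xi> t" using xi_ge sigma by fastforce

text \<open>Later arguments prescribe a scale and read off a parameter at which it is
  attained.\<close>

lemma xi_ivt:
  assumes "t \<in> I" "\<sigma> \<le> r" "r \<le> \<xi> t"
  obtains s where "0 \<le> s" "s \<le> t" "s \<in> I" "\<xi> s = r"
proof -
  have "\<exists>s. 0 \<le> s \<and> s \<le> t \<and> \<xi> s = r"
    using assms xi_0[OF zero_in_I] I_nonneg xi_cont by (intro IVT') auto
  then show ?thesis using that I_down[OF assms(1)] by blast
qed

text \<open>Over a bounded ratio of scales the deviation of the growth exponent from 2 costs at most
  the factor \<Lambda> powr \<nu> \<le> 2.\<close>

lemma S_ratio:
  assumes "t \<in> I" "0 \<le> s" "s \<le> t" "\<xi> t \<le> \<Lambda> * \<xi> s" "\<Lambda> powr \<nu> \<le> 2"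
  shows "S s / S t \<ge> (\<xi> s / \<xi> t)\<^sup>2 / 2" "S t / S s \<ge> (\<xi> t / \<xi> s)\<^sup>2 / 2"
proof -
  have s: "s \<in> I" using I_down assms by blast
  define r where "r = \<xi> t / \<xi> s"
  have r: "1 \<le> r" "0 < r" "r \<le> \<Lambda>" using xi_mono[OF assms(1-3)] xi_pos[OF s] assms(4) by (auto simp: r_def divide_le_eq)
  have p: "0 < S s" "0 < S t" using S_ge_1 s assms(1) by fastforce+
  have rn: "r powr \<nu> \<le> 2"
    using powr_mono2[of \<nu> r \<Lambda>] r nu assms(5) by simp
  have r2: "r powr 2 = r\<^sup>2" using r by simp
  have "S t / S s \<le> r powr (2 + \<nu>)" unfolding r_def by (rule growth_upper[OF assms(1-3)])
  also have "\<dots> = r\<^sup>2 * r powr \<nu>" by (simp only: powr_add r2)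
  also have "\<dots> \<le> r\<^sup>2 * 2" using rn by (intro mult_left_mono) auto
  finally have "S t / S s \<le> 2 * r\<^sup>2" by simp
  then have "S t \<le> 2 * r\<^sup>2 * S s" using p by (simp add: divide_le_eq)
  then show "S s / S t \<ge> (\<xi> s / \<xi> t)\<^sup>2 / 2"
    using p xi_pos[OF s] xi_pos[OF assms(1)] by (simp add: r_def field_simps)
  have "r\<^sup>2 / 2 \<le> r\<^sup>2 / r powr \<nu>" using rn r by (intro divide_left_mono) auto
  also have "\<dots> = r powr (2 - \<nu>)" by (simp only: powr_diff r2)
  also have "\<dots> \<le> S t / S s" unfolding r_def by (rule growth_lower[OF assms(1-3)])
  finally show "S t / S s \<ge> (\<xi> t / \<xi> s)\<^sup>2 / 2" by (simp add: r_def)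
qed

text \<open>Since 1 / (1 - \<nu>) \<le> 1 + 2 \<nu>, a step of the walk with law F s / S s keeps at
  most the mass 1 - S s / S t + 2 \<nu>.\<close>

lemma kill_le:
  assumes "t \<in> I" "0 \<le> s" "s \<le> t"
  shows "(t - s) * S s \<le> 1 - S s / S t + 2 * \<nu>" "(t - s) * S s \<le> (1 - S s / S t) * (1 + 2 * \<nu>)"
proof -
  have s: "s \<in> I" using I_down assms by blast
  have p: "0 < S s" "0 < S t" using S_ge_1 s assms(1) by fastforce+
  have k: "(t - s) * S s * (1 - \<nu>) \<le> 1 - S s / S t" by (rule kill[OF assms])
  have n: "1 \<le> (1 - \<nu>) * (1 + 2 * \<nu>)"
  proof -
    have "0 \<le> \<nu> * (1 - 2 * \<nu>)" using nu by simp
    then show ?thesis by (simp add: algebra_simps)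
  qed
  have c: "0 \<le> (t - s) * S s" using assms p by simp
  have "(t - s) * S s * 1 \<le> (t - s) * S s * ((1 - \<nu>) * (1 + 2 * \<nu>))" using c n by (intro mult_left_mono)
  also have "\<dots> = ((t - s) * S s * (1 - \<nu>)) * (1 + 2 * \<nu>)" by simp
  also have "\<dots> \<le> (1 - S s / S t) * (1 + 2 * \<nu>)" using k nu by (intro mult_right_mono) auto
  finally show 1: "(t - s) * S s \<le> (1 - S s / S t) * (1 + 2 * \<nu>)" by simp
  also have "\<dots> \<le> 1 - S s / S t + 2 * \<nu>"
  proof -
    have "0 \<le> 2 * \<nu> * (S s / S t)" using nu p by simp
    then show ?thesis by (simp add: algebra_simps)
  qed
  finally show "(t - s) * S s \<le> 1 - S s / S t + 2 * \<nu>" .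
qed

text \<open>By the addition theorem, cosh of a coordinate is multiplicative under convolution with
  an even function: the sinh terms sum to zero.\<close>

lemma F_cosh:
  assumes "t \<in> I" "((\<lambda>x. g t x * cosh (h * real_of_int (x $ i))) has_sum X) UNIV"
  shows "((\<lambda>x. F t x * cosh (h * real_of_int (x $ i))) has_sum (\<Sum>w | J w \<noteq> 0. J w * cosh (h * real_of_int (w $ i))) * X) UNIV"
proof -
  have s2: "(\<lambda>y. g t y * sinh (h * real_of_int (y $ i))) summable_on UNIV"
    by (rule summable_on_abs_le[OF has_sum_imp_summable[OF assms(2)]])
      (use g_nonneg[OF assms(1)] in \<open>auto simp: abs_mult sinh_def cosh_def abs_le_iff intro!: mult_left_mono\<close>)
  have i2: "((\<lambda>y. g t y * sinh (h * real_of_int (y $ i))) has_sum 0) UNIV"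
    using has_sum_infsum[OF s2] infsum_odd[of "g t" "\<lambda>y. sinh (h * real_of_int (y $ i))"] g_even[OF assms(1)] by simp
  have sh: "((\<lambda>x. g t (x - w) * cosh (h * real_of_int (x $ i))) has_sum cosh (h * real_of_int (w $ i)) * X) UNIV" for w
  proof (rule has_sum_reindex_bij_witness[where i = "\<lambda>y. y + w" and j = "\<lambda>x. x - w", THEN iffD2])
    show "((\<lambda>y. cosh (h * real_of_int (w $ i)) * (g t y * cosh (h * real_of_int (y $ i))) +
        sinh (h * real_of_int (w $ i)) * (g t y * sinh (h * real_of_int (y $ i)))) has_sum
        (cosh (h * real_of_int (w $ i)) * X + sinh (h * real_of_int (w $ i)) * 0)) UNIV"
      by (intro has_sum_add has_sum_cmult_right assms(2) i2)
    fix x :: "int ^ 'n"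
    have "h * real_of_int (x $ i) = h * real_of_int (w $ i) + h * real_of_int ((x - w) $ i)" by (simp add: algebra_simps)
    then show "cosh (h * real_of_int (w $ i)) * (g t (x - w) * cosh (h * real_of_int ((x - w) $ i))) +
        sinh (h * real_of_int (w $ i)) * (g t (x - w) * sinh (h * real_of_int ((x - w) $ i))) = g t (x - w) * cosh (h * real_of_int (x $ i))"
      by (simp only: cosh_add) (simp add: algebra_simps)
  qed auto
  have "((\<lambda>x. \<Sum>w\<in>A. J w * (g t (x - w) * cosh (h * real_of_int (x $ i)))) has_sum (\<Sum>w\<in>A. J w * (cosh (h * real_of_int (w $ i)) * X))) UNIV" if "finite A" for A
    using that by (induction A rule: finite_induct) (auto intro!: has_sum_add has_sum_cmult_right sh)
  from this[OF J_fin] show ?thesis by (simp add: F_fin sum_distrib_right mult.assoc)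
qed

lemma J_cosh:
  assumes "0 \<le> h" "h * (sqrt (real CARD('n)) / c\<^sub>0 * \<sigma>) \<le> 1"
  shows "(\<Sum>w | J w \<noteq> 0. J w * cosh (h * real_of_int (w $ i))) \<le> 1 + h\<^sup>2 * \<sigma>\<^sup>2"
    and "1 \<le> (\<Sum>w | J w \<noteq> 0. J w * cosh (h * real_of_int (w $ i)))"
proof -
  have f: "(\<Sum>w | J w \<noteq> 0. J w * k w) = (\<Sum>\<^sub>\<infinity>w. J w * k w)" for k :: "int ^ 'n \<Rightarrow> real"
  proof -
    have "(\<Sum>\<^sub>\<infinity>w. J w * k w) = infsum (\<lambda>w. J w * k w) {w. J w \<noteq> 0}" by (rule infsum_cong_neutral) auto
    then show ?thesis using J_fin by simp
  qed
  have one: "(\<Sum>w | J w \<noteq> 0. J w * 1) = 1" using f[of "\<lambda>_. 1"] J_sum by simp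
  have "(\<Sum>w | J w \<noteq> 0. J w * cosh (h * real_of_int (w $ i))) \<le> (\<Sum>w | J w \<noteq> 0. J w * 1 + h\<^sup>2 * (J w * (l2 w)\<^sup>2))"
  proof (rule sum_mono)
    fix w assume "w \<in> {w. J w \<noteq> 0}"
    have wl: "\<bar>real_of_int (w $ i)\<bar> \<le> l2 w" by (rule component_le_l2)
    then have "h * \<bar>real_of_int (w $ i)\<bar> \<le> h * (sqrt (real CARD('n)) / c\<^sub>0 * \<sigma>)"
      using J_range[of w] \<open>w \<in> _\<close> assms(1) by (intro mult_left_mono) auto
    then have "\<bar>h * real_of_int (w $ i)\<bar> \<le> 1" using assms by (simp add: abs_mult)
    then have "cosh (h * real_of_int (w $ i)) \<le> 1 + (h * real_of_int (w $ i))\<^sup>2" by (rule cosh_le_quadratic)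
    also have "\<dots> \<le> 1 + h\<^sup>2 * (l2 w)\<^sup>2"
      using power_mono[OF wl, of 2] by (auto simp: power_mult_distrib intro!: mult_left_mono)
    finally show "J w * cosh (h * real_of_int (w $ i)) \<le> J w * 1 + h\<^sup>2 * (J w * (l2 w)\<^sup>2)"
      using mult_left_mono[OF _ J_nonneg[of w]] by (fastforce simp: algebra_simps)
  qed
  also have "\<dots> = 1 + h\<^sup>2 * \<sigma>\<^sup>2"
    unfolding sum.distrib one sum_distrib_left[symmetric] f J_var by simp
  finally show "(\<Sum>w | J w \<noteq> 0. J w * cosh (h * real_of_int (w $ i))) \<le> 1 + h\<^sup>2 * \<sigma>\<^sup>2" .
  have "(\<Sum>w | J w \<noteq> 0. J w * 1) \<le> (\<Sum>w | J w \<noteq> 0. J w * cosh (h * real_of_int (w $ i)))"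
    by (intro sum_mono mult_left_mono cosh_real_ge_1 J_nonneg)
  then show "1 \<le> (\<Sum>w | J w \<noteq> 0. J w * cosh (h * real_of_int (w $ i)))" using one by simp
qed

text \<open>The weight is truncated because the tilted sum is not known to be finite beforehand.\<close>
lemma cosh_jump:
  assumes t: "t \<in> I" "0 \<le> s" "s \<le> t"
    and Fs: "((\<lambda>x. F s x * cosh (h * real_of_int (x $ i))) has_sum Y) UNIV" and kap: "0 < \<kappa>" "(t - s) * Y \<le> 1 - \<kappa>"
    and gs: "((\<lambda>x. g s x * cosh (h * real_of_int (x $ i))) has_sum Z) UNIV"
  shows "\<exists>X. ((\<lambda>x. g t x * cosh (h * real_of_int (x $ i))) has_sum X) UNIV \<and> X \<le> Z / \<kappa>"
proof -
  have s: "s \<in> I" using I_down t by blast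
  define C where "C = (\<lambda>x::int ^ 'n. cosh (h * real_of_int (x $ i)))"
  have C1: "1 \<le> C x" for x by (simp add: C_def cosh_real_ge_1)
  have main: "(\<Sum>\<^sub>\<infinity>x. g t x * min (C x) k) \<le> Z / \<kappa>" if k: "1 \<le> k" for k
  proof -
    define W where "W = (\<lambda>x. min (C x) k)"
    have W: "0 \<le> W x" "W x \<le> k" "W x \<le> C x" for x using C1[of x] k by (auto simp: W_def)
    obtain m where m: "0 < m" "esum m (g t)" using g_esum[OF t(1)] by blast
    have ms: "esum m (g s)"
      by (rule esum_le[OF m(2), of _ 1]) (use g_mono[OF t] g_nonneg[OF s] g_nonneg[OF t(1)] in simp)
    have Wb: "\<bar>W x\<bar> \<le> k * exp (m * l2 x)" for x
    proof -
      have "k * 1 \<le> k * exp (m * l2 x)" using k m by (intro mult_left_mono) auto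
      then show ?thesis using W[of x] by linarith
    qed
    note cw = conv_weight[OF F_esum[OF ms less_imp_le[OF m(1)]] m(2) less_imp_le[OF m(1)] Wb]
    have sW: "(\<lambda>x. g t x * W x) summable_on UNIV" "(\<lambda>x. g s x * W x) summable_on UNIV"
      by (rule esum_summable[OF m(2) Wb], rule esum_summable[OF ms Wb])
    define X where "X = (\<Sum>\<^sub>\<infinity>x. g t x * W x)"
    have X0: "0 \<le> X" unfolding X_def by (auto intro!: infsum_nonneg mult_nonneg_nonneg g_nonneg t W)
    define \<Phi> where "\<Phi> = (\<lambda>y. \<Sum>\<^sub>\<infinity>z. g t z * W (y + z))"
    \<comment> \<open>The truncated cosh still satisfies W (y + z) + W (z - y) \<le> 2 * C y * W z:
      the addition theorem gives it when W z = C z, and the truncation level k together with C y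
      \<ge> 1 when W z = k.\<close>
    have Phi: "(\<Phi> y + \<Phi> (- y)) / 2 \<le> C y * X" for y
    proof -
      have "\<Phi> y + \<Phi> (- y) = (\<Sum>\<^sub>\<infinity>z. g t z * W (y + z) + g t z * W (- y + z))"
        unfolding \<Phi>_def by (rule infsum_add[symmetric, OF cw(3) cw(3)])
      also have "\<dots> \<le> (\<Sum>\<^sub>\<infinity>z. 2 * C y * (g t z * W z))"
      proof (rule infsum_mono[OF summable_on_add[OF cw(3) cw(3)] summable_on_cmult_right[OF sW(1)]])
        fix z
        have "C (y + z) + C (- y + z) = 2 * C y * C z"
          unfolding C_def by (simp add: cosh_add cosh_diff distrib_left right_diff_distrib flip: diff_conv_add_uminus)
        then have "W (y + z) + W (- y + z) \<le> 2 * (C y * C z)" by (simp add: W_def)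
        moreover have "W (y + z) + W (- y + z) \<le> 2 * (C y * k)"
        proof -
          have "1 * k \<le> C y * k" using C1 k by (intro mult_right_mono) auto
          then show ?thesis using W(2)[of "y + z"] W(2)[of "- y + z"] by linarith
        qed
        ultimately have "W (y + z) + W (- y + z) \<le> 2 * C y * W z"
          by (auto simp: W_def min_def)
        then show "g t z * W (y + z) + g t z * W (- y + z) \<le> 2 * C y * (g t z * W z)"
          using mult_left_mono[OF _ g_nonneg[OF t(1), of z]] by (fastforce simp: algebra_simps)
      qed
      also have "\<dots> = 2 * C y * X" by (simp only: infsum_cmult_right' X_def)
      finally show ?thesis by simp
    qed
    have "X \<le> (\<Sum>\<^sub>\<infinity>x. g s x * W x + (t - s) * (conv (F s) (g t) x * W x))"
      unfolding X_def
    proof (rule infsum_mono[OF sW(1) summable_on_add[OF sW(2) summable_on_cmult_right[OF cw(1)]]])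
      show "g t x * W x \<le> g s x * W x + (t - s) * (conv (F s) (g t) x * W x)" for x
        using mult_right_mono[OF g_upper[OF t, of x] W(1)[of x]] by (simp add: algebra_simps)
    qed
    also have "\<dots> = (\<Sum>\<^sub>\<infinity>x. g s x * W x) + (t - s) * (\<Sum>\<^sub>\<infinity>x. conv (F s) (g t) x * W x)"
      by (subst infsum_add[OF sW(2) summable_on_cmult_right[OF cw(1)]]) (simp add: infsum_cmult_right')
    also have "(\<Sum>\<^sub>\<infinity>x. conv (F s) (g t) x * W x) = (\<Sum>\<^sub>\<infinity>y. F s y * \<Phi> y)"
      by (simp add: cw(2) \<Phi>_def)
    also have "\<dots> = (\<Sum>\<^sub>\<infinity>y. F s y * ((\<Phi> y + \<Phi> (- y)) / 2))"
      by (rule infsum_symmetrize[of "F s" \<Phi>, OF F_even[OF s]]) (use cw(4) in \<open>simp add: \<Phi>_def\<close>)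
    also have "\<dots> \<le> (\<Sum>\<^sub>\<infinity>y. X * (F s y * C y))"
    proof (rule infsum_mono)
      show s2: "(\<lambda>y. X * (F s y * C y)) summable_on UNIV"
        using has_sum_imp_summable[OF Fs] unfolding C_def by (rule summable_on_cmult_right)
      have *: "F s y * ((\<Phi> y + \<Phi> (- y)) / 2) \<le> X * (F s y * C y)" for y
        using mult_left_mono[OF Phi[of y] F_nonneg[OF s, of y]] by (simp add: mult_ac)
      then show "F s y * ((\<Phi> y + \<Phi> (- y)) / 2) \<le> X * (F s y * C y)" for y .
      have "0 \<le> \<Phi> y" for y unfolding \<Phi>_def by (auto intro!: infsum_nonneg mult_nonneg_nonneg g_nonneg t W)
      then show "(\<lambda>y. F s y * ((\<Phi> y + \<Phi> (- y)) / 2)) summable_on UNIV"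
        by (intro summable_on_comparison_test[OF s2 *] mult_nonneg_nonneg F_nonneg s) auto
    qed
    also have "\<dots> = X * Y" using infsumI[OF Fs] by (simp add: infsum_cmult_right' C_def)
    also have "(\<Sum>\<^sub>\<infinity>x. g s x * W x) \<le> Z"
      unfolding infsumI[OF gs, symmetric]
      by (rule infsum_mono[OF sW(2) has_sum_imp_summable[OF gs]]) (use W(3) in \<open>auto simp: C_def intro!: mult_left_mono g_nonneg s\<close>)
    \<comment> \<open>\<open>X\<close> is finite thanks to the truncation, so the term (t - s) X Y
      \<le> (1 - \<kappa>) X can be absorbed. The bound obtained is independent of the level
      k.\<close>
    finally have "X \<le> Z + (t - s) * (X * Y)" using t by (simp add: mult_left_mono)
    moreover have "X * ((t - s) * Y) \<le> X * (1 - \<kappa>)" using kap X0 by (intro mult_left_mono) auto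
    ultimately have "X * \<kappa> \<le> Z" by (simp add: algebra_simps)
    then show ?thesis using kap by (simp add: X_def W_def field_simps)
  qed
  \<comment> \<open>On a finite set the truncation level can be taken above every value of the
    cosh.\<close>
  have fin: "(\<Sum>x\<in>A. g t x * C x) \<le> Z / \<kappa>" if A: "finite A" for A
  proof -
    define k where "k = 1 + (\<Sum>x\<in>A. C x)"
    have C0: "0 \<le> C x" for x by (rule order_trans[OF zero_le_one C1])
    have "0 \<le> (\<Sum>x\<in>A. C x)" by (rule sum_nonneg[OF C0])
    then have k1: "1 \<le> k" by (simp add: k_def)
    have Ck: "C x \<le> k" if "x \<in> A" for x
      using member_le_sum[of x A C, OF that C0 A] by (simp add: k_def)
    obtain m where m: "0 < m" "esum m (g t)" using g_esum[OF t(1)] by blast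
    have sk: "(\<lambda>x. g t x * min (C x) k) summable_on UNIV"
    proof (rule esum_summable[OF m(2)])
      fix x
      show "\<bar>min (C x) k\<bar> \<le> k * exp (m * l2 x)"
      proof -
        have "k * 1 \<le> k * exp (m * l2 x)" using k1 m by (intro mult_left_mono) auto
        moreover have "0 \<le> min (C x) k" "min (C x) k \<le> k" using C0[of x] k1 by auto
        ultimately show ?thesis by linarith
      qed
    qed
    have "(\<Sum>x\<in>A. g t x * C x) = (\<Sum>x\<in>A. g t x * min (C x) k)" using Ck by (intro sum.cong) (auto simp: min_def)
    also have "\<dots> \<le> (\<Sum>\<^sub>\<infinity>x. g t x * min (C x) k)"
      using C0 k1 by (intro finite_sum_le_infsum[OF sk A]) (auto intro!: mult_nonneg_nonneg g_nonneg t)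
    also have "\<dots> \<le> Z / \<kappa>" by (rule main[OF k1])
    finally show ?thesis .
  qed
  have su: "(\<lambda>x. g t x * C x) summable_on UNIV"
  proof (rule nonneg_bdd_above_summable_on)
    show "bdd_above (sum (\<lambda>x. g t x * C x) ` {F. F \<subseteq> UNIV \<and> finite F})"
      using fin by (intro bdd_aboveI2) auto
    show "0 \<le> g t x * C x" for x using g_nonneg[OF t(1), of x] C1[of x] by simp
  qed
  have "(\<Sum>\<^sub>\<infinity>x. g t x * C x) \<le> Z / \<kappa>" by (rule infsum_le_finite_sums[OF su]) (use fin in auto)
  then show ?thesis using has_sum_infsum[OF su] by (auto simp: C_def)
qed

end

section \<open>Propagation of cosh moments from scale to scale\<close>

context scales begin

text \<open>The range of \<open>J\<close> is at most sqrt d / \<open>c\<^sub>0\<close> times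
  \<sigma>, so at this rate relative to \<sigma> the argument of the cosh there is at most 1/4.
  \<open>exp_rate\<close> is smaller by sqrt d, since l2 is at most sqrt d times the largest
  coordinate.\<close>

definition "cosh_rate = c\<^sub>0 / (4 * sqrt (real CARD('n)))"
definition "exp_rate = c\<^sub>0 / (4 * real CARD('n))"

lemma cosh_rate: "0 < cosh_rate" "cosh_rate \<le> 1 / 4" "cosh_rate * (sqrt (real CARD('n)) / c\<^sub>0) = 1 / 4"
    "exp_rate * sqrt (real CARD('n)) = cosh_rate" "0 < exp_rate"
proof -
  have d: "1 \<le> sqrt (real CARD('n))" using d3 by simp
  show "0 < cosh_rate" "0 < exp_rate" using c0 d3 by (auto simp: cosh_rate_def exp_rate_def)
  have "c\<^sub>0 * 1 \<le> 1 * sqrt (real CARD('n))" using c0 d by (intro mult_mono) auto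
  then show "cosh_rate \<le> 1 / 4" using d by (simp add: cosh_rate_def divide_le_eq)
  show "cosh_rate * (sqrt (real CARD('n)) / c\<^sub>0) = 1 / 4" using c0 d3 by (simp add: cosh_rate_def)
  define D where "D = sqrt (real CARD('n))"
  have D: "0 < D" "real CARD('n) = D * D" using d by (auto simp: D_def)
  have "exp_rate = c\<^sub>0 / (4 * (D * D))" unfolding exp_rate_def D(2) ..
  moreover have "cosh_rate = c\<^sub>0 / (4 * D)" unfolding cosh_rate_def D_def ..
  ultimately show "exp_rate * sqrt (real CARD('n)) = cosh_rate" unfolding D_def[symmetric] using D(1) by simp
qed

lemma J_cosh_rate:
  assumes "t \<in> I" "0 \<le> h" "h \<le> cosh_rate / \<xi> t"
  shows "(\<Sum>w | J w \<noteq> 0. J w * cosh (h * real_of_int (w $ i))) \<le> 1 + h\<^sup>2 * \<sigma>\<^sup>2"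
    "1 \<le> (\<Sum>w | J w \<noteq> 0. J w * cosh (h * real_of_int (w $ i)))"
proof -
  have "h * (sqrt (real CARD('n)) / c\<^sub>0 * \<sigma>) \<le> (cosh_rate / \<sigma>) * (sqrt (real CARD('n)) / c\<^sub>0 * \<sigma>)"
  proof (rule mult_right_mono)
    have "cosh_rate / \<xi> t \<le> cosh_rate / \<sigma>"
      using xi_ge[OF assms(1)] sigma cosh_rate by (intro divide_left_mono) auto
    then show "h \<le> cosh_rate / \<sigma>" using assms by linarith
  qed (use c0 sigma in simp)
  also have "\<dots> = cosh_rate * (sqrt (real CARD('n)) / c\<^sub>0)" using sigma by simp
  also have "\<dots> = 1 / 4" by (rule cosh_rate(3))
  finally have 1: "h * (sqrt (real CARD('n)) / c\<^sub>0 * \<sigma>) \<le> 1" by linarith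
  show "(\<Sum>w | J w \<noteq> 0. J w * cosh (h * real_of_int (w $ i))) \<le> 1 + h\<^sup>2 * \<sigma>\<^sup>2"
    "1 \<le> (\<Sum>w | J w \<noteq> 0. J w * cosh (h * real_of_int (w $ i)))"
    using J_cosh[OF assms(2) 1] by auto
qed

text \<open>The constant 16 reproduces itself when passing to a larger scale.\<close>

definition cosh_bound :: "real \<Rightarrow> 'n \<Rightarrow> bool" where
  "cosh_bound t i \<longleftrightarrow> (\<exists>X. ((\<lambda>x. g t x * cosh (cosh_rate / \<xi> t * real_of_int (x $ i))) has_sum X) UNIV \<and> X \<le> 16 * S t)"

lemma thirtytwo_powr: "32 powr \<nu> \<le> 2"
proof -
  have "(32::real) powr \<nu> \<le> 32 powr (1 / 5)" using nu by (intro powr_mono) auto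
  also have "(32::real) = 2 powr 5" by simp
  also have "((2::real) powr 5) powr (1 / 5) = 2" by (subst powr_powr) simp
  finally show ?thesis by simp
qed

text \<open>With q = 1 / r^2 the killing is at least q/2 and exceeds the errors 2 \<nu> \<le> q/16
  and \<eta> \<le> q/8 by q/4. Hence the tilted sum at t is at most Z / (q/4) \<le> 8 r^2 S s \<le>
  16 S t. The bound 1 / 32768 = 1 / (32 * 32^2) on \<nu> is what the largest ratio r = 32
  requires.\<close>

lemma cosh_bound_step:
  assumes t: "t \<in> I" "0 \<le> s" "s \<le> t" and nu': "\<nu> \<le> 1 / 32768"
    and r: "\<xi> t = r * \<xi> s" "1 \<le> r" "r \<le> 32"
    and Z: "((\<lambda>x. g s x * cosh (cosh_rate / \<xi> t * real_of_int (x $ i))) has_sum Z) UNIV"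
    and Y: "(\<Sum>w | J w \<noteq> 0. J w * cosh (cosh_rate / \<xi> t * real_of_int (w $ i))) * Z \<le> S s * (1 + \<eta>)" "0 \<le> \<eta>" "\<eta> \<le> 1 / (8 * r\<^sup>2)"
  shows "cosh_bound t i"
proof -
  have s: "s \<in> I" using I_down t by blast
  have p: "0 < S s" "0 < S t" using S_ge_1 s t(1) by fastforce+
  define h where "h = cosh_rate / \<xi> t"
  have h: "0 \<le> h" using cosh_rate xi_pos[OF t(1)] by (simp add: h_def)
  define j where "j = (\<Sum>w | J w \<noteq> 0. J w * cosh (h * real_of_int (w $ i)))"
  have j: "1 \<le> j" unfolding j_def using J_cosh_rate(2)[OF t(1) h] by (simp add: h_def)
  note Fs = F_cosh[OF s Z[folded h_def], folded j_def]
  have Z0: "0 \<le> Z" by (rule has_sum_nonneg[OF Z]) (intro mult_nonneg_nonneg g_nonneg s cosh_real_nonneg)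
  have "\<xi> t \<le> 32 * \<xi> s" using r xi_pos[OF s] by (simp add: mult_right_mono)
  note ratio = S_ratio[OF t this thirtytwo_powr]
  have rr: "\<xi> s / \<xi> t = 1 / r" "\<xi> t / \<xi> s = r" using r xi_pos[OF s] by auto
  have r2: "1 \<le> r\<^sup>2" "r\<^sup>2 \<le> 1024" using r power_mono[OF r(3), of 2] by (auto simp: one_le_power)
  define q where "q = 1 / r\<^sup>2"
  have q: "1 / 1024 \<le> q" "q \<le> 1" "0 < q" using r2 by (auto simp: q_def le_divide_eq divide_le_eq)
  have eta: "\<eta> \<le> q / 8" using Y(3) by (simp add: q_def)
  have "(t - s) * (j * Z) \<le> (t - s) * (S s * (1 + \<eta>))"
    using Y(1) t by (intro mult_left_mono) (auto simp: j_def h_def)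
  also have "\<dots> = ((t - s) * S s) * (1 + \<eta>)" by simp
  also have "\<dots> \<le> (1 - S s / S t + 2 * \<nu>) * (1 + \<eta>)" using kill_le(1)[OF t] Y(2) by (intro mult_right_mono) auto
  also have "\<dots> \<le> (1 - q / 2 + 2 * \<nu>) * (1 + \<eta>)"
    using ratio(1) Y(2) by (intro mult_right_mono) (auto simp: rr q_def power_one_over)
  also have "\<dots> \<le> 1 - q / 4"
  proof -
    have "(1 - q / 2 + 2 * \<nu>) * (1 + \<eta>) = 1 - q / 2 + 2 * \<nu> + \<eta> * (1 - q / 2 + 2 * \<nu>)" by (simp add: algebra_simps)
    also have "\<eta> * (1 - q / 2 + 2 * \<nu>) \<le> \<eta> * 1" using Y(2) q nu' by (intro mult_left_mono) auto
    finally show ?thesis using eta q nu' by linarith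
  qed
  finally have k: "(t - s) * (j * Z) \<le> 1 - q / 4" .
  obtain X where X: "((\<lambda>x. g t x * cosh (h * real_of_int (x $ i))) has_sum X) UNIV" "X \<le> Z / (q / 4)"
    using cosh_jump[OF t Fs _ k Z[folded h_def]] q by auto
  have "Z * 1 \<le> Z * j" using j Z0 by (intro mult_left_mono)
  then have "Z \<le> S s * (1 + \<eta>)" using Y(1) by (simp add: j_def h_def mult.commute)
  also have "\<dots> \<le> S s * 2" using p eta q by (intro mult_left_mono) auto
  finally have "Z / (q / 4) \<le> S s * 2 / (q / 4)" using q by (intro divide_right_mono) auto
  also have "\<dots> = 8 * r\<^sup>2 * S s" by (simp add: q_def)
  also have "\<dots> \<le> 16 * S t" using ratio(2) p by (simp add: rr field_simps)
  finally show ?thesis using X unfolding cosh_bound_def h_def by (intro exI[of _ X]) auto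
qed

text \<open>The step from parameter 0: there g is a point mass, its tilted sum is 1, and \<eta> is
  the excess of the cosh moment of \<open>J\<close>.\<close>

lemma cosh_bound_base:
  assumes t: "t \<in> I" and nu': "\<nu> \<le> 1 / 32768" and r: "\<xi> t \<le> 32 * \<sigma>"
  shows "cosh_bound t i"
proof -
  note z = zero_in_I[OF t]
  define h where "h = cosh_rate / \<xi> t"
  have h: "0 \<le> h" using cosh_rate xi_pos[OF t] by (simp add: h_def)
  show ?thesis
  proof (rule cosh_bound_step[OF t order_refl I_nonneg[OF t] nu', where r = "\<xi> t / \<sigma>" and Z = 1 and \<eta> = "h\<^sup>2 * \<sigma>\<^sup>2"])
    show "((\<lambda>x. g 0 x * cosh (cosh_rate / \<xi> t * real_of_int (x $ i))) has_sum 1) UNIV"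
      using g_0_has_sum[OF z, of "\<lambda>x. cosh (cosh_rate / \<xi> t * real_of_int (x $ i))"] by simp
    show "(\<Sum>w | J w \<noteq> 0. J w * cosh (cosh_rate / \<xi> t * real_of_int (w $ i))) * 1 \<le> S 0 * (1 + h\<^sup>2 * \<sigma>\<^sup>2)"
      using J_cosh_rate(1)[OF t h] by (simp add: S_0[OF z] h_def)
    have "h\<^sup>2 * \<sigma>\<^sup>2 = cosh_rate\<^sup>2 / (\<xi> t / \<sigma>)\<^sup>2" using sigma by (simp add: h_def power_divide)
    also have "\<dots> \<le> (1 / 4)\<^sup>2 / (\<xi> t / \<sigma>)\<^sup>2" using cosh_rate by (intro divide_right_mono power_mono) auto
    also have "\<dots> \<le> 1 / (8 * (\<xi> t / \<sigma>)\<^sup>2)" by (simp add: power_divide divide_simps)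
    finally show "h\<^sup>2 * \<sigma>\<^sup>2 \<le> 1 / (8 * (\<xi> t / \<sigma>)\<^sup>2)" .
  qed (use xi_0[OF z] xi_ge[OF t] sigma r in \<open>auto simp: divide_le_eq\<close>)
qed

text \<open>Induction over scales of ratio 32. The bound at s holds at a rate 32 times larger than
  the one wanted at t, so it controls the quartic remainder by 32 / 32^4, the numerator being 2 *
  16. Together with the quadratic term this stays below the allowance 1 / (8 * 32^2).\<close>

lemma cosh_bound_all:
  assumes t: "t \<in> I" and nu': "\<nu> \<le> 1 / 32768"
  shows "cosh_bound t i"
proof -
  have "\<forall>t\<in>I. \<xi> t \<le> 32 ^ Suc n * \<sigma> \<longrightarrow> cosh_bound t i" for n
  proof (induction n)
    case 0 then show ?case using cosh_bound_base[OF _ nu'] by simp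
  next
    case (Suc n)
    show ?case
    proof (intro ballI impI)
      fix t assume t: "t \<in> I" and tn: "\<xi> t \<le> 32 ^ Suc (Suc n) * \<sigma>"
      show "cosh_bound t i"
      proof (cases "\<xi> t \<le> 32 * \<sigma>")
        case True then show ?thesis by (rule cosh_bound_base[OF t nu'])
      next
        case False
        obtain s where s: "0 \<le> s" "s \<le> t" "s \<in> I" "\<xi> s = \<xi> t / 32"
          using xi_ivt[OF t, of "\<xi> t / 32"] False xi_pos[OF t] by auto
        have "cosh_bound s i" using Suc.IH s tn by auto
        then obtain X where X: "((\<lambda>x. g s x * cosh (cosh_rate / \<xi> s * real_of_int (x $ i))) has_sum X) UNIV" "X \<le> 16 * S s"
          by (auto simp: cosh_bound_def)
        define h where "h = cosh_rate / \<xi> t"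
        have h: "0 \<le> h" "cosh_rate / \<xi> s = 32 * h" using cosh_rate xi_pos[OF t] by (auto simp: h_def s(4))
        have p: "0 < S s" using S_ge_1[OF s(3)] by simp
        have X0: "0 \<le> X" by (rule has_sum_nonneg[OF X(1)]) (intro mult_nonneg_nonneg g_nonneg s cosh_real_nonneg)
        define j where "j = (\<Sum>w | J w \<noteq> 0. J w * cosh (32 * h * real_of_int (w $ i)))"
        have j: "j \<le> 2"
        proof -
          have "j \<le> 1 + (32 * h)\<^sup>2 * \<sigma>\<^sup>2" unfolding j_def using J_cosh_rate(1)[OF s(3), of "32 * h"] h by simp
          also have "(32 * h)\<^sup>2 * \<sigma>\<^sup>2 = (cosh_rate * (\<sigma> / \<xi> s))\<^sup>2" by (simp add: h(2)[symmetric] power_mult_distrib power_divide)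
          also have "\<dots> \<le> (1 * 1)\<^sup>2"
            using cosh_rate xi_ge[OF s(3)] xi_pos[OF s(3)] sigma by (intro power_mono mult_mono) (auto simp: divide_le_eq)
          finally show ?thesis by simp
        qed
        have FX: "((\<lambda>x. F s x * cosh (32 * h * real_of_int (x $ i))) has_sum j * X) UNIV"
          using F_cosh[OF s(3) X(1)[unfolded h(2)]] by (simp add: j_def)
        have ch: "cosh (h * y) \<le> cosh (32 * h * y)" for y :: real
        proof -
          have "cosh (h * y) = cosh \<bar>h * y\<bar>" "cosh (32 * h * y) = cosh \<bar>32 * h * y\<bar>" by (auto simp: abs_if)
          moreover have "\<bar>h * y\<bar> \<le> \<bar>32 * h * y\<bar>" by (simp add: abs_mult)
          ultimately show ?thesis using cosh_real_nonneg_le_iff[of "\<bar>h * y\<bar>" "\<bar>32 * h * y\<bar>"] by simp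
        qed
        have gs: "(\<lambda>x. g s x * cosh (h * real_of_int (x $ i))) summable_on UNIV"
          by (rule summable_on_abs_le[OF has_sum_imp_summable[OF X(1)[unfolded h(2)]]])
            (use ch g_nonneg[OF s(3)] in \<open>auto simp: abs_mult intro!: mult_left_mono\<close>)
        define Z where "Z = (\<Sum>\<^sub>\<infinity>x. g s x * cosh (h * real_of_int (x $ i)))"
        have Z: "((\<lambda>x. g s x * cosh (h * real_of_int (x $ i))) has_sum Z) UNIV"
          unfolding Z_def by (rule has_sum_infsum[OF gs])
        define \<eta> where "\<eta> = h\<^sup>2 * (\<xi> s)\<^sup>2 / 2 + 32 / 32 ^ 4"
        obtain m where m: "0 < m" "esum m (g s)" using g_esum[OF s(3)] by blast
        have Fl: "((\<lambda>x. F s x * (l2 x)\<^sup>2) has_sum S s * (\<xi> s)\<^sup>2) UNIV"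
          using has_sum_infsum[OF esum_summable_power[OF F_esum[OF m(2) less_imp_le[OF m(1)]] m(1), of 2]] F_var[OF s(3)] by simp
        have "(\<Sum>w | J w \<noteq> 0. J w * cosh (h * real_of_int (w $ i))) * Z \<le> S s + h\<^sup>2 / 2 * (S s * (\<xi> s)\<^sup>2) + (1 / 32 ^ 4) * (j * X)"
        proof (rule has_sum_mono[OF F_cosh[OF s(3) Z]])
          show "((\<lambda>x. F s x + h\<^sup>2 / 2 * (F s x * (l2 x)\<^sup>2) + (1 / 32 ^ 4) * (F s x * cosh (32 * h * real_of_int (x $ i)))) has_sum
              S s + h\<^sup>2 / 2 * (S s * (\<xi> s)\<^sup>2) + (1 / 32 ^ 4) * (j * X)) UNIV"
            by (intro has_sum_add has_sum_cmult_right F_has_sum s Fl FX)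
          fix x :: "int ^ 'n"
          have "cosh (h * real_of_int (x $ i)) \<le> 1 + (h * real_of_int (x $ i))\<^sup>2 / 2 + cosh (32 * (h * real_of_int (x $ i))) / 32 ^ 4"
            by (rule cosh_le_quadratic_quartic) simp
          also have "\<dots> \<le> 1 + h\<^sup>2 / 2 * (l2 x)\<^sup>2 + 1 / 32 ^ 4 * cosh (32 * h * real_of_int (x $ i))"
            using power_mono[OF component_le_l2[of x i], of 2] by (auto simp: power_mult_distrib mult.assoc intro!: mult_left_mono)
          finally show "F s x * cosh (h * real_of_int (x $ i)) \<le> F s x + h\<^sup>2 / 2 * (F s x * (l2 x)\<^sup>2) + (1 / 32 ^ 4) * (F s x * cosh (32 * h * real_of_int (x $ i)))"
            using mult_left_mono[OF _ F_nonneg[OF s(3), of x]] by (fastforce simp: algebra_simps)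
        qed
        also have "\<dots> \<le> S s + h\<^sup>2 / 2 * (S s * (\<xi> s)\<^sup>2) + (1 / 32 ^ 4) * (2 * (16 * S s))"
          using j X X0 p by (intro add_left_mono mult_left_mono mult_mono) auto
        also have "\<dots> = S s * (1 + \<eta>)" by (simp add: \<eta>_def algebra_simps)
        finally have Y: "(\<Sum>w | J w \<noteq> 0. J w * cosh (h * real_of_int (w $ i))) * Z \<le> S s * (1 + \<eta>)" .
        have "h * \<xi> s = cosh_rate / 32" using h(2) xi_pos[OF s(3)] by (simp add: field_simps)
        then have "h\<^sup>2 * (\<xi> s)\<^sup>2 = (cosh_rate / 32)\<^sup>2" by (metis power_mult_distrib)
        also have "\<dots> \<le> (1 / 4 / 32)\<^sup>2" using cosh_rate by (intro power_mono divide_right_mono) auto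
        finally have "\<eta> \<le> 1 / (8 * 32\<^sup>2)" by (simp add: \<eta>_def power_divide)
        note eta = this
        show ?thesis
          by (rule cosh_bound_step[OF t s(1,2) nu' _ _ _ Z[unfolded h_def] Y[unfolded h_def] _ eta]) (use s(4) in \<open>auto simp: \<eta>_def\<close>)
      qed
    qed
  qed
  moreover obtain n where "\<xi> t / \<sigma> < 32 ^ n" using real_arch_pow[of 32 "\<xi> t / \<sigma>"] by auto
  then have "\<xi> t \<le> 32 ^ Suc n * \<sigma>" using sigma xi_pos[OF t] by (simp add: divide_less_eq)
  ultimately show ?thesis using t by blast
qed

text \<open>The largest coordinate is at least l2 / sqrt d in absolute value, and twice its cosh
  dominates the exponential.\<close>

lemma exp_le_sum_cosh:
  fixes x :: "int ^ 'n"
  assumes "0 < r"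
  shows "exp (exp_rate * (l2 x / r)) \<le> (\<Sum>i\<in>UNIV. 2 * cosh (cosh_rate / r * real_of_int (x $ i)))"
proof -
  define M where "M = Max (range (\<lambda>i. \<bar>real_of_int (x $ i)\<bar>))"
  have Mi: "\<bar>real_of_int (x $ i)\<bar> \<le> M" for i unfolding M_def by (intro Max_ge) auto
  have "M \<in> range (\<lambda>i. \<bar>real_of_int (x $ i)\<bar>)" unfolding M_def by (intro Max_in) auto
  then obtain i where i: "M = \<bar>real_of_int (x $ i)\<bar>" by auto
  have M0: "0 \<le> M" using i by simp
  have "(l2 x)\<^sup>2 \<le> (\<Sum>i\<in>(UNIV::'n set). M\<^sup>2)"
    unfolding l2_power2 using Mi by (intro sum_mono) (metis abs_ge_zero power2_abs power_mono)
  then have "(l2 x)\<^sup>2 \<le> (sqrt (real CARD('n)) * M)\<^sup>2" by (simp add: power_mult_distrib)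
  then have "l2 x \<le> sqrt (real CARD('n)) * M" by (rule power2_le_imp_le) (use M0 in simp)
  then have "exp_rate * (l2 x / r) \<le> exp_rate * (sqrt (real CARD('n)) * M / r)"
    using cosh_rate assms by (intro mult_left_mono divide_right_mono) auto
  also have "\<dots> = cosh_rate / r * M" using cosh_rate(4) by (simp add: mult.assoc[symmetric])
  finally have "exp (exp_rate * (l2 x / r)) \<le> exp (cosh_rate / r * M)" by simp
  also have "\<dots> \<le> 2 * cosh (cosh_rate / r * M)" by (simp add: cosh_def)
  also have "cosh (cosh_rate / r * M) = cosh (cosh_rate / r * real_of_int (x $ i))" unfolding i by (auto simp: abs_if)
  also have "2 * \<dots> \<le> (\<Sum>i\<in>UNIV. 2 * cosh (cosh_rate / r * real_of_int (x $ i)))"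
    by (rule member_le_sum[where f = "\<lambda>i. 2 * cosh (cosh_rate / r * real_of_int (x $ i))"]) (auto simp: cosh_real_nonneg)
  finally show ?thesis .
qed

lemma exp_moment_generic:
  fixes f :: "int ^ 'n \<Rightarrow> real"
  assumes "0 < r" "\<And>x. 0 \<le> f x" "\<And>i. ((\<lambda>x. f x * cosh (cosh_rate / r * real_of_int (x $ i))) has_sum X i) UNIV" "\<And>i. X i \<le> B"
  shows "esum (exp_rate / r) f" "(\<Sum>\<^sub>\<infinity>x. f x * exp (exp_rate * (l2 x / r))) \<le> 2 * real CARD('n) * B"
proof -
  have fin: "((\<lambda>x. \<Sum>i\<in>A. 2 * (f x * cosh (cosh_rate / r * real_of_int (x $ i)))) has_sum (\<Sum>i\<in>A. 2 * X i)) UNIV" if "finite A" for A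
    using that
  proof (induction A rule: finite_induct)
    case (insert i A)
    then show ?case
      using has_sum_add[OF has_sum_cmult_right[OF assms(3)[of i], of 2] insert.IH] by (simp add: insert.hyps)
  qed simp
  have le: "f x * exp (exp_rate * (l2 x / r)) \<le> (\<Sum>i\<in>UNIV. 2 * (f x * cosh (cosh_rate / r * real_of_int (x $ i))))" for x
    using mult_left_mono[OF exp_le_sum_cosh[OF assms(1), of x] assms(2)[of x]] by (simp add: sum_distrib_left mult_ac)
  have su: "(\<lambda>x. f x * exp (exp_rate * (l2 x / r))) summable_on UNIV"
    by (rule summable_on_comparison_test[OF has_sum_imp_summable[OF fin[OF finite]] le]) (use assms(2) in auto)
  then show "esum (exp_rate / r) f" using assms(2) by (simp add: esum_def)
  have "(\<Sum>\<^sub>\<infinity>x. f x * exp (exp_rate * (l2 x / r))) \<le> (\<Sum>i\<in>(UNIV::'n set). 2 * X i)"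
    by (rule has_sum_mono[OF has_sum_infsum[OF su] fin[OF finite] le])
  also have "\<dots> \<le> (\<Sum>i\<in>(UNIV::'n set). 2 * B)" using assms(4) by (intro sum_mono) auto
  finally show "(\<Sum>\<^sub>\<infinity>x. f x * exp (exp_rate * (l2 x / r))) \<le> 2 * real CARD('n) * B" by simp
qed

text \<open>Summation over coordinates: 64 d = 2 d * 32, where 32 = 2 * 16 leaves room for the cosh
  moment of \<open>J\<close> in the convolution.\<close>

lemma exp_moments:
  assumes t: "t \<in> I" and nu': "\<nu> \<le> 1 / 32768"
  shows "esum (exp_rate / \<xi> t) (g t)" "(\<Sum>\<^sub>\<infinity>x. g t x * exp (exp_rate * (l2 x / \<xi> t))) \<le> 64 * real CARD('n) * S t"
    "esum (exp_rate / \<xi> t) (F t)" "(\<Sum>\<^sub>\<infinity>x. F t x * exp (exp_rate * (l2 x / \<xi> t))) \<le> 64 * real CARD('n) * S t"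
proof -
  define h where "h = cosh_rate / \<xi> t"
  have h: "0 \<le> h" using cosh_rate xi_pos[OF t] by (simp add: h_def)
  obtain X where X: "\<And>i. ((\<lambda>x. g t x * cosh (h * real_of_int (x $ i))) has_sum X i) UNIV" "\<And>i. X i \<le> 16 * S t"
    using cosh_bound_all[OF t nu'] unfolding cosh_bound_def h_def by metis
  have S1: "1 \<le> S t" by (rule S_ge_1[OF t])
  have X0: "0 \<le> X i" for i by (rule has_sum_nonneg[OF X(1)]) (intro mult_nonneg_nonneg g_nonneg t cosh_real_nonneg)
  define j where "j = (\<lambda>i. \<Sum>w | J w \<noteq> 0. J w * cosh (h * real_of_int (w $ i)))"
  have j: "j i \<le> 2" for i
  proof -
    have "j i \<le> 1 + h\<^sup>2 * \<sigma>\<^sup>2" unfolding j_def using J_cosh_rate(1)[OF t h] by (simp add: h_def)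
    also have "h\<^sup>2 * \<sigma>\<^sup>2 = (cosh_rate * (\<sigma> / \<xi> t))\<^sup>2" by (simp add: h_def power_mult_distrib power_divide)
    also have "\<dots> \<le> (1 * 1)\<^sup>2"
      using cosh_rate xi_ge[OF t] xi_pos[OF t] sigma by (intro power_mono mult_mono) (auto simp: divide_le_eq)
    finally show ?thesis by simp
  qed
  have jX: "j i * X i \<le> 32 * S t" for i
    using mult_mono[OF j[of i] X(2)[of i]] X0[of i] by simp
  have Xb: "X i \<le> 32 * S t" for i using X(2)[of i] S1 by linarith
  note G = exp_moment_generic[OF xi_pos[OF t] g_nonneg[OF t] X(1)[unfolded h_def] Xb]
  have FX: "((\<lambda>x. F t x * cosh (cosh_rate / \<xi> t * real_of_int (x $ i))) has_sum j i * X i) UNIV" for i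
    using F_cosh[OF t X(1)[of i]] by (simp add: j_def h_def)
  note FF = exp_moment_generic[OF xi_pos[OF t] F_nonneg[OF t] FX jX]
  show "esum (exp_rate / \<xi> t) (g t)" "esum (exp_rate / \<xi> t) (F t)" using G(1) FF(1) by auto
  show "(\<Sum>\<^sub>\<infinity>x. g t x * exp (exp_rate * (l2 x / \<xi> t))) \<le> 64 * real CARD('n) * S t"
    "(\<Sum>\<^sub>\<infinity>x. F t x * exp (exp_rate * (l2 x / \<xi> t))) \<le> 64 * real CARD('n) * S t"
    using G(2) FF(2) by (auto simp: mult_ac)
qed

lemma F_kernel:
  assumes t: "t \<in> I" and nu': "\<nu> \<le> 1 / 32768"
  shows "kernel exp_rate (64 * real CARD('n)) (\<xi> t) (\<lambda>z. F t z / S t)"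
proof -
  have p: "0 < S t" using S_ge_1[OF t] by simp
  have q: "(\<Sum>\<^sub>\<infinity>z. F t z / S t * k z) = (\<Sum>\<^sub>\<infinity>z. F t z * k z) / S t" for k
    using infsum_cmult_left'[of "\<lambda>z. F t z * k z" "1 / S t" UNIV] by simp
  show ?thesis
    unfolding kernel_def
  proof (intro conjI allI)
    show "esum (exp_rate / \<xi> t) (\<lambda>z. F t z / S t)"
      by (rule esum_le[OF exp_moments(3)[OF t nu'], of _ "1 / S t"]) (use p in simp)
    show "(\<Sum>\<^sub>\<infinity>z. F t z / S t) = 1" using q[of "\<lambda>_. 1"] infsumI[OF F_has_sum[OF t]] p by simp
    show "(\<Sum>\<^sub>\<infinity>z. F t z / S t * exp (exp_rate * (l2 z / \<xi> t))) \<le> 64 * real CARD('n)"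
      unfolding q using exp_moments(4)[OF t nu'] p by (simp add: divide_le_eq)
    show "(\<Sum>\<^sub>\<infinity>z. F t z / S t * (l2 z)\<^sup>2) = (\<xi> t)\<^sup>2" unfolding q F_var[OF t] using p by simp
    show "(\<Sum>\<^sub>\<infinity>z. F t z / S t * (real_vec x \<bullet> real_vec z)\<^sup>2) = (l2 x)\<^sup>2 * (\<xi> t)\<^sup>2 / real CARD('n)" for x
      unfolding q F_iso[OF t] using p by simp
    show "0 \<le> F t z / S t" for z using p F_nonneg[OF t, of z] by simp
    show "F t (- z) / S t = F t z / S t" for z using F_even[OF t, of z] by simp
  qed (use cosh_rate xi_pos[OF t] in auto)
qed

end

subsection \<open>Mass in balls\<close>

lemma has_sum_finite_sum:
  fixes f :: "'i \<Rightarrow> 'b \<Rightarrow> real"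
  assumes "finite A" "\<And>i. i \<in> A \<Longrightarrow> (f i has_sum s i) B"
  shows "((\<lambda>x. \<Sum>i\<in>A. f i x) has_sum (\<Sum>i\<in>A. s i)) B"
  using assms
proof (induction A rule: finite_induct)
  case (insert i A)
  have "(f i has_sum s i) B" "((\<lambda>x. \<Sum>i\<in>A. f i x) has_sum (\<Sum>i\<in>A. s i)) B"
    using insert by auto
  from has_sum_add[OF this] show ?case by (simp add: insert.hyps)
qed simp

lemma finite_l2_ball: "finite {x :: int ^ 'n. l2 x \<le> r}"
proof -
  have "inj_on (\<lambda>x i. (x :: int ^ 'n) $ i) UNIV" by (auto simp: inj_on_def vec_eq_iff fun_eq_iff)
  moreover have "(\<lambda>x i. x $ i) ` {x :: int ^ 'n. l2 x \<le> r} \<subseteq> PiE UNIV (\<lambda>_. {- \<lceil>r\<rceil>..\<lceil>r\<rceil>})"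
  proof (clarsimp simp: PiE_def)
    fix x :: "int ^ 'n" and i assume "l2 x \<le> r"
    then have "\<bar>real_of_int (x $ i)\<bar> \<le> r" using component_le_l2[of x i] by linarith
    then show "- \<lceil>r\<rceil> \<le> x $ i \<and> x $ i \<le> \<lceil>r\<rceil>" by linarith
  qed
  moreover have "finite (PiE (UNIV::'n set) (\<lambda>_. {- \<lceil>r\<rceil>..\<lceil>r\<rceil>}))" by (intro finite_PiE) auto
  ultimately show ?thesis by (meson finite_imageD finite_subset inj_on_subset subset_UNIV)
qed

context scales begin

lemmas F_kernel_explicit = F_kernel[unfolded exp_rate_def]
lemmas exp_moments_explicit = exp_moments[unfolded exp_rate_def]

lemma F_summable: "t \<in> I \<Longrightarrow> F t summable_on UNIV"
  using F_has_sum has_sum_imp_summable by blast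

lemma F_g_summable: assumes "s \<in> I" "t \<in> I" shows "(\<lambda>z. F s z * g t (w - z)) summable_on UNIV"
  by (rule summable_on_abs_le[OF summable_on_cmult_left[OF F_summable[OF assms(1)], of "S t"]])
    (use g_le_S[OF assms(2)] g_nonneg[OF assms(2)] F_nonneg[OF assms(1)] in \<open>auto simp: abs_mult intro!: mult_left_mono\<close>)

lemma g_upper_sum:
  assumes "t \<in> I" "0 \<le> s" "s \<le> t" "finite A"
  shows "(\<Sum>x\<in>A. g t (y - x)) \<le> (\<Sum>x\<in>A. g s (y - x)) + (t - s) * (\<Sum>\<^sub>\<infinity>z. F s z * (\<Sum>x\<in>A. g t (y - z - x)))"
    "(\<lambda>z. F s z * (\<Sum>x\<in>A. g t (y - z - x))) summable_on UNIV"
proof -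
  have s: "s \<in> I" using I_down assms by blast
  have h: "((\<lambda>z. \<Sum>x\<in>A. F s z * g t (y - x - z)) has_sum (\<Sum>x\<in>A. conv (F s) (g t) (y - x))) UNIV"
    unfolding conv_def[of "F s"] by (intro has_sum_finite_sum assms(4) has_sum_infsum F_g_summable s assms(1))
  have e: "(\<Sum>x\<in>A. F s z * g t (y - x - z)) = F s z * (\<Sum>x\<in>A. g t (y - z - x))" for z
    by (simp add: sum_distrib_left algebra_simps)
  have "(\<Sum>x\<in>A. g t (y - x)) \<le> (\<Sum>x\<in>A. g s (y - x) + (t - s) * conv (F s) (g t) (y - x))"
    by (intro sum_mono g_upper assms)
  also have "\<dots> = (\<Sum>x\<in>A. g s (y - x)) + (t - s) * (\<Sum>x\<in>A. conv (F s) (g t) (y - x))"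
    by (simp add: sum.distrib sum_distrib_left)
  also have "(\<Sum>x\<in>A. conv (F s) (g t) (y - x)) = (\<Sum>\<^sub>\<infinity>z. F s z * (\<Sum>x\<in>A. g t (y - z - x)))"
    using infsumI[OF h] by (simp add: e)
  finally show "(\<Sum>x\<in>A. g t (y - x)) \<le> (\<Sum>x\<in>A. g s (y - x)) + (t - s) * (\<Sum>\<^sub>\<infinity>z. F s z * (\<Sum>x\<in>A. g t (y - z - x)))" .
  show "(\<lambda>z. F s z * (\<Sum>x\<in>A. g t (y - z - x))) summable_on UNIV"
    using has_sum_imp_summable[OF h] by (simp add: e)
qed

end

text \<open>Transience on a single scale: a supersolution decaying like the power \<open>-3/4\<close>, which is
  above the critical exponent \<open>2 - d\<close> in every dimension \<open>d > 2\<close>.\<close>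
lemma ball_potential:
  fixes c\<^sub>0 :: real
  assumes c0: "0 < c\<^sub>0" "c\<^sub>0 \<le> 1" and d3: "3 \<le> CARD('n)"
  obtains c C where "0 < c" "0 < C" "\<And>L \<nu> \<sigma> (J :: int ^ 'n \<Rightarrow> real) I g S \<xi> s t y.
    scales c\<^sub>0 \<nu> \<sigma> J I g S \<xi> \<Longrightarrow> 1 \<le> L \<Longrightarrow> \<nu> \<le> 1 / 32768 \<Longrightarrow> \<nu> \<le> 1 / (32 * L\<^sup>2) \<Longrightarrow> L powr \<nu> \<le> 2 \<Longrightarrow>
    t \<in> I \<Longrightarrow> 0 \<le> s \<Longrightarrow> s \<le> t \<Longrightarrow> \<xi> t \<le> L * \<xi> s \<Longrightarrow>
    (\<Sum>x | l2 x \<le> \<xi> s. g t (y - x)) \<le> C * S s * (1 + (l2 y / \<xi> s)\<^sup>2) powr (- (3/8)) * exp (- c * (l2 y / \<xi> t))"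
proof -
  define d where "d = real CARD('n)"
  have d: "3 \<le> d" using d3 by (simp add: d_def)
  define a where "a = c\<^sub>0 / (4 * d)"
  define K where "K = 64 * d"
  have a: "0 < a" using c0 d by (simp add: a_def)
  have K: "0 < K" "0 \<le> K" using d by (auto simp: K_def)
  define \<alpha> where "\<alpha> = (3/8 :: real)"
  obtain CS where CS: "0 < CS" and SH: "\<And>(P :: int ^ 'n \<Rightarrow> real) \<rho> m \<xi> c \<alpha> x.
    kernel a K \<rho> P \<Longrightarrow> 0 \<le> \<alpha> \<Longrightarrow> \<alpha> \<le> real CARD('n) \<Longrightarrow> 0 < c \<Longrightarrow> c \<le> 1 \<Longrightarrow> c \<le> a / 2 \<Longrightarrow>
    \<rho> \<le> \<xi> \<Longrightarrow> 0 < m \<Longrightarrow> \<rho>\<^sup>2 \<le> (l2 x)\<^sup>2 + m \<Longrightarrow>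
    (\<lambda>z. P z * (of_bool (\<rho>\<^sup>2 \<le> (l2 (x - z))\<^sup>2 + m) * fw \<alpha> (c / \<xi>) (\<xi>\<^sup>2) ((l2 (x - z))\<^sup>2 + m))) summable_on UNIV \<and>
    (\<Sum>\<^sub>\<infinity>z. P z * (of_bool (\<rho>\<^sup>2 \<le> (l2 (x - z))\<^sup>2 + m) * fw \<alpha> (c / \<xi>) (\<xi>\<^sup>2) ((l2 (x - z))\<^sup>2 + m)))
    \<le> fw \<alpha> (c / \<xi>) (\<xi>\<^sup>2) ((l2 x)\<^sup>2 + m) *
      (1 - \<alpha> * \<rho>\<^sup>2 * (m + (real CARD('n) - 2 - 2 * \<alpha>) / real CARD('n) * (l2 x)\<^sup>2) / ((l2 x)\<^sup>2 + m)\<^sup>2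
       + CS * (c * \<rho>\<^sup>2 / \<xi>\<^sup>2 + \<rho> ^ 4 / ((l2 x)\<^sup>2 + m)\<^sup>2))"
    by (rule kernel_superharmonic[OF a K(2), where ?'n = 'n]) (rule that)
  \<comment> \<open>CS * c \<le> 1/8 keeps the error caused by the exponential factor below the
    killing.\<close>
  define c where "c = min (min 1 (a / 2)) (1 / (8 * CS))"
  have c: "0 < c" "c \<le> 1" "c \<le> a / 2" "CS * c \<le> 1 / 8"
  proof -
    show "0 < c" "c \<le> 1" "c \<le> a / 2" using a CS by (auto simp: c_def)
    have "CS * c \<le> CS * (1 / (8 * CS))" using CS by (intro mult_left_mono) (auto simp: c_def)
    then show "CS * c \<le> 1 / 8" using CS by simp
  qed
  \<comment> \<open>The offset m = M \<rho>^2 is so large that half of the gain \<alpha> \<rho>^2 m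
    / \<tau>^2 absorbs the fourth-order error CS \<rho>^4 / \<tau>^2.\<close>
  define M where "M = 1 + 2 * CS / \<alpha>"
  have M: "1 \<le> M" "CS \<le> \<alpha> * M / 2" using CS by (auto simp: M_def \<alpha>_def)
  define W where "W = 48 / (a / 2) ^ 4 + 2 * M\<^sup>2"
  have W: "0 < W" using a M by (auto simp: W_def intro!: add_pos_pos)
  \<comment> \<open>Chosen so that the source, the mass of g s in the ball, is at most the gain
    \<open>x y\<close> times the supersolution.\<close>
  define C where "C = 8 * d / \<alpha> * (K * exp (a + c * (sqrt M + 1)) * W)"
  have C: "0 < C" using d K W by (auto simp: C_def \<alpha>_def)
  show ?thesis
  proof (rule that[OF c(1) C])
    fix L \<nu> \<sigma> :: real and J :: "int ^ 'n \<Rightarrow> real" and I g S \<xi> s t y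
    assume sc: "scales c\<^sub>0 \<nu> \<sigma> J I g S \<xi>" and L: "1 \<le> L" and nu1: "\<nu> \<le> 1 / 32768" and nu2: "\<nu> \<le> 1 / (32 * L\<^sup>2)"
      and Ln: "L powr \<nu> \<le> 2" and t: "t \<in> I" "0 \<le> s" "s \<le> t" and xL: "\<xi> t \<le> L * \<xi> s"
    interpret scales c\<^sub>0 \<nu> \<sigma> J I g S \<xi> by (rule sc)
    have s: "s \<in> I" using I_down t by blast
    define \<rho> where "\<rho> = \<xi> s"
    define X where "X = \<xi> t"
    have rX: "0 < \<rho>" "0 < X" "\<rho> \<le> X" "X \<le> L * \<rho>" using xi_pos s t xi_mono xL by (auto simp: \<rho>_def X_def)
    have p: "0 < S s" "0 < S t" using S_ge_1[OF s] S_ge_1[OF t(1)] by auto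
    define m where "m = M * \<rho>\<^sup>2"
    have m: "0 < m" "\<rho>\<^sup>2 \<le> m" using M rX mult_right_mono[of 1 M "\<rho>\<^sup>2"] by (auto simp: m_def)
    define \<tau> where "\<tau> = (\<lambda>y::int ^ 'n. (l2 y)\<^sup>2 + m)"
    have tau: "0 < \<tau> y" "\<rho>\<^sup>2 \<le> \<tau> y" "m \<le> \<tau> y" for y using m by (auto simp: \<tau>_def add_nonneg_pos add_increasing)
    define f where "f = (\<lambda>y. fw \<alpha> (c / X) (X\<^sup>2) (\<tau> y))"
    have f0: "0 < f y" for y unfolding f_def by (rule fw_pos[OF tau(1)])
    define B where "B = {x :: int ^ 'n. l2 x \<le> \<rho>}"
    have B: "finite B" unfolding B_def by (rule finite_l2_ball)
    define q where "q = \<rho>\<^sup>2 / X\<^sup>2"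
    have q: "0 < q" "q \<le> 1" "1 / L\<^sup>2 \<le> q"
    proof -
      show "0 < q" using rX by (simp add: q_def)
      show "q \<le> 1" using rX power_mono[OF rX(3), of 2] by (simp add: q_def)
      have "X\<^sup>2 \<le> (L * \<rho>)\<^sup>2" using rX by (intro power_mono) auto
      then show "1 / L\<^sup>2 \<le> q" using rX L by (simp add: q_def power_mult_distrib field_simps)
    qed
    have kq: "q / 2 \<le> S s / S t"
      using S_ratio(1)[OF t xL Ln] by (simp add: q_def \<rho>_def X_def power_divide)
    have nq: "2 * \<nu> \<le> q / 16" using nu2 q(3) by simp
    have tS: "(t - s) * S s \<le> 1 - 7 * q / 16" using kill_le(1)[OF t] kq nq by linarith
    \<comment> \<open>The part of the drift gain kept for the source; it is available because d - 2
      - 2 \<alpha> \<ge> 1/4 for \<alpha> = 3/8 and d \<ge> 3.\<close>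
    define x where "x = (\<lambda>y. \<alpha> / (8 * d) * (\<rho>\<^sup>2 / \<tau> y))"
    have x: "0 \<le> x y" "x y \<le> 1 / 2" for y
    proof -
      show "0 \<le> x y" using tau[of y] d by (simp add: x_def \<alpha>_def)
      have "x y \<le> \<alpha> / (8 * d) * 1" unfolding x_def using tau[of y] d by (intro mult_left_mono) (auto simp: \<alpha>_def)
      also have "\<dots> \<le> 1 / 2" using d by (simp add: \<alpha>_def divide_simps)
      finally show "x y \<le> 1 / 2" .
    qed
    note ker = F_kernel_explicit[OF s nu1, folded d_def, folded a_def K_def \<rho>_def]
    have super: "(\<lambda>z. F s z / S s * f (y - z)) summable_on UNIV" "(\<Sum>\<^sub>\<infinity>z. F s z / S s * f (y - z)) \<le> f y * (1 - x y + q / 8)" for y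
    proof -
      have ob: "of_bool (\<rho>\<^sup>2 \<le> (l2 (y - z))\<^sup>2 + m) = (1::real)" for z using tau(2)[of "y - z"] by (simp add: \<tau>_def)
      note SHy = SH[OF ker, of \<alpha> c X m y, OF _ _ c(1-3) rX(3) m(1) tau(2)[unfolded \<tau>_def], unfolded ob mult_1]
      have al: "0 \<le> \<alpha>" "\<alpha> \<le> real CARD('n)" using d by (auto simp: \<alpha>_def d_def)
      have sh: "(\<lambda>z. F s z / S s * f (y - z)) summable_on UNIV" 
        "(\<Sum>\<^sub>\<infinity>z. F s z / S s * f (y - z)) \<le> f y * (1 - \<alpha> * \<rho>\<^sup>2 * (m + (d - 2 - 2 * \<alpha>) / d * (l2 y)\<^sup>2) / (\<tau> y)\<^sup>2 + CS * (c * \<rho>\<^sup>2 / X\<^sup>2 + \<rho> ^ 4 / (\<tau> y)\<^sup>2))"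
        unfolding f_def \<tau>_def d_def using SHy al by blast+
      show "(\<lambda>z. F s z / S s * f (y - z)) summable_on UNIV" by (rule sh(1))
      have "CS * (c * \<rho>\<^sup>2 / X\<^sup>2) \<le> q / 8" using mult_right_mono[OF c(4), of q] q by (simp add: q_def)
      moreover have "x y + CS * (\<rho> ^ 4 / (\<tau> y)\<^sup>2) \<le> \<alpha> * \<rho>\<^sup>2 * (m + (d - 2 - 2 * \<alpha>) / d * (l2 y)\<^sup>2) / (\<tau> y)\<^sup>2"
      proof -
        have "x y + CS * (\<rho> ^ 4 / (\<tau> y)\<^sup>2) = (\<alpha> * \<rho>\<^sup>2 * (\<tau> y / (8 * d)) + CS * \<rho>\<^sup>2 * \<rho>\<^sup>2) / (\<tau> y)\<^sup>2"
          using tau(1)[of y] d by (simp add: x_def field_simps eval_nat_numeral)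
        also have "\<dots> \<le> (\<alpha> * \<rho>\<^sup>2 * (m + (d - 2 - 2 * \<alpha>) / d * (l2 y)\<^sup>2)) / (\<tau> y)\<^sup>2"
        proof (intro divide_right_mono)
          have "CS * \<rho>\<^sup>2 \<le> \<alpha> * M / 2 * \<rho>\<^sup>2" using M by (intro mult_right_mono) auto
          then have "CS * \<rho>\<^sup>2 * \<rho>\<^sup>2 \<le> \<alpha> * m / 2 * \<rho>\<^sup>2" by (intro mult_right_mono) (auto simp: m_def)
          moreover have "\<alpha> * \<rho>\<^sup>2 * (\<tau> y / (8 * d)) \<le> \<alpha> * \<rho>\<^sup>2 * (m / 2 + (d - 2 - 2 * \<alpha>) / d * (l2 y)\<^sup>2)"
          proof (intro mult_left_mono)
            have "m / (8 * d) \<le> m / 2" using m d by (intro divide_left_mono) auto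
            moreover have "(l2 y)\<^sup>2 * (1 / (8 * d)) \<le> (l2 y)\<^sup>2 * ((d - 2 - 2 * \<alpha>) / d)"
              using d by (intro mult_left_mono) (auto simp: \<alpha>_def divide_simps)
            ultimately show "\<tau> y / (8 * d) \<le> m / 2 + (d - 2 - 2 * \<alpha>) / d * (l2 y)\<^sup>2"
              by (simp add: \<tau>_def add_divide_distrib mult.commute)
          qed (auto simp: \<alpha>_def)
          ultimately show "\<alpha> * \<rho>\<^sup>2 * (\<tau> y / (8 * d)) + CS * \<rho>\<^sup>2 * \<rho>\<^sup>2 \<le> \<alpha> * \<rho>\<^sup>2 * (m + (d - 2 - 2 * \<alpha>) / d * (l2 y)\<^sup>2)"
            by (simp add: algebra_simps)
        qed auto
        finally show ?thesis .
      qed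
      ultimately have "1 - \<alpha> * \<rho>\<^sup>2 * (m + (d - 2 - 2 * \<alpha>) / d * (l2 y)\<^sup>2) / (\<tau> y)\<^sup>2 + CS * (c * \<rho>\<^sup>2 / X\<^sup>2 + \<rho> ^ 4 / (\<tau> y)\<^sup>2) \<le> 1 - x y + q / 8"
        unfolding distrib_left[of CS] by linarith
      then show "(\<Sum>\<^sub>\<infinity>z. F s z / S s * f (y - z)) \<le> f y * (1 - x y + q / 8)"
        using sh(2) f0[of y] by (meson mult_left_mono order_trans less_imp_le)
    qed
    define \<Theta> where "\<Theta> = C * S s * \<rho> powr (2 * \<alpha>)"
    have Th: "0 < \<Theta>" using C p rX by (simp add: \<Theta>_def)
    have super2: "(\<lambda>z. (t - s) * F s z * (\<Theta> * f (y - z))) summable_on UNIV"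
      "(\<Sum>\<^sub>\<infinity>z. (t - s) * F s z * (\<Theta> * f (y - z))) \<le> (1 - x y) * (\<Theta> * f y)" for y
    proof -
      have e: "(t - s) * F s z * (\<Theta> * f (y - z)) = ((t - s) * S s * \<Theta>) * (F s z / S s * f (y - z))" for z using p by simp
      show "(\<lambda>z. (t - s) * F s z * (\<Theta> * f (y - z))) summable_on UNIV" unfolding e by (rule summable_on_cmult_right[OF super(1)])
      have "(\<Sum>\<^sub>\<infinity>z. (t - s) * F s z * (\<Theta> * f (y - z))) = ((t - s) * S s * \<Theta>) * (\<Sum>\<^sub>\<infinity>z. F s z / S s * f (y - z))"
        unfolding e by (rule infsum_cmult_right')
      also have "\<dots> \<le> ((t - s) * S s * \<Theta>) * (f y * (1 - x y + q / 8))"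
        using super(2)[of y] t p Th by (intro mult_left_mono) auto
      also have "\<dots> = ((t - s) * S s) * (1 - x y + q / 8) * (\<Theta> * f y)" by simp
      also have "\<dots> \<le> (1 - x y) * (\<Theta> * f y)"
      proof (rule mult_right_mono)
        \<comment> \<open>The killing 7 q / 16 outweighs the error q / 8, so the full gain
          \<open>x y\<close> is left.\<close>
        have "(t - s) * S s * (1 - x y + q / 8) \<le> (1 - 7 * q / 16) * (1 - x y + q / 8)"
          using tS x[of y] q by (intro mult_right_mono) auto
        also have "\<dots> = 1 - x y - 5 * q / 16 + 7 / 16 * (q * x y) - 7 / 128 * q\<^sup>2"
          by (simp add: field_simps power2_eq_square)
        also have "\<dots> \<le> 1 - x y"
        proof -
          have "q * x y \<le> q * (1 / 2)" using x[of y] q by (intro mult_left_mono) auto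
          moreover have "0 \<le> q\<^sup>2" by simp
          ultimately show ?thesis using q by linarith
        qed
        finally show "(t - s) * S s * (1 - x y + q / 8) \<le> 1 - x y" .
      qed (use Th f0[of y] in auto)
      finally show "(\<Sum>\<^sub>\<infinity>z. (t - s) * F s z * (\<Theta> * f (y - z))) \<le> (1 - x y) * (\<Theta> * f y)" .
    qed
    note em = exp_moments_explicit(1,2)[OF s nu1, folded d_def, folded a_def K_def \<rho>_def]
    have bb: "(\<Sum>x\<in>B. g s (y - x)) \<le> K * S s * exp a * exp (- a * (l2 y / \<rho>))" for y
    proof -
      have sE: "(\<lambda>w. g s w * exp (a * (l2 w / \<rho>))) summable_on UNIV"
        by (rule esum_summable[OF em(1), of _ 1]) simp
      have "(\<Sum>x\<in>B. g s (y - x)) \<le> (\<Sum>x\<in>B. exp (a - a * (l2 y / \<rho>)) * (g s (y - x) * exp (a * (l2 (y - x) / \<rho>))))"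
      proof (rule sum_mono)
        fix x assume "x \<in> B"
        then have "l2 x \<le> \<rho>" by (simp add: B_def)
        then have "l2 y - \<rho> \<le> l2 (y - x)" using l2_triangle[of "y - x" x] by simp
        then have "(l2 y - \<rho>) / \<rho> \<le> l2 (y - x) / \<rho>" using rX by (intro divide_right_mono) auto
        then have "a * (l2 y / \<rho> - 1) \<le> a * (l2 (y - x) / \<rho>)" using a rX by (intro mult_left_mono) (auto simp: diff_divide_distrib)
        then have "0 \<le> a - a * (l2 y / \<rho>) + a * (l2 (y - x) / \<rho>)" by (simp add: algebra_simps)
        then have "1 \<le> exp (a - a * (l2 y / \<rho>)) * exp (a * (l2 (y - x) / \<rho>))" by (simp flip: exp_add)
        from mult_left_mono[OF this g_nonneg[OF s, of "y - x"]]
        show "g s (y - x) \<le> exp (a - a * (l2 y / \<rho>)) * (g s (y - x) * exp (a * (l2 (y - x) / \<rho>)))" by (simp add: mult_ac)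
      qed
      also have "\<dots> = exp (a - a * (l2 y / \<rho>)) * (\<Sum>w\<in>(\<lambda>x. y - x) ` B. g s w * exp (a * (l2 w / \<rho>)))"
        by (subst sum.reindex) (auto simp: inj_on_def sum_distrib_left)
      also have "(\<Sum>w\<in>(\<lambda>x. y - x) ` B. g s w * exp (a * (l2 w / \<rho>))) \<le> (\<Sum>\<^sub>\<infinity>w. g s w * exp (a * (l2 w / \<rho>)))"
        using B g_nonneg[OF s] by (intro finite_sum_le_infsum[OF sE]) auto
      also have "\<dots> \<le> K * S s" by (rule em(2))
      finally have "(\<Sum>x\<in>B. g s (y - x)) \<le> exp (a - a * (l2 y / \<rho>)) * (K * S s)" by simp
      also have "\<dots> = K * S s * exp a * exp (- a * (l2 y / \<rho>))" by (simp add: exp_diff exp_minus divide_inverse)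
      finally show ?thesis .
    qed
    have fdec: "\<rho> powr (2 * \<alpha>) * f y = ((l2 y / \<rho>)\<^sup>2 + M) powr (- \<alpha>) * exp (- (c / X) * sqrt (\<tau> y + X\<^sup>2))" for y
    proof -
      have e: "\<tau> y = \<rho>\<^sup>2 * ((l2 y / \<rho>)\<^sup>2 + M)" using rX by (simp add: \<tau>_def m_def field_simps)
      have "\<rho> powr (2 * \<alpha>) = (\<rho>\<^sup>2) powr \<alpha>" using rX powr_powr[of \<rho> 2 \<alpha>] by simp
      then have "\<rho> powr (2 * \<alpha>) * (\<tau> y) powr (- \<alpha>) = ((l2 y / \<rho>)\<^sup>2 + M) powr (- \<alpha>)"
        unfolding e using rX M by (subst powr_mult) (auto simp: powr_minus)
      then show ?thesis by (simp add: f_def fw_def mult.assoc[symmetric])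
    qed
    \<comment> \<open>The source decays exponentially at the scale \<rho>; this beats the power w^(1
      + \<alpha>) that arises from dividing by the gain and by the weight.\<close>
    have bx: "(\<Sum>x\<in>B. g s (y - x)) \<le> x y * (\<Theta> * f y)" for y
    proof -
      define v where "v = l2 y / \<rho>"
      have v: "0 \<le> v" using rX by (simp add: v_def)
      define w where "w = v\<^sup>2 + M"
      have w: "1 \<le> w" using M by (simp add: w_def add_increasing)
      then have "0 < w" by linarith
      note w = w this
      have tw: "\<rho>\<^sup>2 / \<tau> y = 1 / w" using rX by (simp add: \<tau>_def m_def w_def v_def field_simps)
      have E: "exp (- (c * v) - c * (sqrt M + 1)) \<le> exp (- (c / X) * sqrt (\<tau> y + X\<^sup>2))"
      proof -
        have "sqrt (\<tau> y + X\<^sup>2) \<le> l2 y + sqrt M * \<rho> + X"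
        proof (rule real_le_lsqrt)
          have "(sqrt M * \<rho>)\<^sup>2 = m" using M by (simp add: m_def power_mult_distrib)
          moreover have "0 \<le> l2 y * (sqrt M * \<rho>)" "0 \<le> l2 y * X" "0 \<le> sqrt M * \<rho> * X" using M rX by auto
          ultimately show "\<tau> y + X\<^sup>2 \<le> (l2 y + sqrt M * \<rho> + X)\<^sup>2"
            by (simp add: \<tau>_def power2_sum distrib_right)
        qed (use M rX in auto)
        then have "c / X * sqrt (\<tau> y + X\<^sup>2) \<le> c / X * (l2 y + sqrt M * \<rho> + X)" using c rX by (intro mult_left_mono) auto
        also have "\<dots> = c * (l2 y / X) + c * (sqrt M * (\<rho> / X)) + c" using rX by (simp add: field_simps)
        also have "\<dots> \<le> c * v + c * (sqrt M * 1) + c"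
          using c rX M unfolding v_def by (intro add_mono mult_left_mono divide_left_mono) auto
        finally show ?thesis by (simp add: algebra_simps)
      qed
      have w2: "w powr (1 + \<alpha>) \<le> W * exp (a / 2 * v)"
      proof -
        have "w powr (1 + \<alpha>) \<le> w powr 2" using w by (intro powr_mono) (auto simp: \<alpha>_def)
        also have "\<dots> = w\<^sup>2" using w by simp
        also have "\<dots> \<le> 2 * v ^ 4 + 2 * M\<^sup>2"
          using sum_squares_bound[of "v\<^sup>2" M] by (simp add: w_def power2_sum flip: power_mult)
        also have "\<dots> \<le> 2 * (24 / (a / 2) ^ 4 * exp (a / 2 * v)) + 2 * M\<^sup>2 * exp (a / 2 * v)"
        proof (intro add_mono mult_left_mono)
          show "v ^ 4 \<le> 24 / (a / 2) ^ 4 * exp (a / 2 * v)"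
            using power_le_exp[OF v, of "a / 2" 4] a by (simp add: fact_numeral)
          have "1 \<le> exp (a / 2 * v)" using a v by simp
          from mult_left_mono[OF this, of "2 * M\<^sup>2"] show "2 * M\<^sup>2 \<le> 2 * M\<^sup>2 * exp (a / 2 * v)" by simp
        qed auto
        also have "\<dots> = W * exp (a / 2 * v)" by (simp add: W_def algebra_simps)
        finally show ?thesis .
      qed
      have "exp (- a * v) * exp (a / 2 * v) \<le> exp (- (c * v))"
        using mult_right_mono[OF c(3) v] by (simp flip: exp_add add: algebra_simps)
      then have Wm: "W * (exp (- a * v) * exp (a / 2 * v)) \<le> W * exp (- (c * v))" using W by (intro mult_left_mono) auto
      have "exp (- a * v) * w powr (1 + \<alpha>) \<le> exp (- a * v) * (W * exp (a / 2 * v))"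
        using w2 by (rule mult_left_mono) simp
      also have "\<dots> = W * (exp (- a * v) * exp (a / 2 * v))" by (simp only: mult_ac)
      also note Wm
      finally have key: "exp (- a * v) * w powr (1 + \<alpha>) \<le> W * exp (- (c * v))" .
      have wm: "w powr (1 + \<alpha>) * (1 / w * w powr (- \<alpha>)) = 1" using w by (simp add: powr_add powr_minus field_simps)
      have "K * S s * exp a * exp (- a * v) = K * S s * exp a * (exp (- a * v) * w powr (1 + \<alpha>)) * (1 / w * w powr (- \<alpha>))"
        using wm by (simp add: mult.assoc)
      also have "\<dots> \<le> K * S s * exp a * (W * exp (- (c * v))) * (1 / w * w powr (- \<alpha>))"
        using key K p w by (intro mult_right_mono mult_left_mono) auto
      also have "\<dots> = \<alpha> / (8 * d) * (1 / w) * (C * S s * (w powr (- \<alpha>) * exp (- (c * v) - c * (sqrt M + 1))))"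
        using d by (simp add: C_def \<alpha>_def exp_diff exp_add)
      also have "\<dots> \<le> \<alpha> / (8 * d) * (1 / w) * (C * S s * (w powr (- \<alpha>) * exp (- (c / X) * sqrt (\<tau> y + X\<^sup>2))))"
        using E d C p w by (intro mult_left_mono) (auto simp: \<alpha>_def)
      also have "w powr (- \<alpha>) * exp (- (c / X) * sqrt (\<tau> y + X\<^sup>2)) = \<rho> powr (2 * \<alpha>) * f y"
        unfolding fdec w_def v_def ..
      also have "\<alpha> / (8 * d) * (1 / w) * (C * S s * (\<rho> powr (2 * \<alpha>) * f y)) = x y * (\<Theta> * f y)"
        unfolding x_def tw \<Theta>_def by (simp only: mult.assoc)
      finally show ?thesis using bb[of y] by (simp add: v_def)
    qed
    have main: "(\<Sum>x\<in>B. g t (y - x)) \<le> \<Theta> * f y"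
    proof (rule comparison_principle[where A = "\<lambda>z. (t - s) * F s z" and b = "\<lambda>y. \<Sum>x\<in>B. g s (y - x)" and B = "real (card B) * S t"
          and U = "\<lambda>y. \<Sum>x\<in>B. g t (y - x)" and \<Psi> = "\<lambda>y. \<Theta> * f y"])
      show "0 \<le> (t - s) * F s z" for z using t F_nonneg[OF s] by simp
      show "(\<lambda>z. (t - s) * F s z) summable_on UNIV" by (rule summable_on_cmult_right[OF F_summable[OF s]])
      show "(\<Sum>\<^sub>\<infinity>z. (t - s) * F s z) < 1" using tS q infsumI[OF F_has_sum[OF s]] by (simp add: infsum_cmult_right')
      show "0 \<le> (\<Sum>x\<in>B. g t (y - x))" for y by (intro sum_nonneg g_nonneg t)
      show "(\<Sum>x\<in>B. g t (y - x)) \<le> real (card B) * S t" for y by (rule sum_bounded_above[OF g_le_S[OF t(1)]])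
      show "0 \<le> \<Theta> * f y" for y using Th f0[of y] by simp
      show "(\<Sum>x\<in>B. g t (y - x)) \<le> (\<Sum>x\<in>B. g s (y - x)) + (\<Sum>\<^sub>\<infinity>z. (t - s) * F s z * (\<Sum>x\<in>B. g t (y - z - x)))" for y
        using g_upper_sum(1)[OF t B, of y] by (simp add: infsum_cmult_right' mult.assoc)
      show "(\<lambda>z. (t - s) * F s z * (\<Theta> * f (y - z))) summable_on UNIV" for y by (rule super2(1))
      show "(\<Sum>x\<in>B. g s (y - x)) + (\<Sum>\<^sub>\<infinity>z. (t - s) * F s z * (\<Theta> * f (y - z))) \<le> \<Theta> * f y" for y
        using bx[of y] super2(2)[of y] by (simp add: left_diff_distrib)
    qed
    also have "\<Theta> * f y = C * S s * (((l2 y / \<rho>)\<^sup>2 + M) powr (- \<alpha>) * exp (- (c / X) * sqrt (\<tau> y + X\<^sup>2)))"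
      using fdec[of y] by (simp add: \<Theta>_def mult.assoc)
    also have "\<dots> \<le> C * S s * ((1 + (l2 y / \<rho>)\<^sup>2) powr (- \<alpha>) * exp (- c * (l2 y / X)))"
    proof (intro mult_left_mono mult_mono)
      show "((l2 y / \<rho>)\<^sup>2 + M) powr (- \<alpha>) \<le> (1 + (l2 y / \<rho>)\<^sup>2) powr (- \<alpha>)"
        using M by (intro powr_mono2') (auto simp: \<alpha>_def add_pos_nonneg)
      have "l2 y \<le> sqrt (\<tau> y + X\<^sup>2)" using m by (intro real_le_rsqrt) (auto simp: \<tau>_def)
      then have "c / X * l2 y \<le> c / X * sqrt (\<tau> y + X\<^sup>2)" using c rX by (intro mult_left_mono) auto
      then show "exp (- (c / X) * sqrt (\<tau> y + X\<^sup>2)) \<le> exp (- c * (l2 y / X))" by simp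
    qed (use C p in auto)
    finally show "(\<Sum>x | l2 x \<le> \<xi> s. g t (y - x)) \<le> C * S s * (1 + (l2 y / \<xi> s)\<^sup>2) powr (- (3/8)) * exp (- c * (l2 y / \<xi> t))"
      by (simp add: B_def \<rho>_def X_def \<alpha>_def mult.assoc)
  qed
qed

text \<open>The first dyadic scale above v carries the weight up to the factor 2^(9/4) \<le> 8; the
  last term serves v beyond all the scales.\<close>

lemma dyadic_weight_bound:
  fixes v :: real
  assumes "0 \<le> v"
  shows "(1 + v) powr (- (9/4)) \<le> 8 * ((\<Sum>j<n. (2 ^ j) powr (- (9/4)) * of_bool (v \<le> 2 ^ j)) + (2 ^ n) powr (- (9/4)))"
proof (induction n)
  case 0
  have "(1 + v) powr (- (9/4)) \<le> 1 powr (- (9/4))" using assms by (intro powr_mono2') auto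
  then show ?case by simp
next
  case (Suc n)
  show ?case
  proof (cases "v \<le> 2 ^ n")
    case True
    then show ?thesis using Suc by (simp add: add_increasing2)
  next
    case False
    have "(1 + v) powr (- (9/4)) \<le> (2 ^ n) powr (- (9/4))" using False assms by (intro powr_mono2') auto
    also have "\<dots> = 2 powr (9/4) * (2 ^ Suc n) powr (- (9/4))" by (simp add: powr_mult powr_minus)
    also have "\<dots> \<le> 2 powr 3 * (2 ^ Suc n) powr (- (9/4))" by (intro mult_right_mono powr_mono) auto
    also have "\<dots> \<le> 8 * ((\<Sum>j<Suc n. (2 ^ j) powr (- (9/4)) * of_bool (v \<le> 2 ^ j)) + (2 ^ Suc n) powr (- (9/4)))"
      by (simp add: sum_nonneg add_nonneg_nonneg)
    finally show ?thesis .
  qed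
qed

text \<open>The exponent 1/8 is 9/4 - 17/8, the room between the decay of the weights and the growth
  of \<open>S\<close>.\<close>

lemma sum_dyadic_le:
  "(\<Sum>j<n. (2 ^ j :: real) powr (- (1/8))) \<le> 1 / (1 - 2 powr (- (1/8)))"
proof -
  define r where "r = (2::real) powr (- (1/8))"
  have r: "0 < r" "r < 1" using powr_less_mono[of "- (1/8)" 0 "2::real"] by (auto simp: r_def)
  have "(2 ^ j :: real) powr (- (1/8)) = r ^ j" for j
    by (simp add: r_def powr_powr powr_realpow[symmetric] mult.commute)
  then have "(\<Sum>j<n. (2 ^ j :: real) powr (- (1/8))) = (\<Sum>j<n. r ^ j)" by simp
  also have "\<dots> \<le> (\<Sum>j. r ^ j)" using r by (intro sum_le_suminf) auto
  also have "\<dots> = 1 / (1 - r)" using r by (intro suminf_geometric) auto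
  finally show ?thesis by (simp add: r_def)
qed

text \<open>The largest ratio \<open>q\<close> of the mass in the ball of radius \<open>\<xi> s\<close> to \<open>S s\<close> is bounded by a constant plus
  \<open>q / 2\<close>: starting from the larger scale \<open>L * \<xi> s\<close>, the mass reaching the ball is at most
  a sum over dyadic annuli whose masses are again controlled by \<open>q\<close>.\<close>
lemma local_mass:
  fixes c\<^sub>0 :: real
  assumes c0: "0 < c\<^sub>0" "c\<^sub>0 \<le> 1" and d3: "3 \<le> CARD('n)"
  obtains Q \<nu>0 where "1 \<le> Q" "0 < \<nu>0" "\<And>\<nu> \<sigma> (J :: int ^ 'n \<Rightarrow> real) I g S \<xi> s t.
    scales c\<^sub>0 \<nu> \<sigma> J I g S \<xi> \<Longrightarrow> \<nu> \<le> \<nu>0 \<Longrightarrow> t \<in> I \<Longrightarrow> 0 \<le> s \<Longrightarrow> s \<le> t \<Longrightarrow>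
    (\<Sum>x | l2 x \<le> \<xi> s. g t x) \<le> Q * S s"
proof -
  obtain c C where c: "0 < c" and C: "0 < C" and pot: "\<And>L \<nu> \<sigma> (J :: int ^ 'n \<Rightarrow> real) I g S \<xi> s t y.
    scales c\<^sub>0 \<nu> \<sigma> J I g S \<xi> \<Longrightarrow> 1 \<le> L \<Longrightarrow> \<nu> \<le> 1 / 32768 \<Longrightarrow> \<nu> \<le> 1 / (32 * L\<^sup>2) \<Longrightarrow> L powr \<nu> \<le> 2 \<Longrightarrow>
    t \<in> I \<Longrightarrow> 0 \<le> s \<Longrightarrow> s \<le> t \<Longrightarrow> \<xi> t \<le> L * \<xi> s \<Longrightarrow>
    (\<Sum>x | l2 x \<le> \<xi> s. g t (y - x)) \<le> C * S s * (1 + (l2 y / \<xi> s)\<^sup>2) powr (- (3/8)) * exp (- c * (l2 y / \<xi> t))"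
    by (rule ball_potential[OF c0 d3]) (rule that)
  define k where "k = sqrt (real CARD('n)) / c\<^sub>0"
  have k: "0 \<le> k" using c0 by (simp add: k_def)
  \<comment> \<open>The factor 2 comes from comparing 1 + v^2 with (1 + v)^2, the factor 2 + 4 / c^2
    from trading an exponential for a power, and (1 + k)^3 from the range of
    \<open>J\<close>.\<close>
  define K1 where "K1 = 2 * (2 + 4 / c\<^sup>2) * (1 + k) ^ 3"
  have K1: "0 < K1" using k by (auto simp: K1_def intro!: mult_pos_pos add_pos_nonneg)
  define G where "G = 1 / (1 - 2 powr (- (1/8)) :: real)"
  have G: "1 \<le> G"
  proof -
    have "(2::real) powr (- (1/8)) < 1" using powr_less_mono[of "- (1/8)" 0 "2::real"] by simp
    moreover have "0 < (2::real) powr (- (1/8))" by simp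
    ultimately show ?thesis unfolding G_def by (simp add: le_divide_eq)
  qed
  define K2 where "K2 = 16 * C * K1"
  have K2: "0 < K2" using C K1 by (simp add: K2_def)
  \<comment> \<open>The net power of L is -3/8: L^(3/2) is lost in trading the exponential and
    L^(-15/8) gained from 1 / S u. Hence a large L makes the coefficient of q at most 1/2.\<close>
  define L where "L = max 2 ((2 * K2 * G) powr (8/3))"
  have L: "2 \<le> L" "0 < L" by (auto simp: L_def)
  have LK: "K2 * L powr (- (3/8)) * G \<le> 1 / 2" 
  proof -
    have "2 * K2 * G = ((2 * K2 * G) powr (8/3)) powr (3/8)" using K2 G by (simp add: powr_powr)
    also have "\<dots> \<le> L powr (3/8)" by (intro powr_mono2) (auto simp: L_def)
    finally have "2 * K2 * G * L powr (- (3/8)) \<le> L powr (3/8) * L powr (- (3/8))" by (intro mult_right_mono) auto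
    also have "\<dots> = 1" using L by (simp flip: powr_add)
    finally show ?thesis by (simp add: mult_ac)
  qed
  have LK1: "K2 * L powr (- (3/8)) \<le> 1"
  proof -
    have "K2 * L powr (- (3/8)) * 1 \<le> K2 * L powr (- (3/8)) * G" using G K2 by (intro mult_left_mono) auto
    then show ?thesis using LK by linarith
  qed
  \<comment> \<open>Meets the hypotheses of \<open>ball_potential\<close> for this L; the last entry
    yields L powr \<nu> \<le> 2.\<close>
  define \<nu>0 where "\<nu>0 = min (1 / 32768) (min (1 / (32 * L\<^sup>2)) (ln 2 / ln L))"
  \<comment> \<open>The solution of q = L^3 + 1 + q / 2.\<close>
  define Q where "Q = 2 * L ^ 3 + 2"
  show ?thesis
  proof (rule that[of Q \<nu>0])
    show "1 \<le> Q" using L by (simp add: Q_def)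
    show "0 < \<nu>0" using L by (simp add: \<nu>0_def)
    fix \<nu> \<sigma> :: real and J :: "int ^ 'n \<Rightarrow> real" and I g S \<xi> s0 t
    assume sc: "scales c\<^sub>0 \<nu> \<sigma> J I g S \<xi>" and nu0: "\<nu> \<le> \<nu>0" and t: "t \<in> I" and s0: "0 \<le> s0" "s0 \<le> t"
    interpret scales c\<^sub>0 \<nu> \<sigma> J I g S \<xi> by (rule sc)
    have nus: "\<nu> \<le> 1 / 32768" "\<nu> \<le> 1 / (32 * L\<^sup>2)" "\<nu> \<le> 1 / 8" using nu0 by (auto simp: \<nu>0_def)
    have Ln: "L powr \<nu> \<le> 2"
    proof -
      have "\<nu> \<le> ln 2 / ln L" using nu0 by (simp add: \<nu>0_def)
      then have "\<nu> * ln L \<le> ln 2" using L by (simp add: le_divide_eq)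
      then have "exp (\<nu> * ln L) \<le> exp (ln 2)" by (simp only: exp_le_cancel_iff)
      then show ?thesis using L by (simp add: powr_def)
    qed
    define mass where "mass = (\<lambda>r. \<Sum>x | l2 x \<le> r. g t x)"
    have St: "0 < S t" using S_ge_1[OF t] by simp
    have mass_le: "mass r \<le> S t" for r
      unfolding mass_def chi[OF t] by (rule finite_sum_le_infsum[OF g_summable[OF t] finite_l2_ball]) (auto intro: g_nonneg t)
    have sI: "s \<in> I" if "0 \<le> s" "s \<le> t" for s using I_down[OF t that] .
    have Sp: "1 \<le> S s" if "0 \<le> s" "s \<le> t" for s using S_ge_1[OF sI[OF that]] .
    have bdd: "bdd_above ((\<lambda>s. mass (\<xi> s) / S s) ` {0..t})"
    proof (rule bdd_aboveI2)
      fix s assume "s \<in> {0..t}"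
      then have "S t * 1 \<le> S t * S s" using Sp[of s] St by (intro mult_left_mono) auto
      then show "mass (\<xi> s) / S s \<le> S t"
        using mass_le[of "\<xi> s"] Sp[of s] \<open>s \<in> {0..t}\<close> by (simp add: divide_le_eq)
    qed
    \<comment> \<open>The supremum is finite since every ratio is at most S t; this is what permits
      absorbing q / 2 at the end.\<close>
    define q where "q = (SUP s\<in>{0..t}. mass (\<xi> s) / S s)"
    have qs: "mass (\<xi> s) \<le> q * S s" if "0 \<le> s" "s \<le> t" for s
    proof -
      have "mass (\<xi> s) / S s \<le> q" unfolding q_def by (rule cSUP_upper[OF _ bdd]) (use that in auto)
      then show ?thesis using Sp[OF that] by (simp add: divide_le_eq)
    qed
    have q0: "0 \<le> q"
    proof -
      have "0 \<le> mass (\<xi> 0)" unfolding mass_def by (intro sum_nonneg g_nonneg t)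
      then have "0 \<le> q * S 0" using qs[of 0] I_nonneg[OF t] by simp
      then show ?thesis using Sp[of 0] I_nonneg[OF t] by (simp add: zero_le_mult_iff)
    qed
    have up: "S v \<le> S u * (\<xi> v / \<xi> u) powr (17/8)" if "0 \<le> u" "u \<le> v" "v \<le> t" for u v
    proof -
      have vI: "v \<in> I" and uI: "u \<in> I" using sI that by auto
      have r1: "1 \<le> \<xi> v / \<xi> u" using xi_mono[OF vI that(1,2)] xi_pos[OF uI] by simp
      have "S v / S u \<le> (\<xi> v / \<xi> u) powr (2 + \<nu>)" by (rule growth_upper[OF vI that(1,2)])
      also have "\<dots> \<le> (\<xi> v / \<xi> u) powr (17/8)" using r1 nus by (intro powr_mono) auto
      finally show ?thesis using S_ge_1[OF uI] by (simp add: divide_le_eq mult.commute)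
    qed
    have step: "mass (\<xi> s) / S s \<le> L ^ 3 + 1 + q / 2" if s: "0 \<le> s" "s \<le> t" for s
    proof -
      note sI' = sI[OF s]
      define \<rho> where "\<rho> = \<xi> s"
      have rho: "0 < \<rho>" "\<sigma> \<le> \<rho>" "\<rho> \<le> \<xi> t" using xi_pos[OF sI'] xi_ge[OF sI'] xi_mono[OF t s] by (auto simp: \<rho>_def)
      have Ss: "1 \<le> S s" using Sp[OF s] .
      have L3: "r powr (17/8) \<le> L ^ 3" if "1 \<le> r" "r \<le> L" for r
      proof -
        have "r powr (17/8) \<le> L powr (17/8)" using that by (intro powr_mono2) auto
        also have "\<dots> \<le> L powr 3" using L by (intro powr_mono) auto
        also have "\<dots> = L ^ 3" using L by simp
        finally show ?thesis .
      qed
      show ?thesis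
      proof (cases "\<xi> t \<le> L * \<rho>")
        case True
        then have "(\<xi> t / \<rho>) powr (17/8) \<le> L ^ 3" using rho by (intro L3) (auto simp: divide_le_eq)
        then have "S s * (\<xi> t / \<rho>) powr (17/8) \<le> S s * L ^ 3" using Ss by (intro mult_left_mono) auto
        then have "mass (\<xi> s) \<le> S s * L ^ 3" using up[OF s order_refl] mass_le[of "\<xi> s"] by (simp add: \<rho>_def)
        then have "mass (\<xi> s) / S s \<le> L ^ 3" using Ss by (simp add: divide_le_eq mult.commute)
        then show ?thesis using q0 by linarith
      next
        case False
        \<comment> \<open>Restart from the scale L \<rho>. The mass of g u in the ball is at most S
          u \<le> L^3 S s; the rest arrives in the ball through F u.\<close>
        obtain u where u: "0 \<le> u" "u \<le> t" "u \<in> I" "\<xi> u = L * \<rho>"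
        proof (rule xi_ivt[OF t, of "L * \<rho>"])
          have "1 * \<rho> \<le> L * \<rho>" using rho L by (intro mult_right_mono) auto
          then show "\<sigma> \<le> L * \<rho>" using rho by linarith
        qed (use False in auto)
        have su: "s \<le> u"
        proof (rule ccontr)
          assume "\<not> s \<le> u"
          then have "\<xi> u \<le> \<xi> s" using xi_mono[OF sI' u(1)] by simp
          then have "L * \<rho> \<le> 1 * \<rho>" using u(4) by (simp add: \<rho>_def)
          then have "L \<le> 1" using rho by (simp only: mult_le_cancel_right_pos)
          then show False using L by linarith
        qed
        define B where "B = {x :: int ^ 'n. l2 x \<le> \<rho>}"
        have B: "finite B" unfolding B_def by (rule finite_l2_ball)
        define E where "E = C * S s * (K1 * L powr (3/2))"
        have E: "0 < E" using C Ss K1 L by (auto simp: E_def)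
        \<comment> \<open>The mass that F u sends from w into the ball.\<close>
        define V where "V = (\<lambda>w. \<Sum>x\<in>B. F u (x - w))"
        have Vle: "V w \<le> E * (1 + l2 w / \<rho>) powr (- (9/4))" for w
        proof -
          have "V w = (\<Sum>x\<in>B. \<Sum>z | J z \<noteq> 0. J z * g u (w - z - x))"
            unfolding V_def
          proof (rule sum.cong[OF refl])
            fix x
            have "F u (x - w) = F u (w - x)" using F_even[OF u(3), of "w - x"] by simp
            then show "F u (x - w) = (\<Sum>z | J z \<noteq> 0. J z * g u (w - z - x))"
              by (simp add: F_fin algebra_simps)
          qed
          also have "\<dots> = (\<Sum>z | J z \<noteq> 0. J z * (\<Sum>x\<in>B. g u (w - z - x)))"
            by (subst sum.swap) (simp add: sum_distrib_left)
          also have "\<dots> \<le> (\<Sum>z | J z \<noteq> 0. J z * (E * (1 + l2 w / \<rho>) powr (- (9/4))))"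
          proof (intro sum_mono mult_left_mono J_nonneg)
            fix z assume "z \<in> {z. J z \<noteq> 0}"
            then have "l2 z \<le> k * \<sigma>" using J_range[of z] by (simp add: k_def)
            also have "\<dots> \<le> k * \<rho>" using rho k by (intro mult_left_mono)
            finally have z: "l2 z \<le> k * \<rho>" .
            define v where "v = l2 w / \<rho>"
            define v' where "v' = l2 (w - z) / \<rho>"
            have v: "0 \<le> v" "0 \<le> v'" using rho by (auto simp: v_def v'_def)
            have "l2 w \<le> l2 (w - z) + k * \<rho>" using l2_triangle[of "w - z" z] z by simp
            then have "v \<le> v' + k" using rho by (simp add: v_def v'_def field_simps)
            moreover have "0 \<le> k * v'" using k v by simp
            moreover have "(1 + k) * (1 + v') = 1 + k + v' + k * v'" by (simp add: algebra_simps)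
            ultimately have "1 + v \<le> (1 + k) * (1 + v')" by linarith
            then have "(1 + v) powr (9/4) \<le> ((1 + k) * (1 + v')) powr (9/4)"
              using v by (intro powr_mono2) auto
            also have "\<dots> = (1 + k) powr (9/4) * (1 + v') powr (9/4)" using k v by (simp add: powr_mult)
            finally have "(1 + v) powr (9/4) \<le> (1 + k) powr (9/4) * (1 + v') powr (9/4)" .
            moreover have "0 < (1 + v) powr (9/4)" "0 < (1 + v') powr (9/4)" using v by auto
            ultimately have vv: "(1 + v') powr (- (9/4)) \<le> (1 + k) powr (9/4) * (1 + v) powr (- (9/4))"
              unfolding powr_minus by (simp add: field_simps)
            have p1: "(1 + v'\<^sup>2) powr (- (3/8)) \<le> 2 * (1 + v') powr (- (3/4))"
            proof -
              have "(1 + v')\<^sup>2 \<le> 2 * (1 + v'\<^sup>2)" using zero_le_power2[of "1 - v'"] by (simp add: power2_eq_square algebra_simps)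
              then have "(2 * (1 + v'\<^sup>2)) powr (- (3/8)) \<le> ((1 + v')\<^sup>2) powr (- (3/8))"
                using v by (intro powr_mono2') auto
              also have "\<dots> = (1 + v') powr (- (3/4))" using v powr_powr[of "1 + v'" 2 "- (3/8)"] by simp
              also have "(2 * (1 + v'\<^sup>2)) powr (- (3/8)) = 2 powr (- (3/8)) * (1 + v'\<^sup>2) powr (- (3/8))"
                by (subst powr_mult) auto
              finally have "2 powr (- (3/8)) * (1 + v'\<^sup>2) powr (- (3/8)) \<le> (1 + v') powr (- (3/4))" .
              then have "2 powr (3/8) * (2 powr (- (3/8)) * (1 + v'\<^sup>2) powr (- (3/8))) \<le> 2 powr (3/8) * (1 + v') powr (- (3/4))"
                by (intro mult_left_mono) auto
              moreover have "2 powr (3/8) * (2 powr (- (3/8)) * (1 + v'\<^sup>2) powr (- (3/8))) = (1 + v'\<^sup>2) powr (- (3/8))"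
                by (simp add: mult.assoc[symmetric] flip: powr_add)
              moreover have "(2::real) powr (3/8) * (1 + v') powr (- (3/4)) \<le> 2 powr 1 * (1 + v') powr (- (3/4))"
                by (intro mult_right_mono powr_mono) auto
              ultimately show ?thesis by simp
            qed
            \<comment> \<open>Trades the exponential at scale L for the power -3/2. With the -3/4 of
              the potential the total decay is -9/4, faster than \<open>S\<close> grows.\<close>
            have p2: "exp (- c * (v' / L)) \<le> (2 + 4 / c\<^sup>2) * (L powr (3/2) * (1 + v') powr (- (3/2)))"
            proof -
              define y where "y = v' / L"
              have y: "0 \<le> y" using v L by (simp add: y_def)
              have ey: "1 \<le> exp (c * y)" using c y by simp
              have "y\<^sup>2 \<le> 2 / c\<^sup>2 * exp (c * y)" using power_le_exp[OF y c, of 2] by simp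
              then have "(1 + y)\<^sup>2 \<le> 2 * 1 + 2 * (2 / c\<^sup>2 * exp (c * y))"
                using zero_le_power2[of "1 - y"] by (simp add: power2_sum power2_diff)
              also have "\<dots> \<le> 2 * exp (c * y) + 2 * (2 / c\<^sup>2 * exp (c * y))" using ey by simp
              also have "\<dots> = (2 + 4 / c\<^sup>2) * exp (c * y)" by (simp add: algebra_simps)
              finally have 1: "(1 + y)\<^sup>2 \<le> (2 + 4 / c\<^sup>2) * exp (c * y)" .
              have "(1 + y) powr (3/2) \<le> (1 + y) powr 2" using y by (intro powr_mono) auto
              also have "\<dots> = (1 + y)\<^sup>2" using y by simp
              finally have 2: "(1 + y) powr (3/2) \<le> (2 + 4 / c\<^sup>2) * exp (c * y)" using 1 by linarith
              have "(1 + v') / L \<le> 1 + y" using L v by (simp add: y_def add_divide_distrib divide_le_eq)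
              then have "((1 + v') / L) powr (3/2) \<le> (1 + y) powr (3/2)" using v L by (intro powr_mono2) auto
              then have "((1 + v') / L) powr (3/2) \<le> (2 + 4 / c\<^sup>2) * exp (c * y)" using 2 by linarith
              then have "(1 + v') powr (3/2) / L powr (3/2) \<le> (2 + 4 / c\<^sup>2) * exp (c * y)"
                using v L by (simp add: powr_divide)
              moreover have "0 < (1 + v') powr (3/2)" "0 < L powr (3/2)" using v L by auto
              ultimately have "exp (- (c * y)) * ((1 + v') powr (3/2) / L powr (3/2)) * (L powr (3/2) / (1 + v') powr (3/2))
                \<le> exp (- (c * y)) * ((2 + 4 / c\<^sup>2) * exp (c * y)) * (L powr (3/2) / (1 + v') powr (3/2))"
                by (intro mult_right_mono mult_left_mono) auto
              moreover have "exp (- (c * y)) * ((2 + 4 / c\<^sup>2) * exp (c * y)) = 2 + 4 / c\<^sup>2"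
              proof -
                have "exp (- (c * y)) * ((2 + 4 / c\<^sup>2) * exp (c * y)) = (2 + 4 / c\<^sup>2) * (exp (c * y) * exp (- (c * y)))"
                  by (simp only: mult_ac)
                then show ?thesis unfolding exp_minus_inverse by (simp only: mult_1_right)
              qed
              moreover have "exp (- (c * y)) * ((1 + v') powr (3/2) / L powr (3/2)) * (L powr (3/2) / (1 + v') powr (3/2)) = exp (- (c * y))"
                using v L by simp
              ultimately have "exp (- (c * y)) \<le> (2 + 4 / c\<^sup>2) * (L powr (3/2) / (1 + v') powr (3/2))" by (simp only:)
              moreover have "L powr (3/2) / (1 + v') powr (3/2) = L powr (3/2) * (1 + v') powr (- (3/2))"
                unfolding powr_minus by (rule divide_inverse)
              ultimately show ?thesis unfolding y_def mult_minus_left by (simp only:)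
            qed
            have "(\<Sum>x\<in>B. g u (w - z - x)) \<le> C * S s * (1 + v'\<^sup>2) powr (- (3/8)) * exp (- c * (v' / L))"
            proof -
              have "(\<Sum>x | l2 x \<le> \<xi> s. g u (w - z - x)) \<le> C * S s * (1 + (l2 (w - z) / \<xi> s)\<^sup>2) powr (- (3/8)) * exp (- c * (l2 (w - z) / \<xi> u))"
                by (rule pot[OF sc _ nus(1,2) Ln u(3) s(1) su]) (use L u(4) in \<open>auto simp: \<rho>_def\<close>)
              moreover have "l2 (w - z) / \<xi> u = v' / L" by (simp add: u(4) v'_def mult.commute)
              ultimately show ?thesis by (simp add: B_def \<rho>_def v'_def)
            qed
            also have "\<dots> \<le> C * S s * (2 * (1 + v') powr (- (3/4))) * ((2 + 4 / c\<^sup>2) * (L powr (3/2) * (1 + v') powr (- (3/2))))"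
              using p1 p2 C Ss by (intro mult_mono mult_left_mono) auto
            also have "\<dots> = C * S s * (2 * (2 + 4 / c\<^sup>2) * L powr (3/2)) * ((1 + v') powr (- (3/4)) * (1 + v') powr (- (3/2)))" by simp
            also have "(1 + v') powr (- (3/4)) * (1 + v') powr (- (3/2)) = (1 + v') powr (- (9/4))" by (simp flip: powr_add)
            also have "C * S s * (2 * (2 + 4 / c\<^sup>2) * L powr (3/2)) * \<dots> \<le>
              C * S s * (2 * (2 + 4 / c\<^sup>2) * L powr (3/2)) * ((1 + k) ^ 3 * (1 + v) powr (- (9/4)))"
            proof (rule mult_left_mono)
              have "(1 + k) powr (9/4) \<le> (1 + k) powr 3" using k by (intro powr_mono) auto
              then have "(1 + k) powr (9/4) \<le> (1 + k) ^ 3" using k by simp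
              then show "(1 + v') powr (- (9/4)) \<le> (1 + k) ^ 3 * (1 + v) powr (- (9/4))"
                using vv by (meson mult_right_mono order_trans powr_ge_zero)
            qed (use C Ss in auto)
            also have "\<dots> = E * (1 + v) powr (- (9/4))" by (simp add: E_def K1_def)
            finally show "(\<Sum>x\<in>B. g u (w - z - x)) \<le> E * (1 + l2 w / \<rho>) powr (- (9/4))" by (simp add: v_def)
          qed
          also have "\<dots> = (\<Sum>z | J z \<noteq> 0. J z) * (E * (1 + l2 w / \<rho>) powr (- (9/4)))" by (simp add: sum_distrib_right)
          also have "(\<Sum>z | J z \<noteq> 0. J z) = 1"
          proof -
            have "(\<Sum>\<^sub>\<infinity>z. J z) = infsum J {z. J z \<noteq> 0}" by (rule infsum_cong_neutral) auto
            then show ?thesis using J_sum J_fin by simp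
          qed
          finally show ?thesis by simp
        qed
        \<comment> \<open>Radii 2^j \<rho> with j < n are correlation lengths of parameters up to t;
          beyond them S t bounds the mass.\<close>
        obtain n where n: "\<xi> t < 2 ^ n * \<rho>" "\<And>j. j < n \<Longrightarrow> 2 ^ j * \<rho> \<le> \<xi> t"
        proof -
          obtain n0 where "\<xi> t / \<rho> < 2 ^ n0" using real_arch_pow[of 2 "\<xi> t / \<rho>"] by auto
          then have "\<xi> t < 2 ^ n0 * \<rho>" using rho by (simp add: divide_less_eq)
          then have "\<xi> t < 2 ^ (LEAST n. \<xi> t < 2 ^ n * \<rho>) * \<rho>" by (rule LeastI)
          moreover have "2 ^ j * \<rho> \<le> \<xi> t" if "j < (LEAST n. \<xi> t < 2 ^ n * \<rho>)" for j
            using not_less_Least[OF that] by simp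
          ultimately show ?thesis using that by blast
        qed
        have powj: "(2 ^ j :: real) powr (17/8) * (2 ^ j) powr (- (9/4)) = (2 ^ j) powr (- (1/8))" for j
          by (simp flip: powr_add)
        \<comment> \<open>The radius is \<xi> v for some parameter v, so q controls this mass as
          well. Here the estimate refers back to itself.\<close>
        have massj: "mass (2 ^ j * \<rho>) \<le> q * (S s * (2 ^ j) powr (17/8))" if jn: "j < n" for j
        proof -
          have "1 * \<rho> \<le> 2 ^ j * \<rho>" using rho by (intro mult_right_mono) auto
          then have rj: "\<sigma> \<le> 2 ^ j * \<rho>" using rho by linarith
          obtain v where v: "0 \<le> v" "v \<le> t" "v \<in> I" "\<xi> v = 2 ^ j * \<rho>"
            by (rule xi_ivt[OF t, of "2 ^ j * \<rho>"]) (use rj rho n(2)[OF jn] in auto)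
          have "mass (2 ^ j * \<rho>) \<le> q * S v" using qs[OF v(1,2)] v(4) by simp
          also have "S v \<le> S s * (2 ^ j) powr (17/8)"
          proof (cases "s \<le> v")
            case True
            have "\<xi> v / \<xi> s = 2 ^ j" using v(4) rho by (simp add: \<rho>_def)
            then show ?thesis using up[OF s(1) True v(2)] by simp
          next
            case False
            then have "S v \<le> S s * 1" using S_mono[OF sI' v(1)] by simp
            also have "\<dots> \<le> S s * (2 ^ j) powr (17/8)" using Ss by (intro mult_left_mono ge_one_powr_ge_zero) auto
            finally show ?thesis .
          qed
          finally show ?thesis using q0 by (simp add: mult_left_mono)
        qed
        have massn: "S t \<le> S s * (2 ^ n) powr (17/8)"
        proof -
          have "(\<xi> t / \<rho>) powr (17/8) \<le> (2 ^ n) powr (17/8)"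
            using n(1) rho by (intro powr_mono2) (auto simp: divide_le_eq)
          then have "S s * (\<xi> t / \<rho>) powr (17/8) \<le> S s * (2 ^ n) powr (17/8)" using Ss by (intro mult_left_mono) auto
          then show ?thesis using up[OF s order_refl] by (simp add: \<rho>_def)
        qed
        define Y where "Y = (\<Sum>j<n. (2 ^ j) powr (- (9/4)) * mass (2 ^ j * \<rho>)) + (2 ^ n) powr (- (9/4)) * S t"
        have Yle: "Y \<le> S s * (q * G + 1)"
        proof -
          have "Y \<le> (\<Sum>j<n. (2 ^ j) powr (- (9/4)) * (q * (S s * (2 ^ j) powr (17/8)))) + (2 ^ n) powr (- (9/4)) * (S s * (2 ^ n) powr (17/8))"
            unfolding Y_def using massj massn by (intro add_mono sum_mono mult_left_mono) auto
          also have "\<dots> = S s * (q * (\<Sum>j<n. (2 ^ j) powr (- (1/8))) + (2 ^ n) powr (- (1/8)))"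
            by (simp add: powj[symmetric] sum_distrib_left algebra_simps)
          also have "\<dots> \<le> S s * (q * G + 1)"
          proof -
            have "(2 ^ n :: real) powr (- (1/8)) \<le> 1 powr (- (1/8))" by (intro powr_mono2') auto
            then have "(2 ^ n :: real) powr (- (1/8)) \<le> 1" by simp
            then show ?thesis using sum_dyadic_le[of n] q0 Ss by (intro mult_left_mono add_mono) (auto simp: G_def)
          qed
          finally show ?thesis .
        qed
        have Vnn: "0 \<le> V w" for w unfolding V_def by (intro sum_nonneg F_nonneg u)
        have hV: "((\<lambda>w. \<Sum>x\<in>B. g t w * F u (x - w)) has_sum (\<Sum>x\<in>B. conv (F u) (g t) x)) UNIV"
        proof -
          have "(\<lambda>w. g t w * F u (x - w)) summable_on UNIV" for x
          proof -
            have "(\<lambda>w. F u w * g t (x - w)) summable_on UNIV" by (rule F_g_summable[OF u(3) t])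
            then show ?thesis
              by (rule summable_on_reindex_bij_witness[where i = "\<lambda>w. x - w" and j = "\<lambda>w. x - w", THEN iffD2, OF _ _ _ _ _ , rotated -1]) (auto simp: mult.commute)
          qed
          moreover have "conv (F u) (g t) x = (\<Sum>\<^sub>\<infinity>w. g t w * F u (x - w))" for x
            by (subst conv_commute) (simp add: conv_def[of "g t"])
          ultimately show ?thesis by (intro has_sum_finite_sum B) auto
        qed
        have hV': "((\<lambda>w. g t w * V w) has_sum (\<Sum>x\<in>B. conv (F u) (g t) x)) UNIV"
          using hV by (simp add: V_def sum_distrib_left)
        have hY: "((\<lambda>w. g t w * (E * (8 * ((\<Sum>j<n. (2 ^ j) powr (- (9/4)) * of_bool (l2 w / \<rho> \<le> 2 ^ j)) + (2 ^ n) powr (- (9/4)))))) has_sum E * (8 * Y)) UNIV"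
        proof -
          have "((\<lambda>w. g t w * of_bool (l2 w / \<rho> \<le> 2 ^ j)) has_sum mass (2 ^ j * \<rho>)) UNIV" for j
            unfolding mass_def by (rule has_sum_finite_neutralI[OF finite_l2_ball]) (use rho in \<open>auto simp: divide_le_eq\<close>)
          then have "((\<lambda>w. (\<Sum>j<n. (2 ^ j) powr (- (9/4)) * (g t w * of_bool (l2 w / \<rho> \<le> 2 ^ j))) + (2 ^ n) powr (- (9/4)) * g t w) has_sum Y) UNIV"
            unfolding Y_def using has_sum_infsum[OF g_summable[OF t]] chi[OF t]
            by (intro has_sum_add has_sum_finite_sum has_sum_cmult_right) auto
          from has_sum_cmult_right[OF this, of "E * 8"]
          have hs: "((\<lambda>w. E * 8 * ((\<Sum>j<n. (2 ^ j) powr (- (9/4)) * (g t w * of_bool (l2 w / \<rho> \<le> 2 ^ j))) + (2 ^ n) powr (- (9/4)) * g t w)) has_sum E * 8 * Y) UNIV" .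
          have alg: "\<gamma> * (E * (8 * ((\<Sum>j<n. p j * b j) + z))) = E * 8 * ((\<Sum>j<n. p j * (\<gamma> * b j)) + z * \<gamma>)"
            for \<gamma> z :: real and b p :: "nat \<Rightarrow> real"
            by (simp add: sum_distrib_left algebra_simps)
          have "E * (8 * Y) = E * 8 * Y" by simp
          then show ?thesis unfolding alg using hs by (simp only:)
        qed
        have "(\<Sum>x\<in>B. conv (F u) (g t) x) \<le> E * (8 * Y)"
        proof (rule has_sum_mono[OF hV' hY])
          fix w :: "int ^ 'n"
          have "0 \<le> l2 w / \<rho>" using rho by simp
          from mult_left_mono[OF dyadic_weight_bound[OF this, of n] less_imp_le[OF E]]
          show "g t w * V w \<le> g t w * (E * (8 * ((\<Sum>j<n. (2 ^ j) powr (- (9/4)) * of_bool (l2 w / \<rho> \<le> 2 ^ j)) + (2 ^ n) powr (- (9/4)))))"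
            using Vle[of w] g_nonneg[OF t, of w] by (intro mult_left_mono) auto
        qed
        also have "\<dots> \<le> E * (8 * (S s * (q * G + 1)))" using Yle E by (intro mult_left_mono) auto
        finally have cY: "(\<Sum>x\<in>B. conv (F u) (g t) x) \<le> E * (8 * (S s * (q * G + 1)))" .
        have Su: "1 \<le> S u" by (rule S_ge_1[OF u(3)])
        have "mass \<rho> \<le> (\<Sum>x\<in>B. g u x + (t - u) * conv (F u) (g t) x)"
          unfolding mass_def B_def by (intro sum_mono g_upper t u)
        also have "\<dots> = (\<Sum>x\<in>B. g u x) + (t - u) * (\<Sum>x\<in>B. conv (F u) (g t) x)"
          by (simp add: sum.distrib sum_distrib_left)
        also have "(\<Sum>x\<in>B. g u x) \<le> S u"
          unfolding chi[OF u(3)] by (rule finite_sum_le_infsum[OF g_summable[OF u(3)] B]) (auto intro: g_nonneg u)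
        also have "S u \<le> S s * L ^ 3"
        proof -
          have "\<xi> u / \<xi> s = L" using u(4) rho by (simp add: \<rho>_def)
          then have "S u \<le> S s * L powr (17/8)" using up[OF s(1) su u(2)] by simp
          also have "\<dots> \<le> S s * L ^ 3" using L3[of L] L Ss by (intro mult_left_mono) auto
          finally show ?thesis .
        qed
        also have "(t - u) * (\<Sum>x\<in>B. conv (F u) (g t) x) \<le> (2 / S u) * (E * (8 * (S s * (q * G + 1))))"
        proof (rule mult_mono[OF _ cY])
          have "(t - u) * S u \<le> 2"
          proof -
            have "0 \<le> S u / S t" using Su St by simp
            then show ?thesis using kill_le(1)[OF t u(1,2)] nus by linarith
          qed
          then show "t - u \<le> 2 / S u" using Su by (simp add: le_divide_eq)
          show "0 \<le> (\<Sum>x\<in>B. conv (F u) (g t) x)"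
            by (rule has_sum_nonneg[OF hV']) (use Vnn g_nonneg[OF t] in auto)
        qed (use Su in auto)
        also have "\<dots> \<le> S s * (K2 * L powr (- (3/8)) * (q * G + 1))"
        proof -
          have Lr: "\<xi> u / \<xi> s = L" using u(4) rho by (simp add: \<rho>_def)
          have "L powr (15/8) \<le> L powr (2 - \<nu>)" using L nus by (intro powr_mono) auto
          also have "\<dots> \<le> S u / S s" using growth_lower[OF u(3) s(1) su] by (simp add: Lr)
          finally have l: "S s * L powr (15/8) \<le> S u" using Ss by (simp add: le_divide_eq mult.commute)
          have W0: "0 \<le> E * (8 * (S s * (q * G + 1)))" using E Ss q0 G by (intro mult_nonneg_nonneg add_nonneg_nonneg) auto
          have "2 / S u \<le> 2 / (S s * L powr (15/8))"
            using l Ss L Su by (intro divide_left_mono mult_pos_pos) auto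
          then have "(2 / S u) * (E * (8 * (S s * (q * G + 1)))) \<le> 2 / (S s * L powr (15/8)) * (E * (8 * (S s * (q * G + 1))))"
            using W0 by (rule mult_right_mono)
          also have "\<dots> = S s * (K2 * (L powr (3/2) / L powr (15/8)) * (q * G + 1))"
            using Ss L by (simp add: E_def K2_def field_simps)
          also have "L powr (3/2) / L powr (15/8) = L powr (- (3/8))" by (simp flip: powr_diff)
          finally show ?thesis .
        qed
        finally have "mass \<rho> \<le> S s * (L ^ 3 + K2 * L powr (- (3/8)) * (q * G + 1))" by (simp add: distrib_left)
        then have "mass (\<xi> s) / S s \<le> L ^ 3 + K2 * L powr (- (3/8)) * (q * G + 1)"
          using Ss by (simp add: divide_le_eq mult.commute \<rho>_def)
        also have "\<dots> = L ^ 3 + (q * (K2 * L powr (- (3/8)) * G) + K2 * L powr (- (3/8)))" by (simp add: algebra_simps)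
        also have "\<dots> \<le> L ^ 3 + (q * (1 / 2) + 1)" using LK LK1 q0 by (intro add_left_mono add_mono mult_left_mono) auto
        finally show ?thesis by simp
      qed
    qed
    have "q \<le> L ^ 3 + 1 + q / 2" unfolding q_def[symmetric]
      by (subst q_def, rule cSUP_least) (use step I_nonneg[OF t] in auto)
    then have "q \<le> Q" by (simp add: Q_def)
    then have "q * S s0 \<le> Q * S s0" using Sp[OF s0] by (intro mult_right_mono) auto
    then show "(\<Sum>x | l2 x \<le> \<xi> s0. g t x) \<le> Q * S s0" using qs[OF s0] by (simp add: mass_def)
  qed
qed

subsection \<open>The maximum principle\<close>

text \<open>Here \<open>Q\<close> is the constant in the bound on the mass in a ball, \<open>C\<^sub>s\<close> the one in the superharmonicity
  estimate, and \<open>\<eta>\<close> the ratio between the step length \<open>\<rho>\<close> and \<open>min (l2 x) (\<xi> t)\<close>. Only \<open>\<eta>\<close> and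
  \<open>\<nu>\<close> depend on \<open>\<epsilon>\<close>; this makes the final constants independent of it.\<close>
locale barrier = scales c\<^sub>0 \<nu> \<sigma> J I g S \<xi>
  for c\<^sub>0 \<nu> \<sigma> :: real and J :: "int ^ 'n \<Rightarrow> real" and I g S \<xi> +
  fixes C\<^sub>s Q M c \<epsilon> \<eta> \<alpha> q :: real
  assumes alpha: "\<alpha> = (real CARD('n) - 2 - \<epsilon>) / 2" and q_def: "q = \<alpha> * \<epsilon> / real CARD('n)"
    and eps: "0 < \<epsilon>" "\<epsilon> \<le> 1 / 2"
    and Cs: "0 < C\<^sub>s" and M: "8 * C\<^sub>s \<le> M" "real CARD('n) \<le> M"
    and c: "0 < c" "c \<le> 1" "8 * C\<^sub>s * c \<le> 1" "c \<le> c\<^sub>0 / (4 * real CARD('n)) / 2"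
    and superharmonic: "\<And>P \<rho> m \<zeta> x. kernel (c\<^sub>0 / (4 * real CARD('n))) (64 * real CARD('n)) \<rho> P \<Longrightarrow>
      \<rho> \<le> \<zeta> \<Longrightarrow> 0 < m \<Longrightarrow> \<rho>\<^sup>2 \<le> (l2 x)\<^sup>2 + m \<Longrightarrow>
      (\<lambda>z. P z * (of_bool (\<rho>\<^sup>2 \<le> (l2 (x - z))\<^sup>2 + m) * fw \<alpha> (c / \<zeta>) (\<zeta>\<^sup>2) ((l2 (x - z))\<^sup>2 + m))) summable_on UNIV \<and>
      (\<Sum>\<^sub>\<infinity>z :: int ^ 'n. P z * (of_bool (\<rho>\<^sup>2 \<le> (l2 (x - z))\<^sup>2 + m) * fw \<alpha> (c / \<zeta>) (\<zeta>\<^sup>2) ((l2 (x - z))\<^sup>2 + m)))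
      \<le> fw \<alpha> (c / \<zeta>) (\<zeta>\<^sup>2) ((l2 x)\<^sup>2 + m) *
        (1 - \<alpha> * \<rho>\<^sup>2 * (m + (real CARD('n) - 2 - 2 * \<alpha>) / real CARD('n) * (l2 x)\<^sup>2) / ((l2 x)\<^sup>2 + m)\<^sup>2
         + C\<^sub>s * (c * \<rho>\<^sup>2 / \<zeta>\<^sup>2 + \<rho> ^ 4 / ((l2 x)\<^sup>2 + m)\<^sup>2))"
    and local_mass: "1 \<le> Q" "\<And>s t. t \<in> I \<Longrightarrow> 0 \<le> s \<Longrightarrow> s \<le> t \<Longrightarrow> (\<Sum>x | l2 x \<le> \<xi> s. g t x) \<le> Q * S s"
    and eta: "0 < \<eta>" "\<eta> \<le> 1 / 4" "\<eta> * (1 + sqrt (real CARD('n)) / c\<^sub>0) \<le> 1 / 2" "\<eta>\<^sup>2 * M \<le> 1"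
      "C\<^sub>s * \<eta>\<^sup>2 \<le> q / 2" "2 ^ CARD('n) * 9 * exp (- c / (4 * \<eta>)) * (1 + 2 * Q) \<le> q * \<eta>\<^sup>2 / 32"
    and nu_small: "\<nu> \<le> 1 / 32768" "\<nu> \<le> q * \<eta>\<^sup>2 / 32" "(1 / (\<eta> * sqrt q)) powr \<nu> \<le> 2"
begin

text \<open>The ratio of \<xi> t to the step length where the two gains balance: 1 / \<Lambda>^2 = q
  \<eta>^2 = 16 \<kappa>. Below it the killing dominates, above it the drift.\<close>

definition "\<Lambda> = 1 / (\<eta> * sqrt q)"
definition "\<kappa> = q * \<eta>\<^sup>2 / 16"
definition "k = sqrt (real CARD('n)) / c\<^sub>0"
definition "m = M * \<sigma>\<^sup>2"
definition "w t x = fw \<alpha> (c / \<xi> t) ((\<xi> t)\<^sup>2) ((l2 x)\<^sup>2 + m)"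
text \<open>On the support of \<open>J\<close>, \<open>X\<^sub>0 / 4\<close> bounds the gain from
  below, and \<open>B\<^sub>0\<close>, times a power of \<sigma>, bounds the ratio of the source t *
  J x to the weight. Neither involves \<epsilon>, \<eta> or \<nu>.\<close>

definition "X\<^sub>0 = M / (8 * (k\<^sup>2 + M)\<^sup>2)"
definition "B\<^sub>0 = 2 * (sqrt (real CARD('n)) ^ CARD('n) / c\<^sub>0) * ((k\<^sup>2 + M) ^ CARD('n) * exp (sqrt (k\<^sup>2 + M) + 1))"

section \<open>Relations between the parameters\<close>

lemma dim: "3 \<le> real CARD('n)" using d3 by linarith

lemma alpha_bounds: "1 / 4 \<le> \<alpha>" "\<alpha> \<le> real CARD('n) / 2" "2 * \<alpha> = real CARD('n) - 2 - \<epsilon>"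
  using dim eps by (auto simp: alpha field_simps)

lemma q_bounds: "0 < q" "q \<le> 1"
proof -
  show "0 < q" using alpha_bounds eps dim by (simp add: q_def)
  have "\<alpha> * \<epsilon> \<le> real CARD('n) / 2 * (1 / 2)" using alpha_bounds eps by (intro mult_mono) auto
  then show "q \<le> 1" using dim by (simp add: q_def)
qed

lemma kappa_bounds: "0 < \<kappa>" "\<kappa> \<le> 1 / 16" "2 * \<nu> \<le> \<kappa>" "1 / \<Lambda>\<^sup>2 = 16 * \<kappa>"
proof -
  have e2: "\<eta>\<^sup>2 \<le> 1" using eta by (simp add: power_le_one)
  show "0 < \<kappa>" using q_bounds eta by (simp add: \<kappa>_def)
  have "q * \<eta>\<^sup>2 \<le> 1 * 1" using q_bounds e2 by (intro mult_mono) auto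
  then show "\<kappa> \<le> 1 / 16" by (simp add: \<kappa>_def)
  show "2 * \<nu> \<le> \<kappa>" using nu_small by (simp add: \<kappa>_def)
  show "1 / \<Lambda>\<^sup>2 = 16 * \<kappa>" using q_bounds eta by (simp add: \<Lambda>_def \<kappa>_def power_divide power_mult_distrib)
qed

lemma M_pos: "3 \<le> M" and m_pos: "0 < m" and m_ge: "\<sigma>\<^sup>2 \<le> m"
proof -
  show M3: "3 \<le> M" using M dim by linarith
  then show "0 < m" using sigma by (simp add: m_def)
  have "1 * \<sigma>\<^sup>2 \<le> M * \<sigma>\<^sup>2" using M3 by (intro mult_right_mono) auto
  then show "\<sigma>\<^sup>2 \<le> m" by (simp add: m_def)
qed

lemma tau_pos: "0 < (l2 x)\<^sup>2 + m" by (rule add_nonneg_pos[OF zero_le_power2 m_pos])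

lemma w_pos: "0 < w t x" unfolding w_def by (rule fw_pos[OF tau_pos])

lemma k_nonneg: "0 \<le> k" using c0 by (simp add: k_def)

text \<open>Let R = |x| / \<rho> \<ge> 1 / \<eta>. At distance |x| / 2 the exponent of w s, whose
  scale is \<rho>, is at least c R / 2, while that of w t at x is at most c R / 4 + 2. The
  difference leaves exp (- c / (4 \<eta>)), and 9 bounds exp 2.\<close>

lemma w_far:
  assumes t: "t \<in> I" and s: "0 < \<rho>" "\<xi> s = \<rho>" and \<rho>: "\<rho> \<le> \<eta> * \<xi> t" "\<rho> \<le> \<eta> * l2 x" "\<sigma> \<le> \<rho>" and v: "l2 x / 2 \<le> l2 v"
  shows "w s v \<le> 2 ^ CARD('n) * 9 * exp (- c / (4 * \<eta>)) * w t x"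
proof -
  define r X where "r = l2 x" and "X = \<xi> t"
  have X: "0 < X" using xi_pos[OF t] by (simp add: X_def)
  have r: "0 < r"
  proof -
    have "0 < \<eta> * r" using \<rho>(2) s(1) by (simp add: r_def)
    then show ?thesis using eta by (simp add: zero_less_mult_iff)
  qed
  have 1: "((l2 v)\<^sup>2 + m) powr (- \<alpha>) \<le> 2 ^ CARD('n) * (r\<^sup>2 + m) powr (- \<alpha>)"
  proof -
    have "(r / 2)\<^sup>2 \<le> (l2 v)\<^sup>2" using v r by (intro power_mono) (auto simp: r_def)
    then have "(r\<^sup>2 + m) / 4 \<le> (l2 v)\<^sup>2 + m" using m_pos by (simp add: power_divide)
    then have "((l2 v)\<^sup>2 + m) powr (- \<alpha>) \<le> ((r\<^sup>2 + m) / 4) powr (- \<alpha>)"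
      using m_pos r alpha_bounds by (intro powr_mono2') (auto intro!: add_pos_pos)
    also have "\<dots> = (r\<^sup>2 + m) powr (- \<alpha>) / 4 powr (- \<alpha>)" by (rule powr_divide)
    also have "\<dots> = 4 powr \<alpha> * (r\<^sup>2 + m) powr (- \<alpha>)" by (simp add: powr_minus divide_inverse)
    also have "\<dots> \<le> 2 ^ CARD('n) * (r\<^sup>2 + m) powr (- \<alpha>)"
    proof (rule mult_right_mono)
      have "4 powr \<alpha> \<le> (4 :: real) powr (real CARD('n) / 2)" using alpha_bounds by (intro powr_mono) auto
      also have "\<dots> = (2 powr 2) powr (real CARD('n) / 2)" by simp
      also have "\<dots> = 2 powr (real CARD('n))" by (subst powr_powr) simp
      finally show "4 powr \<alpha> \<le> (2 :: real) ^ CARD('n)" by (simp add: powr_realpow)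
    qed simp
    finally show ?thesis .
  qed
  define R where "R = r / \<rho>"
  have R: "1 / \<eta> \<le> R" using \<rho> s eta by (simp add: R_def r_def field_simps)
  have "c / \<rho> * (r / 2) \<le> c / \<rho> * sqrt ((l2 v)\<^sup>2 + m + \<rho>\<^sup>2)"
  proof (rule mult_left_mono)
    have "l2 v \<le> sqrt ((l2 v)\<^sup>2 + m + \<rho>\<^sup>2)" using m_pos by (intro real_le_rsqrt) (simp add: add_nonneg_nonneg)
    then show "r / 2 \<le> sqrt ((l2 v)\<^sup>2 + m + \<rho>\<^sup>2)" using v by (simp add: r_def)
  qed (use c s in auto)
  then have 2: "c * R / 2 \<le> c / \<rho> * sqrt ((l2 v)\<^sup>2 + m + \<rho>\<^sup>2)" by (simp add: R_def)
  have "c / X * sqrt (r\<^sup>2 + m + X\<^sup>2) \<le> c / X * (r + 2 * X)"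
  proof (rule mult_left_mono)
    have "\<sigma>\<^sup>2 \<le> (\<eta> * X)\<^sup>2" using \<rho> sigma by (intro power_mono) (auto simp: X_def)
    then have "M * \<sigma>\<^sup>2 \<le> M * (\<eta> * X)\<^sup>2" using M_pos by (intro mult_left_mono) auto
    also have "\<dots> = (\<eta>\<^sup>2 * M) * X\<^sup>2" by (simp add: power_mult_distrib)
    also have "\<dots> \<le> 1 * X\<^sup>2" using eta by (intro mult_right_mono) auto
    finally have "m \<le> X\<^sup>2" by (simp add: m_def)
    moreover have "0 \<le> r * X" using r X by simp
    moreover have "(r + 2 * X)\<^sup>2 = r\<^sup>2 + 4 * (r * X) + 4 * X\<^sup>2" by (simp add: power2_eq_square algebra_simps)
    ultimately have "r\<^sup>2 + m + X\<^sup>2 \<le> (r + 2 * X)\<^sup>2" using zero_le_power2[of X] by linarith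
    then show "sqrt (r\<^sup>2 + m + X\<^sup>2) \<le> r + 2 * X" using r X by (intro real_le_lsqrt) auto
  qed (use c X in auto)
  also have "\<dots> = c * (r / X) + 2 * c" using X by (simp add: field_simps)
  also have "\<dots> \<le> c * (R / 4) + 2"
  proof -
    have "\<eta> * X \<le> 1 / 4 * X" using eta X by (intro mult_right_mono) auto
    then have "\<rho> \<le> 1 / 4 * X" using \<rho>(1) unfolding X_def by linarith
    then have "r / X \<le> R / 4" using X r s by (simp add: R_def field_simps)
    then have "c * (r / X) \<le> c * (R / 4)" using c by (intro mult_left_mono) auto
    then show ?thesis using c by linarith
  qed
  finally have 3: "c / X * sqrt (r\<^sup>2 + m + X\<^sup>2) \<le> c * (R / 4) + 2" .
  have 4: "exp (- (c / \<rho>) * sqrt ((l2 v)\<^sup>2 + m + \<rho>\<^sup>2)) \<le> 9 * exp (- c / (4 * \<eta>)) * exp (- (c / X) * sqrt (r\<^sup>2 + m + X\<^sup>2))"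
  proof -
    have "c / \<eta> \<le> c * R" using mult_left_mono[OF R, of c] c by simp
    then have "- (c / \<rho> * sqrt ((l2 v)\<^sup>2 + m + \<rho>\<^sup>2)) \<le> 2 + (- (c / \<eta> / 4)) + (- (c / X * sqrt (r\<^sup>2 + m + X\<^sup>2)))"
    proof -
      assume h: "c / \<eta> \<le> c * R"
      have aux: "\<And>S1 S2 h u :: real. u / 2 \<le> S1 \<Longrightarrow> S2 \<le> u / 4 + 2 \<Longrightarrow> h \<le> u \<Longrightarrow> - S1 \<le> 2 + (- (h / 4)) + (- S2)"
        by linarith
      show "- (c / \<rho> * sqrt ((l2 v)\<^sup>2 + m + \<rho>\<^sup>2)) \<le> 2 + (- (c / \<eta> / 4)) + (- (c / X * sqrt (r\<^sup>2 + m + X\<^sup>2)))"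
        by (rule aux[OF 2 _ h]) (use 3 in simp)
    qed
    moreover have "- c / (4 * \<eta>) = - (c / \<eta> / 4)" by simp
    ultimately have "- (c / \<rho>) * sqrt ((l2 v)\<^sup>2 + m + \<rho>\<^sup>2) \<le> 2 + (- c / (4 * \<eta>)) + (- (c / X) * sqrt (r\<^sup>2 + m + X\<^sup>2))"
      by (simp only: mult_minus_left)
    then have "exp (- (c / \<rho>) * sqrt ((l2 v)\<^sup>2 + m + \<rho>\<^sup>2)) \<le> exp (2 + (- c / (4 * \<eta>)) + (- (c / X) * sqrt (r\<^sup>2 + m + X\<^sup>2)))" by (simp only: exp_le_cancel_iff)
    also have "\<dots> = exp 2 * exp (- c / (4 * \<eta>)) * exp (- (c / X) * sqrt (r\<^sup>2 + m + X\<^sup>2))" by (simp only: exp_add)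
    also have "\<dots> \<le> 9 * exp (- c / (4 * \<eta>)) * exp (- (c / X) * sqrt (r\<^sup>2 + m + X\<^sup>2))"
    proof (intro mult_right_mono)
      have "exp (2::real) = exp 1 * exp 1" by (simp flip: exp_add)
      also have "\<dots> \<le> 3 * 3" by (intro mult_mono exp_le) auto
      finally show "exp (2::real) \<le> 9" by simp
    qed auto
    finally show ?thesis .
  qed
  have "w s v \<le> (2 ^ CARD('n) * (r\<^sup>2 + m) powr (- \<alpha>)) * (9 * exp (- c / (4 * \<eta>)) * exp (- (c / X) * sqrt (r\<^sup>2 + m + X\<^sup>2)))"
    unfolding w_def fw_def s(2) by (intro mult_mono 1 4) auto
  also have "\<dots> = 2 ^ CARD('n) * 9 * exp (- c / (4 * \<eta>)) * w t x"
    by (simp add: w_def fw_def r_def X_def)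
  finally show ?thesis .
qed

text \<open>If \<open>\<xi> t\<close> is comparable with \<open>\<rho>\<close>, the killing \<open>S s / S t\<close> pays for the error terms. Otherwise
  \<open>\<rho>\<close> is a small multiple of \<open>l2 x\<close> and the gap \<open>\<epsilon>\<close> between \<open>2 * \<alpha>\<close> and \<open>d - 2\<close> does.\<close>
lemma drift_upper:
  assumes t: "t \<in> I" "0 \<le> s" "s \<le> t" and \<rho>: "\<rho> = \<eta> * min (l2 x) (\<xi> t)" "\<xi> s = \<rho>" "\<sigma> \<le> \<rho>"
  shows "(t - s) * S s * (1 - \<alpha> * \<rho>\<^sup>2 * (m + (real CARD('n) - 2 - 2 * \<alpha>) / real CARD('n) * (l2 x)\<^sup>2) / ((l2 x)\<^sup>2 + m)\<^sup>2
         + C\<^sub>s * (c * \<rho>\<^sup>2 / (\<xi> t)\<^sup>2 + \<rho> ^ 4 / ((l2 x)\<^sup>2 + m)\<^sup>2)) \<le> 1 - \<kappa>"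
proof -
  define r X \<tau> y where "r = l2 x" and "X = \<xi> t" and "\<tau> = (l2 x)\<^sup>2 + m" and "y = (t - s) * S s"
  define p u where "p = \<rho>\<^sup>2 / X\<^sup>2" and "u = \<rho>\<^sup>2 / \<tau>"
  have X: "0 < X" using xi_pos[OF t(1)] by (simp add: X_def)
  have \<tau>: "0 < \<tau>" unfolding \<tau>_def by (rule tau_pos)
  have \<rho>0: "0 < \<rho>" using \<rho>(3) sigma by linarith
  have r: "0 < r" using \<rho>0 \<rho>(1) eta X by (auto simp: zero_less_mult_iff r_def X_def)
  have \<rho>r: "\<rho> \<le> \<eta> * r" "\<rho> \<le> \<eta> * X" using eta unfolding \<rho>(1) r_def X_def by (auto intro!: mult_left_mono)
  have p: "0 < p" "p \<le> 1"
  proof -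
    show "0 < p" using \<rho>0 X by (simp add: p_def)
    have "\<eta> * X \<le> 1 * X" using eta X by (intro mult_right_mono) auto
    then have "\<rho>\<^sup>2 \<le> X\<^sup>2" using \<rho>r \<rho>0 by (intro power_mono) auto
    then show "p \<le> 1" using X by (simp add: p_def)
  qed
  have u0: "0 < u" using \<rho>0 \<tau> by (simp add: u_def)
  have u1: "u \<le> \<eta>\<^sup>2"
  proof -
    have "\<rho>\<^sup>2 \<le> (\<eta> * r)\<^sup>2" using \<rho>r \<rho>0 by (intro power_mono) auto
    also have "\<dots> \<le> \<eta>\<^sup>2 * \<tau>" unfolding power_mult_distrib
      using m_pos by (intro mult_left_mono) (auto simp: \<tau>_def r_def)
    finally show ?thesis using \<tau> by (simp add: u_def divide_le_eq)
  qed
  have y: "0 \<le> y" "y \<le> 1 - S s / S t + 2 * \<nu>"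
    using kill_le(1)[OF t] t S_ge_1[OF I_down[OF t]] by (auto simp: y_def)
  have sr: "0 \<le> S s / S t" using S_ge_1[OF I_down[OF t]] S_ge_1[OF t(1)] by simp
  define Kf where "Kf = 1 - \<alpha> * \<rho>\<^sup>2 * (m + (real CARD('n) - 2 - 2 * \<alpha>) / real CARD('n) * (l2 x)\<^sup>2) / ((l2 x)\<^sup>2 + m)\<^sup>2
         + C\<^sub>s * (c * \<rho>\<^sup>2 / (\<xi> t)\<^sup>2 + \<rho> ^ 4 / ((l2 x)\<^sup>2 + m)\<^sup>2)"
  have Kf: "Kf \<le> 1 - q / 2 * u + p / 8"
  proof -
    have "\<epsilon> / real CARD('n) * m \<le> 1 * m" using eps dim m_pos by (intro mult_right_mono) auto
    then have "\<epsilon> / real CARD('n) * \<tau> \<le> m + \<epsilon> / real CARD('n) * (l2 x)\<^sup>2" by (simp add: \<tau>_def distrib_left)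
    then have "\<alpha> * \<rho>\<^sup>2 * (\<epsilon> / real CARD('n) * \<tau>) / \<tau>\<^sup>2 \<le> \<alpha> * \<rho>\<^sup>2 * (m + \<epsilon> / real CARD('n) * (l2 x)\<^sup>2) / \<tau>\<^sup>2"
      using alpha_bounds by (intro divide_right_mono mult_left_mono) auto
    moreover have "\<alpha> * \<rho>\<^sup>2 * (\<epsilon> / real CARD('n) * \<tau>) / \<tau>\<^sup>2 = q * u" using \<tau> by (simp add: q_def u_def power2_eq_square)
    moreover have e: "real CARD('n) - 2 - 2 * \<alpha> = \<epsilon>" using alpha_bounds by simp
    have "Kf = 1 - \<alpha> * \<rho>\<^sup>2 * (m + \<epsilon> / real CARD('n) * (l2 x)\<^sup>2) / \<tau>\<^sup>2 + C\<^sub>s * (c * \<rho>\<^sup>2 / X\<^sup>2 + \<rho> ^ 4 / \<tau>\<^sup>2)"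
      by (simp only: Kf_def e X_def \<tau>_def)
    moreover have "C\<^sub>s * (\<rho> ^ 4 / \<tau>\<^sup>2) \<le> q / 2 * u"
    proof -
      have "\<rho> ^ 4 / \<tau>\<^sup>2 = u * u" by (simp add: u_def power2_eq_square power4_eq_xxxx)
      also have "C\<^sub>s * (u * u) \<le> C\<^sub>s * (\<eta>\<^sup>2 * u)" using u0 u1 Cs by (intro mult_left_mono mult_right_mono) auto
      also have "\<dots> = C\<^sub>s * \<eta>\<^sup>2 * u" by simp
      also have "\<dots> \<le> q / 2 * u" using eta u0 by (intro mult_right_mono) auto
      finally show ?thesis .
    qed
    moreover have "C\<^sub>s * (c * \<rho>\<^sup>2 / X\<^sup>2) \<le> p / 8"
      using mult_right_mono[OF c(3), of p] p by (simp add: p_def)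
    ultimately show ?thesis unfolding distrib_left[of C\<^sub>s] by linarith
  qed
  have "y * Kf \<le> 1 - \<kappa>"
  proof (cases "X \<le> \<Lambda> * \<rho>")
    case True
    have L: "0 < \<Lambda>" using eta q_bounds by (simp add: \<Lambda>_def)
    have "X\<^sup>2 \<le> (\<Lambda> * \<rho>)\<^sup>2" using True X by (intro power_mono) auto
    then have "1 / \<Lambda>\<^sup>2 \<le> p" using X L by (simp add: p_def power_mult_distrib field_simps)
    then have pk: "16 * \<kappa> \<le> p" using kappa_bounds by simp
    have "S s / S t \<ge> (\<xi> s / \<xi> t)\<^sup>2 / 2"
      by (rule S_ratio[OF t, of \<Lambda>]) (use True nu_small in \<open>auto simp: X_def \<rho>(2) \<Lambda>_def\<close>)
    then have "p / 2 \<le> S s / S t" by (simp add: p_def X_def \<rho>(2) power_divide)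
    then have y1: "y \<le> 1 - p / 2 + p / 16" using y pk kappa_bounds by linarith
    have "y * Kf \<le> y * (1 + p / 8)" using y Kf u0 q_bounds by (intro mult_left_mono) (auto intro: order_trans)
    also have "\<dots> \<le> (1 - p / 2 + p / 16) * (1 + p / 8)" using y1 p by (intro mult_right_mono) auto
    also have "\<dots> \<le> 1 - p / 2 + p / 16 + p / 8" using p by (simp add: field_simps)
    also have "\<dots> \<le> 1 - \<kappa>" using pk kappa_bounds by simp
    finally show ?thesis .
  next
    case False
    have L: "1 \<le> \<Lambda> * \<eta>" "0 < \<Lambda>" using eta q_bounds by (auto simp: \<Lambda>_def)
    have "r < X"
    proof (rule ccontr)
      assume "\<not> r < X"
      then have "\<Lambda> * \<rho> = \<Lambda> * \<eta> * X" by (simp add: \<rho>(1) r_def X_def)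
      also have "\<dots> \<ge> 1 * X" using L X by (intro mult_right_mono) auto
      finally show False using False by simp
    qed
    then have \<rho>eq: "\<rho> = \<eta> * r" by (simp add: \<rho>(1) r_def X_def)
    have "(\<Lambda> * \<rho>)\<^sup>2 \<le> X\<^sup>2" using False L \<rho>0 by (intro power_mono) auto
    then have "p \<le> 1 / \<Lambda>\<^sup>2" using X L by (simp add: p_def power_mult_distrib field_simps)
    then have pk: "p \<le> 16 * \<kappa>" using kappa_bounds by simp
    have "\<tau> \<le> 2 * r\<^sup>2"
    proof -
      have "\<sigma>\<^sup>2 \<le> (\<eta> * r)\<^sup>2" using \<rho>(3) \<rho>eq sigma by (intro power_mono) auto
      then have "M * \<sigma>\<^sup>2 \<le> M * (\<eta> * r)\<^sup>2" using M_pos by (intro mult_left_mono) auto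
      also have "\<dots> = (\<eta>\<^sup>2 * M) * r\<^sup>2" by (simp add: power_mult_distrib)
      also have "\<dots> \<le> 1 * r\<^sup>2" using eta by (intro mult_right_mono) auto
      finally show ?thesis by (simp add: \<tau>_def r_def m_def)
    qed
    then have "\<eta>\<^sup>2 * \<tau> \<le> \<eta>\<^sup>2 * (2 * r\<^sup>2)" by (intro mult_left_mono) auto
    then have "\<eta>\<^sup>2 / 2 \<le> u" using \<tau> by (simp add: u_def \<rho>eq power_mult_distrib field_simps)
    then have "q / 2 * (\<eta>\<^sup>2 / 2) \<le> q / 2 * u" using q_bounds by (intro mult_left_mono) auto
    then have "4 * \<kappa> \<le> q / 2 * u" by (simp add: \<kappa>_def)
    then have "Kf \<le> 1 - 2 * \<kappa>" using Kf pk by linarith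
    then have "y * Kf \<le> y * (1 - 2 * \<kappa>)" using y by (intro mult_left_mono) auto
    also have "\<dots> \<le> (1 + 2 * \<nu>) * (1 - 2 * \<kappa>)" using y sr kappa_bounds by (intro mult_right_mono) auto
    also have "\<dots> \<le> (1 + \<kappa>) * (1 - 2 * \<kappa>)" using kappa_bounds by (intro mult_right_mono) auto
    also have "\<dots> \<le> 1 - \<kappa>" by (simp add: algebra_simps)
    finally show ?thesis .
  qed
  then show ?thesis unfolding y_def Kf_def .
qed

text \<open>Here \<rho> \<ge> \<sigma>, so a parameter s with \<xi> s = \<rho> exists. If x - z lies
  outside the ball of radius \<rho>, the hypothesis replaces g t by the weight and superharmonicity
  applies. Inside, only the total mass of g t, at most Q S s, is known, but then z is far out and F
  s z is exponentially small by \<open>w_far\<close>. The far terms amount to \<theta> (1 + 2 Q),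
  half of the gain \<kappa>.\<close>

lemma upper_region:
  assumes t: "t \<in> I" and A: "0 \<le> A" and hyp: "\<And>s y. 0 \<le> s \<Longrightarrow> s \<le> t \<Longrightarrow> g s y \<le> of_bool (y = 0) + A * w s y"
    and x: "\<sigma> \<le> \<eta> * l2 x" "\<sigma> \<le> \<eta> * \<xi> t"
  shows "g t x \<le> (1 - \<kappa> / 2) * A * w t x"
proof -
  define \<rho> where "\<rho> = \<eta> * min (l2 x) (\<xi> t)"
  have \<rho>: "\<sigma> \<le> \<rho>" "\<rho> \<le> \<eta> * l2 x" "\<rho> \<le> \<eta> * \<xi> t" "0 < \<rho>"
    using x eta sigma by (auto simp: \<rho>_def min_def split: if_splits)
  have "\<eta> * \<xi> t \<le> 1 * \<xi> t" using eta xi_pos[OF t] by (intro mult_right_mono) auto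
  then have \<rho>X: "\<rho> \<le> \<xi> t" using \<rho> by linarith
  obtain s where s: "0 \<le> s" "s \<le> t" "s \<in> I" "\<xi> s = \<rho>" by (rule xi_ivt[OF t \<rho>(1) \<rho>X])
  define \<theta> where "\<theta> = 2 ^ CARD('n) * 9 * exp (- c / (4 * \<eta>))"
  have \<theta>: "0 \<le> \<theta>" by (simp add: \<theta>_def)
  have far: "g s v \<le> A * (\<theta> * w t x)" if "l2 x / 2 \<le> l2 v" for v
  proof -
    have "0 < \<eta> * l2 x" using \<rho> by linarith
    then have "0 < l2 v" using that eta by (simp add: zero_less_mult_iff)
    then have "v \<noteq> 0" using one_le_l2 by (auto simp: l2_def real_vec_def zero_vec_def[symmetric])
    then have "g s v \<le> A * w s v" using hyp[OF s(1,2), of v] by simp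
    also have "\<dots> \<le> A * (\<theta> * w t x)"
      unfolding \<theta>_def by (intro mult_left_mono w_far[OF t \<rho>(4) s(4) \<rho>(3,2,1) that] A)
    finally show ?thesis .
  qed
  \<comment> \<open>Subtracting \<rho> for x - z and k * \<rho> for the range of \<open>J\<close>
    leaves a distance of at least |x| / 2, because \<eta> (1 + k) \<le> 1/2.\<close>
  have farF: "F s z \<le> A * (\<theta> * w t x)" if "l2 (x - z) \<le> \<rho>" for z
  proof -
    have "F s z \<le> (\<Sum>v | J v \<noteq> 0. J v * (A * (\<theta> * w t x)))" unfolding F_fin
    proof (intro sum_mono mult_left_mono J_nonneg far)
      fix v assume "v \<in> {v. J v \<noteq> 0}"
      then have "l2 v \<le> k * \<sigma>" using J_range[of v] by (simp add: k_def)
      also have "\<dots> \<le> k * \<rho>" using \<rho> k_nonneg by (intro mult_left_mono) auto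
      finally have 1: "l2 v \<le> k * \<rho>" .
      have "l2 x \<le> l2 (x - z) + l2 z" using l2_triangle[of "x - z" z] by simp
      moreover have "l2 z \<le> l2 (z - v) + l2 v" using l2_triangle[of "z - v" v] by simp
      moreover have "(1 + k) * \<rho> \<le> (1 + k) * (\<eta> * l2 x)" using \<rho> k_nonneg by (intro mult_left_mono) auto
      moreover have "(1 + k) * (\<eta> * l2 x) = \<eta> * (1 + k) * l2 x" by simp
      moreover have "\<eta> * (1 + k) * l2 x \<le> 1 / 2 * l2 x" using eta by (intro mult_right_mono) (auto simp: k_def l2_def)
      moreover have "(1 + k) * \<rho> = \<rho> + k * \<rho>" by (simp add: distrib_right)
      ultimately show "l2 x / 2 \<le> l2 (z - v)" using 1 that by linarith
    qed
    also have "\<dots> = (\<Sum>v | J v \<noteq> 0. J v) * (A * (\<theta> * w t x))" by (simp add: sum_distrib_right)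
    also have "(\<Sum>v | J v \<noteq> 0. J v) = 1"
    proof -
      have "(\<Sum>\<^sub>\<infinity>z. J z) = infsum J {z. J z \<noteq> 0}" by (rule infsum_cong_neutral) auto
      then show ?thesis using J_sum J_fin by simp
    qed
    finally show ?thesis by simp
  qed
  define P where "P = (\<lambda>z. F s z / S s)"
  have ker: "kernel (c\<^sub>0 / (4 * real CARD('n))) (64 * real CARD('n)) \<rho> P"
    using F_kernel_explicit[OF s(3)] nu_small by (simp add: P_def s(4))
  have Ss: "1 \<le> S s" by (rule S_ge_1[OF s(3)])
  define f where "f = (\<lambda>y :: int ^ 'n. fw \<alpha> (c / \<xi> t) ((\<xi> t)\<^sup>2) ((l2 y)\<^sup>2 + m))"
  define V where "V = (\<Sum>\<^sub>\<infinity>z. P z * (of_bool (\<rho>\<^sup>2 \<le> (l2 (x - z))\<^sup>2 + m) * f (x - z)))"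
  define Kf where "Kf = 1 - \<alpha> * \<rho>\<^sup>2 * (m + (real CARD('n) - 2 - 2 * \<alpha>) / real CARD('n) * (l2 x)\<^sup>2) / ((l2 x)\<^sup>2 + m)\<^sup>2
         + C\<^sub>s * (c * \<rho>\<^sup>2 / (\<xi> t)\<^sup>2 + \<rho> ^ 4 / ((l2 x)\<^sup>2 + m)\<^sup>2)"
  have "\<eta> * l2 x \<le> 1 * l2 x" using eta by (intro mult_right_mono) (auto simp: l2_def)
  then have "\<rho>\<^sup>2 \<le> (l2 x)\<^sup>2" using \<rho> by (intro power_mono) auto
  then have "\<rho>\<^sup>2 \<le> (l2 x)\<^sup>2 + m" using m_pos by linarith
  from superharmonic[OF ker \<rho>X m_pos this]
  have V: "((\<lambda>z. P z * (of_bool (\<rho>\<^sup>2 \<le> (l2 (x - z))\<^sup>2 + m) * f (x - z))) has_sum V) UNIV" "V \<le> w t x * Kf"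
    by (auto simp: V_def f_def w_def Kf_def)
  define h where "h = (\<lambda>y :: int ^ 'n. of_bool (l2 y \<le> \<rho>) * g t y)"
  define W where "W = (\<Sum>y | l2 y \<le> \<rho>. g t y)"
  have "(h has_sum W) UNIV" unfolding W_def
    by (rule has_sum_finite_neutralI[OF finite_l2_ball]) (auto simp: h_def)
  then have W: "((\<lambda>z. h (x - z)) has_sum W) UNIV"
    by (rule has_sum_reindex_bij_witness[where i = "\<lambda>y. x - y" and j = "\<lambda>y. x - y", THEN iffD1, OF _ _ _ _ _ , rotated -1]) auto
  have W0: "0 \<le> W" "W \<le> Q * S s" using local_mass(2)[OF t s(1,2)] g_nonneg[OF t] by (auto simp: W_def s(4) intro: sum_nonneg)
  have "((\<lambda>z. A * S s * (P z * (of_bool (\<rho>\<^sup>2 \<le> (l2 (x - z))\<^sup>2 + m) * f (x - z))) + A * (\<theta> * w t x) * h (x - z))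
      has_sum A * S s * V + A * (\<theta> * w t x) * W) UNIV"
    by (intro has_sum_add has_sum_cmult_right V W)
  with has_sum_infsum[OF F_g_summable[OF s(3) t, of x]]
  have cv: "(\<Sum>\<^sub>\<infinity>z. F s z * g t (x - z)) \<le> A * S s * V + A * (\<theta> * w t x) * W"
  proof (rule has_sum_mono)
    fix z :: "int ^ 'n"
    show "F s z * g t (x - z) \<le> A * S s * (P z * (of_bool (\<rho>\<^sup>2 \<le> (l2 (x - z))\<^sup>2 + m) * f (x - z))) + A * (\<theta> * w t x) * h (x - z)"
    proof (cases "l2 (x - z) \<le> \<rho>")
      case True
      have "F s z * g t (x - z) \<le> A * (\<theta> * w t x) * g t (x - z)"
        by (intro mult_right_mono farF True g_nonneg t)
      moreover have "0 \<le> A * S s * (P z * (of_bool (\<rho>\<^sup>2 \<le> (l2 (x - z))\<^sup>2 + m) * f (x - z)))"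
        using A Ss F_nonneg[OF s(3)] w_pos[of t "x - z"] by (intro mult_nonneg_nonneg) (auto simp: P_def f_def w_def)
      ultimately show ?thesis using True by (simp add: h_def)
    next
      case False
      then have "x - z \<noteq> 0" using \<rho> by (auto simp: l2_def real_vec_def zero_vec_def[symmetric])
      then have "g t (x - z) \<le> A * f (x - z)" using hyp[of t "x - z"] I_nonneg[OF t] by (simp add: f_def w_def)
      then have "F s z * g t (x - z) \<le> F s z * (A * f (x - z))" by (rule mult_left_mono[OF _ F_nonneg[OF s(3)]])
      moreover have "\<rho>\<^sup>2 \<le> (l2 (x - z))\<^sup>2" using False \<rho> by (intro power_mono) auto
      then have "\<rho>\<^sup>2 \<le> (l2 (x - z))\<^sup>2 + m" using m_pos by linarith
      ultimately show ?thesis using False Ss by (simp add: h_def P_def mult_ac)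
    qed
  qed
  define y where "y = (t - s) * S s"
  have y: "0 \<le> y" using s Ss by (simp add: y_def)
  have y2: "y \<le> 2"
  proof -
    have "0 \<le> S s / S t" using Ss S_ge_1[OF t] by simp
    then show ?thesis using kill_le(1)[OF t s(1,2)] nu unfolding y_def by linarith
  qed
  have "g t x \<le> g s x + (t - s) * conv (F s) (g t) x" by (rule g_upper[OF t s(1,2)])
  also have "\<dots> \<le> A * (\<theta> * w t x) + (t - s) * (A * S s * V + A * (\<theta> * w t x) * (Q * S s))"
  proof (intro add_mono mult_left_mono)
    show "g s x \<le> A * (\<theta> * w t x)" by (rule far) (simp add: l2_def)
    have "A * (\<theta> * w t x) * W \<le> A * (\<theta> * w t x) * (Q * S s)"
      using A \<theta> less_imp_le[OF w_pos[of t x]] W0 by (intro mult_left_mono mult_nonneg_nonneg) auto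
    then show "conv (F s) (g t) x \<le> A * S s * V + A * (\<theta> * w t x) * (Q * S s)"
      using cv by (simp add: conv_def[of "F s"])
  qed (use s in auto)
  also have "\<dots> = A * (\<theta> * w t x + y * V + \<theta> * w t x * (Q * y))" by (simp add: y_def algebra_simps)
  also have "\<dots> \<le> A * (\<theta> * w t x + w t x * (1 - \<kappa>) + \<theta> * w t x * (Q * 2))"
  proof (rule mult_left_mono[OF add_mono[OF add_mono[OF order_refl]] A])
    have "y * V \<le> y * (w t x * Kf)" using V y by (intro mult_left_mono)
    also have "\<dots> = w t x * (y * Kf)" by simp
    also have "\<dots> \<le> w t x * (1 - \<kappa>)"
      using drift_upper[OF t s(1,2) \<rho>_def s(4) \<rho>(1)] less_imp_le[OF w_pos] unfolding y_def Kf_def by (intro mult_left_mono) auto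
    finally show "y * V \<le> w t x * (1 - \<kappa>)" .
    show "\<theta> * w t x * (Q * y) \<le> \<theta> * w t x * (Q * 2)"
      using y2 local_mass(1) \<theta> less_imp_le[OF w_pos[of t x]] by (intro mult_left_mono mult_nonneg_nonneg) auto
  qed
  also have "\<dots> = A * w t x * (\<theta> * (1 + 2 * Q) + (1 - \<kappa>))" by (simp add: algebra_simps)
  also have "\<dots> \<le> A * w t x * (\<kappa> / 2 + (1 - \<kappa>))"
  proof (intro mult_left_mono add_mono order_refl)
    show "\<theta> * (1 + 2 * Q) \<le> \<kappa> / 2" using eta(6) by (simp add: \<theta>_def \<kappa>_def)
  qed (use A w_pos[of t x] in auto)
  finally show ?thesis by (simp add: algebra_simps)
qed

text \<open>The step length \<eta> min |x| (\<xi> t) would fall below \<sigma>, so the step is taken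
  from parameter 0 with law \<open>J\<close>, where (t - 0) * S 0 = t. The first bound parallels
  \<open>drift_upper\<close>; the second keeps the gain due to the offset m alone, which is uniform
  in \<epsilon> as \<alpha> \<ge> 1/4.\<close>

lemma drift_base:
  fixes x :: "int ^ 'n"
  assumes t: "t \<in> I" and x: "\<eta> * l2 x < \<sigma> \<or> \<eta> * \<xi> t < \<sigma>"
  defines "Kf \<equiv> 1 - \<alpha> * \<sigma>\<^sup>2 * (m + (real CARD('n) - 2 - 2 * \<alpha>) / real CARD('n) * (l2 x)\<^sup>2) / ((l2 x)\<^sup>2 + m)\<^sup>2
         + C\<^sub>s * (c * \<sigma>\<^sup>2 / (\<xi> t)\<^sup>2 + \<sigma> ^ 4 / ((l2 x)\<^sup>2 + m)\<^sup>2)"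
  shows "t * Kf \<le> 1 - \<kappa>" "t * Kf \<le> 1 - \<alpha> * \<sigma>\<^sup>2 * m / (8 * ((l2 x)\<^sup>2 + m)\<^sup>2)"
proof -
  define r X \<tau> where "r = l2 x" and "X = \<xi> t" and "\<tau> = (l2 x)\<^sup>2 + m"
  define p where "p = \<sigma>\<^sup>2 / X\<^sup>2"
  \<comment> \<open>Half of the drift gain; the other half absorbs the fourth-order error because
    \<open>8 * C\<^sub>s \<le> M\<close>.\<close>
  define Y where "Y = \<alpha> * \<sigma>\<^sup>2 * (m + \<epsilon> / real CARD('n) * r\<^sup>2) / (2 * \<tau>\<^sup>2)"
  have X: "0 < X" "\<sigma> \<le> X" using xi_pos[OF t] xi_ge[OF t] by (auto simp: X_def)
  have \<tau>: "0 < \<tau>" unfolding \<tau>_def by (rule tau_pos)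
  have p: "0 < p" "p \<le> 1"
  proof -
    show "0 < p" using sigma X by (simp add: p_def)
    have "\<sigma>\<^sup>2 \<le> X\<^sup>2" using X sigma by (intro power_mono) auto
    then show "p \<le> 1" using X by (simp add: p_def)
  qed
  have ed: "0 < \<epsilon> / real CARD('n)" "\<epsilon> / real CARD('n) \<le> 1" using eps dim by auto
  have y: "0 \<le> t" "t \<le> 1 - 1 / S t + 2 * \<nu>"
    using kill_le(1)[OF t order_refl I_nonneg[OF t]] I_nonneg[OF t] S_0[OF zero_in_I[OF t]] by auto
  have sr: "0 \<le> 1 / S t" using S_ge_1[OF t] by simp
  have Ym: "\<alpha> * \<sigma>\<^sup>2 * m / (2 * \<tau>\<^sup>2) \<le> Y"
  proof -
    have "0 \<le> \<epsilon> / real CARD('n) * r\<^sup>2" using ed by (intro mult_nonneg_nonneg) auto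
    then have "m \<le> m + \<epsilon> / real CARD('n) * r\<^sup>2" by linarith
    then show ?thesis unfolding Y_def using alpha_bounds by (intro divide_right_mono mult_left_mono) auto
  qed
  have CY: "C\<^sub>s * (\<sigma> ^ 4 / \<tau>\<^sup>2) \<le> Y"
  proof -
    have "8 * C\<^sub>s \<le> 4 * \<alpha> * M" using mult_mono[of 1 "4 * \<alpha>" "8 * C\<^sub>s" M] M alpha_bounds Cs by simp
    then have "8 * C\<^sub>s * (\<sigma> ^ 4 / \<tau>\<^sup>2) \<le> 4 * \<alpha> * M * (\<sigma> ^ 4 / \<tau>\<^sup>2)" by (intro mult_right_mono) auto
    also have "\<dots> = 8 * (\<alpha> * \<sigma>\<^sup>2 * m / (2 * \<tau>\<^sup>2))" by (simp add: m_def power2_eq_square power4_eq_xxxx)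
    finally show ?thesis using Ym by linarith
  qed
  have Kf: "Kf \<le> 1 - Y + p / 8"
  proof -
    have "C\<^sub>s * (c * \<sigma>\<^sup>2 / X\<^sup>2) \<le> p / 8"
      using mult_right_mono[OF c(3), of p] p by (simp add: p_def)
    moreover have e: "real CARD('n) - 2 - 2 * \<alpha> = \<epsilon>" using alpha_bounds by simp
    have "Kf = 1 - \<alpha> * \<sigma>\<^sup>2 * (m + \<epsilon> / real CARD('n) * r\<^sup>2) / \<tau>\<^sup>2 + C\<^sub>s * (c * \<sigma>\<^sup>2 / X\<^sup>2 + \<sigma> ^ 4 / \<tau>\<^sup>2)"
      by (simp only: Kf_def e X_def \<tau>_def r_def)
    moreover have "\<alpha> * \<sigma>\<^sup>2 * (m + \<epsilon> / real CARD('n) * r\<^sup>2) / \<tau>\<^sup>2 = 2 * Y" by (simp add: Y_def)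
    ultimately have "Kf = 1 - 2 * Y + C\<^sub>s * (c * \<sigma>\<^sup>2 / X\<^sup>2) + C\<^sub>s * (\<sigma> ^ 4 / \<tau>\<^sup>2)"
      "C\<^sub>s * (c * \<sigma>\<^sup>2 / X\<^sup>2) \<le> p / 8"
      by (simp_all only: distrib_left add.assoc)
    then show ?thesis using CY by linarith
  qed
  have Y0: "0 \<le> Y" unfolding Y_def using alpha_bounds less_imp_le[OF eps(1)] m_pos by (intro divide_nonneg_nonneg mult_nonneg_nonneg add_nonneg_nonneg) auto
  have Y1: "Y \<le> 1 / 4"
  proof -
    have "\<epsilon> / real CARD('n) * r\<^sup>2 \<le> 1 * r\<^sup>2" using ed by (intro mult_right_mono) auto
    then have "m + \<epsilon> / real CARD('n) * r\<^sup>2 \<le> \<tau>" by (simp add: \<tau>_def r_def)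
    then have "Y \<le> \<alpha> * \<sigma>\<^sup>2 * \<tau> / (2 * \<tau>\<^sup>2)" unfolding Y_def
      using alpha_bounds by (intro divide_right_mono mult_left_mono) auto
    also have "\<dots> = \<alpha> * \<sigma>\<^sup>2 / (2 * \<tau>)" using \<tau> by (simp add: power2_eq_square)
    also have "\<dots> \<le> 1 / 4"
    proof -
      have "2 * \<alpha> * \<sigma>\<^sup>2 \<le> M * \<sigma>\<^sup>2" using alpha_bounds M by (intro mult_right_mono) auto
      also have "\<dots> \<le> \<tau>" by (simp add: \<tau>_def m_def)
      finally show ?thesis using \<tau> by (simp add: divide_le_eq)
    qed
    finally show ?thesis .
  qed
  have "t * Kf \<le> 1 - \<kappa> \<and> t * Kf \<le> 1 - Y / 4"
  proof (cases "X \<le> \<Lambda> * \<sigma>")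
    case True
    have L: "0 < \<Lambda>" using eta q_bounds by (simp add: \<Lambda>_def)
    have "X\<^sup>2 \<le> (\<Lambda> * \<sigma>)\<^sup>2" using True X by (intro power_mono) auto
    then have "1 / \<Lambda>\<^sup>2 \<le> p" using X L by (simp add: p_def power_mult_distrib field_simps)
    then have pk: "16 * \<kappa> \<le> p" using kappa_bounds by simp
    have "S 0 / S t \<ge> (\<xi> 0 / \<xi> t)\<^sup>2 / 2"
      by (rule S_ratio[OF t order_refl I_nonneg[OF t], of \<Lambda>])
        (use True nu_small xi_0[OF zero_in_I[OF t]] in \<open>auto simp: X_def \<Lambda>_def\<close>)
    then have "p / 2 \<le> 1 / S t" using S_0[OF zero_in_I[OF t]] xi_0[OF zero_in_I[OF t]] by (simp add: p_def X_def power_divide)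
    then have y1: "t \<le> 1 - p / 2 + p / 16" using y pk kappa_bounds by linarith
    have "t * Kf \<le> t * ((1 - Y) + p / 8)" using y Kf by (intro mult_left_mono) auto
    also have "\<dots> \<le> (1 - p / 2 + p / 16) * ((1 - Y) + p / 8)" using y1 p Y1 by (intro mult_right_mono) auto
    also have "\<dots> = (1 - Y) + p / 8 - 7 / 16 * p * (1 - Y) - 7 / 16 * (p * p) / 8" by (simp add: field_simps)
    also have "\<dots> \<le> (1 - Y) + p / 8 - 7 / 16 * p * (3 / 4) - 0"
      using p Y1 by (intro diff_mono mult_left_mono order_refl) auto
    finally have "t * Kf \<le> 1 - Y - 13 / 64 * p" by simp
    then show ?thesis using pk Y0 p kappa_bounds by linarith
  next
    case False
    have L: "1 \<le> \<Lambda> * \<eta>" "0 < \<Lambda>" using eta q_bounds by (auto simp: \<Lambda>_def)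
    \<comment> \<open>In this case \<eta> \<xi> t \<ge> \<sigma>, so the hypothesis leaves \<eta>
      |x| < \<sigma>, which bounds |x| by a multiple of \<sigma>.\<close>
    have "1 * \<sigma> \<le> \<Lambda> * \<eta> * \<sigma>" using L sigma by (intro mult_right_mono) auto
    also have "\<dots> = \<eta> * (\<Lambda> * \<sigma>)" by simp
    also have "\<dots> \<le> \<eta> * X" using False eta by (intro mult_left_mono) auto
    finally have r: "\<eta> * r < \<sigma>" using x by (simp add: X_def r_def)
    have "(\<Lambda> * \<sigma>)\<^sup>2 \<le> X\<^sup>2" using False L sigma by (intro power_mono) auto
    then have "p \<le> 1 / \<Lambda>\<^sup>2" using X L by (simp add: p_def power_mult_distrib field_simps)
    then have pk: "p \<le> 16 * \<kappa>" using kappa_bounds by simp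
    have t2: "\<eta>\<^sup>2 * \<tau> \<le> 2 * \<sigma>\<^sup>2"
    proof -
      have "(\<eta> * r)\<^sup>2 \<le> \<sigma>\<^sup>2" using r eta by (intro power_mono) (auto simp: r_def l2_def)
      moreover have "\<eta>\<^sup>2 * M * \<sigma>\<^sup>2 \<le> 1 * \<sigma>\<^sup>2" using eta by (intro mult_right_mono) auto
      ultimately show ?thesis by (simp add: \<tau>_def m_def r_def power_mult_distrib distrib_left)
    qed
    have "\<epsilon> / real CARD('n) * m \<le> 1 * m" using ed m_pos by (intro mult_right_mono) auto
    then have "\<epsilon> / real CARD('n) * \<tau> \<le> m + \<epsilon> / real CARD('n) * r\<^sup>2" by (simp add: \<tau>_def r_def distrib_left)
    then have "\<alpha> * \<sigma>\<^sup>2 * (\<epsilon> / real CARD('n) * \<tau>) / (2 * \<tau>\<^sup>2) \<le> Y" unfolding Y_def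
      using alpha_bounds by (intro divide_right_mono mult_left_mono) auto
    moreover have "\<alpha> * \<sigma>\<^sup>2 * (\<epsilon> / real CARD('n) * \<tau>) / (2 * \<tau>\<^sup>2) = q / 2 * (\<sigma>\<^sup>2 / \<tau>)"
      using \<tau> by (simp add: q_def power2_eq_square field_simps)
    moreover have "q / 2 * (\<eta>\<^sup>2 / 2) \<le> q / 2 * (\<sigma>\<^sup>2 / \<tau>)"
      using t2 \<tau> q_bounds by (intro mult_left_mono) (auto simp: field_simps)
    moreover have "4 * \<kappa> = q / 2 * (\<eta>\<^sup>2 / 2)" by (simp add: \<kappa>_def)
    ultimately have Yk: "4 * \<kappa> \<le> Y" by linarith
    then have "Kf \<le> 1 - Y / 2" using Kf pk by linarith
    then have "t * Kf \<le> t * (1 - Y / 2)" using y by (intro mult_left_mono) auto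
    also have "\<dots> \<le> (1 + 2 * \<nu>) * (1 - Y / 2)"
    proof (rule mult_right_mono)
      show "t \<le> 1 + 2 * \<nu>" using y(2) sr by linarith
    qed (use Y1 in simp)
    also have "\<dots> \<le> (1 + \<kappa>) * (1 - Y / 2)" using kappa_bounds Y1 by (intro mult_right_mono) auto
    also have "\<dots> = 1 + \<kappa> - Y / 2 - \<kappa> * Y / 2" by (simp add: algebra_simps)
    also have "\<dots> \<le> 1 + \<kappa> - Y / 2 - 0" using kappa_bounds Y0 by (intro diff_mono order_refl) auto
    finally show ?thesis using Yk by linarith
  qed
  moreover have "\<alpha> * \<sigma>\<^sup>2 * m / (8 * \<tau>\<^sup>2) \<le> Y / 4" using divide_right_mono[OF Ym, of 4] by (simp add: mult_ac)
  ultimately have "t * Kf \<le> 1 - \<kappa> \<and> t * Kf \<le> 1 - \<alpha> * \<sigma>\<^sup>2 * m / (8 * \<tau>\<^sup>2)" by linarith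
  then show "t * Kf \<le> 1 - \<kappa>" "t * Kf \<le> 1 - \<alpha> * \<sigma>\<^sup>2 * m / (8 * ((l2 x)\<^sup>2 + m)\<^sup>2)"
    unfolding \<tau>_def by blast+
qed

text \<open>For x \<noteq> 0 the only source is t * J x. Where J x = 0 the bound contracts by 1 -
  \<kappa>, which depends on \<epsilon>, but nothing is added. On the support of \<open>J\<close>
  the contraction \<open>1 - X\<^sub>0 / 4\<close> is free of \<epsilon>, and so is the bound that
  the source produces.\<close>

lemma base_region:
  assumes t: "t \<in> I" and A: "0 \<le> A" and hyp: "\<And>y. g t y \<le> of_bool (y = 0) + A * w t y"
    and x: "\<eta> * l2 x < \<sigma> \<or> \<eta> * \<xi> t < \<sigma>"
  shows "g t x - of_bool (x = 0) \<le> (1 - \<kappa>) * A * w t x \<or>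
    g t x - of_bool (x = 0) \<le> (B\<^sub>0 * \<sigma> powr (2 * \<alpha> - real CARD('n)) + (1 - X\<^sub>0 / 4) * A) * w t x"
proof -
  note z = zero_in_I[OF t]
  define f where "f = (\<lambda>y :: int ^ 'n. fw \<alpha> (c / \<xi> t) ((\<xi> t)\<^sup>2) ((l2 y)\<^sup>2 + m))"
  define V where "V = (\<Sum>\<^sub>\<infinity>z. J z * f (x - z))"
  define Kf where "Kf = 1 - \<alpha> * \<sigma>\<^sup>2 * (m + (real CARD('n) - 2 - 2 * \<alpha>) / real CARD('n) * (l2 x)\<^sup>2) / ((l2 x)\<^sup>2 + m)\<^sup>2
         + C\<^sub>s * (c * \<sigma>\<^sup>2 / (\<xi> t)\<^sup>2 + \<sigma> ^ 4 / ((l2 x)\<^sup>2 + m)\<^sup>2)"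
  have ker: "kernel (c\<^sub>0 / (4 * real CARD('n))) (64 * real CARD('n)) \<sigma> J"
    using F_kernel_explicit[OF z] nu_small by (simp add: F_0[OF z] S_0[OF z] xi_0[OF z])
  have cut: "\<sigma>\<^sup>2 \<le> (l2 y)\<^sup>2 + m" for y using m_ge by (rule add_increasing[OF zero_le_power2])
  from superharmonic[OF ker xi_ge[OF t] m_pos cut]
  have V: "((\<lambda>z. J z * f (x - z)) has_sum V) UNIV" "V \<le> w t x * Kf"
    by (auto simp: V_def f_def w_def Kf_def cut)
  have J1: "((\<lambda>z. J z * of_bool (x - z = 0)) has_sum J x) UNIV"
    by (rule has_sum_finite_neutralI[of "{x}"]) auto
  have "F 0 = J" by (rule F_0[OF z])
  then have "(\<lambda>y. J y * g t (x - y)) summable_on UNIV" using F_g_summable[OF z t, of x] by simp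
  then have Jg: "((\<lambda>y. J y * g t (x - y)) has_sum conv J (g t) x) UNIV"
    by (simp add: conv_def)
  have Jf: "((\<lambda>z. J z * of_bool (x - z = 0) + A * (J z * f (x - z))) has_sum J x + A * V) UNIV"
    by (intro has_sum_add has_sum_cmult_right V J1)
  have cv: "conv J (g t) x \<le> J x + A * V"
  proof -
    have "J y * g t (x - y) \<le> J y * of_bool (x - y = 0) + A * (J y * f (x - y))" for y
      using mult_left_mono[OF hyp[of "x - y"] J_nonneg[of y]] by (simp add: f_def w_def algebra_simps)
    then show ?thesis by (intro has_sum_mono[OF Jg Jf])
  qed
  note t0 = I_nonneg[OF t]
  have "g t x \<le> g 0 x + (t - 0) * conv (F 0) (g t) x" by (rule g_upper[OF t order_refl t0])
  also have "\<dots> = of_bool (x = 0) + t * conv J (g t) x" using F_0[OF z] g_0[OF z] by simp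
  also have "\<dots> \<le> of_bool (x = 0) + t * (J x + A * V)" using cv t0 by (intro add_left_mono mult_left_mono)
  finally have 1: "g t x - of_bool (x = 0) \<le> t * J x + A * (t * V)" by (simp add: algebra_simps)
  have tV: "A * (t * V) \<le> A * ((t * Kf) * w t x)"
    using mult_left_mono[OF V(2) t0] A by (intro mult_left_mono) (auto simp: mult_ac)
  note d = drift_base[OF t x, folded Kf_def]
  show ?thesis
  proof (cases "J x = 0")
    case True
    have "A * ((t * Kf) * w t x) \<le> A * ((1 - \<kappa>) * w t x)"
      using d(1) A less_imp_le[OF w_pos] by (intro mult_left_mono mult_right_mono) auto
    then show ?thesis using 1 tV True by (simp add: mult_ac)
  next
    case False
    define N where "N = k\<^sup>2 + M"
    have N: "1 \<le> N" using M_pos by (simp add: N_def add_increasing)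
    have "l2 x \<le> k * \<sigma>" using J_range[OF False] by (simp add: k_def)
    then have "(l2 x)\<^sup>2 \<le> (k * \<sigma>)\<^sup>2" by (intro power_mono) (auto simp: l2_def)
    then have \<tau>: "(l2 x)\<^sup>2 + m \<le> N * \<sigma>\<^sup>2" by (simp add: N_def m_def power_mult_distrib distrib_right)
    have X0: "X\<^sub>0 / 4 \<le> \<alpha> * \<sigma>\<^sup>2 * m / (8 * ((l2 x)\<^sup>2 + m)\<^sup>2)"
    proof -
      have "X\<^sub>0 / 4 = (1 / 4) * \<sigma>\<^sup>2 * m / (8 * (N * \<sigma>\<^sup>2)\<^sup>2)"
        using sigma unfolding X\<^sub>0_def N_def[symmetric] m_def by (simp add: power2_eq_square)
      also have "\<dots> \<le> \<alpha> * \<sigma>\<^sup>2 * m / (8 * ((l2 x)\<^sup>2 + m)\<^sup>2)"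
        using alpha_bounds m_pos tau_pos[of x] \<tau>
        by (intro frac_le mult_right_mono mult_left_mono power_mono mult_nonneg_nonneg) auto
      finally show ?thesis .
    qed
    have "t * Kf \<le> 1 - X\<^sub>0 / 4" using d(2) X0 by linarith
    then have 2: "A * ((t * Kf) * w t x) \<le> A * ((1 - X\<^sub>0 / 4) * w t x)"
      using A less_imp_le[OF w_pos] by (intro mult_left_mono mult_right_mono) auto
    have t2: "t \<le> 2"
    proof -
      have "0 \<le> 1 / S t" using S_ge_1[OF t] by simp
      moreover have "t \<le> 1 - 1 / S t + 2 * \<nu>" using kill_le(1)[OF t order_refl t0] S_0[OF z] by simp
      ultimately show ?thesis using nu by linarith
    qed
    define K where "K = sqrt (real CARD('n)) ^ CARD('n) / c\<^sub>0"
    have K: "0 \<le> K" using c0 by (simp add: K_def)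
    have "N powr (- \<alpha>) * \<sigma> powr (- (2 * \<alpha>)) \<le> ((l2 x)\<^sup>2 + m) powr (- \<alpha>)"
    proof -
      have "(N * \<sigma>\<^sup>2) powr (- \<alpha>) \<le> ((l2 x)\<^sup>2 + m) powr (- \<alpha>)"
        using \<tau> tau_pos[of x] alpha_bounds by (intro powr_mono2') auto
      moreover have "(\<sigma>\<^sup>2) powr (- \<alpha>) = \<sigma> powr (- (2 * \<alpha>))"
        using powr_powr[of \<sigma> 2 "- \<alpha>"] sigma by simp
      ultimately show ?thesis using N by (simp add: powr_mult)
    qed
    moreover have "exp (- (sqrt N + 1)) \<le> exp (- (c / \<xi> t) * sqrt ((l2 x)\<^sup>2 + m + (\<xi> t)\<^sup>2))"
    proof -
      have X: "\<sigma> \<le> \<xi> t" "0 < \<xi> t" using xi_ge[OF t] xi_pos[OF t] by auto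
      have "\<sigma>\<^sup>2 \<le> (\<xi> t)\<^sup>2" using X sigma by (intro power_mono) auto
      then have "N * \<sigma>\<^sup>2 \<le> N * (\<xi> t)\<^sup>2" using N by (intro mult_left_mono) auto
      then have "(l2 x)\<^sup>2 + m + (\<xi> t)\<^sup>2 \<le> N * (\<xi> t)\<^sup>2 + (\<xi> t)\<^sup>2" using \<tau> by linarith
      also have "\<dots> \<le> (sqrt N * \<xi> t + \<xi> t)\<^sup>2"
      proof -
        have "0 \<le> 2 * (sqrt N * \<xi> t) * \<xi> t" using X N by (intro mult_nonneg_nonneg) auto
        then show ?thesis unfolding power2_sum using N by (simp add: power_mult_distrib)
      qed
      finally have "sqrt ((l2 x)\<^sup>2 + m + (\<xi> t)\<^sup>2) \<le> sqrt N * \<xi> t + \<xi> t"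
        using X N by (intro real_le_lsqrt) (auto intro: add_nonneg_nonneg)
      then have "c / \<xi> t * sqrt ((l2 x)\<^sup>2 + m + (\<xi> t)\<^sup>2) \<le> c / \<xi> t * (sqrt N * \<xi> t + \<xi> t)"
        using X c by (intro mult_left_mono) auto
      also have "\<dots> = c * (sqrt N + 1)" using X by (simp add: field_simps)
      also have "\<dots> \<le> 1 * (sqrt N + 1)" using c N by (intro mult_right_mono) auto
      finally show ?thesis by simp
    qed
    ultimately have wl: "N powr (- \<alpha>) * \<sigma> powr (- (2 * \<alpha>)) * exp (- (sqrt N + 1)) \<le> w t x"
      unfolding w_def fw_def by (intro mult_mono) auto
    have "t * J x \<le> 2 * (K / \<sigma> ^ CARD('n))"
      using J_le[of x] t2 t0 J_nonneg by (intro mult_mono) (auto simp: K_def)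
    also have "\<dots> \<le> B\<^sub>0 * \<sigma> powr (2 * \<alpha> - real CARD('n)) * (N powr (- \<alpha>) * \<sigma> powr (- (2 * \<alpha>)) * exp (- (sqrt N + 1)))"
    proof -
      have NN: "1 \<le> N ^ CARD('n) * N powr (- \<alpha>)"
      proof -
        have "N ^ CARD('n) * N powr (- \<alpha>) = N powr (real CARD('n) - \<alpha>)"
          using N by (simp add: powr_realpow[symmetric] powr_add[symmetric])
        then show ?thesis using N alpha_bounds dim by (simp add: ge_one_powr_ge_zero)
      qed
      have ss: "\<sigma> powr (2 * \<alpha> - real CARD('n)) * \<sigma> powr (- (2 * \<alpha>)) = 1 / \<sigma> ^ CARD('n)"
        using sigma by (simp add: powr_diff powr_minus_divide powr_realpow)
      have ee: "exp (sqrt N + 1) * exp (- (sqrt N + 1)) = 1" by (rule exp_minus_inverse)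
      have "B\<^sub>0 * \<sigma> powr (2 * \<alpha> - real CARD('n)) * (N powr (- \<alpha>) * \<sigma> powr (- (2 * \<alpha>)) * exp (- (sqrt N + 1)))
        = 2 * K * (N ^ CARD('n) * N powr (- \<alpha>)) * (\<sigma> powr (2 * \<alpha> - real CARD('n)) * \<sigma> powr (- (2 * \<alpha>))) * (exp (sqrt N + 1) * exp (- (sqrt N + 1)))"
        unfolding B\<^sub>0_def N_def[symmetric] K_def[symmetric] by (simp only: mult_ac)
      also have "\<dots> = 2 * (K / \<sigma> ^ CARD('n)) * (N ^ CARD('n) * N powr (- \<alpha>))" unfolding ss ee by simp
      also have "\<dots> \<ge> 2 * (K / \<sigma> ^ CARD('n)) * 1" using NN K sigma by (intro mult_left_mono) auto
      finally show ?thesis by simp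
    qed
    also have "\<dots> \<le> B\<^sub>0 * \<sigma> powr (2 * \<alpha> - real CARD('n)) * w t x"
    proof (rule mult_left_mono[OF wl])
      have "0 \<le> B\<^sub>0" using K N unfolding B\<^sub>0_def N_def[symmetric] K_def[symmetric] by (intro mult_nonneg_nonneg) auto
      then show "0 \<le> B\<^sub>0 * \<sigma> powr (2 * \<alpha> - real CARD('n))" by simp
    qed
    finally show ?thesis using 1 tV 2 by (simp add: algebra_simps)
  qed
qed

text \<open>Makes the supremum in the maximum principle finite; the constant is irrelevant.\<close>
lemma ratio_bounded:
  assumes t: "t \<in> I"
  obtains Z where "\<And>s y. 0 \<le> s \<Longrightarrow> s \<le> t \<Longrightarrow> g s y \<le> Z * w s y"
proof -
  define a where "a = c\<^sub>0 / (4 * real CARD('n))"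
  have a: "0 < a" "c \<le> a / 2" using c c0 dim by (auto simp: a_def)
  define b where "b = a / 2 / \<xi> t"
  have b: "0 < b" using a xi_pos[OF t] by (simp add: b_def)
  \<comment> \<open>exp (b * r) has to dominate the d-th power of 1 + r^2 / m, so each factor
    receives the rate b / d.\<close>
  define b' where "b' = b / real CARD('n)"
  have b': "0 < b'" using b dim by (simp add: b'_def)
  define E where "E = 1 + 2 / b'\<^sup>2 / m"
  have E: "1 \<le> E" using m_pos by (simp add: E_def)
  define Z where "Z = 64 * real CARD('n) * S t * (m powr \<alpha> * E ^ CARD('n) * exp (sqrt m / \<sigma> + 1))"
  have "g s y \<le> Z * w s y" if s: "0 \<le> s" "s \<le> t" for s y
  proof -
    have sI: "s \<in> I" using I_down[OF t s] .
    define r X \<tau> where "r = l2 y" and "X = \<xi> s" and "\<tau> = r\<^sup>2 + m"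
    have r: "0 \<le> r" by (simp add: r_def l2_def)
    have X: "0 < X" "\<sigma> \<le> X" "X \<le> \<xi> t" using xi_pos[OF sI] xi_ge[OF sI] xi_mono[OF t s] by (auto simp: X_def)
    have \<tau>: "m \<le> \<tau>" "0 < \<tau>" using m_pos by (auto simp: \<tau>_def add_nonneg_pos)
    have 1: "g s y * exp (a * (r / X)) \<le> 64 * real CARD('n) * S t"
    proof -
      have e: "esum (a / X) (g s)" "(\<Sum>\<^sub>\<infinity>x. g s x * exp (a * (l2 x / X))) \<le> 64 * real CARD('n) * S s"
        using exp_moments_explicit(1,2)[OF sI nu_small(1)] by (auto simp: a_def X_def)
      then have "(\<lambda>x. g s x * exp (a * (l2 x / X))) summable_on UNIV"
        using g_nonneg[OF sI] by (simp add: esum_def)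
      from finite_sum_le_infsum[OF this, of "{y}"]
      have "g s y * exp (a * (l2 y / X)) \<le> (\<Sum>\<^sub>\<infinity>x. g s x * exp (a * (l2 x / X)))" using g_nonneg[OF sI] by simp
      also have "\<dots> \<le> 64 * real CARD('n) * S t" by (rule order_trans[OF e(2)]) (use S_mono[OF t s] in \<open>intro mult_left_mono, auto\<close>)
      finally show ?thesis by (simp add: r_def)
    qed
    have 2: "\<tau> powr \<alpha> \<le> m powr \<alpha> * E ^ CARD('n) * exp (b * r)"
    proof -
      define v where "v = \<tau> / m"
      have v1: "1 \<le> v" using \<tau> m_pos by (simp add: v_def)
      have "r\<^sup>2 \<le> 2 / b'\<^sup>2 * exp (b' * r)" using power_le_exp[OF r b', of 2] by (simp add: fact_numeral)
      then have "r\<^sup>2 / m \<le> 2 / b'\<^sup>2 * exp (b' * r) / m" using m_pos by (intro divide_right_mono) auto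
      moreover have "1 \<le> exp (b' * r)" using b' r by simp
      moreover have "v = 1 + r\<^sup>2 / m" using m_pos by (simp add: v_def \<tau>_def add_divide_distrib)
      moreover have "E * exp (b' * r) = exp (b' * r) + 2 / b'\<^sup>2 * exp (b' * r) / m" by (simp add: E_def distrib_right)
      ultimately have "v \<le> E * exp (b' * r)" by linarith
      then have "v ^ CARD('n) \<le> (E * exp (b' * r)) ^ CARD('n)" using v1 by (intro power_mono) auto
      also have "\<dots> = E ^ CARD('n) * exp (b * r)"
        using dim by (simp add: power_mult_distrib exp_of_nat_mult[symmetric] b'_def)
      finally have v2: "v ^ CARD('n) \<le> E ^ CARD('n) * exp (b * r)" .
      have "v powr \<alpha> \<le> v powr (real CARD('n))" using v1 alpha_bounds dim by (intro powr_mono) auto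
      then have "v powr \<alpha> \<le> E ^ CARD('n) * exp (b * r)" using v1 v2 by (simp add: powr_realpow)
      then have "m powr \<alpha> * v powr \<alpha> \<le> m powr \<alpha> * (E ^ CARD('n) * exp (b * r))" by (intro mult_left_mono) auto
      moreover have "m powr \<alpha> * v powr \<alpha> = \<tau> powr \<alpha>" using m_pos v1 by (simp add: powr_mult[symmetric] v_def)
      ultimately show ?thesis by simp
    qed
    have 3: "exp (c / X * sqrt (\<tau> + X\<^sup>2)) \<le> exp (a / 2 * (r / X)) * exp (sqrt m / \<sigma> + 1)"
    proof -
      have "0 \<le> r * sqrt m" "0 \<le> r * X" "0 \<le> sqrt m * X" using r X m_pos by auto
      moreover have "sqrt m * sqrt m = m" using m_pos by simp
      ultimately have "\<tau> + X\<^sup>2 \<le> (r + sqrt m + X)\<^sup>2"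
        by (simp add: \<tau>_def power2_eq_square algebra_simps)
      then have "sqrt (\<tau> + X\<^sup>2) \<le> r + sqrt m + X" using r X m_pos by (intro real_le_lsqrt) auto
      then have "c / X * sqrt (\<tau> + X\<^sup>2) \<le> c / X * (r + sqrt m + X)" using c X by (intro mult_left_mono) auto
      also have "\<dots> = c * (r / X) + c * (sqrt m / X + 1)" using X by (simp add: field_simps)
      also have "\<dots> \<le> a / 2 * (r / X) + 1 * (sqrt m / \<sigma> + 1)"
      proof (intro add_mono mult_mono)
        show "sqrt m / X \<le> sqrt m / \<sigma>" using X sigma m_pos by (intro divide_left_mono) auto
      qed (use a c r X m_pos in auto)
      finally show ?thesis by (simp flip: exp_add)
    qed
    have br: "b * r \<le> a / 2 * (r / X)"
    proof -
      have "a / 2 * r / \<xi> t \<le> a / 2 * r / X" using X a r by (intro divide_left_mono) auto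
      then show ?thesis by (simp add: b_def)
    qed
    define W where "W = \<tau> powr \<alpha> * exp (c / X * sqrt (\<tau> + X\<^sup>2))"
    have W: "0 < W" using \<tau> by (simp add: W_def)
    have wW: "w s y = 1 / W" unfolding w_def fw_def W_def X_def[symmetric] r_def[symmetric] \<tau>_def[symmetric]
      by (simp add: powr_minus exp_minus divide_inverse)
    have "W \<le> (m powr \<alpha> * E ^ CARD('n) * exp (b * r)) * (exp (a / 2 * (r / X)) * exp (sqrt m / \<sigma> + 1))"
      unfolding W_def using 2 3 E by (intro mult_mono) auto
    also have "\<dots> \<le> (m powr \<alpha> * E ^ CARD('n) * exp (a / 2 * (r / X))) * (exp (a / 2 * (r / X)) * exp (sqrt m / \<sigma> + 1))"
      using br E by (intro mult_right_mono mult_left_mono) auto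
    also have "\<dots> = (m powr \<alpha> * E ^ CARD('n) * exp (sqrt m / \<sigma> + 1)) * (exp (a / 2 * (r / X)) * exp (a / 2 * (r / X)))"
      by (simp only: mult_ac)
    also have "exp (a / 2 * (r / X)) * exp (a / 2 * (r / X)) = exp (a * (r / X))" by (simp flip: exp_add)
    finally have "g s y * W \<le> g s y * ((m powr \<alpha> * E ^ CARD('n) * exp (sqrt m / \<sigma> + 1)) * exp (a * (r / X)))"
      using g_nonneg[OF sI] by (rule mult_left_mono)
    also have "\<dots> = (g s y * exp (a * (r / X))) * (m powr \<alpha> * E ^ CARD('n) * exp (sqrt m / \<sigma> + 1))" by simp
    also have "\<dots> \<le> Z" unfolding Z_def using E by (intro mult_right_mono 1) auto
    finally show ?thesis using W by (simp add: wW le_divide_eq)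
  qed
  then show ?thesis by (rule that)
qed

section \<open>Contraction of the supremum\<close>

lemma X0_pos: "0 < X\<^sub>0"
  using M_pos by (auto simp: X\<^sub>0_def intro!: divide_pos_pos mult_pos_pos zero_less_power add_nonneg_pos)

lemma B0_nonneg: "0 \<le> B\<^sub>0"
  using M_pos c0 k_nonneg unfolding B\<^sub>0_def by (intro mult_nonneg_nonneg divide_nonneg_nonneg zero_le_power add_nonneg_nonneg) auto

text \<open>The supremum A runs over all parameters s \<le> t, since \<open>upper_region\<close>
  refers back to smaller ones. As A is finite, A \<le> (1 - \<kappa> / 2) A forces A \<le> 0, and
  the alternative with the source gives A \<le> \<open>4 * B\<^sub>0 / X\<^sub>0\<close> times the
  power of \<sigma>; \<kappa> has disappeared.\<close>

lemma barrier_bound: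
  assumes t: "t \<in> I"
  shows "g t x \<le> of_bool (x = 0) + 4 * B\<^sub>0 / X\<^sub>0 * \<sigma> powr (2 * \<alpha> - real CARD('n)) * w t x"
proof -
  obtain Z where Z: "\<And>s y. 0 \<le> s \<Longrightarrow> s \<le> t \<Longrightarrow> g s y \<le> Z * w s y" by (rule ratio_bounded[OF t]) (rule that)
  define R where "R = (\<lambda>(s, y). (g s y - of_bool (y = 0)) / w s y)"
  define T where "T = {0..t} \<times> (UNIV :: (int ^ 'n) set)"
  have bdd: "bdd_above (R ` T)"
  proof (rule bdd_aboveI2)
    fix u assume u: "u \<in> T"
    obtain s y where sy: "u = (s, y)" by (cases u)
    have "g s y \<le> Z * w s y" using Z[of s y] u by (simp add: T_def sy)
    moreover have "(0 :: real) \<le> of_bool (y = 0)" by simp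
    ultimately have "g s y - of_bool (y = 0) \<le> Z * w s y" by linarith
    then show "R u \<le> Z" using w_pos[of s y] by (simp add: R_def sy divide_le_eq)
  qed
  define A where "A = (SUP u\<in>T. R u)"
  have RA: "R u \<le> A" if "u \<in> T" for u unfolding A_def by (rule cSUP_upper[OF that bdd])
  have hyp: "g s y \<le> of_bool (y = 0) + A * w s y" if "0 \<le> s" "s \<le> t" for s y
    using RA[of "(s, y)"] that w_pos[of s y] by (simp add: T_def R_def divide_le_eq)
  have z: "(0, 0) \<in> T" using I_nonneg[OF t] by (simp add: T_def)
  have A: "0 \<le> A" using RA[OF z] g_0[OF zero_in_I[OF t]] by (simp add: R_def)
  define Y where "Y = \<sigma> powr (2 * \<alpha> - real CARD('n))"
  have "(SUP u\<in>T. R u) \<le> max ((1 - \<kappa> / 2) * A) (B\<^sub>0 * Y + (1 - X\<^sub>0 / 4) * A)"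
  proof (rule cSUP_least)
    show "T \<noteq> {}" using z by auto
    fix u assume u: "u \<in> T"
    obtain s y where sy: "u = (s, y)" by (cases u)
    have s: "0 \<le> s" "s \<le> t" using u by (auto simp: T_def sy)
    have sI: "s \<in> I" using I_down[OF t s] .
    have hs: "g s' y \<le> of_bool (y = 0) + A * w s' y" if "0 \<le> s'" "s' \<le> s" for s' y using hyp that s by simp
    have "R u \<le> (1 - \<kappa> / 2) * A \<or> R u \<le> B\<^sub>0 * Y + (1 - X\<^sub>0 / 4) * A"
    proof (cases "\<sigma> \<le> \<eta> * l2 y \<and> \<sigma> \<le> \<eta> * \<xi> s")
      case True
      have "g s y \<le> (1 - \<kappa> / 2) * A * w s y" by (rule upper_region[OF sI A hs]) (use True in auto)
      moreover have "(0 :: real) \<le> of_bool (y = 0)" by simp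
      ultimately have "g s y - of_bool (y = 0) \<le> (1 - \<kappa> / 2) * A * w s y" by linarith
      then show ?thesis using w_pos[of s y] by (simp add: R_def sy divide_le_eq)
    next
      case False
      have "(1 - \<kappa>) * A \<le> (1 - \<kappa> / 2) * A" using A kappa_bounds by (intro mult_right_mono) auto
      moreover have "g s y - of_bool (y = 0) \<le> (1 - \<kappa>) * A * w s y \<or>
        g s y - of_bool (y = 0) \<le> (B\<^sub>0 * Y + (1 - X\<^sub>0 / 4) * A) * w s y"
        unfolding Y_def by (rule base_region[OF sI A hs]) (use False s in auto)
      then have "R u \<le> (1 - \<kappa>) * A \<or> R u \<le> B\<^sub>0 * Y + (1 - X\<^sub>0 / 4) * A"
        using w_pos[of s y] by (simp add: R_def sy divide_le_eq)
      ultimately show ?thesis by linarith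
    qed
    then show "R u \<le> max ((1 - \<kappa> / 2) * A) (B\<^sub>0 * Y + (1 - X\<^sub>0 / 4) * A)" by (simp add: le_max_iff_disj)
  qed
  then have "A \<le> max ((1 - \<kappa> / 2) * A) (B\<^sub>0 * Y + (1 - X\<^sub>0 / 4) * A)" unfolding A_def[symmetric] .
  then have "A \<le> (1 - \<kappa> / 2) * A \<or> A \<le> B\<^sub>0 * Y + (1 - X\<^sub>0 / 4) * A" by (simp add: le_max_iff_disj)
  then have "A \<le> 4 * B\<^sub>0 / X\<^sub>0 * Y"
  proof
    assume "A \<le> (1 - \<kappa> / 2) * A"
    then have "\<kappa> / 2 * A \<le> 0" by (simp add: algebra_simps)
    then have "A \<le> 0" using kappa_bounds by (simp add: mult_le_0_iff)
    also have "\<dots> \<le> 4 * B\<^sub>0 / X\<^sub>0 * Y" using B0_nonneg X0_pos by (simp add: Y_def)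
    finally show ?thesis .
  next
    assume "A \<le> B\<^sub>0 * Y + (1 - X\<^sub>0 / 4) * A"
    then have "A * X\<^sub>0 \<le> 4 * B\<^sub>0 * Y" by (simp add: algebra_simps)
    then show ?thesis using X0_pos by (simp add: le_divide_eq)
  qed
  then have "A * w t x \<le> 4 * B\<^sub>0 / X\<^sub>0 * Y * w t x" using w_pos[of t x] by (intro mult_right_mono) auto
  then show ?thesis using hyp[OF I_nonneg[OF t] order_refl, of x] by (simp add: Y_def)
qed

text \<open>Because m \<ge> \<sigma>^2, the power of |x|^2 + m is at most one of max \<sigma> (linf
  x); the remaining power of \<sigma> supplies both \<sigma>^(-d) and the numerator of the
  ratio.\<close>

lemma pointwise_bound:
  assumes t: "t \<in> I"
  shows "g t x \<le> of_bool (x = 0) + 4 * B\<^sub>0 / X\<^sub>0 / \<sigma> ^ CARD('n)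
    * (\<sigma> / max \<sigma> (linf x)) powr (real CARD('n) - 2 - \<epsilon>) * exp (- c * (linf x / \<xi> t))"
proof -
  define \<mu> where "\<mu> = max \<sigma> (linf x)"
  have \<mu>: "0 < \<mu>" using sigma by (simp add: \<mu>_def less_max_iff_disj)
  have l: "0 \<le> linf x" "linf x \<le> l2 x" using linf_le_l2[of x] by (auto simp: linf_def infnorm_pos_le)
  have "\<mu>\<^sup>2 \<le> (l2 x)\<^sup>2 + m"
  proof -
    have "(linf x)\<^sup>2 \<le> (l2 x)\<^sup>2" using l by (intro power_mono) auto
    then show ?thesis using m_ge m_pos zero_le_power2[of "l2 x"] unfolding \<mu>_def max_def by (auto intro: add_increasing2 add_increasing)
  qed
  then have "((l2 x)\<^sup>2 + m) powr (- \<alpha>) \<le> (\<mu>\<^sup>2) powr (- \<alpha>)" using \<mu> alpha_bounds by (intro powr_mono2') auto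
  also have "\<dots> = \<mu> powr (- (2 * \<alpha>))" using powr_powr[of \<mu> 2 "- \<alpha>"] \<mu> by simp
  finally have 1: "((l2 x)\<^sup>2 + m) powr (- \<alpha>) \<le> \<mu> powr (- (2 * \<alpha>))" .
  have 2: "exp (- (c / \<xi> t) * sqrt ((l2 x)\<^sup>2 + m + (\<xi> t)\<^sup>2)) \<le> exp (- c * (linf x / \<xi> t))"
  proof -
    have "linf x \<le> sqrt ((l2 x)\<^sup>2 + m + (\<xi> t)\<^sup>2)"
    proof (rule order_trans[OF l(2)])
      show "l2 x \<le> sqrt ((l2 x)\<^sup>2 + m + (\<xi> t)\<^sup>2)" using m_pos by (intro real_le_rsqrt) (simp add: add_nonneg_nonneg)
    qed
    then have "c / \<xi> t * linf x \<le> c / \<xi> t * sqrt ((l2 x)\<^sup>2 + m + (\<xi> t)\<^sup>2)"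
      using c xi_pos[OF t] by (intro mult_left_mono) auto
    then show ?thesis by simp
  qed
  have "w t x \<le> \<mu> powr (- (2 * \<alpha>)) * exp (- c * (linf x / \<xi> t))"
    unfolding w_def fw_def by (intro mult_mono 1 2) auto
  then have "4 * B\<^sub>0 / X\<^sub>0 * \<sigma> powr (2 * \<alpha> - real CARD('n)) * w t x
    \<le> 4 * B\<^sub>0 / X\<^sub>0 * \<sigma> powr (2 * \<alpha> - real CARD('n)) * (\<mu> powr (- (2 * \<alpha>)) * exp (- c * (linf x / \<xi> t)))"
    using B0_nonneg X0_pos by (intro mult_left_mono) auto
  also have "\<dots> = 4 * B\<^sub>0 / X\<^sub>0 * (\<sigma> powr (2 * \<alpha> - real CARD('n)) * \<mu> powr (- (2 * \<alpha>))) * exp (- c * (linf x / \<xi> t))"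
    by (simp only: mult_ac)
  also have "\<sigma> powr (2 * \<alpha> - real CARD('n)) * \<mu> powr (- (2 * \<alpha>)) = (\<sigma> / \<mu>) powr (2 * \<alpha>) / \<sigma> ^ CARD('n)"
    using sigma \<mu> by (simp add: powr_divide powr_diff powr_minus_divide powr_realpow)
  finally show ?thesis using barrier_bound[OF t, of x] by (simp add: \<mu>_def alpha_bounds(3))
qed

end

text \<open>Order of choice: \<open>C\<^sub>s\<close>, \<open>Q\<close>, \<open>c\<close> and
  \<open>M\<close> depend on d and \<open>c\<^sub>0\<close> only; then \<epsilon> fixes \<alpha> and
  q, these fix \<eta>, and \<nu>1 comes last.\<close>

theorem scales_pointwise_bound:
  fixes c\<^sub>0 :: real
  assumes c0: "0 < c\<^sub>0" "c\<^sub>0 \<le> 1" and d3: "3 \<le> CARD('n)"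
  obtains c C where "0 < c" "0 < C" "\<And>\<epsilon>. 0 < \<epsilon> \<Longrightarrow> \<epsilon> \<le> 1 / 2 \<Longrightarrow> \<exists>\<nu>1>0. \<forall>\<nu> \<sigma> (J :: int ^ 'n \<Rightarrow> real) I g S \<xi> t x.
    scales c\<^sub>0 \<nu> \<sigma> J I g S \<xi> \<longrightarrow> \<nu> \<le> \<nu>1 \<longrightarrow> t \<in> I \<longrightarrow>
    g t x \<le> of_bool (x = 0) + C / \<sigma> ^ CARD('n)
      * (\<sigma> / max \<sigma> (linf x)) powr (real CARD('n) - 2 - \<epsilon>) * exp (- c * (linf x / \<xi> t))"
proof -
  define D where "D = real CARD('n)"
  have D: "3 \<le> D" using d3 by (simp add: D_def)
  define a where "a = c\<^sub>0 / (4 * real CARD('n))"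
  have a: "0 < a" using c0 D by (simp add: a_def D_def)
  obtain C\<^sub>s where Cs: "0 < C\<^sub>s" and super: "\<And>(P :: int ^ 'n \<Rightarrow> real) \<rho> m \<xi> c \<alpha> x.
    kernel a (64 * real CARD('n)) \<rho> P \<Longrightarrow> 0 \<le> \<alpha> \<Longrightarrow> \<alpha> \<le> real CARD('n) \<Longrightarrow> 0 < c \<Longrightarrow> c \<le> 1 \<Longrightarrow> c \<le> a / 2 \<Longrightarrow>
    \<rho> \<le> \<xi> \<Longrightarrow> 0 < m \<Longrightarrow> \<rho>\<^sup>2 \<le> (l2 x)\<^sup>2 + m \<Longrightarrow>
    (\<lambda>z. P z * (of_bool (\<rho>\<^sup>2 \<le> (l2 (x - z))\<^sup>2 + m) * fw \<alpha> (c / \<xi>) (\<xi>\<^sup>2) ((l2 (x - z))\<^sup>2 + m))) summable_on UNIV \<and>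
    (\<Sum>\<^sub>\<infinity>z. P z * (of_bool (\<rho>\<^sup>2 \<le> (l2 (x - z))\<^sup>2 + m) * fw \<alpha> (c / \<xi>) (\<xi>\<^sup>2) ((l2 (x - z))\<^sup>2 + m)))
    \<le> fw \<alpha> (c / \<xi>) (\<xi>\<^sup>2) ((l2 x)\<^sup>2 + m) *
      (1 - \<alpha> * \<rho>\<^sup>2 * (m + (real CARD('n) - 2 - 2 * \<alpha>) / real CARD('n) * (l2 x)\<^sup>2) / ((l2 x)\<^sup>2 + m)\<^sup>2
       + C\<^sub>s * (c * \<rho>\<^sup>2 / \<xi>\<^sup>2 + \<rho> ^ 4 / ((l2 x)\<^sup>2 + m)\<^sup>2))"
    by (rule kernel_superharmonic[OF a, of "64 * real CARD('n)"]) (simp, rule that)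
  obtain Q \<nu>0 where Q: "1 \<le> Q" and nu0: "0 < \<nu>0" and lm: "\<And>\<nu> \<sigma> (J :: int ^ 'n \<Rightarrow> real) I g S \<xi> s t.
    scales c\<^sub>0 \<nu> \<sigma> J I g S \<xi> \<Longrightarrow> \<nu> \<le> \<nu>0 \<Longrightarrow> t \<in> I \<Longrightarrow> 0 \<le> s \<Longrightarrow> s \<le> t \<Longrightarrow>
    (\<Sum>x | l2 x \<le> \<xi> s. g t x) \<le> Q * S s"
    by (rule local_mass[OF c0 d3]) (rule that)
  define c where "c = min 1 (min (a / 2) (1 / (8 * C\<^sub>s)))"
  have c: "0 < c" "c \<le> 1" "c \<le> a / 2" "8 * C\<^sub>s * c \<le> 1"
  proof -
    have "c \<le> 1 / (8 * C\<^sub>s)" by (simp add: c_def)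
    then show "8 * C\<^sub>s * c \<le> 1" using Cs by (simp add: le_divide_eq mult.commute)
  qed (use a Cs in \<open>auto simp: c_def\<close>)
  define M where "M = max (8 * C\<^sub>s) (real CARD('n))"
  have M: "8 * C\<^sub>s \<le> M" "real CARD('n) \<le> M" "3 \<le> M" using D by (auto simp: M_def D_def)
  define k where k'_def: "k = sqrt (real CARD('n)) / c\<^sub>0"
  have k: "0 \<le> k" using c0 by (simp add: k'_def)
  define C where "C = 4 * (2 * (sqrt (real CARD('n)) ^ CARD('n) / c\<^sub>0) * ((k\<^sup>2 + M) ^ CARD('n) * exp (sqrt (k\<^sup>2 + M) + 1)))
    / (M / (8 * (k\<^sup>2 + M)\<^sup>2))"
  have kM: "0 < k\<^sup>2 + M" using M by (simp add: add_nonneg_pos)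
  have C: "0 < C" using kM M c0 D by (auto simp: C_def)
  show ?thesis
  proof (rule that[OF c(1) C])
    fix \<epsilon> :: real assume eps: "0 < \<epsilon>" "\<epsilon> \<le> 1 / 2"
    define \<alpha> where "\<alpha> = (real CARD('n) - 2 - \<epsilon>) / 2"
    define q where "q = \<alpha> * \<epsilon> / real CARD('n)"
    have \<alpha>: "0 < \<alpha>" "\<alpha> \<le> real CARD('n)" using D eps by (auto simp: \<alpha>_def D_def)
    have q: "0 < q" using \<alpha> eps D by (simp add: q_def D_def)
    \<comment> \<open>exp (- c / (4 \<eta>)) \<le> 384 / c^3 * \<eta>^3 with 384 = 3! * 4^3, so
      \<eta> \<le> q / Z brings the far terms below q \<eta>^2 / 32.\<close>
    define Z where "Z = 32 * (2 ^ CARD('n) * 9 * (384 / c ^ 3) * (1 + 2 * Q))"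
    have Z: "0 < Z" using c Q by (simp add: Z_def)
    define \<eta> where "\<eta> = min (1 / 4) (min (1 / (2 * (1 + k))) (min (1 / M) (min (q / (2 * C\<^sub>s)) (q / Z))))"
    have \<eta>: "0 < \<eta>" "\<eta> \<le> 1 / 4" "\<eta> \<le> 1 / (2 * (1 + k))" "\<eta> \<le> 1 / M" "\<eta> \<le> q / (2 * C\<^sub>s)" "\<eta> \<le> q / Z"
      unfolding \<eta>_def using k M q Cs Z by (simp, linarith, linarith, linarith, linarith, linarith)
    have \<eta>2: "\<eta>\<^sup>2 \<le> \<eta>" using mult_right_mono[of \<eta> 1 \<eta>] \<eta> by (simp add: power2_eq_square)
    have e1: "\<eta> * (1 + k) \<le> 1 / 2" using \<eta>(3) k by (simp add: le_divide_eq mult_ac)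
    have e2: "\<eta>\<^sup>2 * M \<le> 1"
    proof -
      have "\<eta>\<^sup>2 * M \<le> \<eta> * M" using \<eta>2 M by (intro mult_right_mono) auto
      also have "\<dots> \<le> 1" using \<eta>(4) M by (simp add: le_divide_eq)
      finally show ?thesis .
    qed
    have e3: "C\<^sub>s * \<eta>\<^sup>2 \<le> q / 2"
    proof -
      have "C\<^sub>s * \<eta>\<^sup>2 \<le> C\<^sub>s * \<eta>" using \<eta>2 Cs by (intro mult_left_mono) auto
      also have "\<dots> \<le> q / 2" using \<eta>(5) Cs by (simp add: le_divide_eq mult_ac)
      finally show ?thesis .
    qed
    have e4: "2 ^ CARD('n) * 9 * exp (- c / (4 * \<eta>)) * (1 + 2 * Q) \<le> q * \<eta>\<^sup>2 / 32"
    proof -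
      have "(1 / \<eta>) ^ 3 \<le> fact 3 / (c / 4) ^ 3 * exp (c / 4 * (1 / \<eta>))" using \<eta> c by (intro power_le_exp) auto
      then have "1 \<le> 384 / c ^ 3 * exp (c / (4 * \<eta>)) * \<eta> ^ 3"
        using \<eta> by (simp add: power_divide fact_numeral field_simps)
      then have "exp (- c / (4 * \<eta>)) * 1 \<le> exp (- c / (4 * \<eta>)) * (384 / c ^ 3 * exp (c / (4 * \<eta>)) * \<eta> ^ 3)"
        by (intro mult_left_mono) auto
      also have "\<dots> = 384 / c ^ 3 * \<eta> ^ 3 * (exp (c / (4 * \<eta>)) * exp (- (c / (4 * \<eta>))))" by simp
      also have "\<dots> = 384 / c ^ 3 * \<eta> ^ 3" unfolding exp_minus_inverse by simp
      finally have "2 ^ CARD('n) * 9 * exp (- c / (4 * \<eta>)) * (1 + 2 * Q) \<le> 2 ^ CARD('n) * 9 * (384 / c ^ 3 * \<eta> ^ 3) * (1 + 2 * Q)"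
        using Q by (intro mult_right_mono mult_left_mono) auto
      also have "\<dots> = (2 ^ CARD('n) * 9 * (384 / c ^ 3) * (1 + 2 * Q)) * \<eta> * \<eta>\<^sup>2"
        by (simp add: power2_eq_square power3_eq_cube)
      also have "\<dots> = Z * \<eta> * \<eta>\<^sup>2 / 32" by (simp only: Z_def) simp
      also have "\<dots> \<le> q * \<eta>\<^sup>2 / 32"
        using \<eta>(6) Z by (intro divide_right_mono mult_right_mono) (auto simp: le_divide_eq mult_ac)
      finally show ?thesis .
    qed
    define \<Lambda> where "\<Lambda> = 1 / (\<eta> * sqrt q)"
    have \<Lambda>: "0 < \<Lambda>" using \<eta> q by (simp add: \<Lambda>_def)
    \<comment> \<open>The last entry yields \<Lambda> powr \<nu> \<le> 2; absolute value and added 1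
      keep the denominator positive for every \<Lambda>.\<close>
    define \<nu>1 where "\<nu>1 = min \<nu>0 (min (1 / 32768) (min (q * \<eta>\<^sup>2 / 32) (ln 2 / (\<bar>ln \<Lambda>\<bar> + 1))))"
    have nu1: "0 < \<nu>1" using nu0 q \<eta> by (simp add: \<nu>1_def)
    show "\<exists>\<nu>1>0. \<forall>\<nu> \<sigma> (J :: int ^ 'n \<Rightarrow> real) I g S \<xi> t x.
      scales c\<^sub>0 \<nu> \<sigma> J I g S \<xi> \<longrightarrow> \<nu> \<le> \<nu>1 \<longrightarrow> t \<in> I \<longrightarrow>
      g t x \<le> of_bool (x = 0) + C / \<sigma> ^ CARD('n)
        * (\<sigma> / max \<sigma> (linf x)) powr (real CARD('n) - 2 - \<epsilon>) * exp (- c * (linf x / \<xi> t))"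
    proof (intro exI[of _ \<nu>1] conjI nu1 allI impI)
      fix \<nu> \<sigma> :: real and J :: "int ^ 'n \<Rightarrow> real" and I g S \<xi> t and x :: "int ^ 'n"
      assume sc: "scales c\<^sub>0 \<nu> \<sigma> J I g S \<xi>" and nle: "\<nu> \<le> \<nu>1" and t: "t \<in> I"
      interpret scales c\<^sub>0 \<nu> \<sigma> J I g S \<xi> by (rule sc)
      have Lnu: "\<Lambda> powr \<nu> \<le> 2"
      proof -
        have "\<nu> \<le> ln 2 / (\<bar>ln \<Lambda>\<bar> + 1)" using nle by (simp add: \<nu>1_def)
        then have "\<nu> * (\<bar>ln \<Lambda>\<bar> + 1) \<le> ln 2" by (simp add: le_divide_eq)
        moreover have "\<nu> * ln \<Lambda> \<le> \<nu> * (\<bar>ln \<Lambda>\<bar> + 1)" using scales.nu(1)[OF sc] by (intro mult_left_mono) auto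
        ultimately have "exp (\<nu> * ln \<Lambda>) \<le> exp (ln 2)" by (simp only: exp_le_cancel_iff)
        then show ?thesis using \<Lambda> by (simp add: powr_def)
      qed
      interpret barrier c\<^sub>0 \<nu> \<sigma> J I g S \<xi> C\<^sub>s Q M c \<epsilon> \<eta> \<alpha> q
      proof (unfold_locales)
        fix P :: "int ^ 'n \<Rightarrow> real" and \<rho> m \<zeta> :: real and x :: "int ^ 'n"
        assume p: "kernel (c\<^sub>0 / (4 * real CARD('n))) (64 * real CARD('n)) \<rho> P" "\<rho> \<le> \<zeta>" "0 < m" "\<rho>\<^sup>2 \<le> (l2 x)\<^sup>2 + m"
        show "(\<lambda>z. P z * (of_bool (\<rho>\<^sup>2 \<le> (l2 (x - z))\<^sup>2 + m) * fw \<alpha> (c / \<zeta>) (\<zeta>\<^sup>2) ((l2 (x - z))\<^sup>2 + m))) summable_on UNIV \<and>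
          (\<Sum>\<^sub>\<infinity>z :: int ^ 'n. P z * (of_bool (\<rho>\<^sup>2 \<le> (l2 (x - z))\<^sup>2 + m) * fw \<alpha> (c / \<zeta>) (\<zeta>\<^sup>2) ((l2 (x - z))\<^sup>2 + m)))
          \<le> fw \<alpha> (c / \<zeta>) (\<zeta>\<^sup>2) ((l2 x)\<^sup>2 + m) *
            (1 - \<alpha> * \<rho>\<^sup>2 * (m + (real CARD('n) - 2 - 2 * \<alpha>) / real CARD('n) * (l2 x)\<^sup>2) / ((l2 x)\<^sup>2 + m)\<^sup>2
             + C\<^sub>s * (c * \<rho>\<^sup>2 / \<zeta>\<^sup>2 + \<rho> ^ 4 / ((l2 x)\<^sup>2 + m)\<^sup>2))"
          by (rule super[OF p(1)[folded a_def] less_imp_le[OF \<alpha>(1)] \<alpha>(2) c(1-3) p(2-4)])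
      next
        fix s t assume "t \<in> I" "0 \<le> s" "s \<le> t"
        then show "(\<Sum>x | l2 x \<le> \<xi> s. g t x) \<le> Q * S s"
          by (intro lm[OF sc]) (use nle in \<open>auto simp: \<nu>1_def\<close>)
      qed (use eps Cs M c Q \<eta> e1 e2 e3 e4 Lnu nle in \<open>auto simp: \<alpha>_def q_def a_def k'_def \<nu>1_def \<Lambda>_def\<close>)
      show "g t x \<le> of_bool (x = 0) + C / \<sigma> ^ CARD('n)
        * (\<sigma> / max \<sigma> (linf x)) powr (real CARD('n) - 2 - \<epsilon>) * exp (- c * (linf x / \<xi> t))"
        using pointwise_bound[OF t, of x] unfolding B\<^sub>0_def X\<^sub>0_def C_def k_def k'_def .
    qed
  qed
qed

subsection \<open>Families satisfying the assumptions\<close>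

lemma at_within_greaterThanLessThan:
  fixes a b :: real
  assumes "a < b"
  shows "at a within {a<..<b} = at_right a" "at b within {a<..<b} = at_left b"
proof -
  show "at a within {a<..<b} = at_right a"
    by (rule at_within_nhd[where S = "{..<b}"]) (use assms in auto)
  show "at b within {a<..<b} = at_left b"
    by (rule at_within_nhd[where S = "{a<..}"]) (use assms in auto)
qed

lemma has_sum_ennreal:
  fixes f :: "'b \<Rightarrow> real"
  assumes "(f has_sum s) A" "\<And>x. 0 \<le> f x"
  shows "((\<lambda>x. ennreal (f x)) has_sum ennreal s) A"
proof -
  have "sum (\<lambda>x. ennreal (f x)) = (\<lambda>F. ennreal (sum f F))" using assms(2) by (intro ext sum_ennreal) auto
  then show ?thesis using tendsto_ennrealI[OF assms(1)[unfolded has_sum_def]] by (simp add: has_sum_def)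
qed

lemma conv_bounded_summable:
  fixes f g :: "int ^ 'n \<Rightarrow> real"
  assumes "f summable_on UNIV" "\<And>x. 0 \<le> f x" "\<And>x. 0 \<le> g x" "\<And>x. g x \<le> B"
  shows "(\<lambda>y. f y * g (x - y)) summable_on UNIV"
  by (rule summable_on_abs_le[OF summable_on_cmult_left[OF assms(1), of B]])
    (use assms in \<open>auto simp: abs_mult intro!: mult_left_mono\<close>)

lemma conv_ennreal:
  fixes f g :: "int ^ 'n \<Rightarrow> real"
  assumes "f summable_on UNIV" "\<And>x. 0 \<le> f x" "\<And>x. 0 \<le> g x" "\<And>x. g x \<le> B"
  shows "conv (\<lambda>y. ennreal (f y)) (\<lambda>y. ennreal (g y)) = (\<lambda>x. ennreal (conv f g x))"
proof
  fix x
  have "((\<lambda>y. ennreal (f y * g (x - y))) has_sum ennreal (conv f g x)) UNIV"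
    unfolding conv_def
    by (rule has_sum_ennreal[OF has_sum_infsum[OF conv_bounded_summable[OF assms]]]) (use assms in simp)
  moreover have "ennreal (f y * g (x - y)) = ennreal (f y) * ennreal (g (x - y))" for y
    using assms by (intro ennreal_mult)
  ultimately show "conv (\<lambda>y. ennreal (f y)) (\<lambda>y. ennreal (g y)) x = ennreal (conv f g x)"
    unfolding conv_def by (simp add: infsumI)
qed

lemma exp_decay_esum:
  assumes "exp_decay f"
  shows "\<exists>m>0. esum m (\<lambda>x. enn2real (f x))" "f x < \<infinity>" "\<exists>B. \<forall>x. enn2real (f x) \<le> B"
proof -
  obtain K m where m: "0 < m" and K: "\<And>x. f x \<le> ennreal (K * exp (- m * linf x))"
    using assms unfolding exp_decay_def by blast
  have le: "enn2real (f x) \<le> \<bar>K\<bar> * exp (- m * linf x)" for x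
  proof (rule enn2real_leI)
    have "K * exp (- m * linf x) \<le> \<bar>K\<bar> * exp (- m * linf x)" by (intro mult_right_mono) auto
    then show "f x \<le> ennreal (\<bar>K\<bar> * exp (- m * linf x))" using K[of x] ennreal_leI order_trans by blast
  qed simp
  show "\<exists>m>0. esum m (\<lambda>x. enn2real (f x))"
    by (rule esum_exp_bound[OF m, of _ "\<bar>K\<bar>"]) (use le in simp)
  show "f x < \<infinity>" using K[of x] by (simp add: le_less_trans)
  have "enn2real (f x) \<le> \<bar>K\<bar> * 1" for x
  proof -
    have "\<bar>K\<bar> * exp (- m * linf x) \<le> \<bar>K\<bar> * 1" using m by (intro mult_left_mono) auto
    then show ?thesis using le[of x] by linarith
  qed
  then show "\<exists>B. \<forall>x. enn2real (f x) \<le> B" by blast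
qed

lemma moment2_eq: "moment2 f = (\<Sum>\<^sub>\<infinity>x. f x * (l2 x)\<^sup>2)"
  by (simp add: moment2_def norm1_def mult.commute)

section \<open>From the class of families to the abstract scales\<close>

locale model =
  fixes c\<^sub>0 :: real and J :: "int ^ 'n \<Rightarrow> real" and \<beta>\<^sub>c :: ennreal and G :: "real \<Rightarrow> int ^ 'n \<Rightarrow> ennreal"
    and H :: "real \<Rightarrow> int ^ 'n \<Rightarrow> real"
  assumes d3: "3 \<le> CARD('n)" and c0: "0 < c\<^sub>0" "c\<^sub>0 \<le> 1"
    and admissible: "admissible c\<^sub>0 J" and class_G: "class_G \<beta>\<^sub>c G" and assumption1: "assumption1 J \<beta>\<^sub>c G H"
begin

abbreviation "g \<equiv> fin_part G"
abbreviation "T \<equiv> subcrit \<beta>\<^sub>c"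
text \<open>A down-closed set of parameters, possibly empty and possibly without its supremum; it
  serves as the index set of \<open>family\<close> and \<open>scales\<close>.\<close>

definition "region \<delta> = {t \<in> T. err J G H t < ennreal \<delta>}"

lemma J_facts: "0 \<le> J z" "J 0 = 0" "(\<Sum>\<^sub>\<infinity>x. J x) = 1" "Zd_symmetric J" "finite {x. J x \<noteq> 0}"
  "1 \<le> krange J" "c\<^sub>0 * krange J \<le> sigma_of J" "J z \<le> 1 / (c\<^sub>0 * krange J ^ CARD('n))"
proof -
  have "{x. J x \<noteq> 0} = {x. 0 < J x}" using admissible unfolding admissible_def by (auto simp: order_less_le)
  then show "finite {x. J x \<noteq> 0}" using admissible unfolding admissible_def by simp
qed (use admissible in \<open>auto simp: admissible_def\<close>)

lemma T_down: "t \<in> T \<Longrightarrow> 0 \<le> s \<Longrightarrow> s \<le> t \<Longrightarrow> s \<in> T"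
  by (auto simp: subcrit_def intro: le_less_trans[OF ennreal_leI])

lemma T_nonneg: "t \<in> T \<Longrightarrow> 0 \<le> t" by (simp add: subcrit_def)

lemma decay: "t \<in> T \<Longrightarrow> exp_decay (G t)" using class_G by (simp add: class_G_def)

lemma g_nonneg: "0 \<le> g t x" by (simp add: fin_part_def)

lemma G_eq: "t \<in> T \<Longrightarrow> G t = (\<lambda>x. ennreal (g t x))"
  using exp_decay_esum(2)[OF decay] by (auto simp: fin_part_def)

lemma g_esum: "t \<in> T \<Longrightarrow> \<exists>m>0. esum m (g t)"
  using exp_decay_esum(1)[OF decay] by (simp add: fin_part_def[abs_def])

lemma g_summable: "t \<in> T \<Longrightarrow> g t summable_on UNIV"
  using g_esum[of t] esum_imp_summable by blast

lemma g_bound: "t \<in> T \<Longrightarrow> \<exists>B. \<forall>x. g t x \<le> B"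
  using exp_decay_esum(3)[OF decay] by (simp add: fin_part_def[abs_def])

lemma g_mono: "t \<in> T \<Longrightarrow> 0 \<le> s \<Longrightarrow> s \<le> t \<Longrightarrow> g s x \<le> g t x"
  using class_G T_down[of t s] exp_decay_esum(2)[OF decay, of t x]
  unfolding class_G_def mono_on_def fin_part_def by (auto intro!: enn2real_mono)

lemma g_0: "g 0 x = of_bool (x = 0)"
  using class_G by (simp add: class_G_def fin_part_def)

lemma g_sym: "t \<in> T \<Longrightarrow> Zd_symmetric (g t)"
proof -
  assume t: "t \<in> T"
  then have "0 \<le> t \<and> ennreal t \<le> \<beta>\<^sub>c" by (auto simp: subcrit_def)
  then have "Zd_symmetric (G t)" using class_G unfolding class_G_def by blast
  then show ?thesis unfolding Zd_symmetric_def fin_part_def by auto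
qed

text \<open>Exponential decay makes both convolutions finite, so the inequality descends from
  \<open>ennreal\<close> to the reals.\<close>

lemma g_upper:
  assumes t: "t \<in> T" and s: "0 \<le> s" "s \<le> t"
  shows "g t x \<le> g s x + (t - s) * conv (conv (g s) J) (g t) x"
proof -
  have sT: "s \<in> T" by (rule T_down[OF t s])
  obtain m where m: "0 < m" "esum m (g s)" using g_esum[OF sT] by blast
  have "esum m (conv (g s) J)" using m by (intro esum_conv esum_finite_support[OF J_facts(5)]) auto
  then have cs: "conv (g s) J summable_on UNIV" using m esum_imp_summable by blast
  have cn: "0 \<le> conv (g s) J y" for y unfolding conv_def by (intro infsum_nonneg mult_nonneg_nonneg g_nonneg J_facts)
  have cc: "0 \<le> conv (conv (g s) J) (g t) y" for y unfolding conv_def[of "conv (g s) J"] by (intro infsum_nonneg mult_nonneg_nonneg g_nonneg cn)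
  obtain B where B: "\<And>x. g t x \<le> B" using g_bound[OF t] by blast
  have "G t x \<le> G s x + ennreal (t - s) * conv (conv (G s) (\<lambda>y. ennreal (J y))) (G t) x"
    using assumption1 t s unfolding assumption1_def by auto
  also have "conv (G s) (\<lambda>y. ennreal (J y)) = (\<lambda>y. ennreal (conv (g s) J y))"
    unfolding G_eq[OF sT] by (rule conv_ennreal[OF g_summable[OF sT] g_nonneg J_facts(1) J_facts(8)])
  also have "conv (\<lambda>y. ennreal (conv (g s) J y)) (G t) = (\<lambda>x. ennreal (conv (conv (g s) J) (g t) x))"
    unfolding G_eq[OF t] by (rule conv_ennreal[OF cs cn g_nonneg B])
  finally have "ennreal (g t x) \<le> ennreal (g s x) + ennreal (t - s) * ennreal (conv (conv (g s) J) (g t) x)"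
    unfolding G_eq[OF t] G_eq[OF sT] .
  also have "\<dots> = ennreal (g s x + (t - s) * conv (conv (g s) J) (g t) x)"
    using s cc g_nonneg by (simp add: ennreal_mult ennreal_plus)
  finally show ?thesis using s cc g_nonneg by (subst (asm) ennreal_le_iff) auto
qed

text \<open>Parameters slightly above t stay in \<open>T\<close>, so the derivative within
  \<open>T\<close> is also the limit of right difference quotients; these eventually exceed L -
  \<gamma>.\<close>

lemma g_lower:
  assumes u: "u \<in> T" and t: "0 \<le> t" "t < u"
  shows "rslope_ge (\<lambda>r. g r x) t (conv (conv (g t) (\<lambda>y. J y - H t y)) (g t) x)"
proof -
  have tT: "t \<in> T" using T_down[OF u] t by simp
  define f where "f = (\<lambda>r. g r x)"
  define D where "D = vector_derivative f (at t within T)"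
  define L where "L = conv (conv (g t) (\<lambda>y. J y - H t y)) (g t) x"
  have LD: "L \<le> D" using assumption1 tT by (simp add: assumption1_def L_def D_def f_def)
  have "f differentiable at t within T" using class_G tT unfolding class_G_def differentiable_on_def f_def by blast
  then have "(f has_vector_derivative D) (at t within T)" unfolding D_def by (rule vector_derivative_works[THEN iffD1])
  then have "(f has_real_derivative D) (at t within T)" by (simp add: has_real_derivative_iff_has_vector_derivative)
  moreover have "{t<..<u} \<subseteq> T" using T_down[OF u] t by auto
  ultimately have "(f has_real_derivative D) (at t within {t<..<u})" by (rule DERIV_subset)
  then have lim: "((\<lambda>y. (f y - f t) / (y - t)) \<longlongrightarrow> D) (at_right t)"
    using at_within_greaterThanLessThan(1)[OF t(2)] by (simp add: has_field_derivative_iff)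
  show ?thesis unfolding rslope_ge_def f_def[symmetric] L_def[symmetric]
  proof (intro allI impI)
    fix \<gamma> :: real assume "0 < \<gamma>"
    then have "L - \<gamma> < D" using LD by simp
    from order_tendstoD(1)[OF lim this] eventually_at_right_less[of t]
    show "\<forall>\<^sub>F r in at_right t. (r - t) * (L - \<gamma>) \<le> f r - f t"
    proof eventually_elim
      case (elim r)
      then show ?case by (simp add: less_divide_eq mult.commute)
    qed
  qed
qed

lemma H_facts: "t \<in> T \<Longrightarrow> 0 \<le> H t x" "t \<in> T \<Longrightarrow> H t (- x) = H t x"
  using assumption1 by (auto simp: assumption1_def)

lemma H_esum: assumes "t \<in> T" shows "\<exists>m>0. esum m (H t)"
proof -
  have "exp_decay (\<lambda>x. ennreal (H t x))" using assumption1 assms by (simp add: assumption1_def)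
  from exp_decay_esum(1)[OF this] show ?thesis using H_facts(1)[OF assms] by simp
qed

lemma xi_sq:
  assumes t: "t \<in> T"
  shows "moment2 (Ffun J G t) / chi G t
    = ((\<Sum>\<^sub>\<infinity>x. J x * (l2 x)\<^sup>2) * (\<Sum>\<^sub>\<infinity>x. g t x) + (\<Sum>\<^sub>\<infinity>x. g t x * (l2 x)\<^sup>2)) / (\<Sum>\<^sub>\<infinity>x. g t x)"
proof -
  obtain m where m: "0 < m" "esum m (g t)" using g_esum[OF t] by blast
  have "(\<Sum>\<^sub>\<infinity>x. conv J (g t) x * (l2 x)\<^sup>2) = (\<Sum>\<^sub>\<infinity>x. J x * (l2 x)\<^sup>2) * (\<Sum>\<^sub>\<infinity>x. g t x) + (\<Sum>\<^sub>\<infinity>x. J x) * (\<Sum>\<^sub>\<infinity>x. g t x * (l2 x)\<^sup>2)"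
    by (rule infsum_conv_l2[OF esum_finite_support[OF J_facts(5)] m(2,1)]) (rule Zd_symmetric_minus[OF g_sym[OF t]])
  then show ?thesis by (simp add: moment2_def norm1_def Ffun_def chi_def J_facts mult.commute)
qed

lemma moment2_nonneg: "(\<And>x. 0 \<le> f x) \<Longrightarrow> 0 \<le> moment2 f"
  unfolding moment2_def norm1_def by (intro infsum_nonneg) auto

lemma F_nonneg: "0 \<le> Ffun J G t x"
  unfolding Ffun_def conv_def by (intro infsum_nonneg mult_nonneg_nonneg g_nonneg J_facts)

lemma chi_nonneg: "0 \<le> chi G t"
  unfolding chi_def norm1_def by (intro infsum_nonneg g_nonneg)

lemma xi_power2: "(xi J G t)\<^sup>2 = moment2 (Ffun J G t) / chi G t"
  unfolding xi_def by (intro real_sqrt_pow2 divide_nonneg_nonneg moment2_nonneg F_nonneg chi_nonneg)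

lemma sigma_pos: "0 < sigma_of J" "sigma_of J \<le> sqrt (real CARD('n)) * krange J"
  "J z \<noteq> 0 \<Longrightarrow> l2 z \<le> sqrt (real CARD('n)) * krange J"
proof -
  have r: "l2 z \<le> sqrt (real CARD('n)) * krange J" if "J z \<noteq> 0" for z
  proof -
    have "finite {x. 0 < J x}" using admissible by (simp add: admissible_def)
    moreover have "0 < J z" using J_facts(1)[of z] that by simp
    ultimately have "linf z \<le> krange J" unfolding krange_def by (intro Max_ge) auto
    then have "sqrt (real CARD('n)) * linf z \<le> sqrt (real CARD('n)) * krange J" by (intro mult_left_mono) auto
    then show ?thesis using l2_le_linf[of z] by linarith
  qed
  then show "J z \<noteq> 0 \<Longrightarrow> l2 z \<le> sqrt (real CARD('n)) * krange J" .
  have "0 < c\<^sub>0 * krange J" using c0 J_facts(6) by simp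
  then show "0 < sigma_of J" using J_facts(7) by linarith
  define R where "R = sqrt (real CARD('n)) * krange J"
  have R: "0 \<le> R" using J_facts(6) by (simp add: R_def)
  note s = esum_imp_summable[OF esum_finite_support[OF J_facts(5), of 1]] esum_summable_power[OF esum_finite_support[OF J_facts(5), of 1], of 2]
  have "(\<Sum>\<^sub>\<infinity>x. J x * (l2 x)\<^sup>2) \<le> (\<Sum>\<^sub>\<infinity>x. J x * R\<^sup>2)"
  proof (rule infsum_mono)
    show "J x * (l2 x)\<^sup>2 \<le> J x * R\<^sup>2" for x
      by (cases "J x = 0") (use r[of x] in \<open>auto simp: R_def intro!: mult_left_mono power_mono J_facts(1)\<close>)
  qed (use s in \<open>auto intro: summable_on_cmult_left\<close>)
  also have "\<dots> = R\<^sup>2" using s by (subst infsum_cmult_left) (auto simp: J_facts(3))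
  finally have "sigma_of J \<le> sqrt (R\<^sup>2)" unfolding sigma_of_def moment2_eq by (rule real_sqrt_le_mono)
  then show "sigma_of J \<le> sqrt (real CARD('n)) * krange J" using R by (simp add: R_def)
qed

lemma region_down: "t \<in> region \<delta> \<Longrightarrow> 0 \<le> s \<Longrightarrow> s \<le> t \<Longrightarrow> s \<in> region \<delta>"
proof -
  assume t: "t \<in> region \<delta>" "0 \<le> s" "s \<le> t"
  have "err J G H s \<le> err J G H t" unfolding err_def by (rule SUP_subset_mono) (use t in auto)
  then show ?thesis using t T_down[of t s] by (auto simp: region_def)
qed

lemma H_region:
  assumes t: "t \<in> region \<delta>"
  shows "(\<Sum>\<^sub>\<infinity>x. H t x) + (\<Sum>\<^sub>\<infinity>x. H t x * (l2 x)\<^sup>2) /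
        (((\<Sum>\<^sub>\<infinity>x. J x * (l2 x)\<^sup>2) * (\<Sum>\<^sub>\<infinity>x. g t x) + (\<Sum>\<^sub>\<infinity>x. g t x * (l2 x)\<^sup>2)) / (\<Sum>\<^sub>\<infinity>x. g t x)) \<le> \<delta>"
proof -
  have T: "t \<in> T" using t by (simp add: region_def)
  have "ennreal (norm1 (H t) + moment2 (H t) / (xi J G t)\<^sup>2) \<le> err J G H t"
    unfolding err_def by (rule SUP_upper2[of t]) (use T_nonneg[OF T] in auto)
  also have "\<dots> < ennreal \<delta>" using t by (simp add: region_def)
  finally have "\<not> ennreal \<delta> \<le> ennreal (norm1 (H t) + moment2 (H t) / (xi J G t)\<^sup>2)" by (simp only: not_le)
  then have "\<not> \<delta> \<le> norm1 (H t) + moment2 (H t) / (xi J G t)\<^sup>2" by (rule contrapos_nn) (rule ennreal_leI)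
  then have "norm1 (H t) + moment2 (H t) / (xi J G t)\<^sup>2 \<le> \<delta>" by simp
  then show ?thesis unfolding xi_power2 xi_sq[OF T] unfolding moment2_eq norm1_def .
qed

lemma region_T: "t \<in> region \<delta> \<Longrightarrow> t \<in> T" by (simp add: region_def)

lemma family: "0 < \<delta> \<Longrightarrow> \<delta> \<le> 1 / 10 \<Longrightarrow> family J (region \<delta>) g H \<delta>"
proof (rule family.intro, goal_cases)
  case (3 z) show ?case by (rule J_facts(1))
next
  case 4 show ?case by (rule J_facts(2))
next
  case 5 show ?case by (rule J_facts(3))
next
  case 6 show ?case by (rule J_facts(4))
next
  case 7 show ?case by (rule J_facts(5))
next
  case 8 show ?case by (rule T_nonneg[OF region_T[OF 8(3)]])
next
  case 9 show ?case by (rule region_down[OF 9(3-5)])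
next
  case 10 show ?case by (rule g_nonneg)
next
  case 11 show ?case by (rule g_0)
next
  case 12 show ?case by (rule g_sym[OF region_T[OF 12(3)]])
next
  case 13 show ?case by (rule g_mono[OF region_T[OF 13(3)] 13(4,5)])
next
  case 14 show ?case by (rule g_esum[OF region_T[OF 14(3)]])
next
  case 15 show ?case by (rule g_upper[OF region_T[OF 15(3)] 15(4,5)])
next
  case 16 show ?case by (rule g_lower[OF region_T[OF 16(3)] 16(4,5)])
next
  case 17 show ?case by (rule H_facts(1)[OF region_T[OF 17(3)]])
next
  case 18 show ?case by (rule H_facts(2)[OF region_T[OF 18(3)]])
next
  case 19 show ?case by (rule H_esum[OF region_T[OF 19(3)]])
next
  case 20 show ?case by (rule H_region[OF 20(3)])
qed

text \<open>The range R of \<open>J\<close> is traded for \<sigma> in both directions: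
  \<open>c\<^sub>0 * R \<le> \<sigma>\<close> bounds the support, and \<sigma> \<le> sqrt d * R
  turns the pointwise bound into one in terms of \<sigma>.\<close>

lemma scales:
  assumes \<delta>: "0 < \<delta>" "8 * \<delta> \<le> 1 / 10"
  shows "\<exists>S \<xi>. scales c\<^sub>0 (8 * \<delta>) (sigma_of J) J (region \<delta>) g S \<xi> \<and> (\<forall>t\<in>region \<delta>. \<xi> t = xi J G t)"
proof -
  interpret f: family J "region \<delta>" g H \<delta> by (rule family) (use \<delta> in auto)
  have v: "sigma_of J = sqrt f.var" by (simp add: sigma_of_def moment2_eq f.var_def)
  have R: "0 < krange J" using J_facts(6) by simp
  have "scales c\<^sub>0 (8 * \<delta>) (sqrt f.var) J (region \<delta>) g f.susc f.corr"
  proof (rule f.scalesI[OF c0 refl \<delta>(2) d3], unfold v[symmetric])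
    show "l2 z \<le> sqrt (real CARD('n)) / c\<^sub>0 * sigma_of J" if "J z \<noteq> 0" for z
    proof -
      have "l2 z \<le> sqrt (real CARD('n)) * krange J" by (rule sigma_pos(3)[OF that])
      also have "\<dots> \<le> sqrt (real CARD('n)) * (sigma_of J / c\<^sub>0)"
        using J_facts(7) c0 by (intro mult_left_mono) (auto simp: le_divide_eq mult.commute)
      finally show ?thesis by simp
    qed
    show "J z \<le> sqrt (real CARD('n)) ^ CARD('n) / c\<^sub>0 / sigma_of J ^ CARD('n)" for z
    proof -
      have "sigma_of J ^ CARD('n) \<le> (sqrt (real CARD('n)) * krange J) ^ CARD('n)"
        using sigma_pos(1,2) by (intro power_mono) auto
      then have "1 / (c\<^sub>0 * krange J ^ CARD('n)) \<le> sqrt (real CARD('n)) ^ CARD('n) / c\<^sub>0 / sigma_of J ^ CARD('n)"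
        using c0 R sigma_pos(1) by (simp add: field_simps power_mult_distrib)
      then show ?thesis using J_facts(8)[of z] by linarith
    qed
  qed
  moreover have "f.corr t = xi J G t" if "t \<in> region \<delta>" for t
    using xi_sq[of t] that by (simp add: f.corr_def f.fmom_def f.var_def f.susc_def f.mom_def xi_def region_def)
  ultimately show ?thesis unfolding v by blast
qed

text \<open>The threshold \<open>\<beta>\<close> itself need not lie in the region where the error is small, so the
  correlation length is only compared with its values to the left.\<close>
lemma xi_le:
  assumes \<delta>: "0 < \<delta>" "8 * \<delta> \<le> 1 / 10" and \<beta>: "\<beta> \<in> T" and I: "\<And>t. 0 \<le> t \<Longrightarrow> t < \<beta> \<Longrightarrow> t \<in> region \<delta>"
    and t: "0 \<le> t" "t < \<beta>"
  shows "xi J G t \<le> xi J G \<beta>"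
proof -
  obtain S \<xi> where sc: "scales c\<^sub>0 (8 * \<delta>) (sigma_of J) J (region \<delta>) g S \<xi>" and xi: "\<And>t. t \<in> region \<delta> \<Longrightarrow> \<xi> t = xi J G t"
    using scales[OF \<delta>] by blast
  define X where "X = (xi J G t)\<^sup>2"
  have X: "0 < X" using scales.xi_pos[OF sc I[OF t]] xi[OF I[OF t]] by (simp add: X_def)
  obtain m where m: "0 < m" "esum m (g \<beta>)" using g_esum[OF \<beta>] by blast
  have "esum m (Ffun J G \<beta>)" unfolding Ffun_def using m by (intro esum_conv esum_finite_support[OF J_facts(5)]) auto
  then have Ms: "(\<lambda>x. Ffun J G \<beta> x * (l2 x)\<^sup>2) summable_on UNIV" using m esum_summable_power by blast
  obtain B where B: "\<And>x. g \<beta> x \<le> B" using g_bound[OF \<beta>] by blast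
  have Js: "J summable_on UNIV" by (rule esum_imp_summable[OF esum_finite_support[OF J_facts(5), of 1]]) simp
  \<comment> \<open>Written without division, the comparison of \<xi> at t and r survives the limit:
    the second moment is monotone in the parameter, and the susceptibility at \<beta> is a supremum
    of finite sums, each continuous.\<close>
  have chi_r: "X * chi G r \<le> moment2 (Ffun J G \<beta>)" if r: "t < r" "r < \<beta>" for r
  proof -
    have rI: "r \<in> region \<delta>" and r0: "0 \<le> r" using I[of r] r t by auto
    have "xi J G t \<le> xi J G r" using scales.xi_mono[OF sc rI t(1)] r xi[OF rI] xi[OF I[OF t]] by simp
    then have "X \<le> (xi J G r)\<^sup>2" unfolding X_def using X scales.xi_pos[OF sc I[OF t]] xi[OF I[OF t]] by (intro power_mono) auto
    moreover have "1 \<le> chi G r"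
      using scales.S_ge_1[OF sc rI] scales.chi[OF sc rI] by (simp add: chi_def norm1_def)
    ultimately have "X * chi G r \<le> moment2 (Ffun J G r)" by (simp add: xi_power2 le_divide_eq)
    also have "\<dots> \<le> moment2 (Ffun J G \<beta>)" unfolding moment2_def norm1_def
    proof (rule infsum_mono)
      have F: "Ffun J G r x \<le> Ffun J G \<beta> x" for x unfolding Ffun_def conv_def
      proof (rule infsum_mono)
        show "(\<lambda>y. J y * g r (x - y)) summable_on UNIV"
        proof (rule conv_bounded_summable[OF Js J_facts(1) g_nonneg])
          show "g r x \<le> B" for x using B[of x] g_mono[OF \<beta> r0, of x] r by linarith
        qed
        show "(\<lambda>y. J y * g \<beta> (x - y)) summable_on UNIV" by (rule conv_bounded_summable[OF Js J_facts(1) g_nonneg B])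
        show "J y * g r (x - y) \<le> J y * g \<beta> (x - y)" for y
          using g_mono[OF \<beta> r0] r by (intro mult_left_mono J_facts) auto
      qed
      then show le: "(l2 x)\<^sup>2 * Ffun J G r x \<le> (l2 x)\<^sup>2 * Ffun J G \<beta> x" for x by (intro mult_left_mono) auto
      show b: "(\<lambda>x. (l2 x)\<^sup>2 * Ffun J G \<beta> x) summable_on UNIV" using Ms by (simp add: mult.commute)
      show "(\<lambda>x. (l2 x)\<^sup>2 * Ffun J G r x) summable_on UNIV"
        by (rule summable_on_abs_le[OF b]) (use F_nonneg[of r] le in \<open>simp add: abs_mult\<close>)
    qed
    finally show ?thesis .
  qed
  have "chi G \<beta> \<le> moment2 (Ffun J G \<beta>) / X" unfolding chi_def norm1_def
  proof (rule infsum_le_finite_sums[OF g_summable[OF \<beta>]])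
    fix A :: "(int ^ 'n) set" assume A: "finite A"
    have "continuous (at \<beta> within T) (\<lambda>r. g r x)" for x
    proof -
      have "(\<lambda>r. g r x) differentiable at \<beta> within T" using class_G \<beta> unfolding class_G_def differentiable_on_def by blast
      then show ?thesis by (rule differentiable_imp_continuous_within)
    qed
    then have "((\<lambda>r. g r x) \<longlongrightarrow> g \<beta> x) (at \<beta> within {t<..<\<beta>})" for x
      unfolding continuous_within by (rule tendsto_within_subset) (use T_down[OF \<beta>] t in auto)
    then have "((\<lambda>r. \<Sum>x\<in>A. g r x) \<longlongrightarrow> (\<Sum>x\<in>A. g \<beta> x)) (at_left \<beta>)"
      using t by (intro tendsto_sum) (simp add: at_within_greaterThanLessThan)
    then show "(\<Sum>x\<in>A. g \<beta> x) \<le> moment2 (Ffun J G \<beta>) / X"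
    proof (rule tendsto_upperbound)
      have "\<forall>\<^sub>F r in at_left \<beta>. r \<in> {t<..<\<beta>}" by (rule eventually_at_left_real) (rule t)
      then show "\<forall>\<^sub>F r in at_left \<beta>. (\<Sum>x\<in>A. g r x) \<le> moment2 (Ffun J G \<beta>) / X"
      proof eventually_elim
        case (elim r)
        then have "r \<in> T" using T_down[OF \<beta>] t by auto
        then have "(\<Sum>x\<in>A. g r x) \<le> chi G r" unfolding chi_def norm1_def
          by (intro finite_sum_le_infsum g_summable A g_nonneg) auto
        also have "\<dots> \<le> moment2 (Ffun J G \<beta>) / X" using chi_r[of r] elim X by (simp add: le_divide_eq mult.commute)
        finally show ?case .
      qed
    qed simp
  qed
  moreover have "1 \<le> chi G \<beta>"
  proof -
    have "sum (g \<beta>) {0} \<le> chi G \<beta>" unfolding chi_def norm1_def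
      by (intro finite_sum_le_infsum g_summable[OF \<beta>] g_nonneg) auto
    then show ?thesis using g_mono[OF \<beta>, of 0 0] g_0[of 0] t by simp
  qed
  ultimately have "X \<le> moment2 (Ffun J G \<beta>) / chi G \<beta>" using X by (simp add: field_simps)
  then show ?thesis unfolding xi_power2[symmetric] X_def
    by (rule power2_le_imp_le) (simp add: xi_def divide_nonneg_nonneg moment2_nonneg F_nonneg chi_nonneg)
qed

lemma region_below:
  assumes "ennreal \<beta> \<le> beta_of J \<beta>\<^sub>c G H \<delta>" "0 \<le> t" "t < \<beta>"
  shows "t \<in> region \<delta>"
proof -
  have "ennreal t < beta_of J \<beta>\<^sub>c G H \<delta>" using assms ennreal_lessI[of \<beta> t] by auto
  then obtain u where u: "u \<in> region \<delta>" "ennreal t < ennreal u"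
    unfolding beta_of_def less_Sup_iff by (auto simp: region_def)
  then have "t \<le> u" using ennreal_leI[of u t] by (meson not_le less_imp_le)
  then show ?thesis using region_down[OF u(1) assms(2)] by simp
qed

text \<open>For \<beta> in \<open>T\<close> the limit is continuity of G in the parameter. Otherwise
  \<beta> = \<open>\<beta>\<^sub>c\<close>, the limit is a defining property of the class, and
  monotonicity identifies \<open>xi_ext\<close> with the supremum of the earlier correlation
  lengths.\<close>

lemma limit_below:
  assumes \<delta>: "0 < \<delta>" "8 * \<delta> \<le> 1 / 10" and \<beta>: "0 < \<beta>" "ennreal \<beta> \<le> beta_of J \<beta>\<^sub>c G H \<delta>"
  shows "((\<lambda>t. G t x) \<longlongrightarrow> G \<beta> x) (at_left \<beta>)"
    "\<And>t. 0 \<le> t \<Longrightarrow> t < \<beta> \<Longrightarrow> ennreal (xi J G t) \<le> xi_ext J \<beta>\<^sub>c G \<beta>"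
proof -
  have reg: "t \<in> region \<delta>" if "0 \<le> t" "t < \<beta>" for t by (rule region_below[OF \<beta>(2) that])
  then have sub: "{0..<\<beta>} \<subseteq> T" by (auto simp: region_def)
  have "((\<lambda>t. G t x) \<longlongrightarrow> G \<beta> x) (at_left \<beta>) \<and> (\<forall>t. 0 \<le> t \<longrightarrow> t < \<beta> \<longrightarrow> ennreal (xi J G t) \<le> xi_ext J \<beta>\<^sub>c G \<beta>)"
  proof (cases "\<beta> \<in> T")
    case True
    have "(\<lambda>r. g r x) differentiable at \<beta> within T" using class_G True unfolding class_G_def differentiable_on_def by blast
    then have "continuous (at \<beta> within T) (\<lambda>r. g r x)" by (rule differentiable_imp_continuous_within)
    then have "((\<lambda>r. g r x) \<longlongrightarrow> g \<beta> x) (at \<beta> within {0<..<\<beta>})"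
      unfolding continuous_within by (rule tendsto_within_subset) (use sub in auto)
    then have "((\<lambda>r. ennreal (g r x)) \<longlongrightarrow> ennreal (g \<beta> x)) (at_left \<beta>)"
      using \<beta> by (intro tendsto_ennrealI) (simp add: at_within_greaterThanLessThan)
    moreover have "\<forall>\<^sub>F r in at_left \<beta>. r \<in> {0<..<\<beta>}" by (rule eventually_at_left_real) (rule \<beta>)
    then have "\<forall>\<^sub>F r in at_left \<beta>. ennreal (g r x) = G r x"
    proof eventually_elim
      case (elim r)
      then have "r \<in> T" using sub by auto
      then show ?case by (simp add: G_eq)
    qed
    ultimately have "((\<lambda>t. G t x) \<longlongrightarrow> ennreal (g \<beta> x)) (at_left \<beta>)" by (rule Lim_transform_eventually)
    moreover have "ennreal (xi J G t) \<le> xi_ext J \<beta>\<^sub>c G \<beta>" if "0 \<le> t" "t < \<beta>" for t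
      using xi_le[OF \<delta> True reg that] True by (simp add: xi_ext_def ennreal_leI)
    ultimately show ?thesis using G_eq[OF True] by simp
  next
    case False
    have "beta_of J \<beta>\<^sub>c G H \<delta> \<le> \<beta>\<^sub>c" unfolding beta_of_def by (rule Sup_least) (auto simp: subcrit_def)
    then have bc: "\<beta>\<^sub>c = ennreal \<beta>" using False \<beta> by (auto simp: subcrit_def intro: antisym)
    have T_eq: "T = {0..<\<beta>}" unfolding subcrit_def bc by (auto simp: ennreal_less_iff)
    have at: "at \<beta> within T = at_left \<beta>"
      by (rule at_within_nhd[where S = "{0<..}"]) (use \<beta> in \<open>auto simp: T_eq\<close>)
    have "((\<lambda>t. G t x) \<longlongrightarrow> G \<beta> x) (at_left \<beta>)"
      using class_G \<beta> unfolding class_G_def at[symmetric] by (auto simp: bc)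
    moreover
    obtain S \<xi> where sc: "scales c\<^sub>0 (8 * \<delta>) (sigma_of J) J (region \<delta>) g S \<xi>" and xi: "\<And>t. t \<in> region \<delta> \<Longrightarrow> \<xi> t = xi J G t"
      using scales[OF \<delta>] by blast
    have mono: "ennreal (xi J G s) \<le> ennreal (xi J G t)" if "0 \<le> s" "s \<le> t" "t < \<beta>" for s t
      using scales.xi_mono[OF sc reg[of t] that(1,2)] xi[OF reg[of t]] xi[OF reg[of s]] that by (simp add: ennreal_leI)
    define L where "L = (SUP t\<in>{0..<\<beta>}. ennreal (xi J G t))"
    have up: "ennreal (xi J G t) \<le> L" if "0 \<le> t" "t < \<beta>" for t unfolding L_def by (rule SUP_upper) (use that in auto)
    have ev: "\<forall>\<^sub>F r in at_left \<beta>. r \<in> {u<..<\<beta>}" if "u < \<beta>" for u by (rule eventually_at_left_real) (rule that)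
    have "((\<lambda>t. ennreal (xi J G t)) \<longlongrightarrow> L) (at_left \<beta>)"
    proof (rule increasing_tendsto)
      show "\<forall>\<^sub>F t in at_left \<beta>. ennreal (xi J G t) \<le> L"
        using ev[OF \<beta>(1)] by eventually_elim (use up in auto)
      fix y assume "y < L"
      then obtain u where u: "0 \<le> u" "u < \<beta>" "y < ennreal (xi J G u)" unfolding L_def less_SUP_iff by auto
      show "\<forall>\<^sub>F t in at_left \<beta>. y < ennreal (xi J G t)"
        using ev[OF u(2)]
      proof eventually_elim
        case (elim r)
        then have "ennreal (xi J G u) \<le> ennreal (xi J G r)" using u by (intro mono) auto
        with u(3) show ?case by (rule less_le_trans)
      qed
    qed
    then have "xi_ext J \<beta>\<^sub>c G \<beta> = L" using False by (simp add: xi_ext_def at tendsto_Lim)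
    ultimately show ?thesis using up by simp
  qed
  then show "((\<lambda>t. G t x) \<longlongrightarrow> G \<beta> x) (at_left \<beta>)"
    "\<And>t. 0 \<le> t \<Longrightarrow> t < \<beta> \<Longrightarrow> ennreal (xi J G t) \<le> xi_ext J \<beta>\<^sub>c G \<beta>" by blast+
qed

end

text \<open>The bound is obtained strictly below \<beta>, weakened by replacing \<xi> t with the
  larger value at \<beta>, and carried to \<beta> by the left limit. At \<beta> = 0 there is nothing
  to the left, and G is explicit.\<close>

theorem theorem1p5:
  fixes c\<^sub>0 :: real
  assumes "2 < CARD('n::finite)" and "0 < c\<^sub>0" and "c\<^sub>0 \<le> 1"
  shows "\<exists>c C :: real. 0 < c \<and> 0 < C \<and>
    (\<forall>\<epsilon>::real. 0 < \<epsilon> \<and> \<epsilon> < 1 \<longrightarrow>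
      (\<exists>\<delta>::real. 0 < \<delta> \<and> \<delta> < 1 \<and>
        (\<forall>(J :: int ^ 'n \<Rightarrow> real) (\<beta>\<^sub>c :: ennreal) (G :: real \<Rightarrow> int ^ 'n \<Rightarrow> ennreal) H.
          admissible c\<^sub>0 J \<and> class_G \<beta>\<^sub>c G \<and> assumption1 J \<beta>\<^sub>c G H \<longrightarrow>
          (\<forall>(\<beta>::real) x. 0 \<le> \<beta> \<and> ennreal \<beta> \<le> beta_of J \<beta>\<^sub>c G H \<delta> \<longrightarrow>
            G \<beta> x \<le> ennreal (of_bool (x = 0)
              + C / sigma_of J ^ CARD('n)
                * (sigma_of J / max (sigma_of J) (linf x)) powr (real CARD('n) - 2 - \<epsilon>)
                * exp_factor c (linf x) (xi_ext J \<beta>\<^sub>c G \<beta>))))))"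
proof -
  have d3: "3 \<le> CARD('n)" using assms(1) by simp
  obtain c C where c: "0 < c" and C: "0 < C" and bound: "\<And>\<epsilon>. 0 < \<epsilon> \<Longrightarrow> \<epsilon> \<le> 1 / 2 \<Longrightarrow> \<exists>\<nu>1>0. \<forall>\<nu> \<sigma> (J :: int ^ 'n \<Rightarrow> real) I g S \<xi> t x.
    scales c\<^sub>0 \<nu> \<sigma> J I g S \<xi> \<longrightarrow> \<nu> \<le> \<nu>1 \<longrightarrow> t \<in> I \<longrightarrow>
    g t x \<le> of_bool (x = 0) + C / \<sigma> ^ CARD('n)
      * (\<sigma> / max \<sigma> (linf x)) powr (real CARD('n) - 2 - \<epsilon>) * exp (- c * (linf x / \<xi> t))"
    by (rule scales_pointwise_bound[OF assms(2,3) d3]) (rule that)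
  show ?thesis
  proof (rule exI[of _ c], rule exI[of _ C], intro conjI allI impI c C)
    fix \<epsilon> :: real assume eps: "0 < \<epsilon> \<and> \<epsilon> < 1"
    \<comment> \<open>A smaller \<epsilon> gives a stronger bound since \<sigma> / max \<sigma>
      (linf x) \<le> 1; the cap 1/2 keeps \<alpha> \<ge> 1/4 even for d = 3.\<close>
    define \<epsilon>' where "\<epsilon>' = min \<epsilon> (1 / 2)"
    have \<epsilon>': "0 < \<epsilon>'" "\<epsilon>' \<le> 1 / 2" "\<epsilon>' \<le> \<epsilon>" using eps by (auto simp: \<epsilon>'_def)
    obtain \<nu>1 where nu1: "0 < \<nu>1" and bd: "\<And>\<nu> \<sigma> (J :: int ^ 'n \<Rightarrow> real) I g S \<xi> t x.
      scales c\<^sub>0 \<nu> \<sigma> J I g S \<xi> \<Longrightarrow> \<nu> \<le> \<nu>1 \<Longrightarrow> t \<in> I \<Longrightarrow>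
      g t x \<le> of_bool (x = 0) + C / \<sigma> ^ CARD('n)
        * (\<sigma> / max \<sigma> (linf x)) powr (real CARD('n) - 2 - \<epsilon>') * exp (- c * (linf x / \<xi> t))"
      using bound[OF \<epsilon>'(1,2)] by blast
    \<comment> \<open>Ensures \<nu> = 8 \<delta> \<le> 1/10 and \<nu> \<le> \<nu>1.\<close>
    define \<delta> where "\<delta> = min (1 / 80) (\<nu>1 / 8)"
    have \<delta>: "0 < \<delta>" "8 * \<delta> \<le> 1 / 10" "8 * \<delta> \<le> \<nu>1" "\<delta> < 1" using nu1 by (auto simp: \<delta>_def min_def)
    show "\<exists>\<delta>::real. 0 < \<delta> \<and> \<delta> < 1 \<and>
        (\<forall>(J :: int ^ 'n \<Rightarrow> real) (\<beta>\<^sub>c :: ennreal) (G :: real \<Rightarrow> int ^ 'n \<Rightarrow> ennreal) H.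
          admissible c\<^sub>0 J \<and> class_G \<beta>\<^sub>c G \<and> assumption1 J \<beta>\<^sub>c G H \<longrightarrow>
          (\<forall>(\<beta>::real) x. 0 \<le> \<beta> \<and> ennreal \<beta> \<le> beta_of J \<beta>\<^sub>c G H \<delta> \<longrightarrow>
            G \<beta> x \<le> ennreal (of_bool (x = 0)
              + C / sigma_of J ^ CARD('n)
                * (sigma_of J / max (sigma_of J) (linf x)) powr (real CARD('n) - 2 - \<epsilon>)
                * exp_factor c (linf x) (xi_ext J \<beta>\<^sub>c G \<beta>))))"
    proof (intro exI[of _ \<delta>] conjI \<delta> allI impI)
      fix J :: "int ^ 'n \<Rightarrow> real" and \<beta>\<^sub>c and G :: "real \<Rightarrow> int ^ 'n \<Rightarrow> ennreal" and H \<beta> and x :: "int ^ 'n"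
      assume h: "admissible c\<^sub>0 J \<and> class_G \<beta>\<^sub>c G \<and> assumption1 J \<beta>\<^sub>c G H"
        and \<beta>: "0 \<le> \<beta> \<and> ennreal \<beta> \<le> beta_of J \<beta>\<^sub>c G H \<delta>"
      interpret model c\<^sub>0 J \<beta>\<^sub>c G H by unfold_locales (use assms d3 h in auto)
      define \<sigma> where "\<sigma> = sigma_of J"
      have \<sigma>: "0 < \<sigma>" unfolding \<sigma>_def by (rule sigma_pos(1))
      define P where "P = C / \<sigma> ^ CARD('n) * (\<sigma> / max \<sigma> (linf x)) powr (real CARD('n) - 2 - \<epsilon>)"
      define E where "E = exp_factor c (linf x) (xi_ext J \<beta>\<^sub>c G \<beta>)"
      have P: "0 \<le> P" using C \<sigma> by (simp add: P_def)
      have E: "0 \<le> E" by (simp add: E_def exp_factor_def)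
      have "G \<beta> x \<le> ennreal (of_bool (x = 0) + P * E)"
      proof (cases "\<beta> = 0")
        case True
        have "G 0 x = ennreal (of_bool (x = 0))" using class_G by (simp add: class_G_def)
        also have "\<dots> \<le> ennreal (of_bool (x = 0) + P * E)" using P E by (intro ennreal_leI) simp
        finally show ?thesis using True by simp
      next
        case False
        then have \<beta>0: "0 < \<beta>" "ennreal \<beta> \<le> beta_of J \<beta>\<^sub>c G H \<delta>" using \<beta> by auto
        note lim = limit_below[OF \<delta>(1,2) \<beta>0]
        obtain S \<xi> where sc: "scales c\<^sub>0 (8 * \<delta>) (sigma_of J) J (region \<delta>) g S \<xi>" and xi: "\<And>t. t \<in> region \<delta> \<Longrightarrow> \<xi> t = xi J G t"
          using scales[OF \<delta>(1,2)] by blast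
        show ?thesis
        proof (rule tendsto_upperbound[OF lim(1)])
          have "\<forall>\<^sub>F r in at_left \<beta>. r \<in> {0<..<\<beta>}" by (rule eventually_at_left_real) (rule \<beta>0)
          then show "\<forall>\<^sub>F t in at_left \<beta>. G t x \<le> ennreal (of_bool (x = 0) + P * E)"
          proof eventually_elim
            case (elim t)
            then have t: "0 \<le> t" "t < \<beta>" by auto
            have tI: "t \<in> region \<delta>" by (rule region_below[OF \<beta>0(2) t])
            have X: "0 < xi J G t" using scales.xi_pos[OF sc tI] xi[OF tI] by simp
            have "g t x \<le> of_bool (x = 0) + C / \<sigma> ^ CARD('n)
              * (\<sigma> / max \<sigma> (linf x)) powr (real CARD('n) - 2 - \<epsilon>') * exp (- c * (linf x / \<xi> t))"
              unfolding \<sigma>_def by (rule bd[OF sc \<delta>(3) tI])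
            also have "\<dots> \<le> of_bool (x = 0) + P * E"
            proof (intro add_left_mono mult_mono P)
              have "\<sigma> / max \<sigma> (linf x) \<le> 1" using \<sigma> by (simp add: divide_le_eq less_max_iff_disj)
              then have "(\<sigma> / max \<sigma> (linf x)) powr (real CARD('n) - 2 - \<epsilon>') \<le> (\<sigma> / max \<sigma> (linf x)) powr (real CARD('n) - 2 - \<epsilon>)"
                using \<sigma> \<epsilon>' by (intro powr_mono') auto
              then show "C / \<sigma> ^ CARD('n) * (\<sigma> / max \<sigma> (linf x)) powr (real CARD('n) - 2 - \<epsilon>') \<le> P"
                unfolding P_def using C \<sigma> by (intro mult_left_mono) auto
              show "exp (- c * (linf x / \<xi> t)) \<le> E"
              proof (cases "xi_ext J \<beta>\<^sub>c G \<beta> = \<infinity>")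
                case True
                then show ?thesis using c X by (simp add: E_def exp_factor_def xi[OF tI])
              next
                case False
                define Y where "Y = enn2real (xi_ext J \<beta>\<^sub>c G \<beta>)"
                have "enn2real (ennreal (xi J G t)) \<le> Y" unfolding Y_def
                  using lim(2)[OF t] False by (intro enn2real_mono) (auto simp: less_top)
                then have "xi J G t \<le> Y" using X by simp
                then have "linf x / Y \<le> linf x / xi J G t" using X by (intro divide_left_mono) auto
                then have "c * (linf x / Y) \<le> c * (linf x / xi J G t)" using c by (intro mult_left_mono) auto
                then show ?thesis using False by (simp add: E_def exp_factor_def Y_def xi[OF tI])
              qed
            qed auto
            finally have "ennreal (g t x) \<le> ennreal (of_bool (x = 0) + P * E)" by (rule ennreal_leI)
            moreover have "t \<in> T" using tI by (simp add: region_def)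
            ultimately show ?case using G_eq by simp
          qed
        qed simp
      qed
      then show "G \<beta> x \<le> ennreal (of_bool (x = 0)
              + C / sigma_of J ^ CARD('n)
                * (sigma_of J / max (sigma_of J) (linf x)) powr (real CARD('n) - 2 - \<epsilon>)
                * exp_factor c (linf x) (xi_ext J \<beta>\<^sub>c G \<beta>))"
        unfolding P_def E_def \<sigma>_def .
    qed
  qed
qed

end
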